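(* Let $p$ be a prime, $n\ge2$, $p>n+1$, $G$ the pro-$p$ Iwahori subgroup of $SL_n(\mathbb{Z}_p)$ and $\Omega_G=\Lambda(G)\otimes_{\mathbb{Z}_p}\mathbb{F}_p$. The natural map $\overline{\mathcal{A}}\to\Omega_G$ (sending $U_\beta\mapsto x_\beta(p)-1$, $W_\delta\mapsto h_\delta(1+p)-1$, $V_\alpha\mapsto x_\alpha(1)-1$) induces an isomorphism $\overline{\mathcal{A}}/\overline{\mathcal{R}}\cong\Omega_G$.
   Context: $G$: matrices in $SL_n(\mathbb{Z}_p)$ upper unipotent mod $p$; $\Lambda(G)$ its Iwasawa algebra $\varprojlim_N\mathbb{Z}_p[G/N]$. Roots $\Phi=\{(i,j):i\ne j\}$, $\Phi^+$ ($i<j$), $\Phi^-$ ($i>j$), $\Pi=\{(i,i+1)\}$; $(i,j)+(j,k)=(i,k)$, $-(i,j)=(j,i)$. $x_{(i,j)}(t)=I+tE_{i,j}$; $h_{(c,c+1)}(\lambda)$ is diagonal with $\lambda$ at $(c,c)$, $\lambda^{-1}$ at $(c+1,c+1)$, $1$ elsewhere; $\langle\varsigma,\delta\rangle\in\mathbb{Z}$ is defined by $h_\delta(\lambda)x_\varsigma(t)h_\delta(\lambda)^{-1}=x_\varsigma(\lambda^{\langle\varsigma,\delta\rangle}t)$. $\mathcal{A}=\mathbb{Z}_p\{\{U_\beta,W_\delta,V_\alpha\}\}$ is the non-commutative power series ring in variables $U_\beta$ ($\beta\in\Phi^-$), $W_\delta$ ($\delta\in\Pi$), $V_\alpha$ ($\alpha\in\Phi^+$);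 for $q\in\mathbb{Z}_p$, $(1+X)^q:=\sum_{r\ge0}\binom qrX^r$. $\mathcal{R}\subset\mathcal{A}$ is the closed two-sided ideal generated by LHS$-$RHS of the relations: (1) $(1+W_\delta)(1+U_\beta)=(1+U_\beta)^{(1+p)^{\langle\beta,\delta\rangle}}(1+W_\delta)$; (2) $(1+W_\delta)(1+V_\alpha)=(1+V_\alpha)^{(1+p)^{\langle\alpha,\delta\rangle}}(1+W_\delta)$; (3) $V_\alpha U_\beta=U_\beta V_\alpha$ if $\alpha\ne-\beta$, $\alpha+\beta\notin\Phi$; (4) $(1+V_\alpha)(1+U_\beta)=(1+V_{(i,k)})^p(1+U_\beta)(1+V_\alpha)$, $\alpha=(i,j),\beta=(j,k)$, $i<k$; (5) $(1+V_\alpha)(1+U_\beta)=(1+U_{(i,k)})(1+U_\beta)(1+V_\alpha)$, $\alpha=(i,j),\beta=(j,k)$, $i>k$; (6) $(1+V_\alpha)(1+U_\beta)=(1+V_{(k,j)})^{-p}(1+U_\beta)(1+V_\alpha)$, $\alpha=(i,j),\beta=(k,i)$, $k<j$; (7) $(1+V_\alpha)(1+U_\beta)=(1+U_{(k,j)})^{-1}(1+U_\beta)(1+V_\alpha)$, $\alpha=(i,j),\beta=(k,i)$, $k>j$; (8) $(1+V_\alpha)(1+U_{-\alpha})=(1+U_{-\alpha})^{(1+p)^{-1}}(1+W_{(i,i+1)})\cdots(1+W_{(j-1,j)})(1+V_\alpha)^{(1+p)^{-1}}$, $\alpha=(i,j)$; (9) $U_{\beta_1}U_{\beta_2}=U_{\beta_2}U_{\beta_1}$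 if $\beta_1+\beta_2\notin\Phi$; (10) $(1+U_{\beta_1})(1+U_{\beta_2})=(1+U_{(i,k)})^p(1+U_{\beta_2})(1+U_{\beta_1})$, $\beta_1=(i,j),\beta_2=(j,k)\in\Phi^-$; (11) $(1+U_{\beta_1})(1+U_{\beta_2})=(1+U_{(k,j)})^{-p}(1+U_{\beta_2})(1+U_{\beta_1})$, $\beta_1=(i,j),\beta_2=(k,i)\in\Phi^-$; (12) $W_{\delta_1}W_{\delta_2}=W_{\delta_2}W_{\delta_1}$; (13) $V_{\alpha_1}V_{\alpha_2}=V_{\alpha_2}V_{\alpha_1}$ if $\alpha_1+\alpha_2\notin\Phi$; (14) $(1+V_{\alpha_1})(1+V_{\alpha_2})=(1+V_{(i,k)})(1+V_{\alpha_2})(1+V_{\alpha_1})$, $\alpha_1=(i,j),\alpha_2=(j,k)\in\Phi^+$; (15) $(1+V_{\alpha_2})(1+V_{\alpha_1})=(1+V_{(k,j)})(1+V_{\alpha_1})(1+V_{\alpha_2})$, $\alpha_1=(i,j),\alpha_2=(k,i)\in\Phi^+$. $\overline{\mathcal{A}}=\mathcal{A}/p\mathcal{A}$ and $\overline{\mathcal{R}}$ is the image of $\mathcal{R}$ in $\overline{\mathcal{A}}$. *)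

theory Defs
  imports
    "HOL-Analysis.Function_Topology"
    "HOL-Number_Theory.Residues"
    "HOL-Algebra.QuotRing"
    "HOL-Algebra.Coset"
    "Jordan_Normal_Form.Determinant"
    "Berlekamp_Zassenhaus.Finite_Field"
begin

section \<open>The ring of $p$-adic integers\<close>

text \<open>The prime is \<open>p = CARD('p)\<close>, and the ring is the inverse limit of the \<open>\<int>/p\<^sup>k\<close>: an element is
  a compatible sequence of residues \<open>0 \<le> x k < p\<^sup>k\<close>.\<close>

typedef (overloaded) ('p::prime_card) padic =
  "{x :: nat \<Rightarrow> int. \<forall>k. x k \<in> {0..<int CARD('p) ^ k} \<and> x (Suc k) mod int CARD('p) ^ k = x k}"
  morphisms residue Abs_padic
  by (rule exI[of _ "\<lambda>_. 0"]) (simp add: prime_card prime_gt_0_nat)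

setup_lifting type_definition_padic

lemma padic_eqI: "(\<And>k. residue x k = residue y k) \<Longrightarrow> x = y"
  by (metis ext residue_inject)

lemma prime_card_int_power_pos: "0 < int CARD('p::prime_card) ^ k"
  using prime_card[where 'a='p] by (simp add: prime_gt_0_nat)

lemma mod_power_Suc_mod: "(a mod int p ^ Suc k) mod int p ^ k = a mod int p ^ k"
  by (rule mod_mod_cancel) simp

lemma mod_compatible:
  assumes "a mod (m::int) = a' mod m" "b mod m = b' mod m"
  shows "(a + b) mod m = (a' + b') mod m" "(a * b) mod m = (a' * b') mod m"
    "(a - b) mod m = (a' - b') mod m"
  using assms by (rule mod_add_cong mod_mult_cong mod_diff_cong)+

instantiation padic :: (prime_card) comm_ring_1
begin

lift_definition zero_padic :: "'a padic" is "\<lambda>_. 0"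
  by (simp add: prime_card_int_power_pos)

lift_definition one_padic :: "'a padic" is "\<lambda>k. 1 mod int CARD('a) ^ k"
  by (auto simp: prime_card_int_power_pos mod_power_Suc_mod simp del: power_Suc)

lift_definition plus_padic :: "'a padic \<Rightarrow> 'a padic \<Rightarrow> 'a padic"
  is "\<lambda>x y k. (x k + y k) mod int CARD('a) ^ k"
  apply (auto simp: prime_card_int_power_pos mod_power_Suc_mod simp del: power_Suc)
  apply (rule mod_compatible; metis mod_mod_trivial)
  done

lift_definition times_padic :: "'a padic \<Rightarrow> 'a padic \<Rightarrow> 'a padic"
  is "\<lambda>x y k. (x k * y k) mod int CARD('a) ^ k"
  apply (auto simp: prime_card_int_power_pos mod_power_Suc_mod simp del: power_Suc)
  apply (rule mod_compatible; metis mod_mod_trivial)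
  done

lift_definition minus_padic :: "'a padic \<Rightarrow> 'a padic \<Rightarrow> 'a padic"
  is "\<lambda>x y k. (x k - y k) mod int CARD('a) ^ k"
  apply (auto simp: prime_card_int_power_pos mod_power_Suc_mod simp del: power_Suc)
  apply (rule mod_compatible; metis mod_mod_trivial)
  done

lift_definition uminus_padic :: "'a padic \<Rightarrow> 'a padic"
  is "\<lambda>x k. (- x k) mod int CARD('a) ^ k"
  apply (auto simp: prime_card_int_power_pos mod_power_Suc_mod simp del: power_Suc)
  apply (metis mod_minus_eq)
  done

instance
proof
  show "(0::'a padic) \<noteq> 1"
  proof
    assume "(0::'a padic) = 1"
    then have "residue (0::'a padic) 1 = residue (1::'a padic) 1" by simp
    then show False
      using prime_card[where 'a='a] prime_gt_1_nat by (simp add: zero_padic.rep_eq one_padic.rep_eq)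
  qed
qed (transfer, auto intro!: ext simp: algebra_simps mod_simps)+

end

lemma residue_of_nat: "residue (of_nat m :: 'p::prime_card padic) k = int m mod int CARD('p) ^ k"
proof (induction m)
  case (Suc m)
  have "residue (of_nat (Suc m) :: 'p padic) k =
      (1 mod int CARD('p) ^ k + int m mod int CARD('p) ^ k) mod int CARD('p) ^ k"
    by (simp only: of_nat_Suc plus_padic.rep_eq one_padic.rep_eq Suc)
  then show ?case by (simp add: mod_add_eq)
qed (simp add: zero_padic.rep_eq)

lemma residue_mod:
  fixes x :: "'p::prime_card padic"
  assumes "k \<le> l" shows "residue x l mod int CARD('p) ^ k = residue x k"
  using assms
proof (induction l rule: dec_induct)
  case base
  then show ?case using residue[of x] by simp
next
  case (step l)
  have "residue x (Suc l) mod int CARD('p) ^ l = residue x l"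
    using residue[of x] by simp
  moreover have "int CARD('p) ^ k dvd int CARD('p) ^ l"
    using step by (simp add: le_imp_power_dvd)
  ultimately show ?case using step by (metis mod_mod_cancel)
qed

instance padic :: (prime_card) "{idom, ring_char_0}"
proof
  show "inj (of_nat :: nat \<Rightarrow> 'a padic)"
  proof (rule injI)
    fix a b assume eq: "(of_nat a :: 'a padic) = of_nat b"
    have lt: "c < CARD('a) ^ (a + b)" if "c \<le> a + b" for c
    proof -
      have "c < 2 ^ (a + b)"
        using that by (meson less_exp order_le_less_trans)
      also have "\<dots> \<le> CARD('a) ^ (a + b)"
        using prime_card[where 'a='a] by (simp add: power_mono prime_ge_2_nat)
      finally show ?thesis .
    qed
    have "int a mod int CARD('a) ^ (a + b) = int b mod int CARD('a) ^ (a + b)"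
      using arg_cong[OF eq, of "\<lambda>x. residue x (a + b)"] by (simp add: residue_of_nat)
    then have "a mod CARD('a) ^ (a + b) = b mod CARD('a) ^ (a + b)"
      by (metis of_nat_eq_iff of_nat_mod of_nat_power)
    then show "a = b" using lt[of a] lt[of b] by simp
  qed
next
  fix x y :: "'a padic" assume "x \<noteq> 0" "y \<noteq> 0"
  let ?p = "int CARD('a)"
  have prime: "prime ?p" by (rule prime_card_int)
  obtain k l where k: "residue x k \<noteq> 0" and l: "residue y l \<noteq> 0"
    using \<open>x \<noteq> 0\<close> \<open>y \<noteq> 0\<close> padic_eqI[of x 0] padic_eqI[of y 0] by (auto simp: zero_padic.rep_eq)
  let ?a = "residue x (k + l)" and ?b = "residue y (k + l)"
  have a: "\<not> ?p ^ k dvd ?a" and b: "\<not> ?p ^ l dvd ?b"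
    using k l residue_mod[of k "k + l" x] residue_mod[of l "k + l" y] by (auto simp: dvd_eq_mod_eq_0)
  then have "?a \<noteq> 0" "?b \<noteq> 0" by auto
  have u: "\<not> is_unit ?p" using prime not_prime_unit by blast
  have "multiplicity ?p ?a < k" "multiplicity ?p ?b < l"
    using a b multiplicity_dvd'[of _ ?p] by (meson linorder_not_less)+
  then have "multiplicity ?p (?a * ?b) < k + l"
    using prime \<open>?a \<noteq> 0\<close> \<open>?b \<noteq> 0\<close> by (simp add: prime_elem_multiplicity_mult_distrib)
  then have "\<not> ?p ^ (k + l) dvd ?a * ?b"
    using u \<open>?a \<noteq> 0\<close> \<open>?b \<noteq> 0\<close> by (metis mult_eq_0_iff multiplicity_geI linorder_not_less)
  then have "residue (x * y) (k + l) \<noteq> 0"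
    by (simp add: times_padic.rep_eq dvd_eq_mod_eq_0)
  then show "x * y \<noteq> 0" by (auto simp: zero_padic.rep_eq)
qed

text \<open>Division is exact division, and is meaningful only where the divisor divides; likewise
  \<open>inverse\<close> is meaningful only on units, where it makes \<open>u powi m\<close> the integer power.\<close>

instantiation padic :: (prime_card) semidom_divide
begin

definition divide_padic :: "'a padic \<Rightarrow> 'a padic \<Rightarrow> 'a padic" where
  "divide_padic x y = (if y = 0 then 0 else THE z. x = z * y)"

instance
  by standard (auto simp: divide_padic_def)

end

instantiation padic :: (prime_card) inverse
begin

definition inverse_padic :: "'a padic \<Rightarrow> 'a padic" where
  "inverse_padic x = 1 div x"

instance ..

end

instantiation padic :: (prime_card) topological_space
begin

definition open_padic :: "'a padic set \<Rightarrow> bool" where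
  "open_padic U \<longleftrightarrow> (\<forall>x\<in>U. \<exists>k. \<forall>y. residue y k = residue x k \<longrightarrow> y \<in> U)"

instance
proof
  fix S T :: "'a padic set"
  assume S: "open S" and T: "open T"
  show "open (S \<inter> T)"
    unfolding open_padic_def
  proof
    fix x assume x: "x \<in> S \<inter> T"
    then obtain k l where k: "\<And>y. residue y k = residue x k \<Longrightarrow> y \<in> S"
      and l: "\<And>y. residue y l = residue x l \<Longrightarrow> y \<in> T"
      using S T unfolding open_padic_def by blast
    have "y \<in> S \<inter> T" if "residue y (k + l) = residue x (k + l)" for y
      using that k l residue_mod[of k "k + l"] residue_mod[of l "k + l"]
      by (metis IntI le_add1 le_add2)
    then show "\<exists>m. \<forall>y. residue y m = residue x m \<longrightarrow> y \<in> S \<inter> T" by blast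
  qed
next
  fix K :: "'a padic set set"
  assume "\<forall>S\<in>K. open S"
  then show "open (\<Union>K)" unfolding open_padic_def by (meson Union_iff)
qed (simp add: open_padic_def)

end

abbreviation padic_p :: "'p::prime_card padic" where
  "padic_p \<equiv> of_nat CARD('p)"


text \<open>The binomial coefficient; \<open>r!\<close> does divide the product.\<close>

definition padic_binomial :: "'p::prime_card padic \<Rightarrow> nat \<Rightarrow> 'p padic" where
  "padic_binomial q r = (\<Prod>i<r. q - of_nat i) div fact r"


section \<open>Monoid rings, tensor products, quotient topologies\<close>

definition single :: "'g \<Rightarrow> 'a \<Rightarrow> 'g \<Rightarrow> 'a::zero" where
  "single x c = (\<lambda>y. if y = x then c else 0)"

definition monoid_ring :: "('g, 'm) monoid_scheme \<Rightarrow> ('g \<Rightarrow> 'a::comm_ring_1) ring" where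
  "monoid_ring M =
    \<lparr>carrier = {f. finite {x. f x \<noteq> 0} \<and> (\<forall>x. x \<notin> carrier M \<longrightarrow> f x = 0)},
     monoid.mult = (\<lambda>f g x. \<Sum>(y, z) | f y \<noteq> 0 \<and> g z \<noteq> 0 \<and> y \<otimes>\<^bsub>M\<^esub> z = x. f y * g z),
     one = single \<one>\<^bsub>M\<^esub> 1,
     zero = (\<lambda>_. 0),
     add = (\<lambda>f g x. f x + g x)\<rparr>"

text \<open>The linear extension of a map of monoids to the monoid rings.\<close>

definition pushforward :: "('g \<Rightarrow> 'h) \<Rightarrow> ('g \<Rightarrow> 'a::comm_ring_1) \<Rightarrow> 'h \<Rightarrow> 'a" where
  "pushforward \<phi> f = (\<lambda>y. \<Sum>x | f x \<noteq> 0 \<and> \<phi> x = y. f x)"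

text \<open>The tensor product of two algebras \<open>A\<close>, \<open>B\<close> over a commutative ring \<open>'r\<close>, with structure maps
  \<open>s\<close> and \<open>t\<close>. The free abelian group on the pairs \<open>(a, b)\<close> with product
  \<open>(a, b) (a', b') = (a a', b b')\<close> is the integral monoid ring of \<open>A \<times> B\<close>. The bilinearity relations
  are stable, up to sign and sums, under multiplication by pairs, so the ideal they generate is also
  the subgroup they generate.\<close>

abbreviation tensor_free :: "'a ring \<Rightarrow> 'b ring \<Rightarrow> ('a \<times> 'b \<Rightarrow> int) ring" where
  "tensor_free A B \<equiv> monoid_ring (A \<times>\<times> B)"

inductive_set tensor_rels ::
    "('r \<Rightarrow> 'a) \<Rightarrow> ('r \<Rightarrow> 'b) \<Rightarrow> 'a ring \<Rightarrow> 'b ring \<Rightarrow> ('a \<times> 'b \<Rightarrow> int) set"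
  for s :: "'r \<Rightarrow> 'a" and t :: "'r \<Rightarrow> 'b" and A :: "'a ring" and B :: "'b ring" where
  add_left: "\<lbrakk>a \<in> carrier A; a' \<in> carrier A; b \<in> carrier B\<rbrakk> \<Longrightarrow>
    single (a \<oplus>\<^bsub>A\<^esub> a', b) 1 \<ominus>\<^bsub>tensor_free A B\<^esub>
      (single (a, b) 1 \<oplus>\<^bsub>tensor_free A B\<^esub> single (a', b) 1) \<in> tensor_rels s t A B"
| add_right: "\<lbrakk>a \<in> carrier A; b \<in> carrier B; b' \<in> carrier B\<rbrakk> \<Longrightarrow>
    single (a, b \<oplus>\<^bsub>B\<^esub> b') 1 \<ominus>\<^bsub>tensor_free A B\<^esub>
      (single (a, b) 1 \<oplus>\<^bsub>tensor_free A B\<^esub> single (a, b') 1) \<in> tensor_rels s t A B"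
| balanced: "\<lbrakk>a \<in> carrier A; b \<in> carrier B\<rbrakk> \<Longrightarrow>
    single (s r \<otimes>\<^bsub>A\<^esub> a, b) 1 \<ominus>\<^bsub>tensor_free A B\<^esub> single (a, t r \<otimes>\<^bsub>B\<^esub> b) 1 \<in> tensor_rels s t A B"

definition tensor_ring ::
    "('r \<Rightarrow> 'a) \<Rightarrow> ('r \<Rightarrow> 'b) \<Rightarrow> 'a ring \<Rightarrow> 'b ring \<Rightarrow> ('a \<times> 'b \<Rightarrow> int) set ring" where
  "tensor_ring s t A B = tensor_free A B Quot (Idl\<^bsub>tensor_free A B\<^esub> (tensor_rels s t A B))"

definition pure_tensor ::
    "('r \<Rightarrow> 'a) \<Rightarrow> ('r \<Rightarrow> 'b) \<Rightarrow> 'a ring \<Rightarrow> 'b ring \<Rightarrow> 'a \<Rightarrow> 'b \<Rightarrow> ('a \<times> 'b \<Rightarrow> int) set" where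
  "pure_tensor s t A B a b =
    (Idl\<^bsub>tensor_free A B\<^esub> (tensor_rels s t A B)) +>\<^bsub>tensor_free A B\<^esub> single (a, b) 1"

definition quotient_topology :: "('a \<Rightarrow> 'b) \<Rightarrow> 'a topology \<Rightarrow> 'b topology" where
  "quotient_topology f X =
    topology (\<lambda>U. U \<subseteq> f ` topspace X \<and> openin X {x \<in> topspace X. f x \<in> U})"

lemma openin_quotient_topology:
  "openin (quotient_topology f X) U \<longleftrightarrow> U \<subseteq> f ` topspace X \<and> openin X {x \<in> topspace X. f x \<in> U}"
proof -
  have "istopology (\<lambda>U. U \<subseteq> f ` topspace X \<and> openin X {x \<in> topspace X. f x \<in> U})"
    unfolding istopology_def
  proof (intro conjI allI impI)
    fix S T
    assume *: "S \<subseteq> f ` topspace X \<and> openin X {x \<in> topspace X. f x \<in> S}"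
      "T \<subseteq> f ` topspace X \<and> openin X {x \<in> topspace X. f x \<in> T}"
    have "{x \<in> topspace X. f x \<in> S \<inter> T} = {x \<in> topspace X. f x \<in> S} \<inter> {x \<in> topspace X. f x \<in> T}"
      by blast
    with * show "openin X {x \<in> topspace X. f x \<in> S \<inter> T}" by auto
  next
    fix \<K>
    assume *: "\<forall>K\<in>\<K>. K \<subseteq> f ` topspace X \<and> openin X {x \<in> topspace X. f x \<in> K}"
    have "{x \<in> topspace X. f x \<in> \<Union>\<K>} = (\<Union>K\<in>\<K>. {x \<in> topspace X. f x \<in> K})" by blast
    with * show "openin X {x \<in> topspace X. f x \<in> \<Union>\<K>}" by auto
  qed blast+
  then show ?thesis by (simp add: quotient_topology_def topology_inverse')
qed


section \<open>Iwasawa algebras\<close>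

definition open_normal :: "'g monoid \<Rightarrow> 'g topology \<Rightarrow> 'g set set" where
  "open_normal G T = {N. N \<lhd> G \<and> openin T N}"

text \<open>The inverse limit of the group rings of \<open>G/N\<close>; for \<open>N \<subseteq> M\<close> the transition map comes from
  \<open>N g \<mapsto> M N g = M g\<close>.\<close>

definition iwasawa_algebra ::
    "'g monoid \<Rightarrow> 'g topology \<Rightarrow> ('g set \<Rightarrow> 'g set \<Rightarrow> 'a::comm_ring_1) ring" where
  "iwasawa_algebra G T =
    \<lparr>carrier = {f \<in> (\<Pi>\<^sub>E N\<in>open_normal G T. carrier (monoid_ring (G Mod N))).
       \<forall>N\<in>open_normal G T. \<forall>M\<in>open_normal G T. N \<subseteq> M \<longrightarrow>
         pushforward (\<lambda>C. M <#>\<^bsub>G\<^esub> C) (f N) = f M},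
     monoid.mult = (\<lambda>f g. \<lambda>N\<in>open_normal G T. f N \<otimes>\<^bsub>monoid_ring (G Mod N)\<^esub> g N),
     one = (\<lambda>N\<in>open_normal G T. \<one>\<^bsub>monoid_ring (G Mod N)\<^esub>),
     zero = (\<lambda>N\<in>open_normal G T. \<zero>\<^bsub>monoid_ring (G Mod N)\<^esub>),
     add = (\<lambda>f g. \<lambda>N\<in>open_normal G T. f N \<oplus>\<^bsub>monoid_ring (G Mod N)\<^esub> g N)\<rparr>"

definition iwasawa_topology ::
    "'g monoid \<Rightarrow> 'g topology \<Rightarrow> ('g set \<Rightarrow> 'g set \<Rightarrow> 'a::{comm_ring_1, topological_space}) topology" where
  "iwasawa_topology G T =
    subtopology
      (product_topology (\<lambda>N. top_of_set (carrier (monoid_ring (G Mod N)))) (open_normal G T))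
      (carrier (iwasawa_algebra G T))"

definition iwasawa_elem ::
    "'g monoid \<Rightarrow> 'g topology \<Rightarrow> 'g \<Rightarrow> 'g set \<Rightarrow> 'g set \<Rightarrow> 'a::comm_ring_1" where
  "iwasawa_elem G T g = (\<lambda>N\<in>open_normal G T. single (N #>\<^bsub>G\<^esub> g) 1)"

definition iwasawa_scalar ::
    "'g monoid \<Rightarrow> 'g topology \<Rightarrow> 'a \<Rightarrow> 'g set \<Rightarrow> 'g set \<Rightarrow> 'a::comm_ring_1" where
  "iwasawa_scalar G T c = (\<lambda>N\<in>open_normal G T. single \<one>\<^bsub>G Mod N\<^esub> c)"


section \<open>The pro-$p$ Iwahori subgroup and its root data\<close>

text \<open>Matrix indices, and hence roots, are numbered from \<open>0\<close> to \<open>n - 1\<close>.\<close>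

type_synonym root = "nat \<times> nat"

definition Roots :: "nat \<Rightarrow> root set" where
  "Roots n = {(i, j). i < n \<and> j < n \<and> i \<noteq> j}"

definition PosRoots :: "nat \<Rightarrow> root set" where
  "PosRoots n = {(i, j) \<in> Roots n. i < j}"

definition NegRoots :: "nat \<Rightarrow> root set" where
  "NegRoots n = {(i, j) \<in> Roots n. i > j}"

definition SimpleRoots :: "nat \<Rightarrow> root set" where
  "SimpleRoots n = {(i, j) \<in> Roots n. j = i + 1}"

abbreviation neg_root :: "root \<Rightarrow> root" where
  "neg_root \<equiv> prod.swap"

text \<open>\<open>\<alpha> + \<beta> \<in> \<Phi>\<close>, where addition is the commutative partial operation with
  \<open>(i, j) + (j, k) = (i, k)\<close>.\<close>

definition sum_is_root :: "nat \<Rightarrow> root \<Rightarrow> root \<Rightarrow> bool" where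
  "sum_is_root n \<alpha> \<beta> \<longleftrightarrow>
    (\<exists>i j k. (i, k) \<in> Roots n \<and> (\<alpha> = (i, j) \<and> \<beta> = (j, k) \<or> \<beta> = (i, j) \<and> \<alpha> = (j, k)))"

definition x_mat :: "nat \<Rightarrow> root \<Rightarrow> 'a \<Rightarrow> 'a::comm_ring_1 mat" where
  "x_mat n \<gamma> t = 1\<^sub>m n + mat n n (\<lambda>ij. if ij = \<gamma> then t else 0)"

definition h_mat :: "nat \<Rightarrow> root \<Rightarrow> 'a \<Rightarrow> 'a::{comm_ring_1, inverse} mat" where
  "h_mat n \<delta> l = mat n n (\<lambda>(i, j).
     if i \<noteq> j then 0 else if i = fst \<delta> then l else if i = snd \<delta> then inverse l else 1)"

text \<open>The inverse of \<open>h_mat n \<delta> l\<close> is \<open>h_mat n \<delta> (inverse l)\<close>.\<close>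

definition pairing :: "'p::prime_card itself \<Rightarrow> nat \<Rightarrow> root \<Rightarrow> root \<Rightarrow> int" where
  "pairing _ n \<gamma> \<delta> = (THE m. \<forall>(l::'p padic) t. l dvd 1 \<longrightarrow>
     h_mat n \<delta> l * x_mat n \<gamma> t * h_mat n \<delta> (inverse l) = x_mat n \<gamma> (l powi m * t))"

definition iwahori :: "nat \<Rightarrow> 'p::prime_card padic mat monoid" where
  "iwahori n =
    \<lparr>carrier = {g \<in> carrier_mat n n. det g = 1 \<and>
       (\<forall>i<n. padic_p dvd g $$ (i, i) - 1) \<and> (\<forall>i<n. \<forall>j<i. padic_p dvd g $$ (i, j))},
     monoid.mult = (*),
     one = 1\<^sub>m n\<rparr>"

definition iwahori_topology :: "nat \<Rightarrow> 'p::prime_card padic mat topology" where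
  "iwahori_topology n =
    pullback_topology (carrier (iwahori n)) (\<lambda>g. \<lambda>ij\<in>{..<n} \<times> {..<n}. g $$ ij)
      (product_topology (\<lambda>_. euclidean) ({..<n} \<times> {..<n}))"

type_synonym 'p iwahori_algebra_elem = "'p padic mat set \<Rightarrow> 'p padic mat set \<Rightarrow> 'p padic"

definition Lambda :: "nat \<Rightarrow> 'p::prime_card iwahori_algebra_elem ring" where
  "Lambda n = iwasawa_algebra (iwahori n) (iwahori_topology n)"

definition Lambda_topology :: "nat \<Rightarrow> 'p::prime_card iwahori_algebra_elem topology" where
  "Lambda_topology n = iwasawa_topology (iwahori n) (iwahori_topology n)"

definition Lambda_elem :: "nat \<Rightarrow> 'p::prime_card padic mat \<Rightarrow> 'p iwahori_algebra_elem" where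
  "Lambda_elem n = iwasawa_elem (iwahori n) (iwahori_topology n)"

definition Lambda_scalar :: "nat \<Rightarrow> 'p::prime_card padic \<Rightarrow> 'p iwahori_algebra_elem" where
  "Lambda_scalar n = iwasawa_scalar (iwahori n) (iwahori_topology n)"

text \<open>\<open>\<Lambda>(G) \<otimes> \<F>\<^sub>p\<close> over the \<open>p\<close>-adic integers, which map to \<open>\<F>\<^sub>p\<close> by reduction modulo \<open>p\<close>.\<close>

type_synonym 'p omega_elem = "('p iwahori_algebra_elem \<times> int \<Rightarrow> int) set"

definition Omega :: "nat \<Rightarrow> 'p::prime_card omega_elem ring" where
  "Omega n = tensor_ring (Lambda_scalar n) (\<lambda>c. residue c 1)
     (Lambda n) (residue_ring (int CARD('p)))"

definition Lambda_to_Omega :: "nat \<Rightarrow> 'p::prime_card iwahori_algebra_elem \<Rightarrow> 'p omega_elem" where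
  "Lambda_to_Omega n a = pure_tensor (Lambda_scalar n) (\<lambda>c. residue c 1)
     (Lambda n) (residue_ring (int CARD('p))) a \<one>\<^bsub>residue_ring (int CARD('p))\<^esub>"

definition Omega_topology :: "nat \<Rightarrow> 'p::prime_card omega_elem topology" where
  "Omega_topology n = quotient_topology (Lambda_to_Omega n) (Lambda_topology n)"


section \<open>The non-commutative power series ring\<close>

text \<open>A power series is the family of its coefficients, indexed by the words in the variables.\<close>

definition nc_power_series :: "'v set \<Rightarrow> ('v list \<Rightarrow> 'a::comm_ring_1) ring" where
  "nc_power_series X =
    \<lparr>carrier = lists X \<rightarrow>\<^sub>E UNIV,
     monoid.mult = (\<lambda>f g. \<lambda>w\<in>lists X. \<Sum>k\<le>length w. f (take k w) * g (drop k w)),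
     one = (\<lambda>w\<in>lists X. if w = [] then 1 else 0),
     zero = (\<lambda>w\<in>lists X. 0),
     add = (\<lambda>f g. \<lambda>w\<in>lists X. f w + g w)\<rparr>"

definition nc_topology :: "'v set \<Rightarrow> ('v list \<Rightarrow> 'a::topological_space) topology" where
  "nc_topology X = product_topology (\<lambda>_. euclidean) (lists X)"

definition nc_var :: "'v set \<Rightarrow> 'v \<Rightarrow> 'v list \<Rightarrow> 'a::comm_ring_1" where
  "nc_var X v = (\<lambda>w\<in>lists X. if w = [v] then 1 else 0)"

text \<open>\<open>(1 + v)\<^sup>q\<close>: the coefficient of \<open>v\<^sup>r\<close> is \<open>padic_binomial q r\<close>, all other coefficients vanish.\<close>

definition nc_binomial ::
    "'v set \<Rightarrow> 'v \<Rightarrow> 'p padic \<Rightarrow> 'v list \<Rightarrow> 'p::prime_card padic" where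
  "nc_binomial X v q = (\<lambda>w\<in>lists X. if w = replicate (length w) v then padic_binomial q (length w) else 0)"

definition closed_ideal_gen :: "'a ring \<Rightarrow> 'a topology \<Rightarrow> 'a set \<Rightarrow> 'a set" where
  "closed_ideal_gen R T S = \<Inter>{I. ideal I R \<and> closedin T I \<and> S \<subseteq> I}"

datatype ivar = U root | W root | V root

definition ivars :: "nat \<Rightarrow> ivar set" where
  "ivars n = U ` NegRoots n \<union> W ` SimpleRoots n \<union> V ` PosRoots n"

type_synonym 'p series = "ivar list \<Rightarrow> 'p padic"

definition A_ring :: "nat \<Rightarrow> 'p::prime_card series ring" where
  "A_ring n = nc_power_series (ivars n)"

definition A_topology :: "nat \<Rightarrow> 'p::prime_card series topology" where
  "A_topology n = nc_topology (ivars n)"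

definition A_var :: "nat \<Rightarrow> ivar \<Rightarrow> 'p::prime_card series" where
  "A_var n = nc_var (ivars n)"

definition one_plus :: "nat \<Rightarrow> ivar \<Rightarrow> 'p::prime_card series" where
  "one_plus n v = \<one>\<^bsub>A_ring n\<^esub> \<oplus>\<^bsub>A_ring n\<^esub> A_var n v"

definition one_plus_pow :: "nat \<Rightarrow> ivar \<Rightarrow> 'p padic \<Rightarrow> 'p::prime_card series" where
  "one_plus_pow n v q = nc_binomial (ivars n) v q"

text \<open>The ordered product \<open>(1 + W\<^bsub>(i,i+1)\<^esub>) \<cdots> (1 + W\<^bsub>(j-1,j)\<^esub>)\<close>.\<close>

definition W_prod :: "nat \<Rightarrow> nat \<Rightarrow> nat \<Rightarrow> 'p::prime_card series" where
  "W_prod n i j = foldr (\<lambda>c f. one_plus n (W (c, c + 1)) \<otimes>\<^bsub>A_ring n\<^esub> f) [i..<j] \<one>\<^bsub>A_ring n\<^esub>"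

inductive_set relators :: "nat \<Rightarrow> 'p::prime_card series set" for n :: nat where
  rel1: "\<lbrakk>\<delta> \<in> SimpleRoots n; \<beta> \<in> NegRoots n\<rbrakk> \<Longrightarrow>
    one_plus n (W \<delta>) \<otimes>\<^bsub>A_ring n\<^esub> one_plus n (U \<beta>) \<ominus>\<^bsub>A_ring n\<^esub>
    one_plus_pow n (U \<beta>) ((1 + padic_p) powi pairing TYPE('p) n \<beta> \<delta>) \<otimes>\<^bsub>A_ring n\<^esub> one_plus n (W \<delta>)
    \<in> relators n"
| rel2: "\<lbrakk>\<delta> \<in> SimpleRoots n; \<alpha> \<in> PosRoots n\<rbrakk> \<Longrightarrow>
    one_plus n (W \<delta>) \<otimes>\<^bsub>A_ring n\<^esub> one_plus n (V \<alpha>) \<ominus>\<^bsub>A_ring n\<^esub>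
    one_plus_pow n (V \<alpha>) ((1 + padic_p) powi pairing TYPE('p) n \<alpha> \<delta>) \<otimes>\<^bsub>A_ring n\<^esub> one_plus n (W \<delta>)
    \<in> relators n"
| rel3: "\<lbrakk>\<alpha> \<in> PosRoots n; \<beta> \<in> NegRoots n; \<alpha> \<noteq> neg_root \<beta>; \<not> sum_is_root n \<alpha> \<beta>\<rbrakk> \<Longrightarrow>
    A_var n (V \<alpha>) \<otimes>\<^bsub>A_ring n\<^esub> A_var n (U \<beta>) \<ominus>\<^bsub>A_ring n\<^esub>
    A_var n (U \<beta>) \<otimes>\<^bsub>A_ring n\<^esub> A_var n (V \<alpha>) \<in> relators n"
| rel4: "\<lbrakk>(i, j) \<in> PosRoots n; (j, k) \<in> NegRoots n; i < k\<rbrakk> \<Longrightarrow>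
    one_plus n (V (i, j)) \<otimes>\<^bsub>A_ring n\<^esub> one_plus n (U (j, k)) \<ominus>\<^bsub>A_ring n\<^esub>
    one_plus_pow n (V (i, k)) padic_p \<otimes>\<^bsub>A_ring n\<^esub>
      one_plus n (U (j, k)) \<otimes>\<^bsub>A_ring n\<^esub> one_plus n (V (i, j)) \<in> relators n"
| rel5: "\<lbrakk>(i, j) \<in> PosRoots n; (j, k) \<in> NegRoots n; i > k\<rbrakk> \<Longrightarrow>
    one_plus n (V (i, j)) \<otimes>\<^bsub>A_ring n\<^esub> one_plus n (U (j, k)) \<ominus>\<^bsub>A_ring n\<^esub>
    one_plus n (U (i, k)) \<otimes>\<^bsub>A_ring n\<^esub>
      one_plus n (U (j, k)) \<otimes>\<^bsub>A_ring n\<^esub> one_plus n (V (i, j)) \<in> relators n"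
| rel6: "\<lbrakk>(i, j) \<in> PosRoots n; (k, i) \<in> NegRoots n; k < j\<rbrakk> \<Longrightarrow>
    one_plus n (V (i, j)) \<otimes>\<^bsub>A_ring n\<^esub> one_plus n (U (k, i)) \<ominus>\<^bsub>A_ring n\<^esub>
    one_plus_pow n (V (k, j)) (- padic_p) \<otimes>\<^bsub>A_ring n\<^esub>
      one_plus n (U (k, i)) \<otimes>\<^bsub>A_ring n\<^esub> one_plus n (V (i, j)) \<in> relators n"
| rel7: "\<lbrakk>(i, j) \<in> PosRoots n; (k, i) \<in> NegRoots n; k > j\<rbrakk> \<Longrightarrow>
    one_plus n (V (i, j)) \<otimes>\<^bsub>A_ring n\<^esub> one_plus n (U (k, i)) \<ominus>\<^bsub>A_ring n\<^esub>
    one_plus_pow n (U (k, j)) (- 1) \<otimes>\<^bsub>A_ring n\<^esub>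
      one_plus n (U (k, i)) \<otimes>\<^bsub>A_ring n\<^esub> one_plus n (V (i, j)) \<in> relators n"
| rel8: "(i, j) \<in> PosRoots n \<Longrightarrow>
    one_plus n (V (i, j)) \<otimes>\<^bsub>A_ring n\<^esub> one_plus n (U (j, i)) \<ominus>\<^bsub>A_ring n\<^esub>
    one_plus_pow n (U (j, i)) (inverse (1 + padic_p)) \<otimes>\<^bsub>A_ring n\<^esub>
      W_prod n i j \<otimes>\<^bsub>A_ring n\<^esub> one_plus_pow n (V (i, j)) (inverse (1 + padic_p)) \<in> relators n"
| rel9: "\<lbrakk>\<beta>\<^sub>1 \<in> NegRoots n; \<beta>\<^sub>2 \<in> NegRoots n; \<not> sum_is_root n \<beta>\<^sub>1 \<beta>\<^sub>2\<rbrakk> \<Longrightarrow>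
    A_var n (U \<beta>\<^sub>1) \<otimes>\<^bsub>A_ring n\<^esub> A_var n (U \<beta>\<^sub>2) \<ominus>\<^bsub>A_ring n\<^esub>
    A_var n (U \<beta>\<^sub>2) \<otimes>\<^bsub>A_ring n\<^esub> A_var n (U \<beta>\<^sub>1) \<in> relators n"
| rel10: "\<lbrakk>(i, j) \<in> NegRoots n; (j, k) \<in> NegRoots n\<rbrakk> \<Longrightarrow>
    one_plus n (U (i, j)) \<otimes>\<^bsub>A_ring n\<^esub> one_plus n (U (j, k)) \<ominus>\<^bsub>A_ring n\<^esub>
    one_plus_pow n (U (i, k)) padic_p \<otimes>\<^bsub>A_ring n\<^esub>
      one_plus n (U (j, k)) \<otimes>\<^bsub>A_ring n\<^esub> one_plus n (U (i, j)) \<in> relators n"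
| rel11: "\<lbrakk>(i, j) \<in> NegRoots n; (k, i) \<in> NegRoots n\<rbrakk> \<Longrightarrow>
    one_plus n (U (i, j)) \<otimes>\<^bsub>A_ring n\<^esub> one_plus n (U (k, i)) \<ominus>\<^bsub>A_ring n\<^esub>
    one_plus_pow n (U (k, j)) (- padic_p) \<otimes>\<^bsub>A_ring n\<^esub>
      one_plus n (U (k, i)) \<otimes>\<^bsub>A_ring n\<^esub> one_plus n (U (i, j)) \<in> relators n"
| rel12: "\<lbrakk>\<delta>\<^sub>1 \<in> SimpleRoots n; \<delta>\<^sub>2 \<in> SimpleRoots n\<rbrakk> \<Longrightarrow>
    A_var n (W \<delta>\<^sub>1) \<otimes>\<^bsub>A_ring n\<^esub> A_var n (W \<delta>\<^sub>2) \<ominus>\<^bsub>A_ring n\<^esub>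
    A_var n (W \<delta>\<^sub>2) \<otimes>\<^bsub>A_ring n\<^esub> A_var n (W \<delta>\<^sub>1) \<in> relators n"
| rel13: "\<lbrakk>\<alpha>\<^sub>1 \<in> PosRoots n; \<alpha>\<^sub>2 \<in> PosRoots n; \<not> sum_is_root n \<alpha>\<^sub>1 \<alpha>\<^sub>2\<rbrakk> \<Longrightarrow>
    A_var n (V \<alpha>\<^sub>1) \<otimes>\<^bsub>A_ring n\<^esub> A_var n (V \<alpha>\<^sub>2) \<ominus>\<^bsub>A_ring n\<^esub>
    A_var n (V \<alpha>\<^sub>2) \<otimes>\<^bsub>A_ring n\<^esub> A_var n (V \<alpha>\<^sub>1) \<in> relators n"
| rel14: "\<lbrakk>(i, j) \<in> PosRoots n; (j, k) \<in> PosRoots n\<rbrakk> \<Longrightarrow>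
    one_plus n (V (i, j)) \<otimes>\<^bsub>A_ring n\<^esub> one_plus n (V (j, k)) \<ominus>\<^bsub>A_ring n\<^esub>
    one_plus n (V (i, k)) \<otimes>\<^bsub>A_ring n\<^esub>
      one_plus n (V (j, k)) \<otimes>\<^bsub>A_ring n\<^esub> one_plus n (V (i, j)) \<in> relators n"
| rel15: "\<lbrakk>(i, j) \<in> PosRoots n; (k, i) \<in> PosRoots n\<rbrakk> \<Longrightarrow>
    one_plus n (V (k, i)) \<otimes>\<^bsub>A_ring n\<^esub> one_plus n (V (i, j)) \<ominus>\<^bsub>A_ring n\<^esub>
    one_plus n (V (k, j)) \<otimes>\<^bsub>A_ring n\<^esub>
      one_plus n (V (i, j)) \<otimes>\<^bsub>A_ring n\<^esub> one_plus n (V (k, i)) \<in> relators n"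

definition R_ideal :: "nat \<Rightarrow> 'p::prime_card series set" where
  "R_ideal n = closed_ideal_gen (A_ring n) (A_topology n) (relators n)"

definition pA :: "nat \<Rightarrow> 'p::prime_card series set" where
  "pA n = (\<lambda>a. [CARD('p)] \<cdot>\<^bsub>A_ring n\<^esub> a) ` carrier (A_ring n)"

definition A_bar :: "nat \<Rightarrow> 'p::prime_card series set ring" where
  "A_bar n = A_ring n Quot pA n"

definition to_A_bar :: "nat \<Rightarrow> 'p::prime_card series \<Rightarrow> 'p series set" where
  "to_A_bar n a = pA n +>\<^bsub>A_ring n\<^esub> a"

definition A_bar_topology :: "nat \<Rightarrow> 'p::prime_card series set topology" where
  "A_bar_topology n = quotient_topology (to_A_bar n) (A_topology n)"

definition R_bar :: "nat \<Rightarrow> 'p::prime_card series set set" where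
  "R_bar n = to_A_bar n ` R_ideal n"


section \<open>The natural map\<close>

text \<open>The natural map is the continuous ring homomorphism with the prescribed values on the variables;
  extensionality only fixes its values outside the carrier.\<close>

definition natural_map :: "nat \<Rightarrow> ('p::prime_card series set \<Rightarrow> 'p omega_elem) \<Rightarrow> bool" where
  "natural_map n \<psi> \<longleftrightarrow>
    \<psi> \<in> Ring.ring_hom (A_bar n) (Omega n) \<and>
    \<psi> \<in> extensional (carrier (A_bar n)) \<and>
    continuous_map (A_bar_topology n) (Omega_topology n) \<psi> \<and>
    (\<forall>\<beta>\<in>NegRoots n. \<psi> (to_A_bar n (A_var n (U \<beta>))) =
       Lambda_to_Omega n (Lambda_elem n (x_mat n \<beta> padic_p) \<ominus>\<^bsub>Lambda n\<^esub> \<one>\<^bsub>Lambda n\<^esub>)) \<and>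
    (\<forall>\<delta>\<in>SimpleRoots n. \<psi> (to_A_bar n (A_var n (W \<delta>))) =
       Lambda_to_Omega n (Lambda_elem n (h_mat n \<delta> (1 + padic_p)) \<ominus>\<^bsub>Lambda n\<^esub> \<one>\<^bsub>Lambda n\<^esub>)) \<and>
    (\<forall>\<alpha>\<in>PosRoots n. \<psi> (to_A_bar n (A_var n (V \<alpha>))) =
       Lambda_to_Omega n (Lambda_elem n (x_mat n \<alpha> 1) \<ominus>\<^bsub>Lambda n\<^esub> \<one>\<^bsub>Lambda n\<^esub>))"

definition induces_iso :: "('a \<Rightarrow> 'b) \<Rightarrow> 'a ring \<Rightarrow> 'a set \<Rightarrow> 'b ring \<Rightarrow> bool" where
  "induces_iso \<psi> A I B \<longleftrightarrow> (\<exists>F\<in>ring_iso (A Quot I) B. \<forall>a\<in>carrier A. F (I +>\<^bsub>A\<^esub> a) = \<psi> a)"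

end

theory Submission
  imports Defs
begin

text \<open>
  The group \<open>G\<close> is filtered by the normal subgroups \<open>H d\<close> of matrices congruent to \<open>1\<close> modulo powers
  of the radical of the Iwahori order; commutators and \<open>p\<close>-th powers raise \<open>d\<close>, so long products
  of elements \<open>g - 1\<close> are small and the variables may be evaluated in \<open>\<Lambda>(G)\<close>. The relators vanish in
  \<open>\<Omega>\<^sub>G\<close> by matrix identities. Conversely, give each variable the weight by which its image deviates
  from \<open>1\<close>. Modulo higher weight (this uses \<open>p > n + 1\<close>) the relations become commutation rules up to
  shorter words, so every series is congruent modulo \<open>R\<close>, \<open>p\<close> and arbitrarily high weight to a
  combination of ordered monomials \<open>U \<cdots> U W \<cdots> W V \<cdots> V\<close>. Ordered monomials are independent in
  \<open>\<Omega>\<^sub>G\<close>: the coordinates of the decomposition lower times diagonal times upper are continuous on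
  \<open>G\<close>, and pairing a monomial with products of binomial coefficients of the coordinates extracts
  coefficients (Mahler). Compactness turns the congruences into \<open>Ker = R + p A\<close>, and it gives
  surjectivity because ordered products of powers of the generators are dense in \<open>G\<close>.
\<close>


section \<open>Arithmetic and topology of the p-adic integers\<close>

text \<open>Commutation does not preserve the length of a word: a bracket relation may replace two
  letters by one letter of the same total weight. Rewriting is therefore an induction on the weight
  with an inner induction on the length. The weight of a variable is the depth of its generator in
  the radical filtration: j - i for \<open>V (i, j)\<close>, n - (i - j) for
  \<open>U (i, j)\<close>, n for every W. The p-th powers occurring in the relations are harmless
  because the weight of the commutator exceeds that of the letter being raised to a power by at most
  n, while p * x \<ge> n + x + 1 for every weight x \<ge> 1, by p > n + 1. The radical filtration is
  finer than congruence modulo powers of p; it starts at G itself, so that differences by arbitrary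
  elements of G become nilpotent modulo p at each finite level. The ring \<open>Omega n\<close> is a
  quotient of a free abelian group on pairs. Equality in it is first translated into congruence
  modulo p of all coefficients at all finite levels; kernel and image then become statements about
  such congruences.\<close>

lemma CARD_gt_1: "1 < CARD('p::prime_card)"
  using prime_card[where 'a='p] prime_gt_1_nat by blast

lemma residue_range:
  fixes x :: "'p::prime_card padic"
  shows "0 \<le> residue x k" "residue x k < int CARD('p) ^ k"
  using residue[of x] by auto

lemma residue_diff_eq_0_iff:
  fixes x y :: "'p::prime_card padic"
  shows "residue (x - y) k = 0 \<longleftrightarrow> residue x k = residue y k"
proof -
  have "residue (x - y) k = 0 \<longleftrightarrow> residue x k mod int CARD('p) ^ k = residue y k mod int CARD('p) ^ k"
    by (simp add: minus_padic.rep_eq mod_eq_dvd_iff dvd_eq_mod_eq_0)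
  then show ?thesis using residue_range[of x k] residue_range[of y k] by simp
qed

lemma p_power_dvd_iff:
  fixes x :: "'p::prime_card padic"
  shows "padic_p ^ k dvd x \<longleftrightarrow> residue x k = 0"
proof
  assume "padic_p ^ k dvd x"
  then obtain y where "x = of_nat (CARD('p) ^ k) * y" by auto
  then show "residue x k = 0"
    by (simp only: times_padic.rep_eq residue_of_nat) simp
next
  assume 0: "residue x k = 0"
  let ?p = "int CARD('p)"
  \<comment> \<open>The digits of the quotient by p^k are those of x read k places further
    on.\<close>
  let ?f = "\<lambda>j. residue x (j + k) div ?p ^ k"
  have p: "0 < ?p ^ i" for i by (rule prime_card_int_power_pos)
  have d: "?p ^ k dvd residue x (j + k)" for j
    using residue_mod[of k "j + k" x] 0 by (simp add: dvd_eq_mod_eq_0)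
  have "?f j \<in> {0..<?p ^ j} \<and> ?f (Suc j) mod ?p ^ j = ?f j" for j
  proof (intro conjI)
    have "residue x (j + k) < ?p ^ j * ?p ^ k"
      using residue_range(2)[of x "j + k"] by (simp add: power_add)
    then have "?f j < ?p ^ j"
      using p[of k] by (metis d dvd_div_mult_self mult_less_cancel_right_pos)
    then show "?f j \<in> {0..<?p ^ j}"
      using residue_range(1)[of x "j + k"] p[of k] by (simp add: pos_imp_zdiv_nonneg_iff)
    have "residue x (j + k) = residue x (Suc j + k) mod (?p ^ k * ?p ^ j)"
      using residue_mod[of "j + k" "Suc j + k" x] by (simp add: power_add mult.commute)
    also have "\<dots> = ?p ^ k * (?f (Suc j) mod ?p ^ j)"
      using d[of "Suc j"] by (subst zmod_zmult2_eq) auto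
    finally show "?f (Suc j) mod ?p ^ j = ?f j" using p[of k] by simp
  qed
  then have r: "residue (Abs_padic ?f :: 'p padic) = ?f" by (subst Abs_padic_inverse) auto
  have "x = of_nat (CARD('p) ^ k) * Abs_padic ?f"
  proof (rule padic_eqI)
    fix l
    have "residue (of_nat (CARD('p) ^ k) * Abs_padic ?f :: 'p padic) l = (?p ^ k mod ?p ^ l * ?f l) mod ?p ^ l"
      by (simp only: times_padic.rep_eq residue_of_nat r) simp
    also have "\<dots> = (?p ^ k * ?f l) mod ?p ^ l" by (simp add: mod_mult_left_eq)
    also have "\<dots> = residue x (l + k) mod ?p ^ l" using d[of l] by simp
    also have "\<dots> = residue x l" by (rule residue_mod) simp
    finally show "residue x l = residue (of_nat (CARD('p) ^ k) * Abs_padic ?f :: 'p padic) l" ..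
  qed
  then show "padic_p ^ k dvd x" by (metis dvd_triv_left of_nat_power)
qed

text \<open>Allows every topological statement to be phrased through divisibility of differences by
  powers of p.\<close>

lemma residue_eq_iff:
  fixes x y :: "'p::prime_card padic"
  shows "residue x k = residue y k \<longleftrightarrow> padic_p ^ k dvd x - y"
  by (simp add: p_power_dvd_iff residue_diff_eq_0_iff)

lemma dvd_diff_sym:
  fixes x y :: "'a::comm_ring_1"
  shows "d dvd x - y \<longleftrightarrow> d dvd y - x"
  by (metis dvd_minus_iff minus_diff_eq)

lemma dvd_diff_trans:
  fixes x y z :: "'a::comm_ring_1"
  shows "d dvd x - y \<Longrightarrow> d dvd y - z \<Longrightarrow> d dvd x - z"
  using dvd_add[of d "x - y" "y - z"] by simp

lemma dvd_diff_mult: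
  fixes x y x' y' :: "'a::comm_ring_1"
  assumes "d dvd x - x'" "d dvd y - y'"
  shows "d dvd x * y - x' * y'"
proof -
  have "x * y - x' * y' = (x - x') * y + x' * (y - y')" by (simp add: algebra_simps)
  then show ?thesis using assms by simp
qed

lemma dvd_diff_add:
  fixes x y x' y' :: "'a::comm_ring_1"
  assumes "d dvd x - x'" "d dvd y - y'"
  shows "d dvd (x + y) - (x' + y')"
  using dvd_add[OF assms] by (simp add: algebra_simps)

lemma dvd_diff_sum:
  fixes f g :: "'b \<Rightarrow> 'a::comm_ring_1"
  assumes "\<And>i. i \<in> S \<Longrightarrow> d dvd f i - g i"
  shows "d dvd sum f S - sum g S"
  using assms by (simp add: sum_subtractf[symmetric] dvd_sum)

lemma dvd_diff_prod:
  fixes f g :: "'b \<Rightarrow> 'a::comm_ring_1"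
  assumes "\<And>i. i \<in> S \<Longrightarrow> d dvd f i - g i"
  shows "d dvd prod f S - prod g S"
  using assms by (induction S rule: infinite_finite_induct) (auto intro: dvd_diff_mult)

text \<open>Density of the naturals: the k-th residue itself approximates x to precision k.\<close>

lemma padic_approx_nat: "\<exists>m::nat. padic_p ^ k dvd (x::'p::prime_card padic) - of_nat m"
proof
  show "padic_p ^ k dvd x - of_nat (nat (residue x k))"
    using residue_range[of x k] by (simp add: residue_eq_iff[symmetric] residue_of_nat del: of_nat_nat)
qed

lemma p_not_dvd_1: "\<not> (padic_p :: 'p::prime_card padic) dvd 1"
  using p_power_dvd_iff[of 1 "1 :: 'p padic"] CARD_gt_1[where 'p='p] by (simp add: one_padic.rep_eq)

lemma p_nonzero: "(padic_p :: 'p::prime_card padic) \<noteq> 0"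
  using CARD_gt_1[where 'p='p] by (metis of_nat_eq_0_iff not_one_less_zero)

lemma p_dvd_of_nat_iff: "(padic_p :: 'p::prime_card padic) dvd of_nat m \<longleftrightarrow> CARD('p) dvd m"
  using p_power_dvd_iff[of 1 "of_nat m :: 'p padic"]
  by (simp add: residue_of_nat dvd_eq_mod_eq_0 flip: of_nat_mod)

lemma p_power_dvd_of_nat_iff: "(padic_p :: 'p::prime_card padic) ^ k dvd of_nat m \<longleftrightarrow> CARD('p) ^ k dvd m"
  unfolding p_power_dvd_iff by (simp add: residue_of_nat dvd_eq_mod_eq_0 flip: of_nat_mod of_nat_power)

text \<open>Bezout coefficients invert the residue modulo each p^k; cancelling the unit residue
  shows that the inverses at successive levels are compatible.\<close>

lemma padic_unit:
  fixes u :: "'p::prime_card padic"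
  assumes "\<not> padic_p dvd u"
  shows "u dvd 1"
proof -
  let ?p = "int CARD('p)"
  have prime: "prime ?p" by (rule prime_card_int)
  have cop: "coprime (residue u k) (?p ^ k)" for k
  proof (cases k)
    case (Suc l)
    have "residue u k mod ?p ^ 1 = residue u 1" by (rule residue_mod) (simp add: Suc)
    moreover have "residue u 1 \<noteq> 0" using assms p_power_dvd_iff[of 1 u] by simp
    ultimately have "\<not> ?p dvd residue u k" by (auto simp: dvd_eq_mod_eq_0)
    then have "coprime ?p (residue u k)" using prime prime_imp_coprime by blast
    then show ?thesis by (simp add: coprime_commute)
  qed auto
  define f where "f k = fst (bezout_coefficients (residue u k) (?p ^ k)) mod ?p ^ k" for k
  have f: "(residue u k * f k) mod ?p ^ k = 1 mod ?p ^ k" for k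
  proof -
    have eq: "fst (bezout_coefficients (residue u k) (?p ^ k)) * residue u k
      + snd (bezout_coefficients (residue u k) (?p ^ k)) * ?p ^ k = 1"
      using cop[of k] bezout_coefficients_fst_snd[of "residue u k" "?p ^ k"] by simp
    have "(fst (bezout_coefficients (residue u k) (?p ^ k)) * residue u k) mod ?p ^ k = 1 mod ?p ^ k"
      by (subst eq[symmetric]) simp
    then show ?thesis by (simp add: f_def mod_mult_right_eq mult.commute)
  qed
  have "f k \<in> {0..<?p ^ k} \<and> f (Suc k) mod ?p ^ k = f k" for k
  proof
    show r: "f k \<in> {0..<?p ^ k}" using prime_card_int_power_pos[where 'p='p] by (simp add: f_def)
    have "(residue u (Suc k) * f (Suc k)) mod ?p ^ Suc k mod ?p ^ k = 1 mod ?p ^ k"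
      by (simp only: f mod_power_Suc_mod)
    then have "(residue u (Suc k) * f (Suc k)) mod ?p ^ k = 1 mod ?p ^ k"
      by (simp only: mod_power_Suc_mod)
    then have "(residue u (Suc k) mod ?p ^ k * f (Suc k)) mod ?p ^ k = (residue u k * f k) mod ?p ^ k"
      by (simp only: f mod_mult_left_eq)
    moreover have "residue u (Suc k) mod ?p ^ k = residue u k" by (rule residue_mod) simp
    ultimately have "[residue u k * f (Suc k) = residue u k * f k] (mod ?p ^ k)"
      by (simp add: cong_def)
    then have "[f (Suc k) = f k] (mod ?p ^ k)" using cop by (simp add: cong_mult_lcancel)
    then show "f (Suc k) mod ?p ^ k = f k" using r by (simp add: cong_def)
  qed
  then have r: "residue (Abs_padic f :: 'p padic) = f" by (subst Abs_padic_inverse) auto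
  have "u * Abs_padic f = 1"
    by (rule padic_eqI) (simp add: times_padic.rep_eq one_padic.rep_eq r f)
  then show ?thesis by (metis dvd_triv_left)
qed

lemma padic_inverse:
  fixes u :: "'p::prime_card padic"
  assumes "\<not> padic_p dvd u"
  shows "inverse u * u = 1"
proof -
  obtain v where v: "1 = u * v" using padic_unit[OF assms] by blast
  then have "u \<noteq> 0" by auto
  have "inverse u = v"
    unfolding inverse_padic_def v using \<open>u \<noteq> 0\<close> by simp
  then show ?thesis using v by (simp add: mult.commute)
qed

lemma p_power_dvd_mult_unit:
  fixes u x :: "'p::prime_card padic"
  assumes "\<not> padic_p dvd u"
  shows "padic_p ^ k dvd u * x \<longleftrightarrow> padic_p ^ k dvd x"
  using padic_unit[OF assms] by (simp add: dvd_mult_unit_iff dvd_mult_unit_iff')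

lemma p_dvd_mult_iff:
  fixes x y :: "'p::prime_card padic"
  shows "padic_p dvd x * y \<longleftrightarrow> padic_p dvd x \<or> padic_p dvd y"
  using p_power_dvd_mult_unit[of x 1 y] by auto

lemma padic_of_nat_decompose:
  assumes "m > 0"
  obtains v u where "(of_nat m :: 'p::prime_card padic) = padic_p ^ v * u" "\<not> padic_p dvd u"
proof -
  obtain y where y: "m = CARD('p) ^ multiplicity CARD('p) m * y" "\<not> CARD('p) dvd y"
    by (rule multiplicity_decompose'[of m "CARD('p)"])
       (use assms CARD_gt_1[where 'p='p] in auto)
  then have "(of_nat m :: 'p padic) = padic_p ^ multiplicity CARD('p) m * of_nat y"
    by (metis of_nat_mult of_nat_power)
  then show ?thesis using that y(2) p_dvd_of_nat_iff by blast
qed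

section \<open>Binomial coefficients of p-adic integers\<close>

lemma prod_of_nat_diff_eq_binomial:
  "(\<Prod>i<r. of_nat m - of_nat i :: 'a::{comm_ring_1, semiring_char_0}) = fact r * of_nat (m choose r)"
proof -
  \<comment> \<open>The identity comes from generalised binomials over the reals, is pulled back to
    the integers and from there mapped into an arbitrary ring.\<close>
  have "(\<Prod>i<r. of_nat m - of_nat i :: real) = fact r * of_nat (m choose r)"
    by (simp add: binomial_gbinomial gbinomial_prod_rev atLeast0LessThan)
  then have "real_of_int (\<Prod>i<r. int m - int i) = real_of_int (fact r * int (m choose r))" by simp
  then have "(\<Prod>i<r. int m - int i) = fact r * int (m choose r)" by (simp only: of_int_eq_iff)
  then have "(of_int (\<Prod>i<r. int m - int i) :: 'a) = of_int (fact r * int (m choose r))" by simp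
  then show ?thesis by simp
qed

text \<open>Exactness of the division by r!: write r! = p^v u with a unit u and replace q modulo p^v
  by a natural number, for which r! is known to divide the falling product.\<close>

lemma padic_binomial_times_fact:
  "fact r * padic_binomial q r = (\<Prod>i<r. q - of_nat i :: 'p::prime_card padic)"
proof -
  obtain v u where vu: "(of_nat (fact r) :: 'p padic) = padic_p ^ v * u" "\<not> padic_p dvd u"
    by (rule padic_of_nat_decompose[OF fact_gt_zero])
  then have fact: "(fact r :: 'p padic) = padic_p ^ v * u" by (simp only: of_nat_fact)
  obtain m where m: "padic_p ^ v dvd q - of_nat m" using padic_approx_nat[of v q] by (elim exE)
  have "padic_p ^ v dvd (\<Prod>i<r. q - of_nat i) - (\<Prod>i<r. of_nat m - of_nat i)"
    by (rule dvd_diff_prod) (use m in simp)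
  moreover have "padic_p ^ v dvd (\<Prod>i<r. of_nat m - of_nat i :: 'p padic)"
    by (simp add: prod_of_nat_diff_eq_binomial fact)
  ultimately have "padic_p ^ v dvd (\<Prod>i<r. q - of_nat i)"
    by (metis dvd_add diff_add_cancel)
  then have "fact r dvd (\<Prod>i<r. q - of_nat i)"
    unfolding fact using padic_unit[OF vu(2)] by (simp add: mult_unit_dvd_iff)
  then obtain z where z: "(\<Prod>i<r. q - of_nat i) = fact r * z" by blast
  have "(fact r :: 'p padic) \<noteq> 0" by (metis fact_nonzero of_nat_eq_0_iff of_nat_fact)
  then show ?thesis unfolding padic_binomial_def z by simp
qed

lemma padic_fact_nonzero: "(fact r :: 'p::prime_card padic) \<noteq> 0"
  by (metis fact_nonzero of_nat_eq_0_iff of_nat_fact)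

lemma padic_binomial_of_nat [simp]:
  "padic_binomial (of_nat m :: 'p::prime_card padic) r = of_nat (m choose r)"
proof -
  have "fact r * padic_binomial (of_nat m :: 'p padic) r = fact r * of_nat (m choose r)"
    by (simp only: padic_binomial_times_fact prod_of_nat_diff_eq_binomial)
  then show ?thesis using padic_fact_nonzero by (simp only: mult_cancel_left) auto
qed

lemma padic_binomial_0 [simp]: "padic_binomial q 0 = (1 :: 'p::prime_card padic)"
  using padic_binomial_times_fact[of 0 q] by simp

lemma padic_binomial_1 [simp]: "padic_binomial q (Suc 0) = (q :: 'p::prime_card padic)"
  using padic_binomial_times_fact[of 1 q] by simp

text \<open>Dividing by r! costs its p-adic valuation v, so agreement modulo p^(v+1) of the
  arguments leaves agreement modulo p of the coefficients.\<close>

lemma padic_binomial_cong: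
  "\<exists>K. \<forall>q q' :: 'p::prime_card padic. padic_p ^ K dvd q - q' \<longrightarrow>
     padic_p dvd padic_binomial q r - padic_binomial q' r"
proof -
  obtain v u where vu: "(of_nat (fact r) :: 'p padic) = padic_p ^ v * u" "\<not> padic_p dvd u"
    by (rule padic_of_nat_decompose[OF fact_gt_zero])
  then have fact: "(fact r :: 'p padic) = padic_p ^ v * u" by (simp only: of_nat_fact)
  show ?thesis
  proof (intro exI allI impI)
    fix q q' :: "'p padic" assume *: "padic_p ^ Suc v dvd q - q'"
    have "padic_p ^ Suc v dvd (\<Prod>i<r. q - of_nat i) - (\<Prod>i<r. q' - of_nat i)"
      by (rule dvd_diff_prod) (use * in simp)
    then have "padic_p ^ v * padic_p dvd padic_p ^ v * (u * (padic_binomial q r - padic_binomial q' r))"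
      by (simp add: padic_binomial_times_fact[symmetric] fact algebra_simps)
    then have "padic_p dvd u * (padic_binomial q r - padic_binomial q' r)"
      using p_nonzero[where 'p='p] by (simp only: dvd_mult_cancel_left power_eq_0_iff) simp
    then show "padic_p dvd padic_binomial q r - padic_binomial q' r"
      using vu(2) by (simp add: p_dvd_mult_iff)
  qed
qed

lemma padic_binomial_cong_bounded:
  "\<exists>K. \<forall>r<M. \<forall>q q' :: 'p::prime_card padic. padic_p ^ K dvd q - q' \<longrightarrow>
     padic_p dvd padic_binomial q r - padic_binomial q' r"
proof -
  obtain K where K: "\<And>r q q'. padic_p ^ K r dvd q - q' \<Longrightarrow>
     padic_p dvd padic_binomial q r - (padic_binomial q' r :: 'p padic)"
    using padic_binomial_cong by metis
  show ?thesis
  proof (intro exI allI impI)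
    fix r and q q' :: "'p padic"
    assume r: "r < M" and d: "padic_p ^ (\<Sum>r<M. K r) dvd q - q'"
    have "K r \<le> (\<Sum>r<M. K r)" using r by (intro member_le_sum) auto
    then have "padic_p ^ K r dvd q - q'" using d by (meson dvd_trans le_imp_power_dvd)
    then show "padic_p dvd padic_binomial q r - padic_binomial q' r" by (rule K)
  qed
qed

text \<open>For r < p the factorial is a unit, so one factor divisible by p suffices. With i = 0 and
  i = 1 this removes the intermediate terms of (1 + v)^q when q is 0 or 1 modulo p.\<close>

lemma p_dvd_padic_binomial:
  fixes q :: "'p::prime_card padic"
  assumes "r < CARD('p)" "i < r" "padic_p dvd q - of_nat i"
  shows "padic_p dvd padic_binomial q r"
proof -
  have "padic_p dvd (\<Prod>i<r. q - of_nat i)"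
    using assms(2) by (intro dvd_trans[OF assms(3)] dvd_prodI[of "{..<r}" i "\<lambda>i. q - of_nat i"]) auto
  then have "padic_p dvd fact r * padic_binomial q r" by (simp only: padic_binomial_times_fact)
  moreover have "\<not> CARD('p) dvd fact r"
    using assms(1) prime_card[where 'a='p] by (simp add: prime_dvd_fact_iff)
  then have "\<not> (padic_p :: 'p padic) dvd fact r" by (metis of_nat_fact p_dvd_of_nat_iff)
  ultimately show ?thesis by (simp add: p_dvd_mult_iff)
qed

section \<open>Limits, continuity and compactness through divisibility by powers of p\<close>

lemma eventually_nhds_padic:
  fixes a :: "'p::prime_card padic"
  shows "eventually P (nhds a) \<longleftrightarrow> (\<exists>k. \<forall>y. padic_p ^ k dvd y - a \<longrightarrow> P y)"
proof
  assume "eventually P (nhds a)"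
  then obtain S where S: "open S" "a \<in> S" "\<forall>x\<in>S. P x" by (auto simp: eventually_nhds)
  then obtain k where "\<forall>y. residue y k = residue a k \<longrightarrow> y \<in> S"
    unfolding open_padic_def by blast
  then show "\<exists>k. \<forall>y. padic_p ^ k dvd y - a \<longrightarrow> P y" using S by (auto simp: residue_eq_iff)
next
  assume "\<exists>k. \<forall>y. padic_p ^ k dvd y - a \<longrightarrow> P y"
  then obtain k where k: "\<And>y. padic_p ^ k dvd y - a \<Longrightarrow> P y" by blast
  have "open {y. padic_p ^ k dvd y - a}"
    unfolding open_padic_def residue_eq_iff[symmetric] by (auto intro: exI[of _ k])
  then show "eventually P (nhds a)" unfolding eventually_nhds using k by fastforce
qed

lemma tendsto_padic_iff:
  fixes s :: "'p::prime_card padic"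
  shows "(f \<longlongrightarrow> s) F \<longleftrightarrow> (\<forall>k. eventually (\<lambda>x. padic_p ^ k dvd f x - s) F)"
proof
  assume f: "(f \<longlongrightarrow> s) F"
  show "\<forall>k. eventually (\<lambda>x. padic_p ^ k dvd f x - s) F"
  proof
    fix k
    have "eventually (\<lambda>y. padic_p ^ k dvd y - s) (nhds s)" unfolding eventually_nhds_padic by blast
    then show "eventually (\<lambda>x. padic_p ^ k dvd f x - s) F"
      using f unfolding filterlim_iff by blast
  qed
next
  assume "\<forall>k. eventually (\<lambda>x. padic_p ^ k dvd f x - s) F"
  then show "(f \<longlongrightarrow> s) F"
    unfolding filterlim_iff eventually_nhds_padic by (metis (mono_tags, lifting) eventually_mono)
qed

instance padic :: (prime_card) t2_space
proof
  fix x y :: "'a padic" assume "x \<noteq> y"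
  then obtain k where k: "residue x k \<noteq> residue y k" using padic_eqI by blast
  have "open {z. residue z k = residue x k}" "open {z. residue z k = residue y k}"
    unfolding open_padic_def by (auto intro: exI[of _ k])
  then show "\<exists>U V. open U \<and> open V \<and> x \<in> U \<and> y \<in> V \<and> U \<inter> V = {}"
    using k by (intro exI[of _ "{z. residue z k = residue x k}"] exI[of _ "{z. residue z k = residue y k}"]) auto
qed

lemma eventually_prod_nhds_padic:
  fixes a b :: "'p::prime_card padic"
  shows "eventually (\<lambda>x. padic_p ^ k dvd fst x - a \<and> padic_p ^ k dvd snd x - b) (nhds a \<times>\<^sub>F nhds b)"
  unfolding eventually_prod_filter
  by (rule exI[of _ "\<lambda>y. padic_p ^ k dvd y - a"], rule exI[of _ "\<lambda>y. padic_p ^ k dvd y - b"])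
     (auto simp: eventually_nhds_padic)

instance padic :: (prime_card) topological_ab_group_add
proof
  fix a b :: "'a padic"
  show "((\<lambda>x. fst x + snd x) \<longlongrightarrow> a + b) (nhds a \<times>\<^sub>F nhds b)"
    unfolding tendsto_padic_iff
  proof
    fix k
    show "eventually (\<lambda>x. padic_p ^ k dvd fst x + snd x - (a + b)) (nhds a \<times>\<^sub>F nhds b)"
      by (rule eventually_mono[OF eventually_prod_nhds_padic[of k a b]]) (auto intro: dvd_diff_add)
  qed
  show "(uminus \<longlongrightarrow> - a) (nhds a)"
    unfolding tendsto_padic_iff eventually_nhds_padic
  proof (intro allI exI impI)
    fix k y assume "padic_p ^ k dvd y - a"
    then show "padic_p ^ k dvd - y - - a" by (simp add: dvd_diff_sym[of _ a y])
  qed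
qed

instance padic :: (prime_card) topological_semigroup_mult
proof
  fix a b :: "'a padic"
  show "((\<lambda>x. fst x * snd x) \<longlongrightarrow> a * b) (nhds a \<times>\<^sub>F nhds b)"
    unfolding tendsto_padic_iff
  proof
    fix k
    show "eventually (\<lambda>x. padic_p ^ k dvd fst x * snd x - (a * b)) (nhds a \<times>\<^sub>F nhds b)"
      by (rule eventually_mono[OF eventually_prod_nhds_padic[of k a b]]) (auto intro: dvd_diff_mult)
  qed
qed

text \<open>Completeness: the k-th residues of S are eventually constant, and these constants form
  the limit. The second property keeps the error explicit, because congruences of limits are read
  off from finite stages later.\<close>

lemma padic_LIMSEQ_I:
  fixes S :: "nat \<Rightarrow> 'p::prime_card padic"
  assumes "\<And>k. \<exists>M. \<forall>m\<ge>M. padic_p ^ k dvd S m - S M"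
  obtains s where "S \<longlonglongrightarrow> s" "\<And>k M. (\<And>m. m \<ge> M \<Longrightarrow> padic_p ^ k dvd S m - S M) \<Longrightarrow> padic_p ^ k dvd s - S M"
proof -
  from assms obtain M where M: "\<And>k m. m \<ge> M k \<Longrightarrow> padic_p ^ k dvd S m - S (M k)" by metis
  define f where "f k = residue (S (M k)) k" for k
  have "f k \<in> {0..<int CARD('p) ^ k} \<and> f (Suc k) mod int CARD('p) ^ k = f k" for k
  proof
    show "f k \<in> {0..<int CARD('p) ^ k}" using residue_range by (auto simp: f_def)
    let ?m = "max (M k) (M (Suc k))"
    have "residue (S ?m) k = f k" "residue (S ?m) (Suc k) = f (Suc k)"
      unfolding f_def residue_eq_iff by (intro M; simp)+
    then show "f (Suc k) mod int CARD('p) ^ k = f k"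
      by (metis residue_mod le_SucI order_refl)
  qed
  then have r: "residue (Abs_padic f :: 'p padic) = f" by (subst Abs_padic_inverse) auto
  have lim: "S \<longlonglongrightarrow> Abs_padic f"
    unfolding tendsto_padic_iff eventually_sequentially
  proof (intro allI exI impI)
    fix k m assume "M k \<le> m"
    then have "residue (S m) k = f k" unfolding f_def residue_eq_iff by (rule M)
    then show "padic_p ^ k dvd S m - Abs_padic f" by (simp add: residue_eq_iff[symmetric] r)
  qed
  moreover have "padic_p ^ k dvd Abs_padic f - S N"
    if N: "\<And>m. m \<ge> N \<Longrightarrow> padic_p ^ k dvd S m - S N" for k N
  proof -
    obtain L where "\<And>m. m \<ge> L \<Longrightarrow> padic_p ^ k dvd S m - Abs_padic f"
      using lim unfolding tendsto_padic_iff eventually_sequentially by blast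
    then have "padic_p ^ k dvd Abs_padic f - S (max L N)"
      by (simp add: dvd_diff_sym[of _ "Abs_padic f"])
    then show ?thesis using N[of "max L N"] dvd_diff_trans by (metis max.cobounded2)
  qed
  ultimately show ?thesis using that by blast
qed

text \<open>Compatible sequences form a closed subset of a product of finite discrete spaces,
  compact by Tychonoff, and \<open>Abs_padic\<close> maps this subset continuously onto the
  ring.\<close>

lemma compact_padic: "compact_space (euclidean :: 'p::prime_card padic topology)"
proof -
  let ?p = "int CARD('p)"
  let ?X = "product_topology (\<lambda>k. discrete_topology {0..<?p ^ k}) (UNIV :: nat set)"
  let ?Z = "{x \<in> topspace ?X. \<forall>k. x (Suc k) mod ?p ^ k = x k}"
  have Z: "?Z = {x. \<forall>k. x k \<in> {0..<?p ^ k} \<and> x (Suc k) mod ?p ^ k = x k}"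
    by (auto simp: PiE_def)
  have "compact_space ?X" by (simp add: compact_space_product_topology compact_space_discrete_topology)
  moreover have "closedin ?X ?Z"
  proof -
    have "openin ?X (topspace ?X - ?Z)"
    proof (subst openin_subopen, intro ballI)
      fix x assume x: "x \<in> topspace ?X - ?Z"
      then obtain k where k: "x (Suc k) mod ?p ^ k \<noteq> x k" by blast
      let ?U = "{y \<in> topspace ?X. y k \<in> {x k}} \<inter> {y \<in> topspace ?X. y (Suc k) \<in> {x (Suc k)}}"
      have mem: "x j \<in> {0..<?p ^ j}" for j using x by (auto simp: PiE_iff)
      have "openin ?X {y \<in> topspace ?X. y j \<in> {x j}}" for j
        by (rule openin_continuous_map_preimage[OF continuous_map_product_projection[of j]])
           (use mem[of j] in \<open>auto simp: openin_discrete_topology\<close>)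
      then have "openin ?X ?U" by blast
      moreover have "x \<in> ?U" using x by simp
      moreover have "?U \<subseteq> topspace ?X - ?Z" using k by (auto dest!: spec[of _ k])
      ultimately show "\<exists>T. openin ?X T \<and> x \<in> T \<and> T \<subseteq> topspace ?X - ?Z" by blast
    qed
    then show ?thesis by (auto simp: closedin_def)
  qed
  ultimately have "compactin ?X ?Z" using closedin_compact_space by blast
  then have "compactin (subtopology ?X ?Z) ?Z" by (simp add: compactin_subtopology)
  moreover have "continuous_map (subtopology ?X ?Z) euclidean (Abs_padic :: _ \<Rightarrow> 'p padic)"
    unfolding continuous_map_def
  proof (intro conjI allI impI)
    fix U :: "'p padic set" assume "openin euclidean U"
    then have U: "open U" by simp
    show "openin (subtopology ?X ?Z) {x \<in> topspace (subtopology ?X ?Z). Abs_padic x \<in> U}"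
    proof (subst openin_subopen, intro ballI)
      fix x assume "x \<in> {x \<in> topspace (subtopology ?X ?Z). Abs_padic x \<in> U}"
      then have x: "x \<in> ?Z" "Abs_padic x \<in> U" by auto
      have r: "residue (Abs_padic y :: 'p padic) = y" if "y \<in> ?Z" for y
        using that unfolding Z by (subst Abs_padic_inverse) auto
      obtain k where k: "\<And>y. residue y k = x k \<Longrightarrow> y \<in> U"
        using U x r[OF x(1)] unfolding open_padic_def by metis
      have "openin ?X {y \<in> topspace ?X. y k \<in> {x k}}"
        by (rule openin_continuous_map_preimage[OF continuous_map_product_projection[of k]])
           (use x(1) in \<open>auto simp: openin_discrete_topology PiE_iff\<close>)
      then have "openin (subtopology ?X ?Z) ({y \<in> topspace ?X. y k \<in> {x k}} \<inter> ?Z)"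
        by (auto simp: openin_subtopology)
      moreover have "x \<in> {y \<in> topspace ?X. y k \<in> {x k}} \<inter> ?Z" using x(1) by auto
      moreover have "{y \<in> topspace ?X. y k \<in> {x k}} \<inter> ?Z \<subseteq> {x \<in> topspace (subtopology ?X ?Z). Abs_padic x \<in> U}"
        using k r by auto
      ultimately show "\<exists>T. openin (subtopology ?X ?Z) T \<and> x \<in> T \<and>
          T \<subseteq> {x \<in> topspace (subtopology ?X ?Z). Abs_padic x \<in> U}" by blast
    qed
  qed auto
  ultimately have "compactin euclidean ((Abs_padic :: _ \<Rightarrow> 'p padic) ` ?Z)" by (rule image_compactin)
  moreover have "(Abs_padic :: _ \<Rightarrow> 'p padic) ` ?Z = UNIV"
    unfolding Z by (metis (mono_tags, lifting) type_definition.Abs_image type_definition_padic)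
  ultimately show ?thesis by (simp add: compact_space_def)
qed

section \<open>Monoid rings\<close>

abbreviation fin_supp :: "('g \<Rightarrow> 'a::zero) \<Rightarrow> bool" where
  "fin_supp f \<equiv> finite {x. f x \<noteq> 0}"

text \<open>The pairing of a finitely supported function with an arbitrary F, that is, the linear
  extension of F. Elements of a monoid ring are compared by pairing them with all F, which replaces
  convolution sums by identities in the monoid.\<close>

definition mr_eval :: "('g \<Rightarrow> 'a::comm_ring_1) \<Rightarrow> ('g \<Rightarrow> 'a) \<Rightarrow> 'a" where
  "mr_eval f F = (\<Sum>x | f x \<noteq> 0. f x * F x)"

lemma mr_eval_superset:
  assumes "finite S" "{x. f x \<noteq> 0} \<subseteq> S"
  shows "mr_eval f F = (\<Sum>x\<in>S. f x * F x)"
  unfolding mr_eval_def using assms by (intro sum.mono_neutral_left) auto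

lemma mr_eval_cong:
  "f = f' \<Longrightarrow> (\<And>x. f' x \<noteq> 0 \<Longrightarrow> F x = F' x) \<Longrightarrow> mr_eval f F = mr_eval f' F'"
  unfolding mr_eval_def by (rule sum.cong) auto

lemma mr_eval_indicator:
  assumes "fin_supp f" shows "mr_eval f (\<lambda>y. if y = x then 1 else 0) = f x"
proof -
  have "mr_eval f (\<lambda>y. if y = x then 1 else 0) = (\<Sum>y\<in>insert x {y. f y \<noteq> 0}. f y * (if y = x then 1 else 0))"
    using assms by (intro mr_eval_superset) auto
  also have "\<dots> = (\<Sum>y\<in>insert x {y. f y \<noteq> 0}. if y = x then f y else 0)"
    by (rule sum.cong) auto
  also have "\<dots> = f x" using assms by (subst sum.delta) auto
  finally show ?thesis .
qed

lemma mr_eqI: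
  assumes "fin_supp f" "fin_supp g" "\<And>F. mr_eval f F = mr_eval g F"
  shows "f = g"
  using mr_eval_indicator[OF assms(1)] mr_eval_indicator[OF assms(2)] assms(3) by (intro ext) simp

lemma mr_eval_zero_left [simp]: "mr_eval (\<lambda>_. 0) F = 0"
  by (simp add: mr_eval_def)

lemma mr_eval_add_left:
  assumes "fin_supp f" "fin_supp g"
  shows "mr_eval (\<lambda>x. f x + g x) F = mr_eval f F + mr_eval g F"
proof -
  let ?S = "{x. f x \<noteq> 0} \<union> {x. g x \<noteq> 0}"
  have "finite ?S" using assms by simp
  moreover have "{x. f x + g x \<noteq> 0} \<subseteq> ?S" by auto
  ultimately show ?thesis
    by (simp add: mr_eval_superset[of ?S] sum.distrib distrib_right)
qed

lemma mr_eval_diff_left: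
  assumes "fin_supp f" "fin_supp g"
  shows "mr_eval (\<lambda>x. f x - g x) F = mr_eval f F - mr_eval g F"
proof -
  let ?S = "{x. f x \<noteq> 0} \<union> {x. g x \<noteq> 0}"
  have "finite ?S" using assms by simp
  moreover have "{x. f x - g x \<noteq> 0} \<subseteq> ?S" by auto
  ultimately show ?thesis
    by (simp add: mr_eval_superset[of ?S] sum_subtractf left_diff_distrib)
qed

lemma mr_eval_add_right: "mr_eval f (\<lambda>x. F x + F' x) = mr_eval f F + mr_eval f F'"
  by (simp add: mr_eval_def sum.distrib distrib_left)

lemma mr_eval_diff_right: "mr_eval f (\<lambda>x. F x - F' x) = mr_eval f F - mr_eval f F'"
  by (simp add: mr_eval_def sum_subtractf right_diff_distrib)

lemma mr_eval_mult_right: "mr_eval f (\<lambda>x. c * F x) = c * mr_eval f F"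
  by (simp add: mr_eval_def sum_distrib_left mult.left_commute)

lemma mr_eval_sum_right: "mr_eval f (\<lambda>x. \<Sum>i\<in>I. F i x) = (\<Sum>i\<in>I. mr_eval f (F i))"
  by (simp add: mr_eval_def sum_distrib_left sum.swap[of _ I])

lemma dvd_mr_eval: "(\<And>x. d dvd f x) \<Longrightarrow> d dvd mr_eval f F"
  unfolding mr_eval_def by (intro dvd_sum) auto

lemma fin_supp_single [simp]: "fin_supp (single x c)"
  by (rule finite_subset[of _ "{x}"]) (auto simp: single_def)

lemma mr_eval_single [simp]: "mr_eval (single x c) F = c * F x"
  by (subst mr_eval_superset[of "{x}"]) (auto simp: single_def split: if_splits)

lemma carrier_monoid_ring:
  "f \<in> carrier (monoid_ring M) \<longleftrightarrow> fin_supp f \<and> (\<forall>x. x \<notin> carrier M \<longrightarrow> f x = 0)"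
  by (simp add: monoid_ring_def)

lemma single_in_carrier [simp]: "x \<in> carrier M \<Longrightarrow> single x c \<in> carrier (monoid_ring M)"
  unfolding carrier_monoid_ring by (simp add: single_def)

lemma monoid_ring_simps [simp]:
  "\<one>\<^bsub>monoid_ring M\<^esub> = single \<one>\<^bsub>M\<^esub> 1"
  "\<zero>\<^bsub>monoid_ring M\<^esub> = (\<lambda>_. 0)"
  "f \<oplus>\<^bsub>monoid_ring M\<^esub> g = (\<lambda>x. f x + g x)"
  by (simp_all add: monoid_ring_def)

lemma monoid_ring_mult:
  "(f \<otimes>\<^bsub>monoid_ring M\<^esub> g) x = (\<Sum>(y, z) | f y \<noteq> 0 \<and> g z \<noteq> 0 \<and> y \<otimes>\<^bsub>M\<^esub> z = x. f y * g z)"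
  by (simp add: monoid_ring_def)

lemma
  assumes "fin_supp f" "fin_supp g"
  shows fin_supp_mult: "fin_supp (f \<otimes>\<^bsub>monoid_ring M\<^esub> g)"
    and mr_eval_mult: "mr_eval (f \<otimes>\<^bsub>monoid_ring M\<^esub> g) F = mr_eval f (\<lambda>y. mr_eval g (\<lambda>z. F (y \<otimes>\<^bsub>M\<^esub> z)))"
proof -
  let ?A = "{x. f x \<noteq> 0}" and ?B = "{x. g x \<noteq> 0}"
  let ?m = "\<lambda>(y, z). y \<otimes>\<^bsub>M\<^esub> z"
  let ?S = "?m ` (?A \<times> ?B)"
  have eq: "(f \<otimes>\<^bsub>monoid_ring M\<^esub> g) x = (\<Sum>q\<in>{q \<in> ?A \<times> ?B. ?m q = x}. f (fst q) * g (snd q))" for x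
    unfolding monoid_ring_mult by (rule sum.cong) auto
  have fin: "finite (?A \<times> ?B)" using assms by simp
  have sub: "{x. (f \<otimes>\<^bsub>monoid_ring M\<^esub> g) x \<noteq> 0} \<subseteq> ?S"
  proof
    fix x assume x: "x \<in> {x. (f \<otimes>\<^bsub>monoid_ring M\<^esub> g) x \<noteq> 0}"
    have "{q \<in> ?A \<times> ?B. ?m q = x} \<noteq> {}"
    proof
      assume e: "{q \<in> ?A \<times> ?B. ?m q = x} = {}"
      have "(f \<otimes>\<^bsub>monoid_ring M\<^esub> g) x = 0" unfolding eq e by simp
      then show False using x by simp
    qed
    then show "x \<in> ?S" by blast
  qed
  then show "fin_supp (f \<otimes>\<^bsub>monoid_ring M\<^esub> g)" using fin finite_subset by blast
  \<comment> \<open>The pairs of support elements are grouped by their product, so the fibre sums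
    reassemble to one sum over all pairs.\<close>
  have "mr_eval (f \<otimes>\<^bsub>monoid_ring M\<^esub> g) F =
      (\<Sum>x\<in>?S. \<Sum>q\<in>{q \<in> ?A \<times> ?B. ?m q = x}. f (fst q) * g (snd q) * F (?m q))"
    using fin sub
    by (subst mr_eval_superset[of ?S]) (auto simp: eq sum_distrib_right intro!: sum.cong)
  also have "\<dots> = (\<Sum>q\<in>?A \<times> ?B. f (fst q) * g (snd q) * F (?m q))"
    using fin by (intro sum.group) auto
  also have "\<dots> = (\<Sum>y\<in>?A. \<Sum>z\<in>?B. f y * (g z * F (y \<otimes>\<^bsub>M\<^esub> z)))"
    by (simp add: sum.cartesian_product mult.assoc split_def)
  also have "\<dots> = mr_eval f (\<lambda>y. mr_eval g (\<lambda>z. F (y \<otimes>\<^bsub>M\<^esub> z)))"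
    by (simp add: mr_eval_def sum_distrib_left)
  finally show "mr_eval (f \<otimes>\<^bsub>monoid_ring M\<^esub> g) F = mr_eval f (\<lambda>y. mr_eval g (\<lambda>z. F (y \<otimes>\<^bsub>M\<^esub> z)))" .
qed

lemma monoid_ring_mult_closed:
  assumes "monoid M" "f \<in> carrier (monoid_ring M)" "g \<in> carrier (monoid_ring M)"
  shows "f \<otimes>\<^bsub>monoid_ring M\<^esub> g \<in> carrier (monoid_ring M)"
proof -
  interpret monoid M by fact
  have "(f \<otimes>\<^bsub>monoid_ring M\<^esub> g) x = 0" if "x \<notin> carrier M" for x
    unfolding monoid_ring_mult using assms that
    by (intro sum.neutral) (auto simp: carrier_monoid_ring)
  then show ?thesis
    using assms by (simp add: carrier_monoid_ring fin_supp_mult)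
qed

lemma fin_supp_add: "fin_supp f \<Longrightarrow> fin_supp g \<Longrightarrow> fin_supp (\<lambda>x. f x + (g x :: 'a::comm_ring_1))"
  by (rule finite_subset[of _ "{x. f x \<noteq> 0} \<union> {x. g x \<noteq> 0}"]) auto

lemma monoid_ring_is_ring:
  assumes "monoid M" shows "ring (monoid_ring M :: ('g \<Rightarrow> 'a::comm_ring_1) ring)"
proof -
  interpret M: monoid M by fact
  let ?R = "monoid_ring M :: ('g \<Rightarrow> 'a) ring"
  have fs: "fin_supp f" if "f \<in> carrier ?R" for f using that by (simp add: carrier_monoid_ring)
  have inM: "x \<in> carrier M" if "f \<in> carrier ?R" "f x \<noteq> 0" for f x
    using that by (auto simp: carrier_monoid_ring)
  have add: "(\<lambda>x. f x + g x) \<in> carrier ?R" if "f \<in> carrier ?R" "g \<in> carrier ?R" for f g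
    using that fin_supp_add[of f g] by (simp add: carrier_monoid_ring)
  note mult = monoid_ring_mult_closed[OF assms]
  show ?thesis
  proof (rule ringI)
    show "abelian_group ?R"
    proof (rule abelian_groupI)
      fix f assume f: "f \<in> carrier ?R"
      then have "(\<lambda>x. - f x) \<in> carrier ?R" by (simp add: carrier_monoid_ring)
      moreover have "(\<lambda>x. - f x) \<oplus>\<^bsub>?R\<^esub> f = \<zero>\<^bsub>?R\<^esub>" by simp
      ultimately show "\<exists>y\<in>carrier ?R. y \<oplus>\<^bsub>?R\<^esub> f = \<zero>\<^bsub>?R\<^esub>" by blast
    qed (auto simp: add algebra_simps carrier_monoid_ring intro: fin_supp_add)
    show "Group.monoid ?R"
    proof (rule monoidI)
      fix f g h assume fgh: "f \<in> carrier ?R" "g \<in> carrier ?R" "h \<in> carrier ?R"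
      show "f \<otimes>\<^bsub>?R\<^esub> g \<otimes>\<^bsub>?R\<^esub> h = f \<otimes>\<^bsub>?R\<^esub> (g \<otimes>\<^bsub>?R\<^esub> h)"
        using fgh
        by (intro mr_eqI fin_supp_mult)
           (simp_all add: fs fin_supp_mult mr_eval_mult M.m_assoc inM cong: mr_eval_cong)
    next
      fix f assume f: "f \<in> carrier ?R"
      show "\<one>\<^bsub>?R\<^esub> \<otimes>\<^bsub>?R\<^esub> f = f" "f \<otimes>\<^bsub>?R\<^esub> \<one>\<^bsub>?R\<^esub> = f"
        using f
        by (intro mr_eqI; simp add: fs fin_supp_mult mr_eval_mult inM cong: mr_eval_cong)+
    qed (auto simp: mult)
    fix f g h assume fgh: "f \<in> carrier ?R" "g \<in> carrier ?R" "h \<in> carrier ?R"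
    show "(f \<oplus>\<^bsub>?R\<^esub> g) \<otimes>\<^bsub>?R\<^esub> h = f \<otimes>\<^bsub>?R\<^esub> h \<oplus>\<^bsub>?R\<^esub> g \<otimes>\<^bsub>?R\<^esub> h"
      using fgh
      by (intro mr_eqI) (simp_all add: fs fin_supp_mult mr_eval_mult fin_supp_add mr_eval_add_left)
    show "h \<otimes>\<^bsub>?R\<^esub> (f \<oplus>\<^bsub>?R\<^esub> g) = h \<otimes>\<^bsub>?R\<^esub> f \<oplus>\<^bsub>?R\<^esub> h \<otimes>\<^bsub>?R\<^esub> g"
      using fgh
      by (intro mr_eqI) (simp_all add: fs fin_supp_mult mr_eval_mult fin_supp_add mr_eval_add_left mr_eval_add_right)
  qed
qed

lemma monoid_ring_minus:
  assumes "monoid M" "f \<in> carrier (monoid_ring M)" "g \<in> carrier (monoid_ring M)"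
  shows "f \<ominus>\<^bsub>monoid_ring M\<^esub> g = (\<lambda>x. f x - (g x :: 'a::comm_ring_1))"
proof -
  interpret R: ring "monoid_ring M :: ('b \<Rightarrow> 'a) ring" by (rule monoid_ring_is_ring[OF assms(1)])
  have "(\<lambda>x. - g x) \<in> carrier (monoid_ring M)" using assms(3) by (simp add: carrier_monoid_ring)
  then have "\<ominus>\<^bsub>monoid_ring M\<^esub> g = (\<lambda>x. - g x)"
    using assms(3) by (intro R.minus_equality) auto
  then show ?thesis by (simp add: a_minus_def)
qed

lemma single_mult_single:
  "single x a \<otimes>\<^bsub>monoid_ring M\<^esub> single y b = single (x \<otimes>\<^bsub>M\<^esub> y) (a * b)"
  by (intro mr_eqI) (simp_all add: fin_supp_mult mr_eval_mult)

lemma pushforward_eq_mr_eval: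
  assumes "fin_supp f"
  shows "pushforward \<phi> f y = mr_eval f (\<lambda>x. if \<phi> x = y then 1 else 0)"
proof -
  have "mr_eval f (\<lambda>x. if \<phi> x = y then 1 else 0) = (\<Sum>x\<in>{x. f x \<noteq> 0}. if \<phi> x = y then f x else 0)"
    unfolding mr_eval_def by (rule sum.cong) auto
  also have "\<dots> = (\<Sum>x\<in>{x \<in> {x. f x \<noteq> 0}. \<phi> x = y}. f x)"
    using assms by (subst sum.inter_filter) auto
  finally show ?thesis by (simp add: pushforward_def)
qed

lemma
  assumes "fin_supp f"
  shows fin_supp_pushforward: "fin_supp (pushforward \<phi> f)"
    and mr_eval_pushforward: "mr_eval (pushforward \<phi> f) F = mr_eval f (\<lambda>x. F (\<phi> x))"
proof -
  let ?A = "{x. f x \<noteq> 0}"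
  have eq: "pushforward \<phi> f y = (\<Sum>x\<in>{x \<in> ?A. \<phi> x = y}. f x)" for y by (simp add: pushforward_def)
  have sub: "{x. pushforward \<phi> f x \<noteq> 0} \<subseteq> \<phi> ` ?A"
  proof
    fix y assume y: "y \<in> {x. pushforward \<phi> f x \<noteq> 0}"
    have "{x \<in> ?A. \<phi> x = y} \<noteq> {}"
    proof
      assume e: "{x \<in> ?A. \<phi> x = y} = {}"
      have "pushforward \<phi> f y = 0" unfolding eq e by simp
      then show False using y by simp
    qed
    then show "y \<in> \<phi> ` ?A" by blast
  qed
  then show "fin_supp (pushforward \<phi> f)" using assms finite_subset by blast
  have "mr_eval (pushforward \<phi> f) F = (\<Sum>y\<in>\<phi> ` ?A. \<Sum>x\<in>{x \<in> ?A. \<phi> x = y}. f x * F (\<phi> x))"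
    using assms sub
    by (subst mr_eval_superset[of "\<phi> ` ?A"]) (auto simp: eq sum_distrib_right intro!: sum.cong)
  also have "\<dots> = (\<Sum>x\<in>?A. f x * F (\<phi> x))" using assms by (intro sum.group) auto
  finally show "mr_eval (pushforward \<phi> f) F = mr_eval f (\<lambda>x. F (\<phi> x))" by (simp add: mr_eval_def)
qed

lemma pushforward_single: "pushforward \<phi> (single x c) = single (\<phi> x) c"
  by (intro mr_eqI) (simp_all add: fin_supp_pushforward mr_eval_pushforward)

lemma pushforward_mult:
  assumes "fin_supp f" "fin_supp g"
    and "\<And>x y. f x \<noteq> 0 \<Longrightarrow> g y \<noteq> 0 \<Longrightarrow> \<phi> (x \<otimes>\<^bsub>M\<^esub> y) = \<phi> x \<otimes>\<^bsub>M'\<^esub> \<phi> y"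
  shows "pushforward \<phi> (f \<otimes>\<^bsub>monoid_ring M\<^esub> g) = pushforward \<phi> f \<otimes>\<^bsub>monoid_ring M'\<^esub> pushforward \<phi> g"
  using assms
  by (intro mr_eqI)
     (simp_all add: fin_supp_pushforward fin_supp_mult mr_eval_pushforward mr_eval_mult cong: mr_eval_cong)

section \<open>Iwasawa algebras\<close>

text \<open>Computes the transition map of the inverse limit on cosets.\<close>

lemma (in group) set_mult_r_coset_absorb:
  assumes "subgroup N G" "subgroup M G" "N \<subseteq> M" "x \<in> carrier G"
  shows "M <#> (N #> x) = M #> x"
proof -
  interpret N: subgroup N G by fact
  interpret M: subgroup M G by fact
  show ?thesis
  proof
    show "M <#> (N #> x) \<subseteq> M #> x"
      unfolding set_mult_def r_coset_def using assms(3,4) M.m_closed M.mem_carrier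
      by (auto simp: m_assoc[symmetric] subset_iff)
    show "M #> x \<subseteq> M <#> (N #> x)"
    proof
      fix y assume "y \<in> M #> x"
      then obtain m where m: "m \<in> M" "y = m \<otimes> x" unfolding r_coset_def by auto
      then have "y = m \<otimes> (\<one> \<otimes> x)" using assms(4) by simp
      then show "y \<in> M <#> (N #> x)"
        unfolding set_mult_def r_coset_def using m(1) N.one_closed by blast
    qed
  qed
qed

text \<open>The parameter \<open>pt\<close> fixes the coefficient type. Finiteness of the quotients
  makes every component a function on a finite set of cosets, so that products and transition maps
  are finite sums.\<close>

locale iwasawa = group G for G :: "'g monoid" (structure) +
  fixes T :: "'g topology" and pt :: "'p::prime_card itself"
  assumes finite_quotient: "N \<in> open_normal G T \<Longrightarrow> finite (rcosets N)"
begin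

abbreviation ON :: "'g set set" where "ON \<equiv> open_normal G T"

abbreviation L :: "('g set \<Rightarrow> 'g set \<Rightarrow> 'p padic) ring" where "L \<equiv> iwasawa_algebra G T"

abbreviation MR :: "'g set \<Rightarrow> ('g set \<Rightarrow> 'p padic) ring" where "MR N \<equiv> monoid_ring (G Mod N)"

lemma ON_normal: "N \<in> ON \<Longrightarrow> N \<lhd> G"
  by (simp add: open_normal_def)

lemma ON_subgroup: "N \<in> ON \<Longrightarrow> subgroup N G"
  using ON_normal normal_imp_subgroup by blast

lemma Mod_simps [simp]: "carrier (G Mod N) = rcosets N" "monoid.mult (G Mod N) = (<#>)" "monoid.one (G Mod N) = N"
  by (auto simp: FactGroup_def)

lemma ON_Mod_group: "N \<in> ON \<Longrightarrow> group (G Mod N)"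
  using ON_normal normal.factorgroup_is_group by blast

lemma MR_ring: "N \<in> ON \<Longrightarrow> ring (MR N)"
  using ON_Mod_group monoid_ring_is_ring group.is_monoid by blast

lemma rcoset_mult: "N \<in> ON \<Longrightarrow> x \<in> carrier G \<Longrightarrow> y \<in> carrier G \<Longrightarrow> (N #> x) <#> (N #> y) = N #> (x \<otimes> y)"
  using normal.rcos_sum[OF ON_normal] by blast

lemma rcoset_in: "x \<in> carrier G \<Longrightarrow> N #> x \<in> rcosets N"
  by (auto simp: RCOSETS_def)

lemma N_rcoset: "N \<in> ON \<Longrightarrow> N = N #> \<one>"
  using coset_mult_one[of N] subgroup.subset[OF ON_subgroup] by auto

lemma N_in_rcosets: "N \<in> ON \<Longrightarrow> N \<in> rcosets N"
  using N_rcoset rcoset_in[of \<one> N] by simp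

lemma rcosetsE:
  assumes "C \<in> rcosets N" obtains x where "x \<in> carrier G" "C = N #> x"
  using assms by (auto simp: RCOSETS_def)

lemma transition_rcoset:
  "N \<in> ON \<Longrightarrow> M \<in> ON \<Longrightarrow> N \<subseteq> M \<Longrightarrow> x \<in> carrier G \<Longrightarrow> M <#> (N #> x) = M #> x"
  using set_mult_r_coset_absorb ON_subgroup by blast

lemma transition_mult:
  assumes "N \<in> ON" "M \<in> ON" "N \<subseteq> M" "C \<in> rcosets N" "D \<in> rcosets N"
  shows "M <#> (C <#> D) = (M <#> C) <#> (M <#> D)"
proof -
  obtain x y where "x \<in> carrier G" "C = N #> x" "y \<in> carrier G" "D = N #> y"
    using assms(4,5) by (auto elim!: rcosetsE)
  then show ?thesis using assms by (simp add: rcoset_mult transition_rcoset)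
qed

lemma fin_supp_rcosets:
  assumes "N \<in> ON" "\<And>C. C \<notin> rcosets N \<Longrightarrow> f C = 0"
  shows "fin_supp f"
  by (rule finite_subset[OF _ finite_quotient[OF assms(1)]]) (use assms(2) in auto)

lemma mr_eval_rcosets:
  assumes "N \<in> ON" "\<And>C. C \<notin> rcosets N \<Longrightarrow> f C = 0"
  shows "mr_eval f F = (\<Sum>C\<in>rcosets N. f C * F C)"
  using assms by (intro mr_eval_superset finite_quotient) auto

lemma MR_carrier: "N \<in> ON \<Longrightarrow> f \<in> carrier (MR N) \<longleftrightarrow> (\<forall>C. C \<notin> rcosets N \<longrightarrow> f C = 0)"
  using fin_supp_rcosets[of N f] by (auto simp: carrier_monoid_ring)

text \<open>Compatibility is rewritten as linear equations between finitely many coefficients, a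
  form visibly stable under linear combinations and coordinatewise limits.\<close>

lemma L_carrier_iff:
  "f \<in> carrier L \<longleftrightarrow> f \<in> extensional ON \<and> (\<forall>N\<in>ON. \<forall>C. C \<notin> rcosets N \<longrightarrow> f N C = 0) \<and>
    (\<forall>N\<in>ON. \<forall>M\<in>ON. N \<subseteq> M \<longrightarrow>
      (\<forall>D. f M D = (\<Sum>C\<in>rcosets N. f N C * (if M <#> C = D then 1 else 0))))"
proof -
  have key: "pushforward (\<lambda>C. M <#> C) (f N) = f M \<longleftrightarrow>
      (\<forall>D. f M D = (\<Sum>C\<in>rcosets N. f N C * (if M <#> C = D then 1 else 0)))"
    if "N \<in> ON" "\<forall>C. C \<notin> rcosets N \<longrightarrow> f N C = 0" for N M
    using that by (auto simp: fun_eq_iff pushforward_eq_mr_eval fin_supp_rcosets mr_eval_rcosets[OF that(1)])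
  have L: "f \<in> carrier L \<longleftrightarrow> f \<in> extensional ON \<and> (\<forall>N\<in>ON. f N \<in> carrier (MR N)) \<and>
      (\<forall>N\<in>ON. \<forall>M\<in>ON. N \<subseteq> M \<longrightarrow> pushforward (\<lambda>C. M <#> C) (f N) = f M)"
    by (auto simp: iwasawa_algebra_def PiE_def Pi_def)
  show ?thesis
  proof (cases "\<forall>N\<in>ON. \<forall>C. C \<notin> rcosets N \<longrightarrow> f N C = 0")
    case True
    then show ?thesis unfolding L by (simp add: key MR_carrier)
  next
    case False
    then show ?thesis unfolding L by (simp add: MR_carrier) blast
  qed
qed

lemma L_component: "f \<in> carrier L \<Longrightarrow> N \<in> ON \<Longrightarrow> f N \<in> carrier (MR N)"
  by (auto simp: iwasawa_algebra_def)

lemma L_component_0: "f \<in> carrier L \<Longrightarrow> N \<in> ON \<Longrightarrow> C \<notin> rcosets N \<Longrightarrow> f N C = 0"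
  by (simp add: L_carrier_iff)

lemma L_fin_supp: "f \<in> carrier L \<Longrightarrow> N \<in> ON \<Longrightarrow> fin_supp (f N)"
  using L_component by (auto simp: carrier_monoid_ring)

lemma L_extensional: "f \<in> carrier L \<Longrightarrow> f \<in> extensional ON"
  by (simp add: L_carrier_iff)

lemma L_compat: "f \<in> carrier L \<Longrightarrow> N \<in> ON \<Longrightarrow> M \<in> ON \<Longrightarrow> N \<subseteq> M \<Longrightarrow> pushforward (\<lambda>C. M <#> C) (f N) = f M"
  by (auto simp: iwasawa_algebra_def)

lemma L_ops:
  "f \<otimes>\<^bsub>L\<^esub> g = (\<lambda>N\<in>ON. f N \<otimes>\<^bsub>MR N\<^esub> g N)"
  "\<one>\<^bsub>L\<^esub> = (\<lambda>N\<in>ON. single N 1)"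
  "\<zero>\<^bsub>L\<^esub> = (\<lambda>N\<in>ON. \<lambda>_. 0)"
  "f \<oplus>\<^bsub>L\<^esub> g = (\<lambda>N\<in>ON. \<lambda>C. f N C + g N C)"
  by (simp_all add: iwasawa_algebra_def)

lemma L_carrierI:
  assumes "f \<in> extensional ON" "\<And>N. N \<in> ON \<Longrightarrow> f N \<in> carrier (MR N)"
    "\<And>N M. N \<in> ON \<Longrightarrow> M \<in> ON \<Longrightarrow> N \<subseteq> M \<Longrightarrow> pushforward (\<lambda>C. M <#> C) (f N) = f M"
  shows "f \<in> carrier L"
  using assms by (auto simp: iwasawa_algebra_def PiE_def)

lemma L_eqI:
  assumes "f \<in> carrier L" "g \<in> carrier L" "\<And>N. N \<in> ON \<Longrightarrow> f N = g N"
  shows "f = g"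
  using extensionalityI[of f ON g] L_extensional assms by blast

lemma L_mult_closed:
  assumes "f \<in> carrier L" "g \<in> carrier L"
  shows "f \<otimes>\<^bsub>L\<^esub> g \<in> carrier L"
proof (rule L_carrierI)
  show "f \<otimes>\<^bsub>L\<^esub> g \<in> extensional ON" by (simp add: L_ops)
  show "(f \<otimes>\<^bsub>L\<^esub> g) N \<in> carrier (MR N)" if "N \<in> ON" for N
    using that assms L_component MR_ring[OF that] by (simp add: L_ops ring.ring_simprules)
  fix N M assume NM: "N \<in> ON" "M \<in> ON" "N \<subseteq> M"
  have "pushforward (\<lambda>C. M <#> C) (f N \<otimes>\<^bsub>MR N\<^esub> g N) =
      pushforward (\<lambda>C. M <#> C) (f N) \<otimes>\<^bsub>MR M\<^esub> pushforward (\<lambda>C. M <#> C) (g N)"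
  proof (rule pushforward_mult)
    fix x y assume "f N x \<noteq> 0" "g N y \<noteq> 0"
    then have "x \<in> rcosets N" "y \<in> rcosets N" using assms NM L_component_0 by blast+
    then show "M <#> (x \<otimes>\<^bsub>G Mod N\<^esub> y) = (M <#> x) \<otimes>\<^bsub>G Mod M\<^esub> (M <#> y)"
      using NM by (simp add: transition_mult)
  qed (use assms NM L_fin_supp in auto)
  then show "pushforward (\<lambda>C. M <#> C) ((f \<otimes>\<^bsub>L\<^esub> g) N) = (f \<otimes>\<^bsub>L\<^esub> g) M"
    using NM assms by (simp add: L_ops L_compat)
qed

definition lin :: "'i set \<Rightarrow> ('i \<Rightarrow> 'p padic) \<Rightarrow> ('i \<Rightarrow> 'g set \<Rightarrow> 'g set \<Rightarrow> 'p padic) \<Rightarrow> 'g set \<Rightarrow> 'g set \<Rightarrow> 'p padic"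
  where "lin I c f = (\<lambda>N\<in>ON. \<lambda>C. \<Sum>i\<in>I. c i * f i N C)"

lemma lin_apply: "N \<in> ON \<Longrightarrow> lin I c f N C = (\<Sum>i\<in>I. c i * f i N C)"
  by (simp add: lin_def)

lemma lin_closed:
  assumes "\<And>i. i \<in> I \<Longrightarrow> f i \<in> carrier L"
  shows "lin I c f \<in> carrier L"
  unfolding L_carrier_iff
proof (intro conjI ballI allI impI)
  fix N M D assume NM: "N \<in> ON" "M \<in> ON" "N \<subseteq> M"
  have "lin I c f M D = (\<Sum>i\<in>I. c i * (\<Sum>C\<in>rcosets N. f i N C * (if M <#> C = D then 1 else 0)))"
    unfolding lin_apply[OF NM(2)]
  proof (rule sum.cong[OF refl])
    fix i assume "i \<in> I"
    then have "f i M D = (\<Sum>C\<in>rcosets N. f i N C * (if M <#> C = D then 1 else 0))"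
      using assms NM unfolding L_carrier_iff by blast
    then show "c i * f i M D = c i * (\<Sum>C\<in>rcosets N. f i N C * (if M <#> C = D then 1 else 0))" by simp
  qed
  also have "\<dots> = (\<Sum>C\<in>rcosets N. lin I c f N C * (if M <#> C = D then 1 else 0))"
    by (simp only: lin_apply[OF NM(1)] sum_distrib_left sum_distrib_right mult.assoc sum.swap[of _ I])
  finally show "lin I c f M D = (\<Sum>C\<in>rcosets N. lin I c f N C * (if M <#> C = D then 1 else 0))" .
qed (auto simp: lin_def L_component_0 assms)

lemma mr_eval_lin:
  assumes "N \<in> ON" "\<And>i. i \<in> I \<Longrightarrow> f i \<in> carrier L"
  shows "mr_eval (lin I c f N) F = (\<Sum>i\<in>I. c i * mr_eval (f i N) F)"
proof -
  have "mr_eval (lin I c f N) F = (\<Sum>C\<in>rcosets N. lin I c f N C * F C)"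
    using assms L_component_0[OF lin_closed[of I f c]] by (intro mr_eval_rcosets) auto
  also have "\<dots> = (\<Sum>i\<in>I. c i * (\<Sum>C\<in>rcosets N. f i N C * F C))"
    by (simp only: lin_apply[OF assms(1)] sum_distrib_left sum_distrib_right mult.assoc sum.swap[of _ _ I])
  also have "\<dots> = (\<Sum>i\<in>I. c i * mr_eval (f i N) F)"
    using assms L_component_0 by (intro sum.cong refl arg_cong2[where f="(*)"] mr_eval_rcosets[symmetric]) auto
  finally show ?thesis .
qed

lemma L_add_closed:
  assumes "f \<in> carrier L" "g \<in> carrier L" shows "f \<oplus>\<^bsub>L\<^esub> g \<in> carrier L"
proof -
  have "f \<oplus>\<^bsub>L\<^esub> g = lin {True, False} (\<lambda>_. 1) (\<lambda>b. if b then f else g)"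
    by (simp add: L_ops lin_def)
  then show ?thesis using lin_closed[of "{True, False}" "\<lambda>b. if b then f else g" "\<lambda>_. 1"] assms by simp
qed

definition el :: "'g \<Rightarrow> 'g set \<Rightarrow> 'g set \<Rightarrow> 'p padic" where "el = iwasawa_elem G T"

lemma el_apply: "N \<in> ON \<Longrightarrow> el x N = single (N #> x) 1"
  by (simp add: el_def iwasawa_elem_def)

lemma el_closed:
  assumes "x \<in> carrier G" shows "el x \<in> carrier L"
proof (rule L_carrierI)
  show "el x \<in> extensional ON" by (simp add: el_def iwasawa_elem_def)
qed (use assms in \<open>simp_all add: el_apply rcoset_in pushforward_single transition_rcoset\<close>)

lemma el_one: "el \<one> = \<one>\<^bsub>L\<^esub>"
  unfolding L_ops el_def iwasawa_elem_def by (rule restrict_ext) (simp flip: N_rcoset)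

lemma el_mult: "x \<in> carrier G \<Longrightarrow> y \<in> carrier G \<Longrightarrow> el (x \<otimes> y) = el x \<otimes>\<^bsub>L\<^esub> el y"
  unfolding L_ops el_def iwasawa_elem_def
  by (rule restrict_ext) (simp add: single_mult_single rcoset_mult)

lemma L_ring: "ring L"
proof (rule ringI)
  have zero: "\<zero>\<^bsub>L\<^esub> \<in> carrier L"
    using lin_closed[of "{}"] by (simp add: lin_def L_ops)
  show "abelian_group L"
  proof (rule abelian_groupI)
    fix f assume f: "f \<in> carrier L"
    have "lin {()} (\<lambda>_. - 1) (\<lambda>_. f) \<in> carrier L" using lin_closed[of "{()}" "\<lambda>_. f"] f by simp
    moreover have "lin {()} (\<lambda>_. - 1) (\<lambda>_. f) \<oplus>\<^bsub>L\<^esub> f = \<zero>\<^bsub>L\<^esub>"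
      unfolding L_ops by (rule restrict_ext) (simp add: lin_def)
    ultimately show "\<exists>y\<in>carrier L. y \<oplus>\<^bsub>L\<^esub> f = \<zero>\<^bsub>L\<^esub>" by blast
    show "\<zero>\<^bsub>L\<^esub> \<oplus>\<^bsub>L\<^esub> f = f"
      using L_extensional[OF f] by (auto simp: L_ops fun_eq_iff extensional_def)
  qed (auto simp: zero L_add_closed, auto simp: L_ops algebra_simps)
  have one: "\<one>\<^bsub>L\<^esub> \<in> carrier L" using el_closed[of \<one>] el_one by simp
  show "Group.monoid L"
  proof (rule monoidI)
    fix f g h assume fgh: "f \<in> carrier L" "g \<in> carrier L" "h \<in> carrier L"
    show "f \<otimes>\<^bsub>L\<^esub> g \<otimes>\<^bsub>L\<^esub> h = f \<otimes>\<^bsub>L\<^esub> (g \<otimes>\<^bsub>L\<^esub> h)"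
    proof (rule L_eqI)
      fix N assume N: "N \<in> ON"
      interpret R: ring "MR N" by (rule MR_ring[OF N])
      show "(f \<otimes>\<^bsub>L\<^esub> g \<otimes>\<^bsub>L\<^esub> h) N = (f \<otimes>\<^bsub>L\<^esub> (g \<otimes>\<^bsub>L\<^esub> h)) N"
        using N L_component[OF fgh(1) N] L_component[OF fgh(2) N] L_component[OF fgh(3) N]
        by (simp add: L_ops R.m_assoc)
    qed (auto intro!: L_mult_closed fgh)
  next
    fix f assume f: "f \<in> carrier L"
    show "\<one>\<^bsub>L\<^esub> \<otimes>\<^bsub>L\<^esub> f = f"
    proof (rule L_eqI)
      fix N assume N: "N \<in> ON"
      interpret R: ring "MR N" by (rule MR_ring[OF N])
      show "(\<one>\<^bsub>L\<^esub> \<otimes>\<^bsub>L\<^esub> f) N = f N"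
        using N R.l_one[OF L_component[OF f N]] by (simp add: L_ops)
    qed (auto intro!: L_mult_closed f one)
    show "f \<otimes>\<^bsub>L\<^esub> \<one>\<^bsub>L\<^esub> = f"
    proof (rule L_eqI)
      fix N assume N: "N \<in> ON"
      interpret R: ring "MR N" by (rule MR_ring[OF N])
      show "(f \<otimes>\<^bsub>L\<^esub> \<one>\<^bsub>L\<^esub>) N = f N"
        using N R.r_one[OF L_component[OF f N]] by (simp add: L_ops)
    qed (auto intro!: L_mult_closed f one)
  qed (auto intro: L_mult_closed one)
  fix f g h assume fgh: "f \<in> carrier L" "g \<in> carrier L" "h \<in> carrier L"
  show "(f \<oplus>\<^bsub>L\<^esub> g) \<otimes>\<^bsub>L\<^esub> h = f \<otimes>\<^bsub>L\<^esub> h \<oplus>\<^bsub>L\<^esub> g \<otimes>\<^bsub>L\<^esub> h"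
  proof (rule L_eqI)
    fix N assume N: "N \<in> ON"
    interpret R: ring "MR N" by (rule MR_ring[OF N])
    show "((f \<oplus>\<^bsub>L\<^esub> g) \<otimes>\<^bsub>L\<^esub> h) N = (f \<otimes>\<^bsub>L\<^esub> h \<oplus>\<^bsub>L\<^esub> g \<otimes>\<^bsub>L\<^esub> h) N"
      using N R.l_distr[OF L_component[OF fgh(1) N] L_component[OF fgh(2) N] L_component[OF fgh(3) N]]
      by (simp add: L_ops)
  qed (auto intro!: L_mult_closed L_add_closed fgh)
  show "h \<otimes>\<^bsub>L\<^esub> (f \<oplus>\<^bsub>L\<^esub> g) = h \<otimes>\<^bsub>L\<^esub> f \<oplus>\<^bsub>L\<^esub> h \<otimes>\<^bsub>L\<^esub> g"
  proof (rule L_eqI)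
    fix N assume N: "N \<in> ON"
    interpret R: ring "MR N" by (rule MR_ring[OF N])
    show "(h \<otimes>\<^bsub>L\<^esub> (f \<oplus>\<^bsub>L\<^esub> g)) N = (h \<otimes>\<^bsub>L\<^esub> f \<oplus>\<^bsub>L\<^esub> h \<otimes>\<^bsub>L\<^esub> g) N"
      using N R.r_distr[OF L_component[OF fgh(1) N] L_component[OF fgh(2) N] L_component[OF fgh(3) N]]
      by (simp add: L_ops)
  qed (auto intro!: L_mult_closed L_add_closed fgh)
qed

sublocale L: ring L by (rule L_ring)

lemma L_minus:
  assumes "f \<in> carrier L" "g \<in> carrier L"
  shows "f \<ominus>\<^bsub>L\<^esub> g = (\<lambda>N\<in>ON. \<lambda>C. f N C - g N C)"
proof -
  have c: "lin {()} (\<lambda>_. - 1) (\<lambda>_. g) \<in> carrier L" using lin_closed[of "{()}" "\<lambda>_. g"] assms by simp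
  have "lin {()} (\<lambda>_. - 1) (\<lambda>_. g) \<oplus>\<^bsub>L\<^esub> g = \<zero>\<^bsub>L\<^esub>"
    unfolding L_ops by (rule restrict_ext) (simp add: lin_def)
  then have "\<ominus>\<^bsub>L\<^esub> g = lin {()} (\<lambda>_. - 1) (\<lambda>_. g)" using c assms(2) by (intro L.minus_equality)
  then show ?thesis unfolding a_minus_def L_ops by (intro restrict_ext) (simp add: lin_def)
qed

lemma L_mult_eval:
  assumes "f \<in> carrier L" "g \<in> carrier L" "N \<in> ON"
  shows "mr_eval ((f \<otimes>\<^bsub>L\<^esub> g) N) F = mr_eval (f N) (\<lambda>y. mr_eval (g N) (\<lambda>z. F (y <#> z)))"
  using assms mr_eval_mult[OF L_fin_supp L_fin_supp, of f N g N "G Mod N"] by (simp add: L_ops)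

lemma L_mult_apply:
  assumes "f \<in> carrier L" "g \<in> carrier L" "N \<in> ON"
  shows "(f \<otimes>\<^bsub>L\<^esub> g) N C = mr_eval (f N) (\<lambda>y. mr_eval (g N) (\<lambda>z. if y <#> z = C then 1 else 0))"
  using mr_eval_indicator[OF L_fin_supp[OF L_mult_closed[OF assms(1,2)] assms(3)], of C]
  by (simp add: L_mult_eval[OF assms])

lemma lin_mult:
  assumes "\<And>i. i \<in> I \<Longrightarrow> f i \<in> carrier L" "\<And>j. j \<in> J \<Longrightarrow> g j \<in> carrier L" "N \<in> ON"
  shows "(lin I a f \<otimes>\<^bsub>L\<^esub> lin J b g) N C = (\<Sum>i\<in>I. \<Sum>j\<in>J. a i * b j * (f i \<otimes>\<^bsub>L\<^esub> g j) N C)"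
proof -
  have "(lin I a f \<otimes>\<^bsub>L\<^esub> lin J b g) N C = mr_eval (lin I a f N)
      (\<lambda>y. mr_eval (lin J b g N) (\<lambda>z. if y <#> z = C then 1 else 0))"
    using assms by (intro L_mult_apply lin_closed)
  also have "\<dots> = (\<Sum>i\<in>I. a i * mr_eval (f i N)
      (\<lambda>y. \<Sum>j\<in>J. b j * mr_eval (g j N) (\<lambda>z. if y <#> z = C then 1 else 0)))"
    by (simp only: mr_eval_lin[OF assms(3), of J g b, OF assms(2)] mr_eval_lin[OF assms(3), of I f a, OF assms(1)])
  also have "\<dots> = (\<Sum>i\<in>I. a i * (\<Sum>j\<in>J. b j *
      mr_eval (f i N) (\<lambda>y. mr_eval (g j N) (\<lambda>z. if y <#> z = C then 1 else 0))))"
    by (simp only: mr_eval_sum_right mr_eval_mult_right)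
  also have "\<dots> = (\<Sum>i\<in>I. \<Sum>j\<in>J. a i * b j * (f i \<otimes>\<^bsub>L\<^esub> g j) N C)"
    using assms by (simp add: L_mult_apply sum_distrib_left mult.assoc)
  finally show ?thesis .
qed

lemma limit_closed:
  assumes "\<And>m. y m \<in> carrier L" "z \<in> extensional ON"
    "\<And>N C. N \<in> ON \<Longrightarrow> (\<lambda>m. y m N C) \<longlonglongrightarrow> z N C"
  shows "z \<in> carrier L"
  unfolding L_carrier_iff
proof (intro conjI ballI allI impI)
  show "z N C = 0" if "N \<in> ON" "C \<notin> rcosets N" for N C
  proof -
    have "(\<lambda>m. y m N C) = (\<lambda>_. 0)" using assms(1) that L_component_0 by blast
    then have "(\<lambda>m. y m N C) \<longlonglongrightarrow> 0" by simp
    then show ?thesis using assms(3)[OF that(1), of C] LIMSEQ_unique by blast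
  qed
  fix N M D assume NM: "N \<in> ON" "M \<in> ON" "N \<subseteq> M"
  have "(\<lambda>m. \<Sum>C\<in>rcosets N. y m N C * (if M <#> C = D then 1 else 0))
      \<longlonglongrightarrow> (\<Sum>C\<in>rcosets N. z N C * (if M <#> C = D then 1 else 0))"
    by (intro tendsto_sum tendsto_mult assms(3)[OF NM(1)] tendsto_const)
  moreover have "(\<lambda>m. \<Sum>C\<in>rcosets N. y m N C * (if M <#> C = D then 1 else 0)) = (\<lambda>m. y m M D)"
  proof
    fix m
    show "(\<Sum>C\<in>rcosets N. y m N C * (if M <#> C = D then 1 else 0)) = y m M D"
      using assms(1)[of m] NM unfolding L_carrier_iff by simp
  qed
  ultimately show "z M D = (\<Sum>C\<in>rcosets N. z N C * (if M <#> C = D then 1 else 0))"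
    using assms(3)[OF NM(2), of D] LIMSEQ_unique by auto
qed (rule assms(2))

text \<open>In a fixed component the product is a finite polynomial expression in the coefficients,
  hence continuous.\<close>

lemma limit_mult:
  assumes "\<And>m. y m \<in> carrier L" "\<And>m. y' m \<in> carrier L" "z \<in> carrier L" "z' \<in> carrier L" "N \<in> ON"
    "\<And>C. (\<lambda>m. y m N C) \<longlonglongrightarrow> z N C" "\<And>C. (\<lambda>m. y' m N C) \<longlonglongrightarrow> z' N C"
  shows "(\<lambda>m. (y m \<otimes>\<^bsub>L\<^esub> y' m) N C) \<longlonglongrightarrow> (z \<otimes>\<^bsub>L\<^esub> z') N C"
proof -
  have "(f \<otimes>\<^bsub>L\<^esub> g) N C = (\<Sum>D\<in>rcosets N. f N D * (\<Sum>E\<in>rcosets N. g N E * (if D <#> E = C then 1 else 0)))"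
    if "f \<in> carrier L" "g \<in> carrier L" for f g
    using that assms(5) L_component_0 by (simp add: L_mult_apply mr_eval_rcosets[OF assms(5)])
  then show ?thesis
    using assms(1-4) by simp (intro tendsto_sum tendsto_mult assms(6,7) tendsto_const)
qed

end

section \<open>Iterated differences and products of elements g - 1\<close>

primrec Dif :: "('g, 'm) monoid_scheme \<Rightarrow> 'g list \<Rightarrow> ('g \<Rightarrow> 'a::ab_group_add) \<Rightarrow> 'g \<Rightarrow> 'a" where
  "Dif G [] F = F"
| "Dif G (h # hs) F = Dif G hs (\<lambda>x. F (h \<otimes>\<^bsub>G\<^esub> x) - F x)"

lemma (in group) Dif_cong:
  assumes "set hs \<subseteq> carrier G" "\<And>x. x \<in> carrier G \<Longrightarrow> F x = F' x" "x \<in> carrier G"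
  shows "Dif G hs F x = Dif G hs F' x"
  using assms
proof (induction hs arbitrary: F F')
  case (Cons h hs)
  show ?case unfolding Dif.simps
    by (rule Cons.IH) (use Cons.prems in auto)
qed auto

context iwasawa
begin

definition wl :: "'g list \<Rightarrow> 'g set \<Rightarrow> 'g set \<Rightarrow> 'p padic" where
  "wl hs = foldr (\<lambda>h y. (el h \<ominus>\<^bsub>L\<^esub> \<one>\<^bsub>L\<^esub>) \<otimes>\<^bsub>L\<^esub> y) hs \<one>\<^bsub>L\<^esub>"

lemma wl_Nil [simp]: "wl [] = \<one>\<^bsub>L\<^esub>"
  and wl_Cons: "wl (h # hs) = (el h \<ominus>\<^bsub>L\<^esub> \<one>\<^bsub>L\<^esub>) \<otimes>\<^bsub>L\<^esub> wl hs"
  by (simp_all add: wl_def)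

lemma wl_closed: "set hs \<subseteq> carrier G \<Longrightarrow> wl hs \<in> carrier L"
  by (induction hs) (auto simp: wl_Cons el_closed)

lemma wl_append: "set hs \<subseteq> carrier G \<Longrightarrow> set ks \<subseteq> carrier G \<Longrightarrow> wl (hs @ ks) = wl hs \<otimes>\<^bsub>L\<^esub> wl ks"
  by (induction hs) (auto simp: wl_Cons el_closed wl_closed L.m_assoc)

text \<open>Duality: left multiplication by h - 1 corresponds to replacing a function by its
  difference under left translation by h. Divisibility of long products of such elements thereby
  becomes a question about functions on the group.\<close>

lemma mr_eval_wl:
  assumes "set hs \<subseteq> carrier G" "N \<in> ON"
  shows "mr_eval (wl hs N) F = Dif G hs (\<lambda>x. F (N #> x)) \<one>"
  using assms(1)
proof (induction hs arbitrary: F)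
  case Nil
  then show ?case using assms(2) N_rcoset by (simp add: L_ops)
next
  case (Cons h hs)
  then have h: "h \<in> carrier G" and hs: "set hs \<subseteq> carrier G" by auto
  have d: "(el h \<ominus>\<^bsub>L\<^esub> \<one>\<^bsub>L\<^esub>) N = (\<lambda>C. single (N #> h) 1 C - single N 1 C)"
    using L_minus[OF el_closed[OF h] L.one_closed] assms(2) by (simp add: el_apply L_ops(2))
  have "mr_eval (wl (h # hs) N) F =
      mr_eval (\<lambda>C. single (N #> h) 1 C - single N 1 C) (\<lambda>y. mr_eval (wl hs N) (\<lambda>z. F (y <#> z)))"
    unfolding wl_Cons d[symmetric]
    by (intro L_mult_eval L.minus_closed el_closed wl_closed L.one_closed h hs assms(2))
  also have "\<dots> = mr_eval (wl hs N) (\<lambda>z. F ((N #> h) <#> z) - F (N <#> z))"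
    by (simp add: mr_eval_diff_left mr_eval_diff_right)
  also have "\<dots> = Dif G hs (\<lambda>x. F ((N #> h) <#> (N #> x)) - F (N <#> (N #> x))) \<one>"
    using Cons.IH hs by simp
  also have "\<dots> = Dif G hs (\<lambda>x. F (N #> (h \<otimes> x)) - F (N #> x)) \<one>"
    using hs h assms(2)
    by (intro Dif_cong) (auto simp: rcoset_mult transition_rcoset)
  finally show ?case by simp
qed

lemma wl_apply:
  assumes "set hs \<subseteq> carrier G" "N \<in> ON"
  shows "wl hs N C = Dif G hs (\<lambda>x. if N #> x = C then 1 else 0) \<one>"
  using mr_eval_wl[OF assms, of "\<lambda>D. if D = C then 1 else 0"]
  by (simp add: mr_eval_indicator[OF L_fin_supp[OF wl_closed[OF assms(1)] assms(2)]])

end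

section \<open>Non-commutative power series\<close>

text \<open>All series over the type \<open>'v\<close> form a type, so that ring identities can be checked by
  rewriting; a series in the variables \<open>X\<close> is embedded by extending it by zero.\<close>

typedef (overloaded) ('v, 'a::comm_ring_1) ncs = "UNIV :: ('v list \<Rightarrow> 'a) set"
  morphisms cf Ncs by simp

setup_lifting type_definition_ncs

lemma ncs_eqI: "(\<And>w. cf f w = cf g w) \<Longrightarrow> f = g"
  using cf_inject by blast

instantiation ncs :: (type, comm_ring_1) ring_1
begin

lift_definition zero_ncs :: "('a, 'b) ncs" is "\<lambda>_. 0" .
lift_definition one_ncs :: "('a, 'b) ncs" is "\<lambda>w. if w = [] then 1 else 0" .
lift_definition plus_ncs :: "('a, 'b) ncs \<Rightarrow> ('a, 'b) ncs \<Rightarrow> ('a, 'b) ncs" is "\<lambda>f g w. f w + g w" .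
lift_definition minus_ncs :: "('a, 'b) ncs \<Rightarrow> ('a, 'b) ncs \<Rightarrow> ('a, 'b) ncs" is "\<lambda>f g w. f w - g w" .
lift_definition uminus_ncs :: "('a, 'b) ncs \<Rightarrow> ('a, 'b) ncs" is "\<lambda>f w. - f w" .
lift_definition times_ncs :: "('a, 'b) ncs \<Rightarrow> ('a, 'b) ncs \<Rightarrow> ('a, 'b) ncs"
  is "\<lambda>f g w. \<Sum>k\<le>length w. f (take k w) * g (drop k w)" .

instance
proof
  fix f g h :: "('a, 'b) ncs"
  show "f * g * h = f * (g * h)"
  proof (rule ncs_eqI)
    fix w :: "'a list"
    let ?n = "length w"
    \<comment> \<open>Both bracketings sum over two cut positions j \<le> k of the word w.\<close>
    let ?t = "\<lambda>j k. cf f (take j w) * (cf g (take (k - j) (drop j w)) * cf h (drop k w))"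
    have "cf (f * g * h) w = (\<Sum>k\<le>?n. \<Sum>j\<le>k. ?t j k)"
      by (auto simp: times_ncs.rep_eq sum_distrib_right min_def drop_take mult.assoc intro!: sum.cong)
    also have "\<dots> = (\<Sum>(k, j)\<in>Sigma {..?n} (\<lambda>k. {..k}). ?t j k)"
      by (subst sum.Sigma) auto
    also have "\<dots> = (\<Sum>(j, i)\<in>Sigma {..?n} (\<lambda>j. {..?n - j}). ?t j (j + i))"
      by (rule sum.reindex_bij_witness[of _ "\<lambda>(j, i). (j + i, j)" "\<lambda>(k, j). (j, k - j)"]) auto
    also have "\<dots> = (\<Sum>j\<le>?n. \<Sum>i\<le>?n - j. ?t j (j + i))"
      by (subst sum.Sigma) auto
    also have "\<dots> = cf (f * (g * h)) w"
      by (auto simp: times_ncs.rep_eq sum_distrib_left add.commute intro!: sum.cong)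
    finally show "cf (f * g * h) w = cf (f * (g * h)) w" .
  qed
  show "1 * f = f"
  proof (rule ncs_eqI)
    fix w :: "'a list"
    have "cf (1 * f) w = (\<Sum>k\<le>length w. if k = 0 then cf f w else 0)"
      unfolding times_ncs.rep_eq one_ncs.rep_eq by (rule sum.cong) auto
    then show "cf (1 * f) w = cf f w" by simp
  qed
  show "f * 1 = f"
  proof (rule ncs_eqI)
    fix w :: "'a list"
    have "cf (f * 1) w = (\<Sum>k\<le>length w. if k = length w then cf f w else 0)"
      unfolding times_ncs.rep_eq one_ncs.rep_eq by (rule sum.cong) auto
    then show "cf (f * 1) w = cf f w" by simp
  qed
  show "(f + g) * h = f * h + g * h" "h * (f + g) = h * f + h * g"
    by (rule ncs_eqI, simp add: times_ncs.rep_eq plus_ncs.rep_eq algebra_simps sum.distrib)+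
  show "(0 :: ('a, 'b) ncs) \<noteq> 1"
  proof
    assume "(0 :: ('a, 'b) ncs) = 1"
    then have "cf (0 :: ('a, 'b) ncs) [] = cf 1 []" by simp
    then show False by (simp add: zero_ncs.rep_eq one_ncs.rep_eq)
  qed
qed (rule ncs_eqI, simp add: zero_ncs.rep_eq plus_ncs.rep_eq minus_ncs.rep_eq uminus_ncs.rep_eq)+

end

lemma cf_sum: "cf (\<Sum>i\<in>I. f i) w = (\<Sum>i\<in>I. cf (f i) w)"
  by (induction I rule: infinite_finite_induct) (simp_all add: zero_ncs.rep_eq plus_ncs.rep_eq)

definition AX :: "'v set \<Rightarrow> ('v, 'a::comm_ring_1) ncs set" where
  "AX X = {f. \<forall>w. w \<notin> lists X \<longrightarrow> cf f w = 0}"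

lemma AX_add: "f \<in> AX X \<Longrightarrow> g \<in> AX X \<Longrightarrow> f + g \<in> AX X"
  and AX_diff: "f \<in> AX X \<Longrightarrow> g \<in> AX X \<Longrightarrow> f - g \<in> AX X"
  and AX_uminus: "f \<in> AX X \<Longrightarrow> - f \<in> AX X"
  and AX_0: "0 \<in> AX X"
  and AX_1: "1 \<in> AX X"
  by (auto simp: AX_def zero_ncs.rep_eq one_ncs.rep_eq plus_ncs.rep_eq minus_ncs.rep_eq uminus_ncs.rep_eq)

lemma AX_mult:
  assumes "f \<in> AX X" "g \<in> AX X" shows "f * g \<in> AX X"
proof -
  have "cf f (take k w) * cf g (drop k w) = 0" if "w \<notin> lists X" for k w
  proof -
    have "take k w \<notin> lists X \<or> drop k w \<notin> lists X"
      using that append_take_drop_id[of k w] by (metis append_in_lists_conv)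
    then show ?thesis using assms unfolding AX_def by auto
  qed
  then show ?thesis by (simp add: AX_def times_ncs.rep_eq)
qed

lemma AX_sum: "(\<And>i. i \<in> I \<Longrightarrow> f i \<in> AX X) \<Longrightarrow> (\<Sum>i\<in>I. f i) \<in> AX X"
  by (induction I rule: infinite_finite_induct) (auto intro: AX_add AX_0)

definition emb :: "'v set \<Rightarrow> ('v list \<Rightarrow> 'a::comm_ring_1) \<Rightarrow> ('v, 'a) ncs" where
  "emb X f = Ncs (\<lambda>w. if w \<in> lists X then f w else 0)"

lemma cf_emb [simp]: "cf (emb X f) w = (if w \<in> lists X then f w else 0)"
  unfolding emb_def by (subst Ncs_inverse) auto

lemma emb_in_AX: "emb X f \<in> AX X"
  by (simp add: AX_def)

lemma carrier_nc: "f \<in> carrier (nc_power_series X) \<longleftrightarrow> f \<in> extensional (lists X)"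
  by (auto simp: nc_power_series_def PiE_def)

lemma nc_ops:
  "f \<otimes>\<^bsub>nc_power_series X\<^esub> g = (\<lambda>w\<in>lists X. \<Sum>k\<le>length w. f (take k w) * g (drop k w))"
  "\<one>\<^bsub>nc_power_series X\<^esub> = (\<lambda>w\<in>lists X. if w = [] then 1 else 0)"
  "\<zero>\<^bsub>nc_power_series X\<^esub> = (\<lambda>w\<in>lists X. 0)"
  "f \<oplus>\<^bsub>nc_power_series X\<^esub> g = (\<lambda>w\<in>lists X. f w + g w)"
  by (simp_all add: nc_power_series_def)

lemma emb_inj:
  assumes "f \<in> carrier (nc_power_series X)" "g \<in> carrier (nc_power_series X)" "emb X f = emb X g"
  shows "f = g"
proof (rule extensionalityI[of _ "lists X"])
  fix w assume "w \<in> lists X"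
  then show "f w = g w" using arg_cong[OF assms(3), of "\<lambda>h. cf h w"] by simp
qed (use assms carrier_nc in auto)

lemma emb_surj:
  assumes "F \<in> AX X"
  obtains f where "f \<in> carrier (nc_power_series X)" "emb X f = F" "\<And>w. w \<in> lists X \<Longrightarrow> f w = cf F w"
proof
  show "(\<lambda>w\<in>lists X. cf F w) \<in> carrier (nc_power_series X)" by (simp add: carrier_nc)
  show "emb X (\<lambda>w\<in>lists X. cf F w) = F" using assms by (auto intro!: ncs_eqI simp: AX_def)
qed simp

lemma emb_add: "emb X (f \<oplus>\<^bsub>nc_power_series X\<^esub> g) = emb X f + emb X g"
  and emb_one: "emb X \<one>\<^bsub>nc_power_series X\<^esub> = 1"
  and emb_zero: "emb X \<zero>\<^bsub>nc_power_series X\<^esub> = 0"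
  by (rule ncs_eqI, simp add: nc_ops plus_ncs.rep_eq one_ncs.rep_eq zero_ncs.rep_eq)+

lemma emb_mult: "emb X (f \<otimes>\<^bsub>nc_power_series X\<^esub> g) = emb X f * emb X g"
proof (rule ncs_eqI)
  fix w
  show "cf (emb X (f \<otimes>\<^bsub>nc_power_series X\<^esub> g)) w = cf (emb X f * emb X g) w"
  proof (cases "w \<in> lists X")
    case True
    then have "take k w \<in> lists X" "drop k w \<in> lists X" for k
      using append_take_drop_id[of k w] by (metis append_in_lists_conv)+
    then show ?thesis using True by (simp add: nc_ops times_ncs.rep_eq)
  next
    case False
    then show ?thesis
      using AX_mult[OF emb_in_AX[of X f] emb_in_AX[of X g]] by (simp add: AX_def)
  qed
qed

lemma nc_closed:
  "f \<otimes>\<^bsub>nc_power_series X\<^esub> g \<in> carrier (nc_power_series X)"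
  "\<one>\<^bsub>nc_power_series X\<^esub> \<in> carrier (nc_power_series X)"
  "\<zero>\<^bsub>nc_power_series X\<^esub> \<in> carrier (nc_power_series X)"
  "f \<oplus>\<^bsub>nc_power_series X\<^esub> g \<in> carrier (nc_power_series X)"
  by (simp_all add: carrier_nc nc_ops)

lemma nc_ring: "ring (nc_power_series X :: ('v list \<Rightarrow> 'a::comm_ring_1) ring)"
proof -
  let ?A = "nc_power_series X :: ('v list \<Rightarrow> 'a) ring"
  note [simp] = emb_add emb_one emb_zero emb_mult nc_closed
  show ?thesis
  proof (rule ringI)
    show "abelian_group ?A"
    proof (rule abelian_groupI)
      fix f assume f: "f \<in> carrier ?A"
      have "(\<lambda>w\<in>lists X. - f w) \<in> carrier ?A" by (simp add: carrier_nc)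
      moreover have "(\<lambda>w\<in>lists X. - f w) \<oplus>\<^bsub>?A\<^esub> f = \<zero>\<^bsub>?A\<^esub>"
        unfolding nc_ops by (rule restrict_ext) simp
      ultimately show "\<exists>g\<in>carrier ?A. g \<oplus>\<^bsub>?A\<^esub> f = \<zero>\<^bsub>?A\<^esub>" by blast
    next
      fix f g h assume "f \<in> carrier ?A" "g \<in> carrier ?A" "h \<in> carrier ?A"
      then show "f \<oplus>\<^bsub>?A\<^esub> g \<oplus>\<^bsub>?A\<^esub> h = f \<oplus>\<^bsub>?A\<^esub> (g \<oplus>\<^bsub>?A\<^esub> h)" "f \<oplus>\<^bsub>?A\<^esub> g = g \<oplus>\<^bsub>?A\<^esub> f"
        by (intro emb_inj[of _ X]; simp add: algebra_simps)+
    next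
      fix f assume "f \<in> carrier ?A"
      then show "\<zero>\<^bsub>?A\<^esub> \<oplus>\<^bsub>?A\<^esub> f = f" by (intro emb_inj[of _ X]) simp_all
    qed simp_all
    show "Group.monoid ?A"
      by (rule monoidI) (auto intro: emb_inj[of _ X] simp: mult.assoc)
  qed (auto intro: emb_inj[of _ X] simp: algebra_simps)
qed

lemma emb_minus:
  fixes f g :: "'v list \<Rightarrow> 'a::comm_ring_1"
  assumes "f \<in> carrier (nc_power_series X)" "g \<in> carrier (nc_power_series X)"
  shows "emb X (f \<ominus>\<^bsub>nc_power_series X\<^esub> g) = emb X f - emb X g"
proof -
  interpret A: ring "nc_power_series X :: ('v list \<Rightarrow> 'a) ring" by (rule nc_ring)
  have "emb X (f \<ominus>\<^bsub>nc_power_series X\<^esub> g) + emb X g = emb X ((f \<ominus>\<^bsub>nc_power_series X\<^esub> g) \<oplus>\<^bsub>nc_power_series X\<^esub> g)"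
    by (simp only: emb_add)
  also have "(f \<ominus>\<^bsub>nc_power_series X\<^esub> g) \<oplus>\<^bsub>nc_power_series X\<^esub> g = f"
    using assms A.a_assoc[of f "\<ominus>\<^bsub>nc_power_series X\<^esub> g" g] A.l_neg[of g] by (simp add: a_minus_def)
  finally show ?thesis by (simp add: algebra_simps)
qed

lemma nc_minus:
  fixes f g :: "'v list \<Rightarrow> 'a::comm_ring_1"
  assumes "f \<in> carrier (nc_power_series X)" "g \<in> carrier (nc_power_series X)" "w \<in> lists X"
  shows "(f \<ominus>\<^bsub>nc_power_series X\<^esub> g) w = f w - g w"
  using arg_cong[OF emb_minus[OF assms(1,2)], of "\<lambda>h. cf h w"] assms(3) by (simp add: minus_ncs.rep_eq)

lemma nc_add_pow:
  fixes f :: "'v list \<Rightarrow> 'a::comm_ring_1"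
  assumes "f \<in> carrier (nc_power_series X)"
  shows "[(k::nat)] \<cdot>\<^bsub>nc_power_series X\<^esub> f = (\<lambda>w\<in>lists X. of_nat k * f w)"
proof -
  interpret A: ring "nc_power_series X :: ('v list \<Rightarrow> 'a) ring" by (rule nc_ring)
  show ?thesis
  proof (induction k)
    case 0
    then show ?case by (simp add: nc_ops)
  next
    case (Suc k)
    have "[Suc k] \<cdot>\<^bsub>nc_power_series X\<^esub> f = [k] \<cdot>\<^bsub>nc_power_series X\<^esub> f \<oplus>\<^bsub>nc_power_series X\<^esub> f"
      using A.add.nat_pow_Suc[of k f] by simp
    also have "\<dots> = (\<lambda>w\<in>lists X. of_nat (Suc k) * f w)"
      unfolding Suc nc_ops by (rule restrict_ext) (simp add: algebra_simps)
    finally show ?case .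
  qed
qed

lemma nc_topspace: "topspace (nc_topology X :: ('v list \<Rightarrow> 'p::prime_card padic) topology) = carrier (nc_power_series X)"
  by (simp add: nc_topology_def nc_power_series_def)

lemma nc_compact: "compact_space (nc_topology X :: ('v list \<Rightarrow> 'p::prime_card padic) topology)"
  unfolding nc_topology_def by (simp add: compact_space_product_topology compact_padic)

lemma finite_words: "finite X \<Longrightarrow> finite {w \<in> lists X. length w < m}"
  by (rule finite_subset[OF _ finite_lists_length_le[of X m]]) (auto simp: lists_eq_set)

text \<open>One number m bounds both the length of the inspected words and the precision of their
  coefficients. Since X is finite, only finitely many words are short, so these conditions are open;
  conversely m can dominate the finitely many constraints of a basic open set.\<close>

lemma nc_open_iff:
  fixes S :: "('v list \<Rightarrow> 'p::prime_card padic) set"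
  assumes "finite X"
  shows "openin (nc_topology X) S \<longleftrightarrow> S \<subseteq> carrier (nc_power_series X) \<and>
    (\<forall>f\<in>S. \<exists>m. \<forall>f'\<in>carrier (nc_power_series X).
      (\<forall>w\<in>lists X. length w < m \<longrightarrow> padic_p ^ m dvd f' w - f w) \<longrightarrow> f' \<in> S)"
proof (intro iffI conjI ballI)
  assume S: "openin (nc_topology X) S"
  then show "S \<subseteq> carrier (nc_power_series X)" using openin_subset nc_topspace by blast
  fix f assume f: "f \<in> S"
  obtain B where B: "finite {i \<in> lists X. B i \<noteq> topspace euclidean}" "\<forall>i\<in>lists X. openin euclidean (B i)"
    "f \<in> PiE (lists X) B" "PiE (lists X) B \<subseteq> S"
    using bspec[OF iffD1[OF openin_product_topology_alt S[unfolded nc_topology_def]] f]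
    by (elim exE conjE) (rule that)
  have "\<forall>w. \<exists>k. w \<in> lists X \<longrightarrow> (\<forall>y. padic_p ^ k dvd y - f w \<longrightarrow> y \<in> B w)"
  proof
    fix w
    show "\<exists>k. w \<in> lists X \<longrightarrow> (\<forall>y. padic_p ^ k dvd y - f w \<longrightarrow> y \<in> B w)"
    proof (cases "w \<in> lists X")
      case True
      then have "f w \<in> B w" "open (B w)" using B(2,3) by auto
      then obtain k where "\<forall>y. residue y k = residue (f w) k \<longrightarrow> y \<in> B w"
        unfolding open_padic_def by blast
      then show ?thesis by (auto simp: residue_eq_iff)
    qed simp
  qed
  then obtain K where K: "\<And>w y. w \<in> lists X \<Longrightarrow> padic_p ^ K w dvd y - f w \<Longrightarrow> y \<in> B w" by metis
  let ?J = "{i \<in> lists X. B i \<noteq> topspace euclidean}"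
  define m where "m = (\<Sum>w\<in>?J. K w + length w + 1)"
  have m: "K w \<le> m" "length w < m" if "w \<in> ?J" for w
  proof -
    have "K w + length w + 1 \<le> m" unfolding m_def by (rule member_le_sum[OF that _ B(1)]) simp
    then show "K w \<le> m" "length w < m" by auto
  qed
  show "\<exists>m. \<forall>f'\<in>carrier (nc_power_series X).
      (\<forall>w\<in>lists X. length w < m \<longrightarrow> padic_p ^ m dvd f' w - f w) \<longrightarrow> f' \<in> S"
  proof (intro exI ballI impI)
    fix f' assume f': "f' \<in> carrier (nc_power_series X)"
      and *: "\<forall>w\<in>lists X. length w < m \<longrightarrow> padic_p ^ m dvd f' w - f w"
    have "f' w \<in> B w" if w: "w \<in> lists X" for w
    proof (cases "w \<in> ?J")
      case True
      then have "padic_p ^ m dvd f' w - f w" using * m(2) by blast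
      then have "padic_p ^ K w dvd f' w - f w" using le_imp_power_dvd[OF m(1)[OF True]] dvd_trans by blast
      then show ?thesis using K w by blast
    qed (use w in auto)
    then show "f' \<in> S" using B(4) f' by (auto simp: carrier_nc PiE_def)
  qed
next
  assume S: "S \<subseteq> carrier (nc_power_series X) \<and> (\<forall>f\<in>S. \<exists>m. \<forall>f'\<in>carrier (nc_power_series X).
      (\<forall>w\<in>lists X. length w < m \<longrightarrow> padic_p ^ m dvd f' w - f w) \<longrightarrow> f' \<in> S)"
  show "openin (nc_topology X) S"
  proof (subst openin_subopen, intro ballI)
    fix f assume f: "f \<in> S"
    then obtain m where m: "\<And>f'. f' \<in> carrier (nc_power_series X) \<Longrightarrow>
      (\<forall>w\<in>lists X. length w < m \<longrightarrow> padic_p ^ m dvd f' w - f w) \<Longrightarrow> f' \<in> S" using S by blast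
    let ?B = "\<lambda>w. if length w < m then {y. padic_p ^ m dvd y - f w} else UNIV"
    have o: "open {y. padic_p ^ m dvd y - f w}" for w
      unfolding open_padic_def residue_eq_iff[symmetric] by (auto intro: exI[of _ m])
    have "openin (nc_topology X) (PiE (lists X) ?B)"
      unfolding nc_topology_def openin_PiE_gen
      by (rule disjI2) (use o finite_words[OF assms, of m] in \<open>auto intro: finite_subset[rotated]\<close>)
    moreover have "f \<in> PiE (lists X) ?B" using S f by (auto simp: carrier_nc PiE_def)
    moreover have "PiE (lists X) ?B \<subseteq> S"
    proof
      fix f' assume "f' \<in> PiE (lists X) ?B"
      then show "f' \<in> S" by (intro m) (auto simp: carrier_nc PiE_def Pi_def split: if_splits)
    qed
    ultimately show "\<exists>T. openin (nc_topology X) T \<and> f \<in> T \<and> T \<subseteq> S" by blast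
  qed
qed

section \<open>The homomorphism from power series to the Iwasawa algebra\<close>

text \<open>The assumption \<open>nilp\<close> says that the augmentation ideal is nilpotent modulo
  p at every finite level. It is what makes evaluation of power series at elements g - 1
  converge.\<close>

locale iwasawa_pro_p = iwasawa G T pt
  for G :: "'g monoid" (structure) and T and pt :: "'p::prime_card itself" +
  assumes nilp: "N \<in> ON \<Longrightarrow> \<exists>M. \<forall>hs. set hs \<subseteq> carrier G \<longrightarrow> M \<le> length hs \<longrightarrow>
    (\<forall>C. (padic_p :: 'p padic) dvd wl hs N C)"
begin

lemma dvd_L_mult:
  assumes "f \<in> carrier L" "g \<in> carrier L" "N \<in> ON" "\<And>C. a dvd f N C" "\<And>C. b dvd g N C"
  shows "a * b dvd (f \<otimes>\<^bsub>L\<^esub> g) N C"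
  unfolding L_mult_apply[OF assms(1-3)] mr_eval_def[of "f N"]
  by (intro dvd_sum mult_dvd_mono assms(4) dvd_mr_eval assms(5))

text \<open>A word is cut into blocks, each of which is long enough to contribute one factor p to
  the product.\<close>

lemma nilp_pow:
  assumes "N \<in> ON"
  shows "\<exists>M. \<forall>hs. set hs \<subseteq> carrier G \<longrightarrow> M \<le> length hs \<longrightarrow> (\<forall>C. padic_p ^ k dvd wl hs N C)"
proof (induction k)
  case (Suc k)
  then obtain M where M: "\<And>hs C. set hs \<subseteq> carrier G \<Longrightarrow> M \<le> length hs \<Longrightarrow> padic_p ^ k dvd wl hs N C" by blast
  obtain M1 where "\<forall>hs. set hs \<subseteq> carrier G \<longrightarrow> M1 \<le> length hs \<longrightarrow> (\<forall>C. padic_p dvd wl hs N C)"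
    using nilp[OF assms] by (elim exE)
  then have M1: "padic_p dvd wl hs N C" if "set hs \<subseteq> carrier G" "M1 \<le> length hs" for hs C
    using that by simp
  show ?case
  proof (intro exI allI impI)
    fix hs C assume hs: "set hs \<subseteq> carrier G" "M1 + M \<le> length hs"
    have t: "set (take M1 hs) \<subseteq> carrier G" and d: "set (drop M1 hs) \<subseteq> carrier G"
      using hs(1) set_take_subset[of M1 hs] set_drop_subset[of M1 hs] by auto
    have "wl hs = wl (take M1 hs) \<otimes>\<^bsub>L\<^esub> wl (drop M1 hs)"
      using wl_append[OF t d] by simp
    moreover have "padic_p * padic_p ^ k dvd (wl (take M1 hs) \<otimes>\<^bsub>L\<^esub> wl (drop M1 hs)) N C"
      by (intro dvd_L_mult wl_closed t d assms M M1) (use hs in auto)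
    ultimately show "padic_p ^ Suc k dvd wl hs N C" by simp
  qed
qed simp

end

locale iwasawa_gens = iwasawa_pro_p G T pt
  for G :: "'g monoid" (structure) and T and pt :: "'p::prime_card itself" +
  fixes X :: "'v set" and gn :: "'v \<Rightarrow> 'g"
  assumes finite_X: "finite X" and gn_closed: "v \<in> X \<Longrightarrow> gn v \<in> carrier G"
begin

abbreviation A :: "('v list \<Rightarrow> 'p padic) ring" where "A \<equiv> nc_power_series X"

definition words :: "nat \<Rightarrow> 'v list set" where "words m = {w \<in> lists X. length w < m}"

definition lw :: "'v list \<Rightarrow> 'g set \<Rightarrow> 'g set \<Rightarrow> 'p padic" where "lw w = wl (map gn w)"

definition Phi :: "nat \<Rightarrow> ('v list \<Rightarrow> 'p padic) \<Rightarrow> 'g set \<Rightarrow> 'g set \<Rightarrow> 'p padic" where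
  "Phi m f = lin (words m) f lw"

definition phi :: "('v list \<Rightarrow> 'p padic) \<Rightarrow> 'g set \<Rightarrow> 'g set \<Rightarrow> 'p padic" where
  "phi f = (\<lambda>N\<in>ON. \<lambda>C. lim (\<lambda>m. Phi m f N C))"

lemma map_gn: "w \<in> lists X \<Longrightarrow> set (map gn w) \<subseteq> carrier G"
  using gn_closed by auto

lemma lw_closed: "w \<in> lists X \<Longrightarrow> lw w \<in> carrier L"
  unfolding lw_def by (intro wl_closed map_gn)

lemma lw_append: "u \<in> lists X \<Longrightarrow> w \<in> lists X \<Longrightarrow> lw (u @ w) = lw u \<otimes>\<^bsub>L\<^esub> lw w"
  unfolding lw_def map_append by (intro wl_append map_gn)

lemma words_lists: "w \<in> words m \<Longrightarrow> w \<in> lists X"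
  by (simp add: words_def)

lemma finite_words': "finite (words m)"
  unfolding words_def by (rule finite_words[OF finite_X])

lemma Phi_closed: "Phi m f \<in> carrier L"
  unfolding Phi_def by (intro lin_closed lw_closed words_lists)

lemma Phi_apply: "N \<in> ON \<Longrightarrow> Phi m f N C = (\<Sum>w\<in>words m. f w * lw w N C)"
  by (simp add: Phi_def lin_apply)

lemma lw_small:
  assumes "N \<in> ON"
  shows "\<exists>M. \<forall>w\<in>lists X. M \<le> length w \<longrightarrow> (\<forall>C. padic_p ^ k dvd lw w N C)"
proof -
  obtain M where "\<forall>hs. set hs \<subseteq> carrier G \<longrightarrow> M \<le> length hs \<longrightarrow> (\<forall>C. padic_p ^ k dvd wl hs N C)"
    using nilp_pow[OF assms, of k] by (elim exE)
  then have "\<forall>w\<in>lists X. M \<le> length w \<longrightarrow> (\<forall>C. padic_p ^ k dvd lw w N C)"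
    unfolding lw_def using map_gn by simp
  then show ?thesis by (rule exI)
qed

lemma Phi_diff:
  assumes "N \<in> ON" "M \<le> m" "\<And>w. w \<in> lists X \<Longrightarrow> M \<le> length w \<Longrightarrow> d dvd lw w N C"
  shows "d dvd Phi m f N C - Phi M f N C"
proof -
  have "words M \<subseteq> words m" using assms(2) by (auto simp: words_def)
  then have "Phi m f N C - Phi M f N C = (\<Sum>w\<in>words m - words M. f w * lw w N C)"
    using assms(1) by (simp add: Phi_apply sum_diff finite_words')
  also have "d dvd \<dots>"
    by (intro dvd_sum dvd_mult assms(3)) (auto simp: words_def)
  finally show ?thesis .
qed

text \<open>The truncations are Cauchy because long words have highly divisible values. The error
  bound refers to the truncation at M itself, so claims about \<open>phi\<close> modulo p^k reduce
  to a finite sum.\<close>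

lemma
  assumes N: "N \<in> ON"
  shows phi_tendsto: "(\<lambda>m. Phi m f N C) \<longlonglongrightarrow> phi f N C"
    and phi_approx: "(\<And>w. w \<in> lists X \<Longrightarrow> M \<le> length w \<Longrightarrow> padic_p ^ k dvd lw w N C) \<Longrightarrow>
      padic_p ^ k dvd phi f N C - Phi M f N C"
proof -
  have "\<exists>M. \<forall>m\<ge>M. padic_p ^ k dvd Phi m f N C - Phi M f N C" for k
  proof -
    obtain M where M: "\<forall>w\<in>lists X. M \<le> length w \<longrightarrow> (\<forall>C. padic_p ^ k dvd lw w N C)"
      using lw_small[OF N, of k] by (elim exE)
    have "\<forall>m\<ge>M. padic_p ^ k dvd Phi m f N C - Phi M f N C"
      using M by (intro allI impI Phi_diff[OF N]) auto
    then show ?thesis by (rule exI)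
  qed
  then obtain s where s: "(\<lambda>m. Phi m f N C) \<longlonglongrightarrow> s"
    "\<And>k M. (\<And>m. m \<ge> M \<Longrightarrow> padic_p ^ k dvd Phi m f N C - Phi M f N C) \<Longrightarrow> padic_p ^ k dvd s - Phi M f N C"
    using padic_LIMSEQ_I[of "\<lambda>m. Phi m f N C"] by blast
  have "phi f N C = s" unfolding phi_def using N limI[OF s(1)] by simp
  then show "(\<lambda>m. Phi m f N C) \<longlonglongrightarrow> phi f N C"
    "(\<And>w. w \<in> lists X \<Longrightarrow> M \<le> length w \<Longrightarrow> padic_p ^ k dvd lw w N C) \<Longrightarrow>
      padic_p ^ k dvd phi f N C - Phi M f N C"
    using s Phi_diff[OF N] by auto
qed

lemma phi_closed: "phi f \<in> carrier L"
  by (rule limit_closed[of "\<lambda>m. Phi m f"]) (auto simp: Phi_closed phi_tendsto, simp add: phi_def)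

lemma phi_add: "phi (f \<oplus>\<^bsub>A\<^esub> f') = phi f \<oplus>\<^bsub>L\<^esub> phi f'"
proof (rule L_eqI)
  fix N assume N: "N \<in> ON"
  have "phi (f \<oplus>\<^bsub>A\<^esub> f') N C = phi f N C + phi f' N C" for C
  proof -
    have "Phi m (f \<oplus>\<^bsub>A\<^esub> f') N C = Phi m f N C + Phi m f' N C" for m
      unfolding Phi_apply[OF N] sum.distrib[symmetric]
      by (rule sum.cong) (auto simp: nc_ops algebra_simps dest: words_lists)
    then have "(\<lambda>m. Phi m (f \<oplus>\<^bsub>A\<^esub> f') N C) \<longlonglongrightarrow> phi f N C + phi f' N C"
      using tendsto_add[OF phi_tendsto[OF N, of f C] phi_tendsto[OF N, of f' C]] by simp
    then show ?thesis using phi_tendsto[OF N] LIMSEQ_unique by blast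
  qed
  then show "phi (f \<oplus>\<^bsub>A\<^esub> f') N = (phi f \<oplus>\<^bsub>L\<^esub> phi f') N" using N by (auto simp: L_ops)
qed (auto simp: phi_closed)

lemma phi_finite:
  assumes N: "N \<in> ON" and "finite S" "S \<subseteq> lists X" "\<And>w. w \<in> lists X - S \<Longrightarrow> f w = 0"
  shows "phi f N C = (\<Sum>w\<in>S. f w * lw w N C)"
proof -
  obtain m0 where m0: "\<And>w. w \<in> S \<Longrightarrow> length w < m0"
    using finite_nat_bounded[of "length ` S"] assms(2) by auto
  have "Phi m f N C = (\<Sum>w\<in>S. f w * lw w N C)" if "m0 \<le> m" for m
    unfolding Phi_apply[OF N]
  proof (rule sum.mono_neutral_right[OF finite_words'])
    show "S \<subseteq> words m" using assms(3) m0 that by (fastforce simp: words_def)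
    show "\<forall>w\<in>words m - S. f w * lw w N C = 0" using assms(4) words_lists by fastforce
  qed
  then have "(\<lambda>m. Phi m f N C) \<longlonglongrightarrow> (\<Sum>w\<in>S. f w * lw w N C)"
    by (intro tendsto_eventually) (auto simp: eventually_sequentially)
  then show ?thesis using phi_tendsto[OF N] LIMSEQ_unique by blast
qed

lemma phi_one: "phi \<one>\<^bsub>A\<^esub> = \<one>\<^bsub>L\<^esub>"
proof (rule L_eqI)
  fix N assume N: "N \<in> ON"
  show "phi \<one>\<^bsub>A\<^esub> N = \<one>\<^bsub>L\<^esub> N"
    by (rule ext, subst phi_finite[OF N, of "{[]}"]) (auto simp: nc_ops lw_def)
qed (auto simp: phi_closed)

lemma phi_var:
  assumes v: "v \<in> X"
  shows "phi (nc_var X v) = el (gn v) \<ominus>\<^bsub>L\<^esub> \<one>\<^bsub>L\<^esub>"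
proof (rule L_eqI)
  fix N assume N: "N \<in> ON"
  have "lw [v] = el (gn v) \<ominus>\<^bsub>L\<^esub> \<one>\<^bsub>L\<^esub>"
    unfolding lw_def using el_closed[OF gn_closed[OF v]] by (simp add: wl_Cons)
  then show "phi (nc_var X v) N = (el (gn v) \<ominus>\<^bsub>L\<^esub> \<one>\<^bsub>L\<^esub>) N"
    using v by (intro ext, subst phi_finite[OF N, of "{[v]}"]) (auto simp: nc_var_def)
qed (auto simp: phi_closed el_closed gn_closed[OF v])

text \<open>The product of two truncations and the truncation of the product differ only in pairs of
  words of total length at least m, whose values tend to 0.\<close>

lemma phi_mult: "phi (f \<otimes>\<^bsub>A\<^esub> f') = phi f \<otimes>\<^bsub>L\<^esub> phi f'"
proof (rule L_eqI)
  fix N assume N: "N \<in> ON"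
  have "phi (f \<otimes>\<^bsub>A\<^esub> f') N C = (phi f \<otimes>\<^bsub>L\<^esub> phi f') N C" for C
  proof -
    let ?t = "\<lambda>(u, w). f u * f' w * lw (u @ w) N C"
    let ?P = "\<lambda>m. {(u, w). u \<in> lists X \<and> w \<in> lists X \<and> length u + length w < m}"
    have 1: "Phi m (f \<otimes>\<^bsub>A\<^esub> f') N C = (\<Sum>q\<in>?P m. ?t q)" for m
    proof -
      have "Phi m (f \<otimes>\<^bsub>A\<^esub> f') N C =
          (\<Sum>w\<in>words m. \<Sum>k\<le>length w. f (take k w) * f' (drop k w) * lw (take k w @ drop k w) N C)"
        unfolding Phi_apply[OF N]
        by (rule sum.cong) (auto simp: nc_ops sum_distrib_right dest: words_lists)
      also have "\<dots> = (\<Sum>(w, k)\<in>Sigma (words m) (\<lambda>w. {..length w}).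
          f (take k w) * f' (drop k w) * lw (take k w @ drop k w) N C)"
        by (subst sum.Sigma) (auto simp: finite_words')
      also have "\<dots> = (\<Sum>q\<in>?P m. ?t q)"
        by (rule sum.reindex_bij_witness[of _ "\<lambda>(u, w). (u @ w, length u)" "\<lambda>(w, k). (take k w, drop k w)"])
           (auto simp: words_def dest: in_set_takeD in_set_dropD)
      finally show ?thesis .
    qed
    have 2: "(Phi m f \<otimes>\<^bsub>L\<^esub> Phi m f') N C = (\<Sum>q\<in>words m \<times> words m. ?t q)" for m
    proof -
      have "(Phi m f \<otimes>\<^bsub>L\<^esub> Phi m f') N C = (\<Sum>u\<in>words m. \<Sum>w\<in>words m. f u * f' w * (lw u \<otimes>\<^bsub>L\<^esub> lw w) N C)"
        unfolding Phi_def by (intro lin_mult N lw_closed words_lists)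
      also have "\<dots> = (\<Sum>u\<in>words m. \<Sum>w\<in>words m. ?t (u, w))"
        by (intro sum.cong refl) (simp add: lw_append words_lists)
      also have "\<dots> = (\<Sum>q\<in>words m \<times> words m. ?t q)"
        by (simp only: sum.cartesian_product split_def fst_conv snd_conv)
      finally show ?thesis .
    qed
    have 3: "(\<lambda>m. (Phi m f \<otimes>\<^bsub>L\<^esub> Phi m f') N C - Phi m (f \<otimes>\<^bsub>A\<^esub> f') N C) \<longlonglongrightarrow> 0"
      unfolding tendsto_padic_iff eventually_sequentially
    proof
      fix k
      obtain M where M: "\<forall>w\<in>lists X. M \<le> length w \<longrightarrow> (\<forall>C. padic_p ^ k dvd lw w N C)"
        using lw_small[OF N, of k] by (elim exE)
      have "padic_p ^ k dvd (Phi m f \<otimes>\<^bsub>L\<^esub> Phi m f') N C - Phi m (f \<otimes>\<^bsub>A\<^esub> f') N C - 0" if m: "M \<le> m" for m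
      proof -
        have "?P m \<subseteq> words m \<times> words m" by (auto simp: words_def)
        then have "(Phi m f \<otimes>\<^bsub>L\<^esub> Phi m f') N C - Phi m (f \<otimes>\<^bsub>A\<^esub> f') N C =
            (\<Sum>q\<in>words m \<times> words m - ?P m. ?t q)"
          unfolding 1 2 by (simp add: sum_diff finite_words')
        also have "padic_p ^ k dvd \<dots>"
        proof (rule dvd_sum)
          fix q assume q: "q \<in> words m \<times> words m - ?P m"
          obtain u w where uw: "q = (u, w)" by fastforce
          have "u @ w \<in> lists X" "M \<le> length (u @ w)" using q m unfolding uw by (auto simp: words_def)
          then show "padic_p ^ k dvd ?t q" unfolding uw by (simp add: M)
        qed
        finally show ?thesis by simp
      qed
      then show "\<exists>M. \<forall>m\<ge>M. padic_p ^ k dvd (Phi m f \<otimes>\<^bsub>L\<^esub> Phi m f') N C - Phi m (f \<otimes>\<^bsub>A\<^esub> f') N C - 0"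
        by blast
    qed
    have "(\<lambda>m. (Phi m f \<otimes>\<^bsub>L\<^esub> Phi m f') N C) \<longlonglongrightarrow> (phi f \<otimes>\<^bsub>L\<^esub> phi f') N C"
      by (intro limit_mult Phi_closed phi_closed N phi_tendsto)
    from tendsto_diff[OF this 3]
    have "(\<lambda>m. Phi m (f \<otimes>\<^bsub>A\<^esub> f') N C) \<longlonglongrightarrow> (phi f \<otimes>\<^bsub>L\<^esub> phi f') N C" by simp
    then show ?thesis using phi_tendsto[OF N] LIMSEQ_unique by blast
  qed
  then show "phi (f \<otimes>\<^bsub>A\<^esub> f') N = (phi f \<otimes>\<^bsub>L\<^esub> phi f') N" by blast
qed (auto simp: phi_closed)

end

section \<open>The topology of the Iwasawa algebra\<close>

context iwasawa
begin

abbreviation LT :: "('g set \<Rightarrow> 'g set \<Rightarrow> 'p padic) topology" where "LT \<equiv> iwasawa_topology G T"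

lemma topspace_LT: "topspace LT = carrier L"
  unfolding iwasawa_topology_def by (auto simp: L_component PiE_iff extensional_arb[OF L_extensional])

lemma projection_continuous:
  assumes "N \<in> ON" shows "continuous_map LT euclidean (\<lambda>f. f N C)"
  unfolding iwasawa_topology_def
proof (rule continuous_map_from_subtopology)
  let ?P = "product_topology (\<lambda>N. top_of_set (carrier (MR N))) ON"
  have "continuous_map ?P (top_of_set (carrier (MR N))) (\<lambda>f. f N)"
    by (rule continuous_map_product_projection[OF assms])
  moreover have "continuous_map (top_of_set (carrier (MR N))) euclidean (\<lambda>h. h C)"
    unfolding continuous_map_iff_continuous
    by (rule continuous_on_subset[OF continuous_on_product_coordinates]) simp
  ultimately show "continuous_map ?P euclidean (\<lambda>f. f N C)"
    using continuous_map_compose[of ?P _ "\<lambda>f. f N" euclidean "\<lambda>h. h C"] by (simp add: o_def)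
qed

lemma open_p_cong: "open {y :: 'p padic. padic_p ^ k dvd y - a}"
  unfolding open_padic_def residue_eq_iff[symmetric] by (auto intro: exI[of _ k])

text \<open>The condition concerns only the finitely many cosets of N, since both functions vanish
  elsewhere; it is a finite intersection of open conditions.\<close>

lemma open_cong_component:
  assumes "N \<in> ON" "\<mu> \<in> carrier L"
  shows "openin LT {f \<in> carrier L. \<forall>C. padic_p dvd f N C - \<mu> N C}"
proof -
  have "openin LT {f \<in> topspace LT. f N C \<in> {y. padic_p ^ 1 dvd y - \<mu> N C}}" for C
    by (rule openin_continuous_map_preimage[OF projection_continuous[OF assms(1)]])
       (use open_p_cong[of 1] in simp)
  then have "openin LT (\<Inter>C\<in>rcosets N. {f \<in> topspace LT. f N C \<in> {y. padic_p ^ 1 dvd y - \<mu> N C}})"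
    using finite_quotient[OF assms(1)] N_in_rcosets[OF assms(1)] by (intro openin_INT2) auto
  moreover have "(\<Inter>C\<in>rcosets N. {f \<in> topspace LT. f N C \<in> {y. padic_p ^ 1 dvd y - \<mu> N C}}) =
      {f \<in> carrier L. \<forall>C. padic_p dvd f N C - \<mu> N C}" (is "?l = ?r")
  proof
    show "?l \<subseteq> ?r"
    proof
      fix f assume f: "f \<in> ?l"
      then have fL: "f \<in> carrier L" using N_in_rcosets[OF assms(1)] by (auto simp: topspace_LT)
      have "padic_p dvd f N C - \<mu> N C" for C
        using f L_component_0[OF fL assms(1), of C] L_component_0[OF assms(2,1), of C]
        by (cases "C \<in> rcosets N") auto
      then show "f \<in> ?r" using fL by simp
    qed
  qed (auto simp: topspace_LT)
  ultimately show ?thesis by simp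
qed

section \<open>Reduction of the Iwasawa algebra modulo p\<close>

abbreviation sc :: "'p padic \<Rightarrow> 'g set \<Rightarrow> 'g set \<Rightarrow> 'p padic" where "sc \<equiv> iwasawa_scalar G T"
definition red :: "'p padic \<Rightarrow> int" where "red = (\<lambda>c. residue c 1)"
abbreviation TF :: "(('g set \<Rightarrow> 'g set \<Rightarrow> 'p padic) \<times> int \<Rightarrow> int) ring" where "TF \<equiv> tensor_free L (residue_ring (int CARD('p)))"
definition Rels :: "(('g set \<Rightarrow> 'g set \<Rightarrow> 'p padic) \<times> int \<Rightarrow> int) set" where
  "Rels = tensor_rels sc red L (residue_ring (int CARD('p)))"
definition TI :: "(('g set \<Rightarrow> 'g set \<Rightarrow> 'p padic) \<times> int \<Rightarrow> int) set" where "TI = Idl\<^bsub>TF\<^esub> Rels"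
definition Om :: "(('g set \<Rightarrow> 'g set \<Rightarrow> 'p padic) \<times> int \<Rightarrow> int) set ring" where
  "Om = tensor_ring sc red L (residue_ring (int CARD('p)))"
definition toOm :: "('g set \<Rightarrow> 'g set \<Rightarrow> 'p padic) \<Rightarrow> (('g set \<Rightarrow> 'g set \<Rightarrow> 'p padic) \<times> int \<Rightarrow> int) set" where
  "toOm a = pure_tensor sc red L (residue_ring (int CARD('p))) a \<one>\<^bsub>(residue_ring (int CARD('p)))\<^esub>"

lemma Fp_simps [simp]:
  "carrier (residue_ring (int CARD('p))) = {0..<int CARD('p)}" "x \<otimes>\<^bsub>(residue_ring (int CARD('p)))\<^esub> y = (x * y) mod int CARD('p)"
  "x \<oplus>\<^bsub>(residue_ring (int CARD('p)))\<^esub> y = (x + y) mod int CARD('p)" "\<one>\<^bsub>(residue_ring (int CARD('p)))\<^esub> = 1"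
  by (auto simp: residue_ring_def)

lemma Fp_monoid: "Group.monoid (residue_ring (int CARD('p)))"
proof -
  have "residues (int CARD('p))" using CARD_gt_1[where 'p='p] by unfold_locales simp
  then have "cring (residue_ring (int CARD('p)))" by (rule residues.cring)
  then show ?thesis using cring.axioms(1) ring.is_monoid by blast
qed

lemma LB_monoid: "Group.monoid (L \<times>\<times> (residue_ring (int CARD('p))))"
  by (intro DirProd_monoid L.is_monoid Fp_monoid)

lemma LB_simps [simp]: "carrier (L \<times>\<times> (residue_ring (int CARD('p)))) = carrier L \<times> {0..<int CARD('p)}"
  "(a, b) \<otimes>\<^bsub>L \<times>\<times> (residue_ring (int CARD('p)))\<^esub> (a', b') = (a \<otimes>\<^bsub>L\<^esub> a', (b * b') mod int CARD('p))"
  by (auto simp: DirProd_def)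

lemma TF_ring: "ring TF"
  by (rule monoid_ring_is_ring[OF LB_monoid])

lemma sc_mult:
  assumes "f \<in> carrier L" "N \<in> ON"
  shows "(sc c \<otimes>\<^bsub>L\<^esub> f) N C = c * f N C"
proof -
  have "(sc c \<otimes>\<^bsub>L\<^esub> f) N C = mr_eval (single N c \<otimes>\<^bsub>MR N\<^esub> f N) (\<lambda>D. if D = C then 1 else 0)"
    using assms L_fin_supp[OF assms]
    by (subst mr_eval_indicator) (auto simp: L_ops iwasawa_scalar_def fin_supp_mult)
  also have "\<dots> = c * mr_eval (f N) (\<lambda>z. if N <#> z = C then 1 else 0)"
    using L_fin_supp[OF assms] by (simp add: mr_eval_mult)
  also have "mr_eval (f N) (\<lambda>z. if N <#> z = C then 1 else 0) = mr_eval (f N) (\<lambda>z. if z = C then 1 else 0)"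
  proof (rule mr_eval_cong[OF refl])
    fix z assume "f N z \<noteq> 0"
    then have "z \<in> rcosets N" using L_component_0 assms by blast
    then obtain x where "x \<in> carrier G" "z = N #> x" by (rule rcosetsE)
    then show "(if N <#> z = C then 1 else 0) = (if z = C then 1 else (0 :: 'p padic))"
      using transition_rcoset[OF assms(2) assms(2)] by simp
  qed
  also have "\<dots> = f N C" by (rule mr_eval_indicator[OF L_fin_supp[OF assms]])
  finally show ?thesis .
qed

lemma transition_N: "N \<in> ON \<Longrightarrow> M \<in> ON \<Longrightarrow> N \<subseteq> M \<Longrightarrow> M <#> N = M"
  using transition_rcoset[of N M \<one>] N_rcoset by simp

lemma sc_closed: "sc c \<in> carrier L"
  by (rule L_carrierI)
     (auto simp: iwasawa_scalar_def N_in_rcosets pushforward_single transition_N)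

text \<open>The value at level N and coset C of a formal sum of pairs (a, b), where b is lifted from
  the residue field to an integer. Only its class modulo p is invariant under the tensor
  relations.\<close>

definition theta :: "'g set \<Rightarrow> 'g set \<Rightarrow> (('g set \<Rightarrow> 'g set \<Rightarrow> 'p padic) \<times> int \<Rightarrow> int) \<Rightarrow> 'p padic" where
  "theta N C f = mr_eval (\<lambda>x. of_int (f x)) (\<lambda>(a, b). of_int b * a N C)"

lemma TF_fin_supp: "f \<in> carrier TF \<Longrightarrow> fin_supp f"
  and TF_support: "f \<in> carrier TF \<Longrightarrow> f (a, b) \<noteq> 0 \<Longrightarrow> a \<in> carrier L"
  by (auto simp: carrier_monoid_ring)

lemma theta_add:
  "f \<in> carrier TF \<Longrightarrow> g \<in> carrier TF \<Longrightarrow> theta N C (\<lambda>x. f x + g x) = theta N C f + theta N C g"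
  unfolding theta_def of_int_add using TF_fin_supp by (intro mr_eval_add_left) auto

lemma theta_diff:
  "f \<in> carrier TF \<Longrightarrow> g \<in> carrier TF \<Longrightarrow> theta N C (\<lambda>x. f x - g x) = theta N C f - theta N C g"
  unfolding theta_def of_int_diff using TF_fin_supp by (intro mr_eval_diff_left) auto

lemma theta_single: "theta N C (single (a, b) 1) = of_int b * a N C"
proof -
  have "(\<lambda>x. of_int (single (a, b) (1::int) x)) = single (a, b) (1 :: 'p padic)"
    by (auto simp: single_def)
  then show ?thesis unfolding theta_def by (simp only: mr_eval_single) simp
qed

lemma of_int_mod_p: "padic_p dvd (of_int (x mod int CARD('p)) - of_int x :: 'p padic)"
proof -
  have "of_int x = (of_int (int CARD('p) * (x div int CARD('p)) + x mod int CARD('p)) :: 'p padic)"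
    by simp
  also have "\<dots> = padic_p * of_int (x div int CARD('p)) + of_int (x mod int CARD('p))"
    by (simp only: of_int_add of_int_mult of_int_of_nat_eq)
  finally have "of_int (x mod int CARD('p)) - of_int x = (padic_p * (- of_int (x div int CARD('p))) :: 'p padic)"
    by simp
  then show ?thesis by simp
qed

lemma of_int_red: "padic_p dvd (of_int (red c) - c :: 'p padic)"
proof -
  have "residue (of_nat (nat (residue c 1)) :: 'p padic) 1 = residue c 1"
    using residue_range[of c 1] by (simp add: residue_of_nat del: of_nat_nat)
  then have "padic_p ^ 1 dvd of_nat (nat (residue c 1)) - c" by (simp only: residue_eq_iff)
  then show ?thesis using residue_range(1)[of c 1] by (simp add: red_def)
qed

lemma dvd_diffD: "d dvd (y :: 'p padic) \<Longrightarrow> d dvd x - y \<Longrightarrow> d dvd x"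
  using dvd_add[of d "x - y" y] by simp

lemma dvd_mr_eval_right:
  "(\<And>x. f x \<noteq> 0 \<Longrightarrow> d dvd F x) \<Longrightarrow> d dvd mr_eval f F"
  unfolding mr_eval_def by (intro dvd_sum) auto

lemma theta_mult:
  assumes "f \<in> carrier TF" "g \<in> carrier TF"
  shows "theta N C (f \<otimes>\<^bsub>TF\<^esub> g) = mr_eval (\<lambda>x. of_int (f x)) (\<lambda>(a, b). mr_eval (\<lambda>x. of_int (g x))
    (\<lambda>(a', b'). of_int ((b * b') mod int CARD('p)) * (a \<otimes>\<^bsub>L\<^esub> a') N C))"
proof -
  have fs: "fin_supp (\<lambda>x. of_int (f x) :: 'p padic)" "fin_supp (\<lambda>x. of_int (g x) :: 'p padic)"
    using assms TF_fin_supp by auto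
  have "(\<lambda>x. of_int ((f \<otimes>\<^bsub>TF\<^esub> g) x)) =
      (\<lambda>x. of_int (f x)) \<otimes>\<^bsub>monoid_ring (L \<times>\<times> (residue_ring (int CARD('p))))\<^esub> (\<lambda>x. of_int (g x) :: 'p padic)"
    by (intro ext) (simp add: monoid_ring_mult of_int_sum split_def)
  then show ?thesis
    unfolding theta_def by (simp add: mr_eval_mult[OF fs] split_def DirProd_def)
qed

text \<open>Multiplication by a fixed element acts on the coefficients at level N as a finite
  matrix, so it preserves divisibility of all coefficients by p. The same holds on the
  right.\<close>

lemma theta_mult_left:
  assumes "a \<in> carrier L" "g \<in> carrier TF" "N \<in> ON" "\<And>E. padic_p dvd theta N E g"
  shows "padic_p dvd mr_eval (\<lambda>x. of_int (g x)) (\<lambda>(a', b'). of_int b' * (a \<otimes>\<^bsub>L\<^esub> a') N C)"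
proof -
  have "mr_eval (\<lambda>x. of_int (g x)) (\<lambda>(a', b'). of_int b' * (a \<otimes>\<^bsub>L\<^esub> a') N C) =
      mr_eval (\<lambda>x. of_int (g x)) (\<lambda>x. \<Sum>D\<in>rcosets N. a N D *
        (\<Sum>E\<in>rcosets N. (if D <#> E = C then 1 else 0) * (case x of (a', b') \<Rightarrow> of_int b' * a' N E)))"
  proof (rule mr_eval_cong[OF refl])
    fix x assume "of_int (g x) \<noteq> (0 :: 'p padic)"
    moreover obtain a' b' where x: "x = (a', b')" by fastforce
    ultimately have "a' \<in> carrier L" using TF_support[OF assms(2)] by auto
    then show "(case x of (a', b') \<Rightarrow> of_int b' * (a \<otimes>\<^bsub>L\<^esub> a') N C) = (\<Sum>D\<in>rcosets N. a N D *
        (\<Sum>E\<in>rcosets N. (if D <#> E = C then 1 else 0) * (case x of (a', b') \<Rightarrow> of_int b' * a' N E)))"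
      unfolding x using assms(1,3)
      by (simp add: L_mult_apply mr_eval_rcosets[OF assms(3)] L_component_0 sum_distrib_left mult_ac)
  qed
  also have "\<dots> = (\<Sum>D\<in>rcosets N. a N D * (\<Sum>E\<in>rcosets N. (if D <#> E = C then 1 else 0) * theta N E g))"
    by (simp only: mr_eval_sum_right mr_eval_mult_right theta_def)
  also have "padic_p dvd \<dots>"
    by (intro dvd_sum dvd_mult assms(4))
  finally show ?thesis .
qed

lemma theta_mult_right:
  assumes "a \<in> carrier L" "g \<in> carrier TF" "N \<in> ON" "\<And>E. padic_p dvd theta N E g"
  shows "padic_p dvd mr_eval (\<lambda>x. of_int (g x)) (\<lambda>(a', b'). of_int b' * (a' \<otimes>\<^bsub>L\<^esub> a) N C)"
proof -
  have "mr_eval (\<lambda>x. of_int (g x)) (\<lambda>(a', b'). of_int b' * (a' \<otimes>\<^bsub>L\<^esub> a) N C) =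
      mr_eval (\<lambda>x. of_int (g x)) (\<lambda>x. \<Sum>D\<in>rcosets N.
        (\<Sum>E\<in>rcosets N. a N E * (if D <#> E = C then 1 else 0)) * (case x of (a', b') \<Rightarrow> of_int b' * a' N D))"
  proof (rule mr_eval_cong[OF refl])
    fix x assume "of_int (g x) \<noteq> (0 :: 'p padic)"
    moreover obtain a' b' where x: "x = (a', b')" by fastforce
    ultimately have "a' \<in> carrier L" using TF_support[OF assms(2)] by auto
    then show "(case x of (a', b') \<Rightarrow> of_int b' * (a' \<otimes>\<^bsub>L\<^esub> a) N C) = (\<Sum>D\<in>rcosets N.
        (\<Sum>E\<in>rcosets N. a N E * (if D <#> E = C then 1 else 0)) * (case x of (a', b') \<Rightarrow> of_int b' * a' N D))"
      unfolding x using assms(1,3)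
      by (simp add: L_mult_apply mr_eval_rcosets[OF assms(3)] L_component_0 sum_distrib_left mult_ac)
  qed
  also have "\<dots> = (\<Sum>D\<in>rcosets N. (\<Sum>E\<in>rcosets N. a N E * (if D <#> E = C then 1 else 0)) * theta N D g)"
    by (simp only: mr_eval_sum_right mr_eval_mult_right theta_def)
  also have "padic_p dvd \<dots>"
    by (intro dvd_sum dvd_mult assms(4))
  finally show ?thesis .
qed

text \<open>An upper bound for the ideal \<open>TI\<close> of tensor relations: vanishing modulo p
  of all coefficients is an ideal condition which every relation satisfies.\<close>

definition TK :: "(('g set \<Rightarrow> 'g set \<Rightarrow> 'p padic) \<times> int \<Rightarrow> int) set" where
  "TK = {f \<in> carrier TF. \<forall>N\<in>ON. \<forall>C. padic_p dvd theta N C f}"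

lemma TK_ideal: "ideal TK TF"
proof -
  interpret TF: ring TF by (rule TF_ring)
  have neg: "\<ominus>\<^bsub>TF\<^esub> f = (\<lambda>x. 0 - f x)" if "f \<in> carrier TF" for f
    using monoid_ring_minus[OF LB_monoid TF.zero_closed that] TF.minus_eq[of "\<zero>\<^bsub>TF\<^esub>" f] that by simp
  \<comment> \<open>The second component of a product is reduced modulo p, so the pairing respects
    products only up to multiples of p.\<close>
  have prod_mod: "padic_p dvd mr_eval h (\<lambda>(a', b'). of_int ((b * b') mod int CARD('p)) * F a')
      - of_int b * mr_eval h (\<lambda>(a', b'). of_int b' * F a')" for h :: "_ \<Rightarrow> 'p padic" and b F
  proof -
    have "mr_eval h (\<lambda>(a', b'). of_int ((b * b') mod int CARD('p)) * F a')
        - of_int b * mr_eval h (\<lambda>(a', b'). of_int b' * F a') =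
      mr_eval h (\<lambda>x. (of_int ((b * snd x) mod int CARD('p)) - of_int (b * snd x)) * F (fst x))"
      by (simp add: mr_eval_mult_right[symmetric] mr_eval_diff_right[symmetric] split_def algebra_simps)
    also have "padic_p dvd \<dots>" by (intro dvd_mr_eval_right dvd_mult2 of_int_mod_p)
    finally show ?thesis .
  qed
  show ?thesis
  proof (rule idealI[OF TF_ring])
    show "subgroup TK (add_monoid TF)"
    proof
      show "TK \<subseteq> carrier (add_monoid TF)" by (auto simp: TK_def)
      show "f \<otimes>\<^bsub>add_monoid TF\<^esub> g \<in> TK" if "f \<in> TK" "g \<in> TK" for f g
        using that TF.a_closed[of f g] by (simp add: TK_def theta_add)
      show "\<one>\<^bsub>add_monoid TF\<^esub> \<in> TK"
        using TF.zero_closed by (simp add: TK_def theta_def)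
      show "inv\<^bsub>add_monoid TF\<^esub> f \<in> TK" if "f \<in> TK" for f
      proof -
        have f: "f \<in> carrier TF" "(\<lambda>_. 0) \<in> carrier TF" using that TF.zero_closed by (auto simp: TK_def)
        have "(\<lambda>x. 0 - f x) \<in> TK"
          using that theta_diff[OF f(2,1)] TF.a_inv_closed[OF f(1)] neg[OF f(1)]
          by (simp add: TK_def theta_def)
        then show ?thesis using neg[OF f(1)] by (simp add: a_inv_def)
      qed
    qed
    fix g f assume g: "g \<in> TK" and f: "f \<in> carrier TF"
    then have gT: "g \<in> carrier TF" and gd: "\<And>N C. N \<in> ON \<Longrightarrow> padic_p dvd theta N C g" by (auto simp: TK_def)
    have "padic_p dvd theta N C (f \<otimes>\<^bsub>TF\<^esub> g)" if N: "N \<in> ON" for N C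
      unfolding theta_mult[OF f gT]
    proof (rule dvd_mr_eval_right)
      fix x assume x0: "of_int (f x) \<noteq> (0 :: 'p padic)"
      obtain a b where x: "x = (a, b)" by fastforce
      have a: "a \<in> carrier L" using TF_support[OF f] x0 x by auto
      have "padic_p dvd of_int b * mr_eval (\<lambda>x. of_int (g x)) (\<lambda>(a', b'). of_int b' * (a \<otimes>\<^bsub>L\<^esub> a') N C)"
        by (intro dvd_mult theta_mult_left a gT N gd)
      then show "padic_p dvd (case x of (a, b) \<Rightarrow> mr_eval (\<lambda>x. of_int (g x))
          (\<lambda>(a', b'). of_int ((b * b') mod int CARD('p)) * (a \<otimes>\<^bsub>L\<^esub> a') N C))"
        unfolding x prod.case
        using prod_mod[of "\<lambda>x. of_int (g x)" b "\<lambda>a'. (a \<otimes>\<^bsub>L\<^esub> a') N C"]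
        by (rule dvd_diffD)
    qed
    then show "f \<otimes>\<^bsub>TF\<^esub> g \<in> TK" using TF.m_closed[OF f gT] by (simp add: TK_def)
    have "padic_p dvd theta N C (g \<otimes>\<^bsub>TF\<^esub> f)" if N: "N \<in> ON" for N C
    proof -
      have "theta N C (g \<otimes>\<^bsub>TF\<^esub> f) = mr_eval (\<lambda>x. of_int (f x)) (\<lambda>(a', b'). mr_eval (\<lambda>x. of_int (g x))
          (\<lambda>(a, b). of_int ((b * b') mod int CARD('p)) * (a \<otimes>\<^bsub>L\<^esub> a') N C))"
        unfolding theta_mult[OF gT f] mr_eval_def split_def
        by (simp add: sum_distrib_left sum.swap[of _ "{x. g x \<noteq> 0}"] mult.left_commute)
      also have "padic_p dvd \<dots>"
      proof (rule dvd_mr_eval_right)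
        fix x assume x0: "of_int (f x) \<noteq> (0 :: 'p padic)"
        obtain a b where x: "x = (a, b)" by fastforce
        have a: "a \<in> carrier L" using TF_support[OF f] x0 x by auto
        have "padic_p dvd of_int b * mr_eval (\<lambda>x. of_int (g x)) (\<lambda>(a', b'). of_int b' * (a' \<otimes>\<^bsub>L\<^esub> a) N C)"
          by (intro dvd_mult theta_mult_right a gT N gd)
        then show "padic_p dvd (case x of (a', b') \<Rightarrow> mr_eval (\<lambda>x. of_int (g x))
            (\<lambda>(a, b). of_int ((b * b') mod int CARD('p)) * (a \<otimes>\<^bsub>L\<^esub> a') N C))"
          unfolding x prod.case
          using prod_mod[of "\<lambda>x. of_int (g x)" b "\<lambda>a'. (a' \<otimes>\<^bsub>L\<^esub> a) N C", unfolded mult.commute[of b]]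
          by (rule dvd_diffD)
      qed
      finally show ?thesis .
    qed
    then show "g \<otimes>\<^bsub>TF\<^esub> f \<in> TK" using TF.m_closed[OF gT f] by (simp add: TK_def)
  qed
qed

lemma single_TF: "a \<in> carrier L \<Longrightarrow> b \<in> {0..<int CARD('p)} \<Longrightarrow> single (a, b) c \<in> carrier TF"
  by simp

lemma Fp_mod_range: "x mod int CARD('p) \<in> {0..<int CARD('p)}"
  using CARD_gt_1[where 'p='p] by simp

lemma Rels_TK: "Rels \<subseteq> TK"
proof
  interpret TF: ring TF by (rule TF_ring)
  fix x assume "x \<in> Rels"
  then show "x \<in> TK" unfolding Rels_def
  proof cases
    case (add_left a a' b)
    then have c: "single (a \<oplus>\<^bsub>L\<^esub> a', b) 1 \<in> carrier TF" "single (a, b) 1 \<in> carrier TF" "single (a', b) 1 \<in> carrier TF"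
      by auto
    then have c2: "(\<lambda>x. single (a, b) 1 x + single (a', b) 1 x) \<in> carrier TF"
      using TF.a_closed[OF c(2,3)] by simp
    have "theta N C x = 0" if "N \<in> ON" for N C
      using that unfolding add_left(1) monoid_ring_simps monoid_ring_minus[OF LB_monoid c(1) c2]
        theta_diff[OF c(1) c2] theta_add[OF c(2,3)] theta_single by (simp add: L_ops algebra_simps)
    then show ?thesis
      using TF.minus_closed[OF c(1) c2] unfolding add_left(1) TK_def by simp
  next
    case (add_right a b b')
    then have c: "single (a, b \<oplus>\<^bsub>(residue_ring (int CARD('p)))\<^esub> b') 1 \<in> carrier TF" "single (a, b) 1 \<in> carrier TF" "single (a, b') 1 \<in> carrier TF"
      using Fp_mod_range by auto
    then have c2: "(\<lambda>x. single (a, b) 1 x + single (a, b') 1 x) \<in> carrier TF"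
      using TF.a_closed[OF c(2,3)] by simp
    have "padic_p dvd theta N C x" for N C
    proof -
      have "theta N C x = (of_int ((b + b') mod int CARD('p)) - of_int (b + b')) * a N C"
        unfolding add_right(1) monoid_ring_simps monoid_ring_minus[OF LB_monoid c(1) c2]
          theta_diff[OF c(1) c2] theta_add[OF c(2,3)] theta_single by (simp add: algebra_simps)
      then show ?thesis using of_int_mod_p dvd_mult2 by metis
    qed
    then show ?thesis
      using TF.minus_closed[OF c(1) c2] unfolding add_right(1) TK_def by simp
  next
    case (balanced a b r)
    then have c: "single (sc r \<otimes>\<^bsub>L\<^esub> a, b) 1 \<in> carrier TF" "single (a, red r \<otimes>\<^bsub>(residue_ring (int CARD('p)))\<^esub> b) 1 \<in> carrier TF"
      using sc_closed Fp_mod_range by (auto intro: L.m_closed)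
    have "padic_p dvd theta N C x" if "N \<in> ON" for N C
    proof -
      have "theta N C x = of_int b * (r * a N C) - of_int ((red r * b) mod int CARD('p)) * a N C"
        unfolding balanced(1) monoid_ring_minus[OF LB_monoid c]
          theta_diff[OF c] theta_single sc_mult[OF balanced(2) that] by simp
      also have "\<dots> = - ((of_int ((red r * b) mod int CARD('p)) - of_int (red r * b)) * a N C)
          - (of_int (red r) - r) * (of_int b * a N C)"
        by (simp add: algebra_simps)
      also have "padic_p dvd \<dots>"
        by (intro dvd_diff dvd_minus_iff[THEN iffD2] dvd_mult2[OF of_int_mod_p] dvd_mult2[OF of_int_red])
      finally show ?thesis .
    qed
    then show ?thesis
      using TF.minus_closed[OF c] unfolding balanced(1) TK_def by simp
  qed
qed

lemma Rels_carrier: "Rels \<subseteq> carrier TF"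
  using Rels_TK by (auto simp: TK_def)

lemma TI_ideal: "ideal TI TF"
  unfolding TI_def by (rule ring.genideal_ideal[OF TF_ring Rels_carrier])

lemma Rels_TI: "Rels \<subseteq> TI"
  unfolding TI_def by (rule ring.genideal_self[OF TF_ring Rels_carrier])

lemma TI_TK: "TI \<subseteq> TK"
  unfolding TI_def by (rule ring.genideal_minimal[OF TF_ring TK_ideal Rels_TK])

lemma Om_eq: "Om = TF Quot TI"
  by (simp add: Om_def tensor_ring_def TI_def Rels_def)

lemma Om_ring: "ring Om"
  unfolding Om_eq by (rule ideal.quotient_is_ring[OF TI_ideal])

lemma Om_proj_hom: "(\<lambda>f. TI +>\<^bsub>TF\<^esub> f) \<in> Ring.ring_hom TF Om"
  unfolding Om_eq by (rule ideal.rcos_ring_hom[OF TI_ideal])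

lemma Om_proj_eq_iff:
  assumes "f \<in> carrier TF" "g \<in> carrier TF"
  shows "TI +>\<^bsub>TF\<^esub> f = TI +>\<^bsub>TF\<^esub> g \<longleftrightarrow> f \<ominus>\<^bsub>TF\<^esub> g \<in> TI"
  using ring.quotient_eq_iff_same_a_r_cos[OF TF_ring TI_ideal assms] by simp

lemma toOm_eq: "toOm a = TI +>\<^bsub>TF\<^esub> single (a, 1) 1"
  by (simp add: toOm_def pure_tensor_def TI_def Rels_def)

lemma one_range: "1 \<in> {0..<int CARD('p)}"
  using CARD_gt_1[where 'p='p] by simp

lemma toOm_hom: "toOm \<in> Ring.ring_hom L Om"
proof (rule ring_hom_memI)
  note h = Om_proj_hom
  fix a b assume ab: "a \<in> carrier L" "b \<in> carrier L"
  note s = single_TF[OF _ one_range, where c=1]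
  show "toOm a \<in> carrier Om" unfolding toOm_eq using ring_hom_closed[OF h s[OF ab(1)]] .
  have "single (a \<otimes>\<^bsub>L\<^esub> b, 1) 1 = single (a, 1) 1 \<otimes>\<^bsub>TF\<^esub> single (b, 1) 1"
    using CARD_gt_1[where 'p='p] by (simp add: single_mult_single)
  then show "toOm (a \<otimes>\<^bsub>L\<^esub> b) = toOm a \<otimes>\<^bsub>Om\<^esub> toOm b"
    unfolding toOm_eq using ring_hom_mult[OF h s[OF ab(1)] s[OF ab(2)]] by simp
  have "single (a \<oplus>\<^bsub>L\<^esub> b, 1) 1 \<ominus>\<^bsub>TF\<^esub> (single (a, 1) 1 \<oplus>\<^bsub>TF\<^esub> single (b, 1) 1) \<in> TI"
    using tensor_rels.add_left[OF ab, of 1 "residue_ring (int CARD('p))" sc red] Rels_TI one_range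
    unfolding Rels_def by auto
  then have "TI +>\<^bsub>TF\<^esub> single (a \<oplus>\<^bsub>L\<^esub> b, 1) 1 = TI +>\<^bsub>TF\<^esub> (single (a, 1) 1 \<oplus>\<^bsub>TF\<^esub> single (b, 1) 1)"
    using ab s ring.ring_simprules(1)[OF TF_ring] by (subst Om_proj_eq_iff) auto
  then show "toOm (a \<oplus>\<^bsub>L\<^esub> b) = toOm a \<oplus>\<^bsub>Om\<^esub> toOm b"
    unfolding toOm_eq using ring_hom_add[OF h s[OF ab(1)] s[OF ab(2)]] by simp
next
  have "\<one>\<^bsub>TF\<^esub> = single (\<one>\<^bsub>L\<^esub>, 1) 1" by (simp add: DirProd_def)
  then show "toOm \<one>\<^bsub>L\<^esub> = \<one>\<^bsub>Om\<^esub>" unfolding toOm_eq using ring_hom_one[OF Om_proj_hom] by simp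
qed

text \<open>From left to right this is the inclusion of \<open>TI\<close> in \<open>TK\<close>.
  Conversely, a - a' = p b for some b in the inverse limit, and p b tensor 1 equals b tensor 0 by
  balancing, which is 0.\<close>

lemma toOm_eq_iff:
  assumes "a \<in> carrier L" "a' \<in> carrier L"
  shows "toOm a = toOm a' \<longleftrightarrow> (\<forall>N\<in>ON. \<forall>C. padic_p dvd a N C - a' N C)"
proof
  interpret Om: ring Om by (rule Om_ring)
  note s = single_TF[OF _ one_range, where c=1]
  {
    assume "toOm a = toOm a'"
    then have "single (a, 1) 1 \<ominus>\<^bsub>TF\<^esub> single (a', 1) 1 \<in> TK"
      unfolding toOm_eq using TI_TK s assms by (subst (asm) Om_proj_eq_iff) auto
    then show "\<forall>N\<in>ON. \<forall>C. padic_p dvd a N C - a' N C"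
      unfolding monoid_ring_minus[OF LB_monoid s[OF assms(1)] s[OF assms(2)]]
      by (simp add: TK_def theta_diff s assms theta_single)
  }
  assume d: "\<forall>N\<in>ON. \<forall>C. padic_p dvd a N C - a' N C"
  \<comment> \<open>The quotient by p is taken coefficient by coefficient; since p is not a zero
    divisor, compatibility between levels survives.\<close>
  define b where "b = (\<lambda>N\<in>ON. \<lambda>C. (a N C - a' N C) div padic_p)"
  have b: "padic_p * b N C = a N C - a' N C" if N: "N \<in> ON" for N C
  proof -
    obtain z where z: "a N C - a' N C = padic_p * z" using d N by blast
    then show ?thesis unfolding b_def using N p_nonzero[where 'p='p] by simp
  qed
  have "b \<in> carrier L"
    unfolding L_carrier_iff
  proof (intro conjI ballI allI impI)
    show "b \<in> extensional ON" by (simp add: b_def)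
    show "b N C = 0" if "N \<in> ON" "C \<notin> rcosets N" for N C
      using that b[of N C] L_component_0[OF assms(1) that] L_component_0[OF assms(2) that] p_nonzero[where 'p='p]
      by simp
    fix N M D assume NM: "N \<in> ON" "M \<in> ON" "N \<subseteq> M"
    have e: "f M D = (\<Sum>C\<in>rcosets N. f N C * (if M <#> C = D then 1 else 0))" if "f \<in> carrier L" for f
      using that NM unfolding L_carrier_iff by blast
    have "padic_p * b M D = (\<Sum>C\<in>rcosets N. (a N C - a' N C) * (if M <#> C = D then 1 else 0))"
      unfolding b[OF NM(2)] e[OF assms(1)] e[OF assms(2)] by (simp only: sum_subtractf left_diff_distrib)
    also have "\<dots> = padic_p * (\<Sum>C\<in>rcosets N. b N C * (if M <#> C = D then 1 else 0))"
      by (simp only: b[OF NM(1), symmetric] sum_distrib_left mult.assoc)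
    finally show "b M D = (\<Sum>C\<in>rcosets N. b N C * (if M <#> C = D then 1 else 0))"
      using p_nonzero[where 'p='p] by (simp only: mult_cancel_left) simp
  qed
  then have bL: "b \<in> carrier L" and sbL: "sc padic_p \<otimes>\<^bsub>L\<^esub> b \<in> carrier L" using sc_closed by auto
  have a: "a = a' \<oplus>\<^bsub>L\<^esub> (sc padic_p \<otimes>\<^bsub>L\<^esub> b)"
  proof (rule L_eqI)
    fix N assume N: "N \<in> ON"
    show "a N = (a' \<oplus>\<^bsub>L\<^esub> (sc padic_p \<otimes>\<^bsub>L\<^esub> b)) N"
      using N b[OF N] by (auto simp: L_ops(4) sc_mult[OF bL N])
  qed (use assms sbL in auto)
  have r0: "red padic_p = 0" using residue_of_nat[of "CARD('p)" 1, where 'p='p] by (simp add: red_def)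
  have z: "0 \<in> {0..<int CARD('p)}" using CARD_gt_1[where 'p='p] by simp
  have "single (sc padic_p \<otimes>\<^bsub>L\<^esub> b, 1) 1 \<ominus>\<^bsub>TF\<^esub> single (b, red padic_p \<otimes>\<^bsub>(residue_ring (int CARD('p)))\<^esub> 1) 1 \<in> TI"
    using tensor_rels.balanced[OF bL, of 1 "residue_ring (int CARD('p))" sc padic_p red] Rels_TI one_range
    unfolding Rels_def by auto
  then have 1: "toOm (sc padic_p \<otimes>\<^bsub>L\<^esub> b) = TI +>\<^bsub>TF\<^esub> single (b, 0) 1"
    unfolding toOm_eq using sbL s bL z by (subst Om_proj_eq_iff) (auto simp: r0)
  \<comment> \<open>Additivity in the second argument shows that b tensor 0 equals its own double,
    hence is 0.\<close>
  have "single (b, 0 \<oplus>\<^bsub>(residue_ring (int CARD('p)))\<^esub> 0) 1 \<ominus>\<^bsub>TF\<^esub> (single (b, 0) 1 \<oplus>\<^bsub>TF\<^esub> single (b, 0) 1) \<in> TI"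
    using tensor_rels.add_right[OF bL, of 0 "residue_ring (int CARD('p))" 0 sc red] Rels_TI z
    unfolding Rels_def by auto
  moreover have "0 \<oplus>\<^bsub>residue_ring (int CARD('p))\<^esub> 0 = 0" by simp
  ultimately have "single (b, 0) 1 \<ominus>\<^bsub>TF\<^esub> (single (b, 0) 1 \<oplus>\<^bsub>TF\<^esub> single (b, 0) 1) \<in> TI" by (simp only:)
  then have 2: "TI +>\<^bsub>TF\<^esub> single (b, 0) 1 = TI +>\<^bsub>TF\<^esub> (single (b, 0) 1 \<oplus>\<^bsub>TF\<^esub> single (b, 0) 1)"
    by (simp only: Om_proj_eq_iff[OF single_TF[OF bL z]
          ring.ring_simprules(1)[OF TF_ring single_TF[OF bL z] single_TF[OF bL z]]])
  let ?z = "TI +>\<^bsub>TF\<^esub> single (b, 0) 1"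
  have zc: "?z \<in> carrier Om" using ring_hom_closed[OF Om_proj_hom single_TF[OF bL z]] .
  have "?z = ?z \<oplus>\<^bsub>Om\<^esub> ?z"
    by (rule trans[OF 2 ring_hom_add[OF Om_proj_hom single_TF[OF bL z] single_TF[OF bL z]]])
  then have "?z = \<zero>\<^bsub>Om\<^esub>" using Om.add.l_cancel_one'[OF zc zc] by simp
  then show "toOm a = toOm a'"
    using ring_hom_add[OF toOm_hom assms(2) sbL] ring_hom_closed[OF toOm_hom assms(2)] 1
    by (subst a) simp
qed

text \<open>Balancing with a natural number that reduces to b turns the pure tensor of a and b into
  one with second factor 1. Formal sums follow since the image is an additive group.\<close>

lemma toOm_surj: "carrier Om = toOm ` carrier L"
proof
  show "toOm ` carrier L \<subseteq> carrier Om" using ring_hom_closed[OF toOm_hom] by blast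
  interpret TF: ring TF by (rule TF_ring)
  interpret Om: ring Om by (rule Om_ring)
  interpret h: ring_hom_ring L Om toOm
    by (intro ring_hom_ringI2 L_ring Om_ring toOm_hom)
  interpret pr: ring_hom_ring TF Om "\<lambda>f. TI +>\<^bsub>TF\<^esub> f"
    by (intro ring_hom_ringI2 TF_ring Om_ring Om_proj_hom)
  define S where "S = {f \<in> carrier TF. TI +>\<^bsub>TF\<^esub> f \<in> toOm ` carrier L}"
  have S_add: "f \<oplus>\<^bsub>TF\<^esub> g \<in> S" if fg: "f \<in> S" "g \<in> S" for f g
  proof -
    obtain a b where "a \<in> carrier L" "b \<in> carrier L" "TI +>\<^bsub>TF\<^esub> f = toOm a" "TI +>\<^bsub>TF\<^esub> g = toOm b"
      using fg by (auto simp: S_def)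
    moreover have "f \<in> carrier TF" "g \<in> carrier TF" using fg by (auto simp: S_def)
    ultimately have "TI +>\<^bsub>TF\<^esub> (f \<oplus>\<^bsub>TF\<^esub> g) = toOm (a \<oplus>\<^bsub>L\<^esub> b)" "a \<oplus>\<^bsub>L\<^esub> b \<in> carrier L" "f \<oplus>\<^bsub>TF\<^esub> g \<in> carrier TF"
      using pr.hom_add[of f g] h.hom_add[of a b] L.a_closed[of a b] TF.a_closed[of f g] by simp_all
    then show ?thesis unfolding S_def by blast
  qed
  have S_neg: "\<ominus>\<^bsub>TF\<^esub> f \<in> S" if f: "f \<in> S" for f
  proof -
    obtain a where "a \<in> carrier L" "TI +>\<^bsub>TF\<^esub> f = toOm a" using f by (auto simp: S_def)
    moreover have "f \<in> carrier TF" using f by (auto simp: S_def)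
    ultimately have "TI +>\<^bsub>TF\<^esub> (\<ominus>\<^bsub>TF\<^esub> f) = toOm (\<ominus>\<^bsub>L\<^esub> a)" "\<ominus>\<^bsub>L\<^esub> a \<in> carrier L" "\<ominus>\<^bsub>TF\<^esub> f \<in> carrier TF"
      using pr.hom_a_inv[of f] h.hom_a_inv[of a] L.a_inv_closed[of a] TF.a_inv_closed[of f] by simp_all
    then show ?thesis unfolding S_def by blast
  qed
  have S0: "(\<lambda>_. 0) \<in> S"
    using pr.hom_zero imageI[OF L.zero_closed, of toOm] h.hom_zero TF.zero_closed unfolding S_def by simp
  have S1: "single x 1 \<in> S" if x0: "x \<in> carrier (L \<times>\<times> (residue_ring (int CARD('p))))" for x
  proof -
    obtain a b where x: "x = (a, b)" and a: "a \<in> carrier L" and b: "b \<in> {0..<int CARD('p)}"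
      using x0 by auto
    have rb: "red (of_nat (nat b)) = b"
      using b residue_of_nat[of "nat b" 1, where 'p='p] by (simp add: red_def del: of_nat_nat)
    have c: "sc (of_nat (nat b)) \<otimes>\<^bsub>L\<^esub> a \<in> carrier L" using sc_closed a by auto
    have "single (sc (of_nat (nat b)) \<otimes>\<^bsub>L\<^esub> a, 1) 1 \<ominus>\<^bsub>TF\<^esub> single (a, red (of_nat (nat b)) \<otimes>\<^bsub>(residue_ring (int CARD('p)))\<^esub> 1) 1 \<in> TI"
      using tensor_rels.balanced[OF a, of 1 "residue_ring (int CARD('p))" sc "of_nat (nat b)" red] Rels_TI one_range
      unfolding Rels_def by auto
    then have "toOm (sc (of_nat (nat b)) \<otimes>\<^bsub>L\<^esub> a) = TI +>\<^bsub>TF\<^esub> single (a, b) 1"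
      unfolding toOm_eq rb using b a c single_TF[OF _ one_range] by (subst Om_proj_eq_iff) auto
    then show ?thesis unfolding S_def x using c a b single_TF[OF a b] by auto
  qed
  have Sn: "single x (int k) \<in> S" if "x \<in> carrier (L \<times>\<times> (residue_ring (int CARD('p))))" for x k
  proof (induction k)
    case 0
    have "single x (int 0) = (\<lambda>_. 0)" by (auto simp: single_def)
    then show ?case using S0 by simp
  next
    case (Suc k)
    have "single x (int (Suc k)) = single x (int k) \<oplus>\<^bsub>TF\<^esub> single x 1" by (auto simp: single_def)
    then show ?case using S_add[OF Suc S1[OF that]] by simp
  qed
  have Sz: "single x c \<in> S" if x: "x \<in> carrier (L \<times>\<times> (residue_ring (int CARD('p))))" for x c
  proof (cases "c \<ge> 0")
    case True
    then show ?thesis using Sn[OF x, of "nat c"] by simp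
  next
    case False
    have "\<ominus>\<^bsub>TF\<^esub> single x (int (nat (- c))) = (\<lambda>_. 0) \<ominus>\<^bsub>TF\<^esub> single x (int (nat (- c)))"
      using TF.minus_eq[of "\<zero>\<^bsub>TF\<^esub>" "single x (int (nat (- c)))"] single_in_carrier[OF x] by simp
    also have "\<dots> = single x c"
      using False TF.zero_closed single_in_carrier[OF x]
      by (subst monoid_ring_minus[OF LB_monoid]) (auto simp: single_def)
    finally show ?thesis using S_neg[OF Sn[OF x, of "nat (- c)"]] by simp
  qed
  have "f \<in> S" if "f \<in> carrier TF" for f
  proof -
    have "(\<lambda>x. if x \<in> B then f x else 0) \<in> S" if "finite B" "B \<subseteq> carrier (L \<times>\<times> (residue_ring (int CARD('p))))" for B
      using that
    proof (induction B rule: finite_induct)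
      case empty
      then show ?case using S0 by simp
    next
      case (insert x B)
      have "(\<lambda>y. if y \<in> insert x B then f y else 0) =
          single x (f x) \<oplus>\<^bsub>TF\<^esub> (\<lambda>y. if y \<in> B then f y else 0)"
        using insert.hyps by (auto simp: single_def)
      then show ?case using S_add[OF Sz[of x "f x"] insert.IH] insert.prems by simp
    qed
    from this[of "{x. f x \<noteq> 0}"] have "(\<lambda>x. if x \<in> {x. f x \<noteq> 0} then f x else 0) \<in> S"
      using \<open>f \<in> carrier TF\<close> unfolding carrier_monoid_ring by blast
    moreover have "(\<lambda>x. if x \<in> {x. f x \<noteq> 0} then f x else 0) = f" by auto
    ultimately show ?thesis by simp
  qed
  then show "carrier Om \<subseteq> toOm ` carrier L"
    unfolding Om_eq FactRing_def A_RCOSETS_def' S_def by auto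
qed

end

section \<open>Continuity of the evaluation map\<close>

context iwasawa_gens
begin

lemma phi_component_continuous:
  assumes "N \<in> ON" shows "continuous_map (nc_topology X) euclidean (\<lambda>f. phi f N C)"
  unfolding continuous_map_def
proof (intro conjI allI impI)
  fix S :: "'p padic set" assume "openin euclidean S"
  then have S: "open S" by simp
  show "openin (nc_topology X) {f \<in> topspace (nc_topology X). phi f N C \<in> S}"
    unfolding nc_open_iff[OF finite_X] nc_topspace
  proof (intro conjI ballI)
    fix f assume "f \<in> {f \<in> carrier A. phi f N C \<in> S}"
    then obtain k where k: "\<And>y. padic_p ^ k dvd y - phi f N C \<Longrightarrow> y \<in> S"
      using S unfolding open_padic_def residue_eq_iff by blast
    obtain M where M: "\<forall>w\<in>lists X. M \<le> length w \<longrightarrow> (\<forall>C. padic_p ^ k dvd lw w N C)"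
      using lw_small[OF assms, of k] by (elim exE)
    have ap: "padic_p ^ k dvd phi h N C - Phi (max k M) h N C" for h
      by (rule phi_approx[OF assms]) (use M in auto)
    show "\<exists>m. \<forall>f'\<in>carrier A. (\<forall>w\<in>lists X. length w < m \<longrightarrow> padic_p ^ m dvd f' w - f w) \<longrightarrow>
        f' \<in> {f \<in> carrier A. phi f N C \<in> S}"
    \<comment> \<open>One number must serve as length bound and as precision: M controls the
      discarded words, k the coefficients of the remaining ones.\<close>
    proof (intro exI[of _ "max k M"] ballI impI)
      fix f' assume f': "f' \<in> carrier A"
        and *: "\<forall>w\<in>lists X. length w < max k M \<longrightarrow> padic_p ^ max k M dvd f' w - f w"
      have "padic_p ^ k dvd Phi (max k M) f' N C - Phi (max k M) f N C"
        unfolding Phi_apply[OF assms]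
      proof (intro dvd_diff_sum dvd_diff_mult)
        fix w assume "w \<in> words (max k M)"
        then have "padic_p ^ max k M dvd f' w - f w" using * by (auto simp: words_def)
        then show "padic_p ^ k dvd f' w - f w"
          using le_imp_power_dvd[of k "max k M"] dvd_trans max.cobounded1 by blast
      qed simp
      then have "padic_p ^ k dvd phi f' N C - phi f N C"
        using dvd_diff_trans[OF dvd_diff_trans[OF ap[of f']]] ap[of f] dvd_diff_sym by blast
      then show "f' \<in> {f \<in> carrier A. phi f N C \<in> S}" using f' k by simp
    qed
  qed auto
qed auto

lemma phi_continuous: "continuous_map (nc_topology X) LT phi"
proof -
  have "continuous_map (nc_topology X) (top_of_set (carrier (MR N))) (\<lambda>f. phi f N)" if N: "N \<in> ON" for N
  proof -
    have "continuous_map (nc_topology X) (product_topology (\<lambda>_. euclidean) UNIV) (\<lambda>f. phi f N)"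
      unfolding continuous_map_componentwise using phi_component_continuous[OF N] by simp
    then have "continuous_map (nc_topology X) euclidean (\<lambda>f. phi f N)"
      by (simp add: euclidean_product_topology)
    then show ?thesis
      unfolding continuous_map_in_subtopology using L_component[OF phi_closed N] by auto
  qed
  then show ?thesis
    unfolding iwasawa_topology_def continuous_map_in_subtopology continuous_map_componentwise
    using L_extensional[OF phi_closed] phi_closed by auto
qed

end

section \<open>Ordered monomials span modulo commutation relations\<close>

definition nmono :: "'v list \<Rightarrow> ('v, 'a::comm_ring_1) ncs" where
  "nmono u = Ncs (\<lambda>w. if w = u then 1 else 0)"

definition const :: "'a \<Rightarrow> ('v, 'a::comm_ring_1) ncs" where
  "const c = Ncs (\<lambda>w. if w = [] then c else 0)"

lemma cf_mono: "cf (nmono u) w = (if w = u then 1 else 0)"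
  unfolding nmono_def by (subst Ncs_inverse) auto

lemma cf_const_mult: "cf (const c * f) w = c * cf f w"
proof -
  have "cf (const c * f) w = (\<Sum>k\<le>length w. if k = 0 then c * cf f w else 0)"
    unfolding times_ncs.rep_eq const_def by (subst Ncs_inverse, simp, rule sum.cong) auto
  then show ?thesis by simp
qed

lemma cf_mult_const: "cf (f * const c) w = c * cf f w"
proof -
  have "cf (f * const c) w = (\<Sum>k\<le>length w. if k = length w then c * cf f w else 0)"
    unfolding times_ncs.rep_eq const_def by (subst Ncs_inverse, simp, rule sum.cong) auto
  then show ?thesis by simp
qed

lemma const_commute: "const c * f = f * const c"
  by (rule ncs_eqI) (simp add: cf_const_mult cf_mult_const)

lemma mono_append: "nmono (u @ v) = (nmono u * nmono v :: ('v, 'b::comm_ring_1) ncs)"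
proof (rule ncs_eqI)
  fix w
  have "cf (nmono u * nmono v :: ('v, 'b) ncs) w = (\<Sum>k\<le>length w. if k = length u then (if w = u @ v then 1 else 0) else 0)"
    unfolding times_ncs.rep_eq cf_mono
  proof (rule sum.cong[OF refl])
    fix k assume "k \<in> {..length w}"
    then have k: "length (take k w) = k" by simp
    have "(take k w = u \<and> drop k w = v) \<longleftrightarrow> (k = length u \<and> w = u @ v)"
    proof
      assume "take k w = u \<and> drop k w = v"
      then show "k = length u \<and> w = u @ v" using append_take_drop_id[of k w] k by simp
    qed simp
    moreover have "(if take k w = u then 1 else 0) * (if drop k w = v then 1 else 0) =
        (if take k w = u \<and> drop k w = v then 1 else (0 :: 'b))" by simp
    ultimately show "(if take k w = u then 1 else 0) * (if drop k w = v then 1 else 0) =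
        (if k = length u then (if w = u @ v then 1 else 0) else (0 :: 'b))" by simp
  qed
  also have "\<dots> = (if w = u @ v then 1 else 0)" by auto
  finally show "cf (nmono (u @ v)) w = cf (nmono u * nmono v :: ('v, 'b) ncs) w" by (simp add: cf_mono)
qed

lemma mono_Cons: "nmono (x # w) = nmono [x] * nmono w"
  by (subst mono_append[symmetric]) simp

lemma mono_Nil: "nmono [] = 1"
  by (rule ncs_eqI) (simp add: cf_mono one_ncs.rep_eq)

lemma mono_AX: "w \<in> lists X \<Longrightarrow> nmono w \<in> AX X"
  by (auto simp: AX_def cf_mono)

lemma const_AX: "const c \<in> AX X"
  by (auto simp: AX_def const_def Ncs_inverse)

section \<open>Weights of words and the weight filtration modulo p\<close>

locale weighted_alphabet =
  fixes X :: "'v set" and wt :: "'v \<Rightarrow> nat" and pt :: "'p::prime_card itself"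
  assumes wt_pos: "v \<in> X \<Longrightarrow> 0 < wt v" and finite_X: "finite X"
begin

definition weight :: "'v list \<Rightarrow> nat" where "weight w = sum_list (map wt w)"

text \<open>Coefficients divisible by p count as having infinite weight, because everything is
  eventually compared modulo p.\<close>

definition Fd :: "nat \<Rightarrow> ('v, 'p padic) ncs set" where
  "Fd d = {f \<in> AX X. \<forall>w. weight w < d \<longrightarrow> padic_p dvd cf f w}"

lemma weight_append: "weight (u @ w) = weight u + weight w"
  by (simp add: weight_def)

lemma weight_Cons: "weight (x # w) = wt x + weight w"
  by (simp add: weight_def)

lemma weight_Nil: "weight [] = 0"
  by (simp add: weight_def)

lemma length_le_weight: "w \<in> lists X \<Longrightarrow> length w \<le> weight w"
proof (induction w)
  case (Cons x w)
  then show ?case using wt_pos[of x] by (simp add: weight_Cons)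
qed simp

lemma finite_weight: "finite {w \<in> lists X. weight w = d}"
  by (rule finite_subset[OF _ finite_words[OF finite_X, of "Suc d"]]) (use length_le_weight in \<open>auto simp: less_Suc_eq_le\<close>)

lemma Fd_AX: "f \<in> Fd d \<Longrightarrow> f \<in> AX X"
  by (simp add: Fd_def)

lemma Fd_0: "Fd 0 = AX X"
  by (simp add: Fd_def)

lemma Fd_zero: "0 \<in> Fd d"
  by (simp add: Fd_def AX_0 zero_ncs.rep_eq)

lemma Fd_add: "f \<in> Fd d \<Longrightarrow> g \<in> Fd d \<Longrightarrow> f + g \<in> Fd d"
  by (simp add: Fd_def AX_add plus_ncs.rep_eq)

lemma Fd_uminus: "f \<in> Fd d \<Longrightarrow> - f \<in> Fd d"
  by (simp add: Fd_def AX_uminus uminus_ncs.rep_eq)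

lemma Fd_mono: "d \<le> e \<Longrightarrow> f \<in> Fd e \<Longrightarrow> f \<in> Fd d"
  by (simp add: Fd_def)

lemma Fd_mult:
  assumes "f \<in> Fd d" "g \<in> Fd e" shows "f * g \<in> Fd (d + e)"
proof -
  have "padic_p dvd cf (f * g) w" if "weight w < d + e" for w
    unfolding times_ncs.rep_eq
  proof (rule dvd_sum)
    fix k
    have "weight (take k w) + weight (drop k w) = weight w"
      unfolding weight_append[symmetric] by simp
    then have "weight (take k w) < d \<or> weight (drop k w) < e" using that by linarith
    then show "padic_p dvd cf f (take k w) * cf g (drop k w)"
      using assms unfolding Fd_def by auto
  qed
  then show ?thesis using assms AX_mult unfolding Fd_def by blast
qed

lemma Fd_mult_left: "a \<in> AX X \<Longrightarrow> f \<in> Fd d \<Longrightarrow> a * f \<in> Fd d"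
  using Fd_mult[of a 0 f d] by (simp add: Fd_0)

lemma Fd_mult_right: "a \<in> AX X \<Longrightarrow> f \<in> Fd d \<Longrightarrow> f * a \<in> Fd d"
  using Fd_mult[of f d a 0] by (simp add: Fd_0)

lemma nmono_Fd: "w \<in> lists X \<Longrightarrow> nmono w \<in> Fd (weight w)"
  by (auto simp: Fd_def mono_AX cf_mono)

end

text \<open>In \<open>comm\<close> the commutator may contain single letters z of the same total
  weight. Inserting such a letter shortens the word, which is why the rewriting terminates inside a
  fixed weight.\<close>

locale nc_rewriting = weighted_alphabet X wt pt
  for X :: "'v set" and wt and pt :: "'p::prime_card itself" +
  fixes vs :: "'v list" and R :: "('v, 'p padic) ncs set"
  assumes set_vs: "set vs = X" and distinct_vs: "distinct vs"
    and R_AX: "R \<subseteq> AX X" and R_zero: "0 \<in> R"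
    and R_add: "r \<in> R \<Longrightarrow> r' \<in> R \<Longrightarrow> r + r' \<in> R"
    and R_left: "a \<in> AX X \<Longrightarrow> r \<in> R \<Longrightarrow> a * r \<in> R"
    and R_right: "a \<in> AX X \<Longrightarrow> r \<in> R \<Longrightarrow> r * a \<in> R"
    and comm: "x \<in> X \<Longrightarrow> y \<in> X \<Longrightarrow> \<exists>c r f. (\<forall>z\<in>X. c z \<noteq> 0 \<longrightarrow> wt z = wt x + wt y) \<and>
      r \<in> R \<and> f \<in> Fd (wt x + wt y + 1) \<and>
      nmono [x] * nmono [y] - nmono [y] * nmono [x] = (\<Sum>z\<in>X. const (c z) * nmono [z]) + r + f"
begin

definition RF :: "nat \<Rightarrow> ('v, 'p padic) ncs set" where
  "RF d = {r + f | r f. r \<in> R \<and> f \<in> Fd d}"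

lemma RF_I: "r \<in> R \<Longrightarrow> f \<in> Fd d \<Longrightarrow> r + f \<in> RF d"
  unfolding RF_def by blast

lemma Fd_RF: "f \<in> Fd d \<Longrightarrow> f \<in> RF d"
  using RF_I[OF R_zero] by simp

lemma RF_add:
  assumes "x \<in> RF d" "y \<in> RF d" shows "x + y \<in> RF d"
proof -
  obtain r f r' f' where "r \<in> R" "f \<in> Fd d" "r' \<in> R" "f' \<in> Fd d" "x = r + f" "y = r' + f'"
    using assms unfolding RF_def by blast
  then show ?thesis using RF_I[OF R_add Fd_add, of r r' f d f'] by (simp add: algebra_simps)
qed

lemma RF_left:
  assumes "a \<in> Fd e" "x \<in> RF d" shows "a * x \<in> RF (e + d)"
proof -
  obtain r f where "r \<in> R" "f \<in> Fd d" "x = r + f" using assms unfolding RF_def by blast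
  then show ?thesis using RF_I[OF R_left[OF Fd_AX[OF assms(1)]] Fd_mult[OF assms(1)], of r f d]
    by (simp add: algebra_simps)
qed

lemma RF_right:
  assumes "a \<in> Fd e" "x \<in> RF d" shows "x * a \<in> RF (d + e)"
proof -
  obtain r f where "r \<in> R" "f \<in> Fd d" "x = r + f" using assms unfolding RF_def by blast
  then show ?thesis using RF_I[OF R_right[OF Fd_AX[OF assms(1)]] Fd_mult[OF _ assms(1)], of r f d]
    by (simp add: algebra_simps)
qed

lemma RF_const: "x \<in> RF d \<Longrightarrow> const c * x \<in> RF d"
  using RF_left[of "const c" 0 x d] by (simp add: Fd_0 const_AX)

definition ordered :: "('v \<Rightarrow> nat) \<Rightarrow> 'v list" where
  "ordered a = concat (map (\<lambda>v. replicate (a v) v) vs)"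

definition Sorted :: "nat \<Rightarrow> ('v, 'p padic) ncs set" where
  "Sorted d = {s \<in> AX X. \<forall>w. cf s w \<noteq> 0 \<longrightarrow> w \<in> range ordered \<and> weight w = d}"

text \<open>One step of the approximation: ordered monomials of weight exactly d suffice, up to R
  and weight d + 1. The aim is that every monomial of weight d belongs to it.\<close>

definition SP :: "nat \<Rightarrow> ('v, 'p padic) ncs set" where
  "SP d = {s + x | s x. s \<in> Sorted d \<and> x \<in> RF (Suc d)}"

lemma Sorted_0: "0 \<in> Sorted d"
  by (simp add: Sorted_def AX_0 zero_ncs.rep_eq)

lemma Sorted_add: "s \<in> Sorted d \<Longrightarrow> s' \<in> Sorted d \<Longrightarrow> s + s' \<in> Sorted d"
  unfolding Sorted_def by (auto simp: AX_add plus_ncs.rep_eq) (metis add.right_neutral)+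

lemma Sorted_const: "s \<in> Sorted d \<Longrightarrow> const c * s \<in> Sorted d"
  unfolding Sorted_def by (auto simp: AX_mult const_AX cf_const_mult)

lemma SP_I: "s \<in> Sorted d \<Longrightarrow> x \<in> RF (Suc d) \<Longrightarrow> s + x \<in> SP d"
  unfolding SP_def by blast

lemma RF_SP: "x \<in> RF (Suc d) \<Longrightarrow> x \<in> SP d"
  using SP_I[OF Sorted_0] by simp

lemma Sorted_SP: "s \<in> Sorted d \<Longrightarrow> s \<in> SP d"
  using SP_I[of s d 0] Fd_RF[OF Fd_zero] by simp

lemma SP_add:
  assumes "x \<in> SP d" "y \<in> SP d" shows "x + y \<in> SP d"
proof -
  obtain s f s' f' where "s \<in> Sorted d" "f \<in> RF (Suc d)" "s' \<in> Sorted d" "f' \<in> RF (Suc d)" "x = s + f" "y = s' + f'"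
    using assms unfolding SP_def by blast
  then show ?thesis using SP_I[OF Sorted_add RF_add, of s d s' f f'] by (simp add: algebra_simps)
qed

lemma SP_const:
  assumes "x \<in> SP d" shows "const c * x \<in> SP d"
proof -
  obtain s f where "s \<in> Sorted d" "f \<in> RF (Suc d)" "x = s + f" using assms unfolding SP_def by blast
  then show ?thesis using SP_I[OF Sorted_const RF_const, of s d f c c] by (simp add: algebra_simps)
qed

lemma SP_0: "0 \<in> SP d"
  by (rule Sorted_SP[OF Sorted_0])

lemma SP_sum: "(\<And>i. i \<in> I \<Longrightarrow> f i \<in> SP d) \<Longrightarrow> (\<Sum>i\<in>I. f i) \<in> SP d"
  by (induction I rule: infinite_finite_induct) (auto intro: SP_add SP_0)

text \<open>Between the contexts a and b, the letters z in the commutator produce words one letter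
  shorter of the same weight, which \<open>short\<close> covers; the rest lies in R or has weight
  above d.\<close>

lemma swap_SP:
  assumes short: "\<And>u. u \<in> lists X \<Longrightarrow> weight u = d \<Longrightarrow> length u < length (a @ x # y # b) \<Longrightarrow> nmono u \<in> SP d"
    and w: "a @ x # y # b \<in> lists X" "weight (a @ x # y # b) = d"
  shows "nmono (a @ x # y # b) - nmono (a @ y # x # b) \<in> SP d"
proof -
  have xy: "x \<in> X" "y \<in> X" and ab: "a \<in> lists X" "b \<in> lists X" using w(1) by auto
  obtain c r f where c: "\<forall>z\<in>X. c z \<noteq> 0 \<longrightarrow> wt z = wt x + wt y" and rf: "r \<in> R" "f \<in> Fd (wt x + wt y + 1)"
    and eq: "nmono [x] * nmono [y] - nmono [y] * nmono [x] = (\<Sum>z\<in>X. const (c z) * nmono [z]) + r + f"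
    using comm[OF xy] by blast
  have m: "nmono (a @ z1 # z2 # b) = (nmono a * (nmono [z1] * nmono [z2]) * nmono b :: ('v, 'p padic) ncs)" for z1 z2
    by (simp only: mono_append[of a] mono_Cons[of z1 "z2 # b"] mono_Cons[of z2 b] mult.assoc)
  have "nmono (a @ x # y # b) - nmono (a @ y # x # b) =
      (nmono a * (nmono [x] * nmono [y] - nmono [y] * nmono [x]) * nmono b :: ('v, 'p padic) ncs)"
    unfolding m by (simp add: algebra_simps)
  also have "\<dots> = nmono a * (\<Sum>z\<in>X. const (c z) * nmono [z]) * nmono b + nmono a * (r + f) * nmono b"
    unfolding eq by (simp add: algebra_simps)
  also have "nmono a * (\<Sum>z\<in>X. const (c z) * nmono [z]) * nmono b = (\<Sum>z\<in>X. const (c z) * nmono (a @ z # b))"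
    unfolding sum_distrib_left sum_distrib_right
  proof (rule sum.cong[OF refl])
    fix z
    have "nmono (a @ z # b) = (nmono a * (nmono [z] * nmono b) :: ('v, 'p padic) ncs)"
      by (simp only: mono_append[of a] mono_Cons[of z b])
    then show "nmono a * (const (c z) * nmono [z]) * nmono b = const (c z) * nmono (a @ z # b)"
      by (simp only: mult.assoc[symmetric] const_commute[of "c z" "nmono a"])
  qed
  finally have e: "nmono (a @ x # y # b) - nmono (a @ y # x # b) =
      (\<Sum>z\<in>X. const (c z) * nmono (a @ z # b)) + nmono a * (r + f) * nmono b" .
  have "const (c z) * nmono (a @ z # b) \<in> SP d" if z: "z \<in> X" for z
  proof (cases "c z = 0")
    case True
    then have "const (c z) * nmono (a @ z # b) = 0"
      by (intro ncs_eqI) (simp add: cf_const_mult zero_ncs.rep_eq)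
    then show ?thesis by (simp add: SP_0)
  next
    case False
    then have "wt z = wt x + wt y" using c z by blast
    then show ?thesis
      using w(2) ab z by (intro SP_const short) (auto simp: weight_append weight_Cons)
  qed
  moreover have "nmono a * (r + f) * nmono b \<in> SP d"
  proof (rule RF_SP)
    have "nmono a * (r + f) * nmono b \<in> RF ((weight a + (wt x + wt y + 1)) + weight b)"
      by (intro RF_left RF_right nmono_Fd ab RF_I rf)
    then show "nmono a * (r + f) * nmono b \<in> RF (Suc d)" using w(2) by (simp add: weight_append weight_Cons add_ac)
  qed
  ultimately show ?thesis unfolding e by (intro SP_add SP_sum)
qed

lemma move_SP:
  assumes short: "\<And>u. u \<in> lists X \<Longrightarrow> weight u = d \<Longrightarrow> length u < l \<Longrightarrow> nmono u \<in> SP d"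
    and w: "a @ x # pre @ post \<in> lists X" "weight (a @ x # pre @ post) = d" "length (a @ x # pre @ post) = l"
  shows "nmono (a @ x # pre @ post) - nmono (a @ pre @ x # post) \<in> SP d"
  using w
proof (induction pre arbitrary: a)
  case Nil
  then show ?case by (simp add: SP_0)
next
  case (Cons y pre)
  have "nmono (a @ x # y # (pre @ post)) - nmono (a @ y # x # (pre @ post)) \<in> SP d"
    using Cons.prems by (intro swap_SP short) auto
  moreover have "nmono ((a @ [y]) @ x # pre @ post) - nmono ((a @ [y]) @ pre @ x # post) \<in> SP d"
    using Cons.prems by (intro Cons.IH) (auto simp: weight_append weight_Cons)
  ultimately show ?case using SP_add by fastforce
qed

lemma ordered_insert:
  assumes "x \<in> X"
  obtains pre post where "ordered a = pre @ post" "ordered (a(x := Suc (a x))) = pre @ x # post"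
proof -
  obtain vs1 vs2 where vs: "vs = vs1 @ x # vs2" using assms set_vs split_list by metis
  then have x: "x \<notin> set vs1" "x \<notin> set vs2" using distinct_vs by auto
  let ?f = "\<lambda>a v. replicate (a v) v"
  have m: "map (?f (a(x := Suc (a x)))) vs1 = map (?f a) vs1" "map (?f (a(x := Suc (a x)))) vs2 = map (?f a) vs2"
    using x by auto
  have o: "ordered b = concat (map (?f b) vs1) @ replicate (b x) x @ concat (map (?f b) vs2)" for b
    by (simp only: ordered_def) (simp add: vs)
  show ?thesis
    by (rule that[of "concat (map (?f a) vs1)" "replicate (a x) x @ concat (map (?f a) vs2)"])
       (unfold o m, simp_all)
qed

lemma count_list_Cons_upd: "count_list (x # w) = (count_list w)(x := Suc (count_list w x))"
  by auto

lemma
  assumes "w \<in> lists X"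
  shows ordered_weight: "weight (ordered (count_list w)) = weight w"
    and ordered_length: "length (ordered (count_list w)) = length w"
proof -
  have "weight (ordered (count_list w)) = weight w \<and> length (ordered (count_list w)) = length w"
    using assms
  proof (induction w)
    case Nil
    have "ordered (\<lambda>_. 0) = []" by (simp add: ordered_def)
    then show ?case by simp
  next
    case (Cons x w)
    then have x: "x \<in> X" by simp
    obtain pre post where "ordered (count_list w) = pre @ post" "ordered (count_list (x # w)) = pre @ x # post"
      unfolding count_list_Cons_upd by (rule ordered_insert[OF x])
    then show ?case using Cons by (simp add: weight_append weight_Cons del: count_list.simps)
  qed
  then show "weight (ordered (count_list w)) = weight w" "length (ordered (count_list w)) = length w" by auto
qed

lemma ordered_lists: "ordered a \<in> lists X"
  unfolding ordered_def using set_vs by auto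

text \<open>Insertion sort: the tail behind x is ordered first, then x is moved to its place. The
  untouched prefix a is carried along so that the induction applies inside a word.\<close>

lemma sort_SP:
  assumes short: "\<And>u. u \<in> lists X \<Longrightarrow> weight u = d \<Longrightarrow> length u < l \<Longrightarrow> nmono u \<in> SP d"
    and w: "a @ w \<in> lists X" "weight (a @ w) = d" "length (a @ w) = l"
  shows "nmono (a @ w) - nmono (a @ ordered (count_list w)) \<in> SP d"
  using w
proof (induction w arbitrary: a)
  case Nil
  have "ordered (\<lambda>_. 0) = []" by (simp add: ordered_def)
  then show ?case by (simp add: SP_0)
next
  case (Cons x w)
  then have x: "x \<in> X" and w: "w \<in> lists X" and a: "a \<in> lists X" by auto
  have 1: "nmono ((a @ [x]) @ w) - nmono ((a @ [x]) @ ordered (count_list w)) \<in> SP d"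
    using Cons.prems by (intro Cons.IH) auto
  obtain pre post where o: "ordered (count_list w) = pre @ post" "ordered (count_list (x # w)) = pre @ x # post"
    unfolding count_list_Cons_upd by (rule ordered_insert[OF x])
  have "a @ x # pre @ post \<in> lists X" using a x ordered_lists[of "count_list w"] o(1) by auto
  moreover have "weight (a @ x # pre @ post) = d" "length (a @ x # pre @ post) = l"
    using Cons.prems ordered_weight[OF w] ordered_length[OF w] unfolding o(1)
    by (auto simp: weight_append weight_Cons)
  ultimately have "nmono (a @ x # pre @ post) - nmono (a @ pre @ x # post) \<in> SP d"
    using short by (intro move_SP)
  from SP_add[OF 1 this] show ?case unfolding o by simp
qed

lemma mono_SP: "w \<in> lists X \<Longrightarrow> weight w = d \<Longrightarrow> nmono w \<in> SP d"
proof (induction "length w" arbitrary: w rule: less_induct)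
  case less
  have "nmono ([] @ w) - nmono ([] @ ordered (count_list w)) \<in> SP d"
    by (rule sort_SP[where l="length w"]) (use less in auto)
  moreover have "nmono (ordered (count_list w)) \<in> Sorted d"
    using less ordered_lists[of "count_list w"] ordered_weight[of w]
    by (auto simp: Sorted_def mono_AX cf_mono)
  ultimately have "nmono w - nmono (ordered (count_list w)) + nmono (ordered (count_list w)) \<in> SP d"
    by (intro SP_add) (simp_all add: Sorted_SP)
  then show ?case by simp
qed

text \<open>There are finitely many words of weight d, so the part of f of exactly this weight is a
  polynomial; what remains has weight at least d + 1 modulo p.\<close>

lemma Fd_SP:
  assumes "f \<in> Fd d" shows "f \<in> SP d"
proof -
  let ?Q = "{w \<in> lists X. weight w = d}"
  define g where "g = (\<Sum>w\<in>?Q. const (cf f w) * nmono w)"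
  have g: "cf g w = (if w \<in> ?Q then cf f w else 0)" for w
  proof -
    have "cf g w = (\<Sum>u\<in>?Q. if u = w then cf f w else 0)"
      unfolding g_def cf_sum cf_const_mult cf_mono by (rule sum.cong) auto
    then show ?thesis using finite_weight[of d] by (simp add: sum.delta)
  qed
  have gA: "g \<in> AX X"
    unfolding g_def by (intro AX_sum AX_mult const_AX mono_AX) simp
  have "f - g \<in> Fd (Suc d)"
    unfolding Fd_def
  proof (intro CollectI conjI allI impI)
    show "f - g \<in> AX X" using gA Fd_AX[OF assms] by (rule AX_diff[rotated])
    fix w assume "weight w < Suc d"
    then show "padic_p dvd cf (f - g) w"
      using assms Fd_AX[OF assms] unfolding minus_ncs.rep_eq g
      by (cases "weight w < d") (auto simp: Fd_def AX_def)
  qed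
  then have "f - g \<in> SP d" by (intro RF_SP Fd_RF)
  moreover have "g \<in> SP d" unfolding g_def by (intro SP_sum SP_const mono_SP) auto
  ultimately have "(f - g) + g \<in> SP d" by (rule SP_add)
  then show ?thesis by simp
qed

text \<open>Step d of the approximation adds only words of weight d, so each coefficient stabilises
  and the limit s is supported on ordered words. The element of R that accounts for f - s may still
  depend on d.\<close>

theorem ordered_spanning:
  assumes f: "f \<in> AX X"
  obtains s where "s \<in> AX X" "\<And>w. cf s w \<noteq> 0 \<Longrightarrow> w \<in> range ordered" "\<And>d. f - s \<in> RF d"
proof -
  define P where "P d x \<longleftrightarrow> x \<in> AX X \<and> (\<forall>w. cf x w \<noteq> 0 \<longrightarrow> w \<in> range ordered \<and> weight w < d) \<and> f - x \<in> RF d" for d x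
  have "\<exists>x. \<forall>d. P d (x d) \<and> x (Suc d) - x d \<in> Sorted d"
  proof (rule dependent_nat_choice)
    show "\<exists>x. P 0 x"
      using f by (intro exI[of _ 0]) (simp add: P_def AX_0 zero_ncs.rep_eq Fd_RF Fd_0)
    fix x d assume x: "P d x"
    then obtain r g where rg: "r \<in> R" "g \<in> Fd d" "f - x = r + g" unfolding P_def RF_def by blast
    then obtain s y where sy: "s \<in> Sorted d" "y \<in> RF (Suc d)" "g = s + y" using Fd_SP unfolding SP_def by blast
    have "f - (x + s) = (r + 0) + y" using rg(3) sy(3) by (simp add: algebra_simps)
    moreover have "(r + 0) + y \<in> RF (Suc d)" by (intro RF_add RF_I rg(1) Fd_zero sy(2))
    ultimately have "f - (x + s) \<in> RF (Suc d)" by simp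
    moreover have "w \<in> range ordered \<and> weight w < Suc d" if w: "cf (x + s) w \<noteq> 0" for w
    proof -
      have "cf x w \<noteq> 0 \<or> cf s w \<noteq> 0" using w by (auto simp: plus_ncs.rep_eq)
      then show ?thesis using x sy(1) unfolding P_def Sorted_def by auto
    qed
    moreover have "x + s \<in> AX X" using x sy(1) by (auto simp: P_def Sorted_def intro: AX_add)
    ultimately have "P (Suc d) (x + s)" unfolding P_def by blast
    then show "\<exists>y. P (Suc d) y \<and> y - x \<in> Sorted d" using sy(1) by (intro exI[of _ "x + s"]) simp
  qed
  then obtain x where x: "\<And>d. P d (x d)" and step: "\<And>d. x (Suc d) - x d \<in> Sorted d" by blast
  \<comment> \<open>The coefficient of w is final from stage \<open>Suc (weight w)\<close>
    on.\<close>
  define s where "s = Ncs (\<lambda>w. cf (x (Suc (weight w))) w)"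
  have s: "cf s w = cf (x (Suc (weight w))) w" for w unfolding s_def by (subst Ncs_inverse) auto
  have stable: "cf (x (Suc (weight w) + k)) w = cf s w" for w k
  proof (induction k)
    case 0
    then show ?case by (simp add: s)
  next
    case (Suc k)
    define n where "n = Suc (weight w) + k"
    have "cf (x (Suc n) - x n) w = 0"
    proof (rule ccontr)
      assume "cf (x (Suc n) - x n) w \<noteq> 0"
      then have "weight w = n" using step[of n] unfolding Sorted_def by blast
      then show False by (simp add: n_def)
    qed
    then have "cf (x (Suc n)) w = cf (x n) w" by (simp add: minus_ncs.rep_eq)
    then show ?case using Suc by (simp only: n_def add_Suc_right)
  qed
  have sA: "s \<in> AX X"
    unfolding AX_def
  proof (intro CollectI allI impI)
    fix w assume "w \<notin> lists X"
    moreover have "x (Suc (weight w)) \<in> AX X" using x by (simp add: P_def)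
    ultimately show "cf s w = 0" unfolding s AX_def by blast
  qed
  moreover have "w \<in> range ordered" if "cf s w \<noteq> 0" for w using x that unfolding P_def s by blast
  moreover have "f - s \<in> RF d" for d
  proof -
    have "x d - s \<in> Fd d"
      unfolding Fd_def
    proof (intro CollectI conjI allI impI)
      show "x d - s \<in> AX X" using x[of d] sA by (auto simp: P_def intro: AX_diff)
      fix w assume "weight w < d"
      then have "d = Suc (weight w) + (d - Suc (weight w))" by simp
      then have "cf (x d) w = cf s w" using stable by metis
      then show "padic_p dvd cf (x d - s) w" by (simp add: minus_ncs.rep_eq)
    qed
    then have "(f - x d) + (x d - s) \<in> RF d" using x[of d] Fd_RF RF_add unfolding P_def by blast
    then show ?thesis by simp
  qed
  ultimately show ?thesis using that by blast
qed

end

section \<open>Iterated differences\<close>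

text \<open>Pascal's rule: the i-fold forward difference of a first difference is the (i+1)-fold
  difference.\<close>

lemma alternating_sum_Suc:
  fixes f :: "nat \<Rightarrow> 'a::comm_ring_1"
  shows "(\<Sum>j\<le>i. (- 1) ^ (i + j) * of_nat (i choose j) * (f (Suc j) - f j)) =
    (\<Sum>j\<le>Suc i. (- 1) ^ (Suc i + j) * of_nat (Suc i choose j) * f j)"
proof -
  have "(\<Sum>j\<le>i. (- 1) ^ (i + j) * of_nat (i choose j) * f j) =
      (\<Sum>j\<le>Suc i. (- 1) ^ (i + j) * of_nat (i choose j) * f j)" by (simp add: binomial_eq_0)
  also have "\<dots> = (- 1) ^ i * f 0 + (\<Sum>j\<le>i. (- 1) ^ (i + Suc j) * of_nat (i choose Suc j) * f (Suc j))"
    by (subst sum.atMost_Suc_shift) simp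
  finally have 1: "(\<Sum>j\<le>i. (- 1) ^ (i + j) * of_nat (i choose j) * f j) =
      (- 1) ^ i * f 0 - (\<Sum>j\<le>i. (- 1) ^ (i + j) * of_nat (i choose Suc j) * f (Suc j))"
    by (simp add: sum_negf)
  have "(\<Sum>j\<le>Suc i. (- 1) ^ (Suc i + j) * of_nat (Suc i choose j) * f j) =
      - ((- 1) ^ i * f 0) + (\<Sum>j\<le>i. (- 1) ^ (i + j) * of_nat ((i choose j) + (i choose Suc j)) * f (Suc j))"
    by (subst sum.atMost_Suc_shift) simp
  also have "\<dots> = (\<Sum>j\<le>i. (- 1) ^ (i + j) * of_nat (i choose j) * f (Suc j)) -
      (\<Sum>j\<le>i. (- 1) ^ (i + j) * of_nat (i choose j) * f j)"
    unfolding 1 by (simp add: algebra_simps sum.distrib)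
  finally show ?thesis by (simp add: algebra_simps sum_subtractf)
qed

text \<open>The sum is the b-fold difference at 0 of the function that sends j to (j choose a), and
  each difference lowers a by one.\<close>

lemma binomial_orthogonality:
  "(\<Sum>j\<le>b. (- 1) ^ (b + j) * of_nat (b choose j) * of_nat (j choose a) :: 'a::comm_ring_1) = (if a = b then 1 else 0)"
proof (induction b arbitrary: a)
  case 0
  then show ?case by (cases a) auto
next
  case (Suc b)
  have "(\<Sum>j\<le>Suc b. (- 1) ^ (Suc b + j) * of_nat (Suc b choose j) * of_nat (j choose a) :: 'a) =
      (\<Sum>j\<le>b. (- 1) ^ (b + j) * of_nat (b choose j) * (of_nat (Suc j choose a) - of_nat (j choose a)))"
    by (rule alternating_sum_Suc[symmetric])
  also have "\<dots> = (if a = Suc b then 1 else 0)"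
  proof (cases a)
    case (Suc a')
    then show ?thesis using Suc.IH[of a'] by simp
  qed simp
  finally show ?case .
qed

context group
begin

lemma Dif_append: "Dif G (hs @ ks) F = Dif G ks (Dif G hs F)"
  by (induction hs arbitrary: F) auto

lemma Dif_cong_dvd:
  fixes F :: "'a \<Rightarrow> 'c::comm_ring_1"
  assumes "set hs \<subseteq> carrier G" "\<And>x. x \<in> carrier G \<Longrightarrow> d dvd F x - F' x" "x \<in> carrier G"
  shows "d dvd Dif G hs F x - Dif G hs F' x"
  using assms(1,2)
proof (induction hs arbitrary: F F')
  case (Cons h hs)
  have "d dvd (F (h \<otimes> y) - F y) - (F' (h \<otimes> y) - F' y)" if "y \<in> carrier G" for y
    using dvd_diff[OF Cons.prems(2)[of "h \<otimes> y"] Cons.prems(2)[of y]] that Cons.prems(1) by (simp add: algebra_simps)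
  then show ?case using Cons by simp
qed (use assms(3) in simp)

lemma Dif_dvd:
  fixes F :: "'a \<Rightarrow> 'c::comm_ring_1"
  assumes "set hs \<subseteq> carrier G" "\<And>x. x \<in> carrier G \<Longrightarrow> d dvd F x" "x \<in> carrier G"
  shows "d dvd Dif G hs F x"
proof -
  have 0: "Dif G hs (\<lambda>_. 0) = (\<lambda>_. 0 :: 'c)" by (induction hs) auto
  have "d dvd Dif G hs F x - Dif G hs (\<lambda>_. 0) x"
    by (rule Dif_cong_dvd) (use assms in auto)
  then show ?thesis by (simp add: 0)
qed

lemma Dif_replicate:
  fixes F :: "'a \<Rightarrow> 'c::comm_ring_1"
  assumes "s \<in> carrier G" "x \<in> carrier G"
  shows "Dif G (replicate i s) F x = (\<Sum>j\<le>i. (- 1) ^ (i + j) * of_nat (i choose j) * F (s [^] j \<otimes> x))"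
  using assms(2)
proof (induction i arbitrary: F)
  case (Suc i)
  have m: "s \<otimes> (s [^] j \<otimes> x) = s [^] Suc j \<otimes> x" for j :: nat
    using assms(1) Suc.prems nat_pow_comm[of s 1 j] by (simp add: m_assoc[symmetric])
  have "Dif G (replicate (Suc i) s) F x =
      (\<Sum>j\<le>i. (- 1) ^ (i + j) * of_nat (i choose j) * (F (s [^] Suc j \<otimes> x) - F (s [^] j \<otimes> x)))"
    using Suc.IH[OF Suc.prems, of "\<lambda>x. F (s \<otimes> x) - F x"] by (simp only: replicate_Suc Dif.simps m)
  then show ?case by (simp only: alternating_sum_Suc[of i "\<lambda>j. F (s [^] j \<otimes> x)"])
qed simp

text \<open>The dual form of s^q = (1 + (s - 1))^q. It identifies the value of a binomial series at
  s - 1 for natural exponents.\<close>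

lemma Newton_forward:
  fixes F :: "'a \<Rightarrow> 'c::comm_ring_1"
  assumes "s \<in> carrier G" "x \<in> carrier G"
  shows "(\<Sum>r\<le>q. of_nat (q choose r) * Dif G (replicate r s) F x) = F (s [^] q \<otimes> x)"
  using assms(2)
proof (induction q arbitrary: F)
  case (Suc q)
  let ?D = "\<lambda>r. Dif G (replicate r s) F x"
  have "(\<Sum>r\<le>Suc q. of_nat (Suc q choose r) * ?D r) =
      ?D 0 + (\<Sum>r\<le>q. of_nat ((q choose r) + (q choose Suc r)) * ?D (Suc r))"
    by (subst sum.atMost_Suc_shift) (simp del: of_nat_add)
  also have "\<dots> = (?D 0 + (\<Sum>r\<le>q. of_nat (q choose Suc r) * ?D (Suc r))) + (\<Sum>r\<le>q. of_nat (q choose r) * ?D (Suc r))"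
    by (simp only: of_nat_add distrib_right sum.distrib add_ac)
  also have "?D 0 + (\<Sum>r\<le>q. of_nat (q choose Suc r) * ?D (Suc r)) = (\<Sum>r\<le>Suc q. of_nat (q choose r) * ?D r)"
    by (subst sum.atMost_Suc_shift) simp
  also have "\<dots> = (\<Sum>r\<le>q. of_nat (q choose r) * ?D r)" by (simp add: binomial_eq_0)
  also have "\<dots> = F (s [^] q \<otimes> x)" by (rule Suc.IH[OF Suc.prems])
  also have "(\<Sum>r\<le>q. of_nat (q choose r) * ?D (Suc r)) = F (s \<otimes> (s [^] q \<otimes> x)) - F (s [^] q \<otimes> x)"
    using Suc.IH[OF Suc.prems, of "\<lambda>x. F (s \<otimes> x) - F x"] by simp
  also have "s \<otimes> (s [^] q \<otimes> x) = s [^] Suc q \<otimes> x"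
    using assms(1) Suc.prems nat_pow_comm[of s 1 q] by (simp add: m_assoc[symmetric])
  finally show ?case by simp
qed simp

definition inv_mod :: "'a set \<Rightarrow> ('a \<Rightarrow> 'p::prime_card padic) \<Rightarrow> bool" where
  "inv_mod S F \<longleftrightarrow> (\<forall>h\<in>S. \<forall>x\<in>carrier G. padic_p dvd F (h \<otimes> x) - F x)"

lemma inv_modD: "inv_mod S F \<Longrightarrow> h \<in> S \<Longrightarrow> x \<in> carrier G \<Longrightarrow> padic_p dvd F (h \<otimes> x) - F x"
  by (simp add: inv_mod_def)

lemma inv_mod_subset: "inv_mod S F \<Longrightarrow> S' \<subseteq> S \<Longrightarrow> inv_mod S' F"
  by (auto simp: inv_mod_def)

lemma inv_mod_Un: "inv_mod (S \<union> S') F \<longleftrightarrow> inv_mod S F \<and> inv_mod S' F"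
  by (auto simp: inv_mod_def)

end

section \<open>Groups filtered with central finite layers of exponent p\<close>

locale central_p_series = group G for G (structure) +
  fixes H :: "nat \<Rightarrow> 'a set" and pt :: "'p::prime_card itself"
  assumes H_closed: "h \<in> H d \<Longrightarrow> h \<in> carrier G"
    and H_Suc: "H (Suc d) \<subseteq> H d"
    and H_comm: "g \<in> carrier G \<Longrightarrow> h \<in> H d \<Longrightarrow> \<exists>c\<in>H (Suc d). g \<otimes> h = c \<otimes> (h \<otimes> g)"
    and H_pow: "h \<in> H d \<Longrightarrow> h [^] CARD('p) \<in> H (Suc d)"
    and H_fin: "\<exists>S. finite S \<and> S \<subseteq> H d \<and> (\<forall>h\<in>H d. \<exists>s\<in>S. \<exists>c\<in>H (Suc d). h = c \<otimes> s)"
    and H_0: "H 0 = carrier G"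
    and odd_p: "odd CARD('p)"
begin

text \<open>The commutator of g and h lies in \<open>H (Suc d)\<close>, under which F is invariant,
  so modulo p the translations by G and by \<open>H d\<close> commute on F.\<close>

lemma swap_dvd:
  fixes F :: "'a \<Rightarrow> 'p padic"
  assumes "inv_mod (H (Suc d)) F" "g \<in> carrier G" "h \<in> H d" "x \<in> carrier G"
  shows "padic_p dvd F (g \<otimes> (h \<otimes> x)) - F (h \<otimes> (g \<otimes> x))"
proof -
  obtain c where c: "c \<in> H (Suc d)" "g \<otimes> h = c \<otimes> (h \<otimes> g)" using H_comm assms by blast
  have "g \<otimes> (h \<otimes> x) = c \<otimes> (h \<otimes> (g \<otimes> x))"
    using assms(2,4) H_closed[OF assms(3)] H_closed[OF c(1)] c(2)
    by (metis m_assoc m_closed)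
  then show ?thesis
    using inv_modD[OF assms(1) c(1), of "h \<otimes> (g \<otimes> x)"] assms H_closed by simp
qed

lemma inv_mod_diff:
  fixes F :: "'a \<Rightarrow> 'p padic"
  assumes "inv_mod (H (Suc d)) F" "inv_mod S F" "S \<subseteq> H d" "g \<in> carrier G"
  shows "inv_mod S (\<lambda>x. F (g \<otimes> x) - F x)"
  unfolding inv_mod_def
proof (intro ballI)
  fix h x assume h: "h \<in> S" and x: "x \<in> carrier G"
  then have hd: "h \<in> H d" and hc: "h \<in> carrier G" using assms(3) H_closed by auto
  have "padic_p dvd F (g \<otimes> (h \<otimes> x)) - F (g \<otimes> x)"
    using dvd_diff_trans[OF swap_dvd[OF assms(1,4) hd x] inv_modD[OF assms(2) h, of "g \<otimes> x"]] assms(4) x by simp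
  from dvd_diff[OF this inv_modD[OF assms(2) h x]]
  show "padic_p dvd F (g \<otimes> (h \<otimes> x)) - F (h \<otimes> x) - (F (g \<otimes> x) - F x)" by (simp add: algebra_simps)
qed

lemma inv_mod_Dif:
  fixes F :: "'a \<Rightarrow> 'p padic"
  assumes "inv_mod (H (Suc d)) F" "inv_mod S F" "S \<subseteq> H d" "set hs \<subseteq> carrier G"
  shows "inv_mod S (Dif G hs F)"
  using assms(1,2,4)
proof (induction hs arbitrary: F)
  case (Cons h hs)
  then show ?case
    using inv_mod_diff[OF Cons.prems(1,1) H_Suc] inv_mod_diff[OF Cons.prems(1,2) assms(3)] by simp
qed simp

lemma Dif_commute_single:
  fixes F :: "'a \<Rightarrow> 'p padic"
  assumes "inv_mod (H (Suc d)) F" "s \<in> H d" "set hs \<subseteq> carrier G" "x \<in> carrier G"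
  shows "padic_p dvd Dif G [s] (Dif G hs F) x - Dif G hs (Dif G [s] F) x"
  using assms(1,3)
proof (induction hs arbitrary: F)
  case (Cons g hs)
  then have g: "g \<in> carrier G" and hs: "set hs \<subseteq> carrier G" by auto
  let ?F = "\<lambda>x. F (g \<otimes> x) - F x"
  have sc: "s \<in> carrier G" using H_closed assms(2) by blast
  have 1: "padic_p dvd Dif G [s] (Dif G hs ?F) x - Dif G hs (Dif G [s] ?F) x"
    using inv_mod_diff[OF Cons.prems(1,1) H_Suc g] by (intro Cons.IH hs)
  have "padic_p dvd Dif G [s] ?F y - (\<lambda>x. Dif G [s] F (g \<otimes> x) - Dif G [s] F x) y" if y: "y \<in> carrier G" for y
    using swap_dvd[OF Cons.prems(1) g assms(2) y] by (simp add: algebra_simps)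
  then have 2: "padic_p dvd Dif G hs (Dif G [s] ?F) x - Dif G hs (\<lambda>x. Dif G [s] F (g \<otimes> x) - Dif G [s] F x) x"
    by (intro Dif_cong_dvd hs assms(4))
  show ?case using dvd_diff_trans[OF 1 2] by simp
qed simp

lemma Dif_commute_replicate:
  fixes F :: "'a \<Rightarrow> 'p padic"
  assumes "inv_mod (H (Suc d)) F" "s \<in> H d" "set hs \<subseteq> carrier G" "x \<in> carrier G"
  shows "padic_p dvd Dif G (replicate i s) (Dif G hs F) x - Dif G hs (Dif G (replicate i s) F) x"
  using assms(1)
proof (induction i arbitrary: F)
  case (Suc i)
  have sc: "s \<in> carrier G" using H_closed assms(2) by blast
  have 1: "padic_p dvd Dif G (replicate i s) (Dif G [s] (Dif G hs F)) x - Dif G (replicate i s) (Dif G hs (Dif G [s] F)) x"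
    by (intro Dif_cong_dvd Dif_commute_single[OF Suc.prems] assms) (use sc in auto)
  have 2: "padic_p dvd Dif G (replicate i s) (Dif G hs (Dif G [s] F)) x - Dif G hs (Dif G (replicate i s) (Dif G [s] F)) x"
    by (rule Suc.IH) (use inv_mod_Dif[OF Suc.prems Suc.prems H_Suc, of "[s]"] sc in simp)
  show ?case using dvd_diff_trans[OF 1 2] by simp
qed simp

text \<open>Modulo p one has (s - 1)^p = s^p - 1, and s^p lies one step deeper, where F is
  invariant.\<close>

lemma Dif_p_power:
  fixes F :: "'a \<Rightarrow> 'p padic"
  assumes "inv_mod (H (Suc d)) F" "s \<in> H d" "x \<in> carrier G"
  shows "padic_p dvd Dif G (replicate CARD('p) s) F x"
proof -
  let ?p = "CARD('p)"
  have sc: "s \<in> carrier G" using H_closed assms(2) by blast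
  let ?t = "\<lambda>j. (- 1) ^ (?p + j) * of_nat (?p choose j) * F (s [^] j \<otimes> x)"
  have p0: "0 < ?p" using CARD_gt_1[where 'p='p] by simp
  have "Dif G (replicate ?p s) F x = (\<Sum>j\<le>?p. ?t j)" by (rule Dif_replicate[OF sc assms(3)])
  also have "{..?p} = insert 0 (insert ?p {1..<?p})" using p0 by auto
  also have "(\<Sum>j\<in>insert 0 (insert ?p {1..<?p}). ?t j) = ?t 0 + (?t ?p + (\<Sum>j\<in>{1..<?p}. ?t j))"
    using p0 by simp
  \<comment> \<open>Oddness of p gives the term for j = 0 the sign -1.\<close>
  also have "?t 0 + (?t ?p + (\<Sum>j\<in>{1..<?p}. ?t j)) = (F (s [^] ?p \<otimes> x) - F x) + (\<Sum>j\<in>{1..<?p}. ?t j)"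
    using odd_p assms(3) by simp
  also have "padic_p dvd \<dots>"
  proof (rule dvd_add)
    show "padic_p dvd F (s [^] ?p \<otimes> x) - F x" using inv_modD[OF assms(1) H_pow[OF assms(2)] assms(3)] .
    show "padic_p dvd (\<Sum>j\<in>{1..<?p}. ?t j)"
    proof (rule dvd_sum)
      fix j assume j: "j \<in> {1..<?p}"
      then have "?p dvd (?p choose j)" using prime_card[where 'a='p] by (intro dvd_choose_prime) auto
      then have "(padic_p :: 'p padic) dvd of_nat (?p choose j)" by (simp only: p_dvd_of_nat_iff)
      then show "padic_p dvd ?t j" by simp
    qed
  qed
  finally show ?thesis .
qed

text \<open>By induction on d. A function invariant under \<open>H (Suc d)\<close> is turned into
  one invariant under \<open>H d\<close> by treating the finitely many representatives s of the
  layer one after the other: s - 1 is nilpotent of order p on the function, and differences by s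
  commute with all others.\<close>

theorem Dif_nilpotent:
  "\<exists>M. \<forall>F :: 'a \<Rightarrow> 'p padic. inv_mod (H d) F \<longrightarrow>
    (\<forall>hs. set hs \<subseteq> carrier G \<longrightarrow> M \<le> length hs \<longrightarrow> (\<forall>x\<in>carrier G. padic_p dvd Dif G hs F x))"
proof (induction d)
  case 0
  have "padic_p dvd Dif G hs F x"
    if F: "inv_mod (H 0) F" and hs: "set hs \<subseteq> carrier G" "1 \<le> length hs" and x: "x \<in> carrier G"
    for F :: "'a \<Rightarrow> 'p padic" and hs x
  proof -
    obtain h ks where hk: "hs = h # ks" using hs(2) by (cases hs) auto
    then have h: "h \<in> carrier G" and ks: "set ks \<subseteq> carrier G" using hs(1) by auto
    show ?thesis unfolding hk Dif.simps
      by (rule Dif_dvd[OF ks _ x]) (use inv_modD[OF F] h H_0 in auto)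
  qed
  then show ?case by blast
next
  case (Suc d)
  define kills where "kills M F \<longleftrightarrow>
    (\<forall>hs. set hs \<subseteq> carrier G \<longrightarrow> M \<le> length hs \<longrightarrow> (\<forall>x\<in>carrier G. padic_p dvd Dif G hs F x))"
    for M and F :: "'a \<Rightarrow> 'p padic"
  have "\<exists>M. \<forall>F. inv_mod (H d) F \<longrightarrow> kills M F" using Suc.IH by (simp only: kills_def)
  then obtain M where M: "\<forall>F. inv_mod (H d) F \<longrightarrow> kills M F" by (elim exE)
  obtain S where S: "finite S" "S \<subseteq> H d" "\<forall>h\<in>H d. \<exists>s\<in>S. \<exists>c\<in>H (Suc d). h = c \<otimes> s"
    using H_fin[of d] by (elim exE conjE)
  \<comment> \<open>B holds the representatives under which F need not be invariant. For empty B the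
    function is invariant under \<open>H d\<close>, so the bound M of the outer induction
    applies.\<close>
  have "\<exists>M. \<forall>F. inv_mod (H (Suc d)) F \<longrightarrow> inv_mod (S - B) F \<longrightarrow> kills M F" if "finite B" "B \<subseteq> S" for B
    using that
  proof (induction B rule: finite_induct)
    case empty
    have "inv_mod (H d) F" if F: "inv_mod (H (Suc d)) F" "inv_mod S F" for F :: "'a \<Rightarrow> 'p padic"
      unfolding inv_mod_def
    proof (intro ballI)
      fix h x assume h: "h \<in> H d" and x: "x \<in> carrier G"
      then obtain s c where s: "s \<in> S" and c: "c \<in> H (Suc d)" and hc: "h = c \<otimes> s" using S(3) by blast
      have cc: "c \<in> carrier G" "s \<in> carrier G" using H_closed c s S(2) by auto
      have "padic_p dvd F (c \<otimes> (s \<otimes> x)) - F (s \<otimes> x)" using inv_modD[OF F(1) c] cc x by simp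
      from dvd_diff_trans[OF this inv_modD[OF F(2) s x]]
      show "padic_p dvd F (h \<otimes> x) - F x" using cc x by (simp add: hc m_assoc)
    qed
    then show ?case using M by auto
  next
    case (insert s B)
    then have sS: "s \<in> S" and sH: "s \<in> H d" using S(2) by auto
    have "B \<subseteq> S" using insert.prems by simp
    then obtain M' where M': "\<forall>F. inv_mod (H (Suc d)) F \<longrightarrow> inv_mod (S - B) F \<longrightarrow> kills M' F"
      using insert.IH by (elim meta_impE exE)
    \<comment> \<open>Induction on the order i of nilpotency of s - 1 on F. If (s - 1)^(i+1) kills
      F, then (s - 1)^i F is invariant under s and is killed by any block of M' differences; after
      such a block, (s - 1)^i kills F already.\<close>
    have step: "kills (i * M') F"
      if "inv_mod (H (Suc d)) F" "inv_mod (S - insert s B) F"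
        "\<And>x. x \<in> carrier G \<Longrightarrow> padic_p dvd Dif G (replicate i s) F x" for i F
      using that
    proof (induction i arbitrary: F)
      case 0
      show ?case unfolding kills_def
        by (intro allI impI ballI Dif_dvd) (use 0(3) in auto)
    next
      case (Suc i)
      show ?case
        unfolding kills_def
      proof (intro allI impI ballI)
        fix hs x assume hs: "set hs \<subseteq> carrier G" "Suc i * M' \<le> length hs" and x: "x \<in> carrier G"
        define h1 h2 where "h1 = take M' hs" and "h2 = drop M' hs"
        have h: "set h1 \<subseteq> carrier G" "set h2 \<subseteq> carrier G" "hs = h1 @ h2" "M' \<le> length h1" "i * M' \<le> length h2"
          using hs set_take_subset[of M' hs] set_drop_subset[of M' hs] by (auto simp: h1_def h2_def)
        let ?E = "Dif G (replicate i s) F"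
        have sc: "set (replicate k s) \<subseteq> carrier G" for k using H_closed[OF sH] by auto
        have E1: "inv_mod (H (Suc d)) ?E" by (intro inv_mod_Dif[OF Suc.prems(1,1) H_Suc sc])
        have "inv_mod {s} ?E"
          unfolding inv_mod_def
        proof (intro ballI)
          fix h y assume hy: "h \<in> {s}" "y \<in> carrier G"
          have "Dif G (replicate i s @ [s]) F y = ?E (s \<otimes> y) - ?E y" by (simp add: Dif_append)
          moreover have "replicate i s @ [s] = replicate (Suc i) s" by (simp add: replicate_append_same)
          ultimately show "padic_p dvd ?E (h \<otimes> y) - ?E y" using Suc.prems(3)[OF hy(2)] hy(1) by simp
        qed
        moreover have "inv_mod (S - insert s B) ?E"
          by (rule inv_mod_Dif[OF Suc.prems(1,2) _ sc]) (use S(2) in auto)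
        moreover have "S - B \<subseteq> {s} \<union> (S - insert s B)" by auto
        ultimately have "inv_mod (S - B) ?E" using inv_mod_Un inv_mod_subset by blast
        then have "kills M' ?E" using M' E1 by blast
        then have k1: "padic_p dvd Dif G h1 ?E y" if "y \<in> carrier G" for y
          using that h unfolding kills_def by blast
        have "kills (i * M') (Dif G h1 F)"
        proof (rule Suc.IH)
          show "inv_mod (H (Suc d)) (Dif G h1 F)" by (rule inv_mod_Dif[OF Suc.prems(1,1) H_Suc h(1)])
          show "inv_mod (S - insert s B) (Dif G h1 F)"
            by (rule inv_mod_Dif[OF Suc.prems(1,2) _ h(1)]) (use S(2) in auto)
          fix y assume y: "y \<in> carrier G"
          have "padic_p dvd Dif G (replicate i s) (Dif G h1 F) y - Dif G h1 ?E y"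
            by (rule Dif_commute_replicate[OF Suc.prems(1) sH h(1) y])
          from dvd_add[OF this k1[OF y]] show "padic_p dvd Dif G (replicate i s) (Dif G h1 F) y" by simp
        qed
        then show "padic_p dvd Dif G hs F x" using h x unfolding kills_def h(3) Dif_append by blast
      qed
    qed
    have "kills (CARD('p) * M') F" if F: "inv_mod (H (Suc d)) F" "inv_mod (S - insert s B) F" for F
      by (rule step[OF F Dif_p_power[OF F(1) sH]])
    then show ?case by blast
  qed
  from this[of S] show ?case using S(1) unfolding kills_def by (auto simp: inv_mod_def)
qed

end

section \<open>The pro-p Iwahori group\<close>

lemma mat_mult_entry:
  assumes "A \<in> carrier_mat n n" "B \<in> carrier_mat n n" "i < n" "j < n"
  shows "(A * B) $$ (i, j) = (\<Sum>l<n. A $$ (i, l) * B $$ (l, j))"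
  using assms by (simp add: scalar_prod_def atLeast0LessThan)

lemma int_div_less:
  fixes x m n :: int
  assumes "0 < n" "x < m * n" shows "x div n < m"
proof (rule ccontr)
  assume "\<not> x div n < m"
  then have "m * n \<le> (x div n) * n" using assms(1) by (simp add: mult_right_mono)
  moreover have "x = (x div n) * n + x mod n" by simp
  moreover have "0 \<le> x mod n" using assms(1) by simp
  ultimately show False using assms(2) by linarith
qed

text \<open>Subadditivity of the ceiling of x / n, in the form (x + n - 1) div n. It is the reason
  why the filtration \<open>Md\<close> is multiplicative.\<close>

lemma ceiling_div_add_le:
  fixes x y :: int
  assumes "0 < n"
  shows "(x + y + n - 1) div n \<le> (x + n - 1) div n + (y + n - 1) div n"
proof -
  have le: "z \<le> n * ((z + n - 1) div n)" for z
  proof -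
    have "(z + n - 1) mod n < n" using assms by simp
    moreover have "z + n - 1 = n * ((z + n - 1) div n) + (z + n - 1) mod n" by simp
    ultimately show ?thesis by linarith
  qed
  have "x + y + n - 1 < n * ((x + n - 1) div n + (y + n - 1) div n + 1)"
    using le[of x] le[of y] by (simp add: distrib_left)
  then have "(x + y + n - 1) div n < (x + n - 1) div n + (y + n - 1) div n + 1"
    using assms by (intro int_div_less) (simp_all add: mult.commute)
  then show ?thesis by simp
qed

lemma x_mat_carrier [simp]: "x_mat n \<gamma> t \<in> carrier_mat n n"
  by (simp add: x_mat_def)

lemma x_mat_index:
  "i < n \<Longrightarrow> j < n \<Longrightarrow> x_mat n \<gamma> t $$ (i, j) = (if i = j then 1 else 0) + (if (i, j) = \<gamma> then t else 0)"
  by (simp add: x_mat_def)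

lemma h_mat_carrier [simp]: "h_mat n \<delta> l \<in> carrier_mat n n"
  by (simp add: h_mat_def)

lemma h_mat_index:
  "i < n \<Longrightarrow> j < n \<Longrightarrow> h_mat n \<delta> l $$ (i, j) =
    (if i \<noteq> j then 0 else if i = fst \<delta> then l else if i = snd \<delta> then inverse l else 1)"
  by (simp add: h_mat_def)

lemma det_x_mat:
  assumes "i \<noteq> j" shows "det (x_mat n (i, j) t) = (1 :: 'a::comm_ring_1)"
proof -
  have "x_mat n (i, j) t = addrow_mat n t i j"
    using assms by (intro eq_matI) (auto simp: x_mat_index carrier_matD[OF x_mat_carrier])
  then show ?thesis using assms by (simp add: det_addrow_mat)
qed

lemma det_h_mat:
  fixes l :: "'p::prime_card padic"
  assumes "c + 1 < n" "\<not> padic_p dvd l"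
  shows "det (h_mat n (c, c + 1) l) = 1"
proof -
  have "det (h_mat n (c, c + 1) l) = (\<Prod>i\<in>{0..<n}. h_mat n (c, c + 1) l $$ (i, i))"
    using det_upper_triangular[of "h_mat n (c, c + 1) l" n] prod_list_diag_prod[of "h_mat n (c, c + 1) l"]
    by (auto simp: upper_triangular_def h_mat_index carrier_matD[OF h_mat_carrier])
  also have "\<dots> = (\<Prod>i\<in>{0..<n}. (if i = c then l else 1) * (if i = c + 1 then inverse l else 1))"
    by (rule prod.cong) (auto simp: h_mat_index)
  also have "\<dots> = l * inverse l" using assms(1) by (simp add: prod.distrib)
  finally show ?thesis using padic_inverse[OF assms(2)] by (simp add: mult.commute)
qed

lemma minus_one_mult:
  fixes a b :: "'a::comm_ring_1 mat"
  assumes "a \<in> carrier_mat n n" "b \<in> carrier_mat n n"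
  shows "(a - 1\<^sub>m n) * b = a * b - b" "b * (a - 1\<^sub>m n) = b * a - b"
  using minus_mult_distrib_mat[of a n n "1\<^sub>m n" b n] mult_minus_distrib_mat[of b n n a n "1\<^sub>m n"] assms
  by simp_all

section \<open>The filtration by powers of the radical of the Iwahori order\<close>

locale iwahori_setting =
  fixes n :: nat and pt :: "'p::prime_card itself"
  assumes n_ge_2: "2 \<le> n" and p_gt: "n + 1 < CARD('p)"
begin

abbreviation G :: "'p padic mat monoid" where "G \<equiv> iwahori n"
abbreviation GT :: "'p padic mat topology" where "GT \<equiv> iwahori_topology n"

text \<open>The ceiling of (d + i - j) / n, cut off at 0. For d \<ge> 0, \<open>Md d\<close> is the
  d-th power of the radical of the order of matrices that are upper triangular modulo p. Negative d
  are allowed so that every matrix lies in \<open>Md (- int n)\<close>.\<close>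

definition mexp :: "int \<Rightarrow> nat \<Rightarrow> nat \<Rightarrow> nat" where
  "mexp d i j = nat ((d + (int i - int j) + int n - 1) div int n)"

definition Md :: "int \<Rightarrow> 'p padic mat set" where
  "Md d = {a \<in> carrier_mat n n. \<forall>i<n. \<forall>j<n. padic_p ^ mexp d i j dvd a $$ (i, j)}"

lemma n_pos: "0 < int n" using n_ge_2 by simp

lemma Md_carrier: "a \<in> Md d \<Longrightarrow> a \<in> carrier_mat n n"
  by (simp add: Md_def)

lemma mexp_add: "mexp (d + e) i j \<le> mexp d i l + mexp e l j"
proof -
  have "(d + e + (int i - int j) + int n - 1) div int n \<le>
      (d + (int i - int l) + int n - 1) div int n + (e + (int l - int j) + int n - 1) div int n"
    using ceiling_div_add_le[OF n_pos, of "d + (int i - int l)" "e + (int l - int j)"]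
    by (simp add: algebra_simps)
  then show ?thesis unfolding mexp_def by linarith
qed

lemma mexp_mono: "d \<le> e \<Longrightarrow> mexp d i j \<le> mexp e i j"
  unfolding mexp_def by (intro nat_mono zdiv_mono1) (use n_pos in auto)

lemma mexp_Suc: "mexp (d + 1) i j \<le> mexp d i j + 1"
  using mexp_add[of d 1 i j j] n_pos by (simp add: mexp_def[of 1 j j])

lemma Md_mult:
  assumes "a \<in> Md d" "b \<in> Md e" shows "a * b \<in> Md (d + e)"
proof -
  have c: "a \<in> carrier_mat n n" "b \<in> carrier_mat n n" using assms Md_carrier by auto
  have "padic_p ^ mexp (d + e) i j dvd (a * b) $$ (i, j)" if "i < n" "j < n" for i j
    unfolding mat_mult_entry[OF c that]
  proof (rule dvd_sum)
    fix l assume "l \<in> {..<n}"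
    then have "padic_p ^ mexp d i l * padic_p ^ mexp e l j dvd a $$ (i, l) * b $$ (l, j)"
      using assms that by (intro mult_dvd_mono) (auto simp: Md_def)
    then show "padic_p ^ mexp (d + e) i j dvd a $$ (i, l) * b $$ (l, j)"
      using dvd_trans[OF le_imp_power_dvd[OF mexp_add[of d e i j l]]] by (simp add: power_add)
  qed
  then show ?thesis using c by (auto simp: Md_def)
qed

lemma Md_mono: "d \<le> e \<Longrightarrow> a \<in> Md e \<Longrightarrow> a \<in> Md d"
  unfolding Md_def by (auto intro: power_le_dvd[OF _ mexp_mono])

lemma Md_add: "a \<in> Md d \<Longrightarrow> b \<in> Md d \<Longrightarrow> a + b \<in> Md d"
  by (auto simp: Md_def)

lemma Md_diff: "a \<in> Md d \<Longrightarrow> b \<in> Md d \<Longrightarrow> a - b \<in> Md d"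
  by (auto simp: Md_def)

lemma Md_zero: "0\<^sub>m n n \<in> Md d"
  by (auto simp: Md_def)

lemma Md_one: "1\<^sub>m n \<in> Md 0"
proof -
  have "mexp 0 i i = 0" for i using n_pos by (simp add: mexp_def)
  then show ?thesis by (auto simp: Md_def one_mat_def)
qed

lemma Md_low: "a \<in> carrier_mat n n \<Longrightarrow> a \<in> Md (- int n)"
proof -
  have "mexp (- int n) i j = 0" if "i < n" for i j
  proof -
    have "(- int n + (int i - int j) + int n - 1) div int n < 1"
      using that n_pos by (intro int_div_less) auto
    then show ?thesis by (simp add: mexp_def)
  qed
  then show "a \<in> carrier_mat n n \<Longrightarrow> a \<in> Md (- int n)" by (auto simp: Md_def)
qed

lemma mexp_1: "i < n \<Longrightarrow> j < n \<Longrightarrow> mexp 1 i j = (if j \<le> i then 1 else 0)"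
proof -
  assume ij: "i < n" "j < n"
  show "mexp 1 i j = (if j \<le> i then 1 else 0)"
  proof (cases "j \<le> i")
    case True
    have "1 + (int i - int j) + int n - 1 = (int i - int j) + int n" by simp
    then have "(1 + (int i - int j) + int n - 1) div int n = (int i - int j) div int n + 1"
      using n_pos by (simp only: div_add_self2)
    also have "(int i - int j) div int n = 0" using True ij by (intro div_pos_pos_trivial) auto
    finally have "(1 + (int i - int j) + int n - 1) div int n = 1" by simp
    then show ?thesis using True by (simp add: mexp_def)
  next
    case False
    then have "(1 + (int i - int j) + int n - 1) div int n = 0"
      using ij by (intro div_pos_pos_trivial) auto
    then show ?thesis using False by (simp add: mexp_def)
  qed
qed

text \<open>Together with \<open>Md_dvd_all\<close> this makes the radical filtration and the
  congruence filtration cofinal, so that both define the same topology.\<close>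

lemma Md_all_dvd:
  assumes "a \<in> carrier_mat n n" "\<And>i j. i < n \<Longrightarrow> j < n \<Longrightarrow> padic_p ^ (d + 1) dvd a $$ (i, j)"
  shows "a \<in> Md (int d)"
proof -
  have "mexp (int d) i j \<le> d + 1" if "i < n" for i j
  proof -
    have "int d \<le> int d * int n" using n_pos by (simp add: mult_le_cancel_left1)
    then have "int d + (int i - int j) + int n - 1 < (int d + 2) * int n"
      using that by (simp add: algebra_simps)
    then have "(int d + (int i - int j) + int n - 1) div int n < int d + 2"
      using n_pos by (intro int_div_less)
    then show ?thesis unfolding mexp_def by linarith
  qed
  then have "padic_p ^ mexp (int d) i j dvd a $$ (i, j)" if "i < n" "j < n" for i j
    using power_le_dvd[OF assms(2)[OF that]] that by simp
  then show ?thesis using assms(1) by (simp add: Md_def)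
qed

lemma Md_dvd_all:
  assumes "a \<in> Md (int (n * k))" "i < n" "j < n"
  shows "padic_p ^ k dvd a $$ (i, j)"
proof -
  have "int k = (int k * int n) div int n" using n_pos by simp
  also have "\<dots> \<le> (int (n * k) + (int i - int j) + int n - 1) div int n"
    using n_pos assms(3) by (intro zdiv_mono1) (auto simp: mult.commute)
  finally have "k \<le> mexp (int (n * k)) i j" unfolding mexp_def by linarith
  moreover have "padic_p ^ mexp (int (n * k)) i j dvd a $$ (i, j)" using assms by (simp add: Md_def)
  ultimately show ?thesis by (rule power_le_dvd[rotated])
qed

lemma iwahori_carrier_iff:
  "g \<in> carrier G \<longleftrightarrow> g \<in> carrier_mat n n \<and> det g = 1 \<and> g - 1\<^sub>m n \<in> Md 1"
proof -
  have "(\<forall>i<n. padic_p dvd g $$ (i, i) - 1) \<and> (\<forall>i<n. \<forall>j<i. padic_p dvd g $$ (i, j)) \<longleftrightarrow> g - 1\<^sub>m n \<in> Md 1"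
    if g: "g \<in> carrier_mat n n"
  proof -
    have "g - 1\<^sub>m n \<in> Md 1 \<longleftrightarrow> (\<forall>i<n. \<forall>j<n. j \<le> i \<longrightarrow> padic_p dvd g $$ (i, j) - 1\<^sub>m n $$ (i, j))"
      using g by (auto simp: Md_def mexp_1)
    also have "\<dots> \<longleftrightarrow> (\<forall>i<n. padic_p dvd g $$ (i, i) - 1) \<and> (\<forall>i<n. \<forall>j<i. padic_p dvd g $$ (i, j))"
    proof (intro iffI conjI allI impI)
      fix i j assume *: "\<forall>i<n. \<forall>j<n. j \<le> i \<longrightarrow> padic_p dvd g $$ (i, j) - 1\<^sub>m n $$ (i, j)" and i: "i < n"
      from *[rule_format, OF i i] show "padic_p dvd g $$ (i, i) - 1" using i by simp
      assume "j < i"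
      then show "padic_p dvd g $$ (i, j)" using *[rule_format, OF i, of j] i by simp
    next
      fix i j assume *: "(\<forall>i<n. padic_p dvd g $$ (i, i) - 1) \<and> (\<forall>i<n. \<forall>j<i. padic_p dvd g $$ (i, j))"
        and ij: "i < n" "j < n" "j \<le> i"
      show "padic_p dvd g $$ (i, j) - 1\<^sub>m n $$ (i, j)"
        using * ij by (cases "j = i") auto
    qed
    finally show ?thesis by simp
  qed
  then show ?thesis unfolding iwahori_def by auto
qed

lemma G_simps [simp]: "x \<otimes>\<^bsub>G\<^esub> y = x * y" "\<one>\<^bsub>G\<^esub> = 1\<^sub>m n"
  by (simp_all add: iwahori_def)

lemma G_mat: "g \<in> carrier G \<Longrightarrow> g \<in> carrier_mat n n"
  by (simp add: iwahori_carrier_iff)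

lemma G_Md0:
  assumes "g \<in> carrier G" shows "g \<in> Md 0"
proof -
  have "g = (g - 1\<^sub>m n) + 1\<^sub>m n" using G_mat[OF assms] by (intro eq_matI) auto
  moreover have "(g - 1\<^sub>m n) + 1\<^sub>m n \<in> Md 0"
    using assms by (intro Md_add Md_one Md_mono[of 0 1]) (auto simp: iwahori_carrier_iff)
  ultimately show ?thesis by simp
qed

lemma mult_minus_one:
  fixes g h :: "'p padic mat"
  assumes "g \<in> carrier_mat n n" "h \<in> carrier_mat n n"
  shows "g * h - 1\<^sub>m n = (g - 1\<^sub>m n) * h + (h - 1\<^sub>m n)"
proof -
  have "(g - 1\<^sub>m n) * h = g * h - h" by (rule minus_one_mult[OF assms])
  then show ?thesis using assms by (intro eq_matI) auto
qed

text \<open>The adjugate b is only known to be integral, that is, in \<open>Md (- int n)\<close>.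
  The identity b = 1 - (g - 1) b improves its depth by one at a time until depth 0 is reached, and
  once more gives b - 1 in \<open>Md 1\<close>.\<close>

lemma G_inverse:
  assumes g: "g \<in> carrier G"
  obtains b where "b \<in> carrier G" "b * g = 1\<^sub>m n" "g * b = 1\<^sub>m n"
proof
  have gc: "g \<in> carrier_mat n n" and dg: "det g = 1" and g1: "g - 1\<^sub>m n \<in> Md 1"
    using g by (auto simp: iwahori_carrier_iff)
  let ?b = "adj_mat g"
  have bc: "?b \<in> carrier_mat n n" and gb: "g * ?b = 1\<^sub>m n" and bg: "?b * g = 1\<^sub>m n"
    using adj_mat[OF gc] dg by auto
  have eq: "?b = 1\<^sub>m n - (g - 1\<^sub>m n) * ?b"
  proof -
    have "(g - 1\<^sub>m n) * ?b = 1\<^sub>m n - ?b"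
      using minus_one_mult(1)[OF gc bc] gb by simp
    then show ?thesis using bc by (intro eq_matI) auto
  qed
  have "?b \<in> Md (- int n + int k)" if "k \<le> n" for k
    using that
  proof (induction k)
    case 0
    then show ?case using Md_low[OF bc] by simp
  next
    case (Suc k)
    have "(g - 1\<^sub>m n) * ?b \<in> Md (1 + (- int n + int k))" using Suc by (intro Md_mult g1) simp
    then have "(g - 1\<^sub>m n) * ?b \<in> Md (- int n + int (Suc k))" by (simp add: add_ac)
    then have "1\<^sub>m n - (g - 1\<^sub>m n) * ?b \<in> Md (- int n + int (Suc k))"
      using Suc.prems by (intro Md_diff Md_mono[OF _ Md_one]) auto
    then show ?case using eq by simp
  qed
  from this[of n] have b0: "?b \<in> Md 0" by simp
  have "?b - 1\<^sub>m n = 0\<^sub>m n n - (g - 1\<^sub>m n) * ?b"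
    unfolding minus_one_mult(1)[OF gc bc] gb using bc by (intro eq_matI) auto
  also have "\<dots> \<in> Md 1" using Md_mult[OF g1 b0] by (intro Md_diff Md_zero) simp
  finally have "?b - 1\<^sub>m n \<in> Md 1" .
  moreover have "det ?b = 1" using det_mult[OF gc bc] gb dg by simp
  ultimately show "?b \<in> carrier G" using bc by (simp add: iwahori_carrier_iff)
  show "?b * g = 1\<^sub>m n" "g * ?b = 1\<^sub>m n" by fact+
qed

lemma G_mult_closed:
  assumes "g \<in> carrier G" "h \<in> carrier G" shows "g * h \<in> carrier G"
proof -
  have c: "g \<in> carrier_mat n n" "h \<in> carrier_mat n n" using assms G_mat by auto
  have "(g - 1\<^sub>m n) * h \<in> Md (1 + 0)" using assms G_Md0 by (intro Md_mult) (auto simp: iwahori_carrier_iff)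
  then have "g * h - 1\<^sub>m n \<in> Md 1"
    unfolding mult_minus_one[OF c] using assms by (intro Md_add) (auto simp: iwahori_carrier_iff)
  then show ?thesis using assms c det_mult[OF c] by (auto simp: iwahori_carrier_iff)
qed

lemma G_one: "1\<^sub>m n \<in> carrier G"
proof -
  have "1\<^sub>m n - 1\<^sub>m n \<in> Md 1" by (auto simp: Md_def)
  then show ?thesis by (simp add: iwahori_carrier_iff)
qed

lemma G_group: "group G"
proof (rule groupI)
  fix x y z assume "x \<in> carrier G" "y \<in> carrier G" "z \<in> carrier G"
  then show "x \<otimes>\<^bsub>G\<^esub> y \<otimes>\<^bsub>G\<^esub> z = x \<otimes>\<^bsub>G\<^esub> (y \<otimes>\<^bsub>G\<^esub> z)"
    using assoc_mult_mat[OF G_mat G_mat G_mat] by simp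
next
  fix x assume x: "x \<in> carrier G"
  show "\<exists>y\<in>carrier G. y \<otimes>\<^bsub>G\<^esub> x = \<one>\<^bsub>G\<^esub>" using G_inverse[OF x] by (metis G_simps)
  show "\<one>\<^bsub>G\<^esub> \<otimes>\<^bsub>G\<^esub> x = x" using G_mat[OF x] by simp
qed (auto simp: G_mult_closed G_one)

sublocale G: group G by (rule G_group)

lemma G_inv: "g \<in> carrier G \<Longrightarrow> inv\<^bsub>G\<^esub> g * g = 1\<^sub>m n" "g \<in> carrier G \<Longrightarrow> g * inv\<^bsub>G\<^esub> g = 1\<^sub>m n"
  using G.l_inv[of g] G.r_inv[of g] by simp_all

text \<open>The index is shifted by one so that \<open>H 0\<close> is the whole group.\<close>

definition H :: "nat \<Rightarrow> 'p padic mat set" where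
  "H d = {g \<in> carrier G. g - 1\<^sub>m n \<in> Md (int d + 1)}"

lemma H_G: "h \<in> H d \<Longrightarrow> h \<in> carrier G"
  by (simp add: H_def)

lemma H_mono: "d \<le> e \<Longrightarrow> H e \<subseteq> H d"
  unfolding H_def using Md_mono[of "int d + 1" "int e + 1"] by auto

lemma H_quotient:
  assumes "g \<in> carrier G" "h \<in> carrier G" "g - h \<in> Md (int d + 1)"
  shows "g * inv\<^bsub>G\<^esub> h \<in> H d"
proof -
  have c: "g \<in> carrier_mat n n" "h \<in> carrier_mat n n" "inv\<^bsub>G\<^esub> h \<in> carrier_mat n n" using assms G_mat by auto
  have "g * inv\<^bsub>G\<^esub> h - 1\<^sub>m n = (g - h) * inv\<^bsub>G\<^esub> h"
    using minus_mult_distrib_mat[OF c(1,2,3)] G_inv(2)[OF assms(2)] by simp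
  moreover have "(g - h) * inv\<^bsub>G\<^esub> h \<in> Md (int d + 1 + 0)"
    using assms by (intro Md_mult G_Md0) auto
  ultimately show ?thesis using assms G_mult_closed[of g "inv\<^bsub>G\<^esub> h"] by (simp add: H_def)
qed

lemma H_quotient_eq:
  assumes "g \<in> carrier G" "h \<in> carrier G"
  shows "g = (g * inv\<^bsub>G\<^esub> h) * h"
  using assms G.m_assoc[of g "inv\<^bsub>G\<^esub> h" h] G_inv(1)[OF assms(2)] G_mat[OF assms(1)] by simp

lemma H_subgroup: "subgroup (H d) G"
proof
  show "H d \<subseteq> carrier G" by (auto simp: H_def)
  show "\<one>\<^bsub>G\<^esub> \<in> H d"
  proof -
    have "1\<^sub>m n - 1\<^sub>m n \<in> Md (int d + 1)" by (auto simp: Md_def)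
    then show ?thesis using G_one by (simp add: H_def)
  qed
  show "x \<otimes>\<^bsub>G\<^esub> y \<in> H d" if xy: "x \<in> H d" "y \<in> H d" for x y
  proof -
    have "(x - 1\<^sub>m n) * y \<in> Md (int d + 1 + 0)" using xy by (intro Md_mult G_Md0) (auto simp: H_def)
    then have "(x - 1\<^sub>m n) * y + (y - 1\<^sub>m n) \<in> Md (int d + 1)" using xy by (intro Md_add) (simp_all add: H_def)
    then have "x * y - 1\<^sub>m n \<in> Md (int d + 1)"
      using mult_minus_one[OF G_mat[OF H_G[OF xy(1)]] G_mat[OF H_G[OF xy(2)]]] by simp
    then show ?thesis using xy G_mult_closed[of x y] by (simp add: H_def)
  qed
  show "inv\<^bsub>G\<^esub> x \<in> H d" if x: "x \<in> H d" for x
  proof -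
    have xc: "x \<in> carrier_mat n n" "x \<in> carrier G" using x H_G G_mat by auto
    have "1\<^sub>m n - x = 0\<^sub>m n n - (x - 1\<^sub>m n)" using xc by (intro eq_matI) auto
    moreover have "0\<^sub>m n n - (x - 1\<^sub>m n) \<in> Md (int d + 1)" using x by (intro Md_diff[OF Md_zero]) (simp add: H_def)
    ultimately have "1\<^sub>m n * inv\<^bsub>G\<^esub> x \<in> H d" by (intro H_quotient G_one xc(2)) simp
    then show ?thesis using G_mat[of "inv\<^bsub>G\<^esub> x"] xc(2) by simp
  qed
qed

text \<open>The difference g h - h g equals (g - 1)(h - 1) - (h - 1)(g - 1), a combination of
  products of depths 1 and d + 1.\<close>

lemma commutator_H:
  assumes "g \<in> carrier G" "h \<in> H d"
  shows "\<exists>c\<in>H (Suc d). g \<otimes>\<^bsub>G\<^esub> h = c \<otimes>\<^bsub>G\<^esub> (h \<otimes>\<^bsub>G\<^esub> g)"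
proof -
  have hG: "h \<in> carrier G" using assms H_G by blast
  have c: "g \<in> carrier_mat n n" "h \<in> carrier_mat n n" using assms hG G_mat by auto
  have e: "(a - 1\<^sub>m n) * (b - 1\<^sub>m n) = (a * b - a) - (b - 1\<^sub>m n)"
    if "a \<in> carrier_mat n n" "b \<in> carrier_mat n n" for a b :: "'p padic mat"
    using minus_one_mult(1)[OF that(1) minus_carrier_mat[OF one_carrier_mat], of b] minus_one_mult(2)[OF that(2,1)]
    by simp
  have "g * h - h * g = (g - 1\<^sub>m n) * (h - 1\<^sub>m n) - (h - 1\<^sub>m n) * (g - 1\<^sub>m n)"
    unfolding e[OF c] e[OF c(2,1)] using c by (intro eq_matI) auto
  moreover have "(g - 1\<^sub>m n) * (h - 1\<^sub>m n) \<in> Md (1 + (int d + 1))"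
    using assms by (intro Md_mult) (auto simp: H_def iwahori_carrier_iff)
  moreover have "(h - 1\<^sub>m n) * (g - 1\<^sub>m n) \<in> Md ((int d + 1) + 1)"
    using assms by (intro Md_mult) (auto simp: H_def iwahori_carrier_iff)
  ultimately have "g * h - h * g \<in> Md (int (Suc d) + 1)" by (simp add: Md_diff add_ac)
  then have "(g * h) * inv\<^bsub>G\<^esub> (h * g) \<in> H (Suc d)"
    by (intro H_quotient G_mult_closed assms(1) hG)
  moreover have "g * h = ((g * h) * inv\<^bsub>G\<^esub> (h * g)) * (h * g)"
    by (intro H_quotient_eq G_mult_closed assms(1) hG)
  ultimately show ?thesis by (metis G_simps(1))
qed

lemma H_normal: "H d \<lhd> G"
proof (rule G.normal_invI[OF H_subgroup])
  fix g h assume g: "g \<in> carrier G" and h: "h \<in> H d"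
  obtain c where c: "c \<in> H (Suc d)" "g \<otimes>\<^bsub>G\<^esub> h = c \<otimes>\<^bsub>G\<^esub> (h \<otimes>\<^bsub>G\<^esub> g)" using commutator_H[OF g h] by blast
  have cG: "c \<in> carrier G" "h \<in> carrier G" using H_G c(1) h by auto
  have "g \<otimes>\<^bsub>G\<^esub> h \<otimes>\<^bsub>G\<^esub> inv\<^bsub>G\<^esub> g = c \<otimes>\<^bsub>G\<^esub> h"
    unfolding c(2) using cG g by (simp add: G.m_assoc del: G_simps)
  then show "g \<otimes>\<^bsub>G\<^esub> h \<otimes>\<^bsub>G\<^esub> inv\<^bsub>G\<^esub> g \<in> H d"
    using subgroup.m_closed[OF H_subgroup _ h, of c] c(1) H_mono[of d "Suc d"] by auto
qed

text \<open>Up to products (h^i - 1)(h - 1) of depth 2 d + 2, the power h^r is 1 + r (h - 1). For r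
  = p the linear term gains a step as well, since one more factor p raises every exponent by
  one.\<close>

lemma H_power:
  assumes h: "h \<in> H d" shows "h [^]\<^bsub>G\<^esub> CARD('p) \<in> H (Suc d)"
proof -
  let ?a = "h - 1\<^sub>m n"
  have hG: "h \<in> carrier G" and a: "?a \<in> Md (int d + 1)" using h by (simp_all add: H_def)
  have hc: "h \<in> carrier_mat n n" by (rule G_mat[OF hG])
  have "h [^]\<^bsub>G\<^esub> r - 1\<^sub>m n - of_nat r \<cdot>\<^sub>m ?a \<in> Md (int (Suc d) + 1)" for r :: nat
  proof (induction r)
    case 0
    have "h [^]\<^bsub>G\<^esub> (0::nat) - 1\<^sub>m n - of_nat 0 \<cdot>\<^sub>m ?a = 0\<^sub>m n n" using hc by (intro eq_matI) auto
    then show ?case by (simp add: Md_zero)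
  next
    case (Suc r)
    let ?P = "h [^]\<^bsub>G\<^esub> r"
    have PH: "?P \<in> H d" using G.subgroup_int_pow_closed[OF H_subgroup h, of "int r"] by (simp add: int_pow_int)
    then have Pc: "?P \<in> carrier_mat n n" by (rule G_mat[OF H_G])
    have "(?P - 1\<^sub>m n) * ?a \<in> Md ((int d + 1) + (int d + 1))"
      using PH a by (intro Md_mult) (auto simp: H_def)
    then have 1: "(?P - 1\<^sub>m n) * ?a \<in> Md (int (Suc d) + 1)" by (rule Md_mono[rotated]) simp
    have 2: "(?P - 1\<^sub>m n) * ?a = (?P * h - ?P) - ?a"
      using minus_one_mult(1)[OF Pc minus_carrier_mat[OF one_carrier_mat], of h] minus_one_mult(2)[OF hc Pc] by simp
    have "h [^]\<^bsub>G\<^esub> Suc r - 1\<^sub>m n - of_nat (Suc r) \<cdot>\<^sub>m ?a =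
        (?P - 1\<^sub>m n - of_nat r \<cdot>\<^sub>m ?a) + (?P - 1\<^sub>m n) * ?a"
      unfolding 2 using Pc hc by (intro eq_matI) (auto simp: algebra_simps)
    then show ?case using Md_add[OF Suc 1] by simp
  qed
  from this[of "CARD('p)"] have 1: "h [^]\<^bsub>G\<^esub> CARD('p) - 1\<^sub>m n - padic_p \<cdot>\<^sub>m ?a \<in> Md (int (Suc d) + 1)" .
  have "padic_p ^ mexp (int d + 1 + 1) i j dvd padic_p * ?a $$ (i, j)" if "i < n" "j < n" for i j
  proof -
    have "padic_p * padic_p ^ mexp (int d + 1) i j dvd padic_p * ?a $$ (i, j)"
      using a that by (intro mult_dvd_mono) (auto simp: Md_def)
    then have "padic_p ^ (mexp (int d + 1) i j + 1) dvd padic_p * ?a $$ (i, j)" by simp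
    then show ?thesis using mexp_Suc by (rule power_le_dvd)
  qed
  then have 2: "padic_p \<cdot>\<^sub>m ?a \<in> Md (int (Suc d) + 1)" using hc by (auto simp: Md_def add_ac)
  have Pc: "h [^]\<^bsub>G\<^esub> CARD('p) \<in> carrier_mat n n" using hG G_mat by simp
  have "h [^]\<^bsub>G\<^esub> CARD('p) - 1\<^sub>m n = (h [^]\<^bsub>G\<^esub> CARD('p) - 1\<^sub>m n - padic_p \<cdot>\<^sub>m ?a) + padic_p \<cdot>\<^sub>m ?a"
    using Pc hc by (intro eq_matI) auto
  then show ?thesis using Md_add[OF 1 2] hG by (simp add: H_def)
qed

text \<open>Matrices whose entries agree modulo p^(d+2) differ by depth d + 1 at least, hence by a
  factor from \<open>H d\<close>; there are finitely many residue patterns.\<close>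

lemma finite_representatives:
  assumes "K \<subseteq> carrier G"
  shows "\<exists>S. finite S \<and> S \<subseteq> K \<and> (\<forall>h\<in>K. \<exists>s\<in>S. \<exists>c\<in>H d. h = c \<otimes>\<^bsub>G\<^esub> s)"
proof -
  let ?I = "{..<n} \<times> {..<n}"
  define rs where "rs g = (\<lambda>ij\<in>?I. residue (g $$ ij) (d + 2))" for g :: "'p padic mat"
  define S where "S = (\<lambda>r. SOME g. g \<in> K \<and> rs g = r) ` (rs ` K)"
  have "rs ` K \<subseteq> PiE ?I (\<lambda>_. {0..<int CARD('p) ^ (d + 2)})"
    unfolding rs_def atLeastLessThan_def atLeast_def lessThan_def
    by (intro image_subsetI restrict_PiE_iff[THEN iffD2] ballI) (simp only: Int_iff mem_Collect_eq residue_range simp_thms)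
  moreover have "finite (PiE ?I (\<lambda>_. {0..<int CARD('p) ^ (d + 2)}))" by (intro finite_PiE) auto
  ultimately have "finite S" unfolding S_def using finite_subset by blast
  have pick: "(SOME g. g \<in> K \<and> rs g = rs h) \<in> K \<and> rs (SOME g. g \<in> K \<and> rs g = rs h) = rs h" if "h \<in> K" for h
    using someI[of "\<lambda>g. g \<in> K \<and> rs g = rs h" h] that by blast
  have "S \<subseteq> K" unfolding S_def using pick by auto
  moreover have "\<exists>s\<in>S. \<exists>c\<in>H d. h = c \<otimes>\<^bsub>G\<^esub> s" if h: "h \<in> K" for h
  proof -
    define s where "s = (SOME g. g \<in> K \<and> rs g = rs h)"
    have s: "s \<in> S" "s \<in> K" "rs s = rs h" using pick[OF h] h unfolding s_def S_def by auto
    have G: "h \<in> carrier G" "s \<in> carrier G" using assms h s by auto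
    have "padic_p ^ (d + 1 + 1) dvd (h - s) $$ (i, j)" if ij: "i < n" "j < n" for i j
    proof -
      have "residue (h $$ (i, j)) (d + 2) = residue (s $$ (i, j)) (d + 2)"
        using fun_cong[OF s(3), of "(i, j)"] ij by (simp add: rs_def)
      then show ?thesis using G_mat[OF G(1)] G_mat[OF G(2)] ij by (simp add: residue_eq_iff)
    qed
    then have "h - s \<in> Md (int (d + 1))"
      by (intro Md_all_dvd minus_carrier_mat G_mat[OF G(2)]) simp_all
    then have "h * inv\<^bsub>G\<^esub> s \<in> H d" by (intro H_quotient G) (simp add: add_ac)
    moreover have "h = (h * inv\<^bsub>G\<^esub> s) \<otimes>\<^bsub>G\<^esub> s" using H_quotient_eq[OF G] by simp
    ultimately show ?thesis using s(1) by blast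
  qed
  ultimately show ?thesis using \<open>finite S\<close> by blast
qed

lemma odd_p: "odd CARD('p)"
  using prime_card[where 'a='p] p_gt n_ge_2 prime_odd_nat by auto

sublocale S: central_p_series G H pt
proof
  show "H 0 = carrier G" by (auto simp: H_def iwahori_carrier_iff)
  show "\<exists>S. finite S \<and> S \<subseteq> H d \<and> (\<forall>h\<in>H d. \<exists>s\<in>S. \<exists>c\<in>H (Suc d). h = c \<otimes>\<^bsub>G\<^esub> s)" for d
    by (rule finite_representatives[OF subgroup.subset[OF H_subgroup]])
  show "H (Suc d) \<subseteq> H d" for d by (rule H_mono) simp
qed (fact H_G commutator_H H_power odd_p)+

lemma H_cong_entries:
  assumes "g \<in> carrier G" "\<And>i j. i < n \<Longrightarrow> j < n \<Longrightarrow> padic_p ^ (d + 2) dvd g $$ (i, j) - 1\<^sub>m n $$ (i, j)"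
  shows "g \<in> H d"
proof -
  have "g - 1\<^sub>m n \<in> Md (int (d + 1))"
    using assms G_mat[OF assms(1)] by (intro Md_all_dvd) auto
  then show ?thesis using assms(1) by (simp add: H_def add_ac)
qed

lemma H_entries:
  assumes "g \<in> H (n * k)" "i < n" "j < n"
  shows "padic_p ^ k dvd g $$ (i, j) - 1\<^sub>m n $$ (i, j)"
proof -
  have "g - 1\<^sub>m n \<in> Md (int (n * k) + 1)" using assms(1) by (simp add: H_def)
  then have "g - 1\<^sub>m n \<in> Md (int (n * k))" by (rule Md_mono[rotated]) simp
  from Md_dvd_all[OF this assms(2,3)] show ?thesis using assms(2,3) by simp
qed

section \<open>Open normal subgroups and finite levels\<close>

lemma H_open: "openin GT (H d)"
proof -
  let ?I = "{..<n} \<times> {..<n}"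
  let ?B = "\<lambda>ij. {y :: 'p padic. padic_p ^ mexp (int d + 1) (fst ij) (snd ij) dvd y - 1\<^sub>m n $$ ij}"
  have "open (?B ij)" for ij
    unfolding open_padic_def residue_eq_iff[symmetric]
    by (auto intro: exI[of _ "mexp (int d + 1) (fst ij) (snd ij)"])
  then have "openin (product_topology (\<lambda>_. euclidean) ?I) (PiE ?I ?B)"
    by (intro openin_PiE_gen[THEN iffD2] disjI2) auto
  moreover have "H d = (\<lambda>g. \<lambda>ij\<in>?I. g $$ ij) -` (PiE ?I ?B) \<inter> carrier G"
  proof (rule Set.set_eqI)
    fix g
    have "g \<in> H d \<longleftrightarrow> g \<in> carrier G \<and> (\<forall>i<n. \<forall>j<n. padic_p ^ mexp (int d + 1) i j dvd g $$ (i, j) - 1\<^sub>m n $$ (i, j))"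
      unfolding H_def Md_def by (simp add: minus_carrier_mat[OF one_carrier_mat])
    also have "(\<forall>i<n. \<forall>j<n. padic_p ^ mexp (int d + 1) i j dvd g $$ (i, j) - 1\<^sub>m n $$ (i, j)) \<longleftrightarrow>
        (\<lambda>ij\<in>?I. g $$ ij) \<in> PiE ?I ?B"
      by (simp only: restrict_PiE_iff split_paired_Ball_Sigma,
          simp only: Ball_def lessThan_iff mem_Collect_eq fst_conv snd_conv)
    finally show "g \<in> H d \<longleftrightarrow> g \<in> (\<lambda>g. \<lambda>ij\<in>?I. g $$ ij) -` (PiE ?I ?B) \<inter> carrier G"
      by (simp only: Int_iff vimage_eq conj_commute)
  qed
  ultimately show ?thesis unfolding iwahori_topology_def openin_pullback_topology by blast
qed

lemma H_open_normal: "H d \<in> open_normal G GT"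
  using H_open H_normal by (simp add: open_normal_def)

text \<open>An open neighbourhood of 1 prescribes finitely many entries to finite precision. The sum
  of the precisions serves all entries, and depth n * k guarantees precision k.\<close>

lemma H_cofinal:
  assumes "N \<in> open_normal G GT" obtains d where "H d \<subseteq> N"
proof -
  let ?I = "{..<n} \<times> {..<n}"
  let ?f = "\<lambda>g :: 'p padic mat. \<lambda>ij\<in>?I. g $$ ij"
  have N: "openin GT N" "N \<lhd> G" using assms by (auto simp: open_normal_def)
  obtain Q where Q: "openin (product_topology (\<lambda>_. euclidean) ?I) Q" "N = ?f -` Q \<inter> carrier G"
    using N(1)[unfolded iwahori_topology_def openin_pullback_topology] by (elim exE conjE)
  have "1\<^sub>m n \<in> N" using subgroup.one_closed[OF normal_imp_subgroup[OF N(2)]] by simp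
  then have f1: "?f (1\<^sub>m n) \<in> Q" using Q(2) by auto
  obtain B where B: "\<forall>i\<in>?I. openin euclidean (B i)" "?f (1\<^sub>m n) \<in> PiE ?I B" "PiE ?I B \<subseteq> Q"
    using bspec[OF iffD1[OF openin_product_topology_alt Q(1)] f1] by (elim exE conjE) (rule that)
  have "\<exists>k. \<forall>y. padic_p ^ k dvd y - 1\<^sub>m n $$ ij \<longrightarrow> y \<in> B ij" if ij: "ij \<in> ?I" for ij
  proof -
    have "open (B ij)" "1\<^sub>m n $$ ij \<in> B ij" using B(1,2) ij by (auto simp: PiE_iff)
    then have "\<exists>k. \<forall>y. residue y k = residue (1\<^sub>m n $$ ij :: 'p padic) k \<longrightarrow> y \<in> B ij"
      unfolding open_padic_def by (rule bspec)
    then show ?thesis by (simp only: residue_eq_iff)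
  qed
  then have "\<exists>K. \<forall>ij\<in>?I. \<forall>y. padic_p ^ K ij dvd y - 1\<^sub>m n $$ ij \<longrightarrow> y \<in> B ij" by (rule bchoice[OF ballI])
  then obtain K where K: "\<forall>ij\<in>?I. \<forall>y. padic_p ^ K ij dvd y - 1\<^sub>m n $$ ij \<longrightarrow> y \<in> B ij" by (elim exE)
  define k where "k = (\<Sum>ij\<in>?I. K ij)"
  have "H (n * k) \<subseteq> N"
  proof
    fix g assume g: "g \<in> H (n * k)"
    have "?f g \<in> PiE ?I B"
    proof (rule restrict_PiE_iff[THEN iffD2], intro ballI)
      fix ij assume ij: "ij \<in> ?I"
      have "K ij \<le> k" unfolding k_def by (rule member_le_sum[OF ij]) auto
      moreover have "padic_p ^ k dvd g $$ ij - 1\<^sub>m n $$ ij" using H_entries[OF g] ij by auto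
      ultimately have "padic_p ^ K ij dvd g $$ ij - 1\<^sub>m n $$ ij" by (rule power_le_dvd[rotated])
      then show "g $$ ij \<in> B ij" using K ij by blast
    qed
    then have "?f g \<in> Q" using B(3) by (rule subsetD[rotated])
    then show "g \<in> N" using H_G[OF g] unfolding Q(2) by (simp only: Int_iff vimage_eq simp_thms)
  qed
  then show ?thesis by (rule that)
qed

lemma open_normal_finite:
  assumes "N \<in> open_normal G GT" shows "finite (rcosets\<^bsub>G\<^esub> N)"
proof -
  obtain d where d: "H d \<subseteq> N" by (rule H_cofinal[OF assms])
  have N: "subgroup N G" using assms normal_imp_subgroup by (auto simp: open_normal_def)
  obtain S where S: "finite S" "S \<subseteq> carrier G" "\<forall>h\<in>carrier G. \<exists>s\<in>S. \<exists>c\<in>H d. h = c \<otimes>\<^bsub>G\<^esub> s"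
    using finite_representatives[OF order_refl, of d] by (elim exE conjE)
  have "rcosets\<^bsub>G\<^esub> N \<subseteq> (\<lambda>s. N #>\<^bsub>G\<^esub> s) ` S"
  proof
    fix C assume "C \<in> rcosets\<^bsub>G\<^esub> N"
    then obtain h where h: "h \<in> carrier G" "C = N #>\<^bsub>G\<^esub> h" by (auto simp: RCOSETS_def)
    then obtain s c where sc: "s \<in> S" "c \<in> H d" "h = c \<otimes>\<^bsub>G\<^esub> s" using S(3) by blast
    then have "c \<in> N" "c \<in> carrier G" "s \<in> carrier G" using d H_G S(2) by auto
    then have "C = N #>\<^bsub>G\<^esub> s"
      unfolding h(2) sc(3) using G.coset_mult_assoc[OF subgroup.subset[OF N], of c s] G.coset_join2[OF _ N, of c]
      by (simp del: G_simps)
    then show "C \<in> (\<lambda>s. N #>\<^bsub>G\<^esub> s) ` S" using sc(1) by blast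
  qed
  then show ?thesis using S(1) finite_surj by blast
qed

sublocale I: iwasawa G GT pt
  by unfold_locales (rule open_normal_finite)

lemma coset_function_inv_mod:
  assumes "N \<in> open_normal G GT" "H d \<subseteq> N"
  shows "G.inv_mod (H d) (\<lambda>x. if N #>\<^bsub>G\<^esub> x = C then 1 else (0 :: 'p padic))"
  unfolding G.inv_mod_def
proof (intro ballI)
  fix h x assume h: "h \<in> H d" and x: "x \<in> carrier G"
  have N: "subgroup N G" using assms(1) normal_imp_subgroup by (auto simp: open_normal_def)
  have "N #>\<^bsub>G\<^esub> (h \<otimes>\<^bsub>G\<^esub> x) = N #>\<^bsub>G\<^esub> x"
    using G.coset_mult_assoc[OF subgroup.subset[OF N] H_G[OF h] x] G.coset_join2[OF H_G[OF h] N] h assms(2)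
    by (auto simp del: G_simps)
  then show "padic_p dvd (if N #>\<^bsub>G\<^esub> (h \<otimes>\<^bsub>G\<^esub> x) = C then 1 else (0 :: 'p padic)) - (if N #>\<^bsub>G\<^esub> x = C then 1 else 0)"
    by simp
qed

text \<open>The indicator of a coset of N is invariant under any \<open>H d\<close> inside N, so
  nilpotency of differences gives the required divisibility of products of elements g - 1.\<close>

sublocale I: iwasawa_pro_p G GT pt
proof
  fix N assume N: "N \<in> open_normal G GT"
  obtain d where d: "H d \<subseteq> N" by (rule H_cofinal[OF N])
  obtain M where M: "\<forall>F :: 'p padic mat \<Rightarrow> 'p padic. G.inv_mod (H d) F \<longrightarrow>
    (\<forall>hs. set hs \<subseteq> carrier G \<longrightarrow> M \<le> length hs \<longrightarrow> (\<forall>x\<in>carrier G. padic_p dvd Dif G hs F x))"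
    using S.Dif_nilpotent[of d] by (elim exE)
  have "\<forall>hs. set hs \<subseteq> carrier G \<longrightarrow> M \<le> length hs \<longrightarrow> (\<forall>C. padic_p dvd I.wl hs N C)"
  proof (intro allI impI)
    fix hs C assume hs: "set hs \<subseteq> carrier G" "M \<le> length hs"
    show "padic_p dvd I.wl hs N C"
      unfolding I.wl_apply[OF hs(1) N] using M coset_function_inv_mod[OF N d, of C] hs G.one_closed by blast
  qed
  then show "\<exists>M. \<forall>hs. set hs \<subseteq> carrier G \<longrightarrow> M \<le> length hs \<longrightarrow> (\<forall>C. (padic_p :: 'p padic) dvd I.wl hs N C)"
    by (rule exI)
qed

section \<open>Generators attached to the variables\<close>

fun gen :: "ivar \<Rightarrow> 'p padic mat" where
  "gen (U \<beta>) = x_mat n \<beta> padic_p"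
| "gen (W \<delta>) = h_mat n \<delta> (1 + padic_p)"
| "gen (V \<alpha>) = x_mat n \<alpha> 1"

lemma Roots_finite: "finite (Roots n)"
  by (rule finite_subset[of _ "{..<n} \<times> {..<n}"]) (auto simp: Roots_def)

lemma finite_ivars: "finite (ivars n)"
  using Roots_finite unfolding ivars_def PosRoots_def NegRoots_def SimpleRoots_def
  by (auto intro: finite_subset)

lemma p_not_dvd_1p: "\<not> padic_p dvd (1 + padic_p :: 'p padic)"
  using p_not_dvd_1[where 'p='p] by (simp add: dvd_add_left_iff)

lemma x_mat_neg_closed: "\<beta> \<in> NegRoots n \<Longrightarrow> x_mat n \<beta> (t * padic_p) \<in> carrier G"
  by (auto simp: iwahori_def NegRoots_def Roots_def det_x_mat x_mat_index)

lemma x_mat_pos_closed: "\<alpha> \<in> PosRoots n \<Longrightarrow> x_mat n \<alpha> t \<in> carrier G"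
  by (auto simp: iwahori_def PosRoots_def Roots_def det_x_mat x_mat_index)

lemma inverse_1_mod_p:
  assumes "padic_p dvd l - (1 :: 'p padic)"
  shows "\<not> padic_p dvd l" "padic_p dvd inverse l - 1"
proof -
  show nd: "\<not> padic_p dvd l"
  proof
    assume "padic_p dvd l"
    from dvd_diff[OF this assms] show False using p_not_dvd_1[where 'p='p] by simp
  qed
  have "inverse l - 1 = - (inverse l * (l - 1))" using padic_inverse[OF nd] by (simp add: algebra_simps)
  then show "padic_p dvd inverse l - 1" using assms by simp
qed

lemma h_mat_closed:
  assumes "\<delta> \<in> SimpleRoots n" "padic_p dvd l - (1 :: 'p padic)"
  shows "h_mat n \<delta> l \<in> carrier G"
proof -
  obtain c where c: "\<delta> = (c, c + 1)" "c + 1 < n" using assms(1) by (auto simp: SimpleRoots_def Roots_def)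
  note i = inverse_1_mod_p[OF assms(2)]
  show ?thesis
    using c i assms(2) det_h_mat[OF c(2) i(1)] by (auto simp: iwahori_def h_mat_index)
qed

lemma gen_closed: "v \<in> ivars n \<Longrightarrow> gen v \<in> carrier G"
  using x_mat_neg_closed[of _ 1] x_mat_pos_closed h_mat_closed unfolding ivars_def by auto

sublocale I: iwasawa_gens G GT pt "ivars n" gen
  by unfold_locales (auto simp: finite_ivars gen_closed)

end

section \<open>The relators vanish modulo p\<close>

lemma x_mat_mult_index:
  fixes B :: "'a::comm_ring_1 mat"
  assumes "B \<in> carrier_mat n n" "i < n" "j < n" "a < n" "b < n"
  shows "(x_mat n (i, j) t * B) $$ (a, b) = B $$ (a, b) + (if a = i then t * B $$ (j, b) else 0)"
proof -
  have "(x_mat n (i, j) t * B) $$ (a, b) =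
      (\<Sum>l<n. (if l = a then B $$ (l, b) else 0) + (if l = j then (if a = i then t * B $$ (l, b) else 0) else 0))"
    unfolding mat_mult_entry[OF x_mat_carrier assms(1,4,5)]
    by (rule sum.cong) (use assms in \<open>auto simp: x_mat_index algebra_simps\<close>)
  also have "\<dots> = B $$ (a, b) + (if a = i then t * B $$ (j, b) else 0)"
    using assms by (simp add: sum.distrib)
  finally show ?thesis .
qed

lemma h_mat_mult_index:
  fixes B :: "'a::{comm_ring_1, inverse} mat"
  assumes "B \<in> carrier_mat n n" "a < n" "b < n"
  shows "(h_mat n \<delta> l * B) $$ (a, b) = h_mat n \<delta> l $$ (a, a) * B $$ (a, b)"
proof -
  have "(h_mat n \<delta> l * B) $$ (a, b) = (\<Sum>k<n. if k = a then h_mat n \<delta> l $$ (a, a) * B $$ (a, b) else 0)"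
    unfolding mat_mult_entry[OF h_mat_carrier assms] by (rule sum.cong) (use assms in \<open>auto simp: h_mat_index\<close>)
  then show ?thesis using assms by simp
qed

lemma mult_h_mat_index:
  fixes B :: "'a::{comm_ring_1, inverse} mat"
  assumes "B \<in> carrier_mat n n" "a < n" "b < n"
  shows "(B * h_mat n \<delta> l) $$ (a, b) = B $$ (a, b) * h_mat n \<delta> l $$ (b, b)"
proof -
  have "(B * h_mat n \<delta> l) $$ (a, b) = (\<Sum>k<n. if k = b then B $$ (a, b) * h_mat n \<delta> l $$ (b, b) else 0)"
    unfolding mat_mult_entry[OF assms(1) h_mat_carrier assms(2,3)]
    by (rule sum.cong) (use assms in \<open>auto simp: h_mat_index\<close>)
  then show ?thesis using assms by simp
qed

lemma mat_eq_carrierI: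
  assumes "A \<in> carrier_mat n n" "B \<in> carrier_mat n n" "\<And>a b. a < n \<Longrightarrow> b < n \<Longrightarrow> A $$ (a, b) = B $$ (a, b)"
  shows "A = B"
  by (rule eq_matI) (use assms in auto)

lemma x_mat_mult_carrier [simp]: "B \<in> carrier_mat n n \<Longrightarrow> x_mat n \<gamma> t * B \<in> carrier_mat n n"
  by (rule mult_carrier_mat[OF x_mat_carrier])

lemma x_mat_add:
  fixes s t :: "'a::comm_ring_1"
  assumes "i < n" "j < n" "i \<noteq> j"
  shows "x_mat n (i, j) s * x_mat n (i, j) t = x_mat n (i, j) (s + t)"
  by (rule mat_eq_carrierI[of _ n]) (use assms in \<open>auto simp: x_mat_mult_index x_mat_index algebra_simps\<close>)

lemma x_mat_zero: "x_mat n (i, j) 0 = 1\<^sub>m n"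
  by (rule mat_eq_carrierI[of _ n]) (auto simp: x_mat_index)

lemma x_mat_commutator:
  fixes s t :: "'a::comm_ring_1"
  assumes "i < n" "j < n" "k < n" "i \<noteq> j" "j \<noteq> k" "i \<noteq> k"
  shows "x_mat n (i, j) s * x_mat n (j, k) t = x_mat n (i, k) (s * t) * (x_mat n (j, k) t * x_mat n (i, j) s)"
  by (rule mat_eq_carrierI[of _ n]) (use assms in \<open>auto simp: x_mat_mult_index x_mat_index algebra_simps\<close>)

lemma x_mat_commutator':
  fixes s t :: "'a::comm_ring_1"
  assumes "i < n" "j < n" "k < n" "i \<noteq> j" "j \<noteq> k" "i \<noteq> k"
  shows "x_mat n (i, j) s * x_mat n (k, i) t = x_mat n (k, j) (- (s * t)) * (x_mat n (k, i) t * x_mat n (i, j) s)"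
  by (rule mat_eq_carrierI[of _ n]) (use assms in \<open>auto simp: x_mat_mult_index x_mat_index algebra_simps\<close>)

lemma x_mat_commute:
  fixes s t :: "'a::comm_ring_1"
  assumes "i < n" "j < n" "k < n" "l < n" "j \<noteq> k" "i \<noteq> l"
  shows "x_mat n (i, j) s * x_mat n (k, l) t = x_mat n (k, l) t * x_mat n (i, j) s"
  by (rule mat_eq_carrierI[of _ n]) (use assms in \<open>auto simp: x_mat_mult_index x_mat_index algebra_simps\<close>)

lemma h_mat_commute:
  fixes u :: "'a::{comm_ring_1, inverse}"
  shows "h_mat n \<delta> u * h_mat n \<delta>' u = h_mat n \<delta>' u * h_mat n \<delta> u"
  by (rule mat_eq_carrierI[of _ n])
     (auto simp: h_mat_mult_index mult_carrier_mat[OF h_mat_carrier h_mat_carrier], auto simp: h_mat_index mult.commute)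

text \<open>For the total function \<open>inverse\<close> the law of exponents has to be derived
  from the hypothesis that l is a unit.\<close>

lemma padic_powi_add:
  fixes l :: "'p::prime_card padic"
  assumes "inverse l * l = 1"
  shows "l powi (a + b) = l powi a * l powi b"
proof -
  have i: "l * inverse l = 1" using assms by (simp add: mult.commute)
  have 1: "l powi (k + 1) = l * l powi k" for k
  proof (cases "0 \<le> k")
    case True
    then show ?thesis by (simp add: power_int_def nat_add_distrib)
  next
    case False
    define m where "m = nat (- k - 1)"
    have k: "k = - int m - 1" using False by (simp add: m_def)
    have "l powi (k + 1) = inverse l ^ m" unfolding k by (auto simp: power_int_def)
    moreover have "l powi k = inverse l ^ Suc m" unfolding k by (simp add: power_int_def nat_add_distrib)
    ultimately show ?thesis using i by (simp add: mult.assoc[symmetric])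
  qed
  have 2: "l powi (a + int m) = l ^ m * l powi a" for a m
  proof (induction m)
    case (Suc m)
    have "l powi (a + int (Suc m)) = l powi ((a + int m) + 1)" by (simp add: add_ac)
    also have "\<dots> = l * (l ^ m * l powi a)" unfolding 1 Suc ..
    finally show ?case by (simp add: mult.assoc)
  qed simp
  show ?thesis
  proof (cases "0 \<le> b")
    case True
    then show ?thesis using 2[of a "nat b"] by (simp add: power_int_def mult.commute)
  next
    case False
    define m where "m = nat (- b)"
    have b: "b = - int m" "m > 0" using False by (auto simp: m_def)
    have "l powi a = l ^ m * l powi (a + b)" using 2[of "a + b" m] by (simp add: b)
    then have "inverse l ^ m * l powi a = (inverse l * l) ^ m * l powi (a + b)"
      by (simp add: power_mult_distrib mult.assoc)
    moreover have "l powi b = inverse l ^ m" using b by (simp add: power_int_def)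
    ultimately show ?thesis using assms by (simp add: mult.commute)
  qed
qed

context iwahori_setting
begin

section \<open>Evaluation of series in the reduced algebra\<close>

abbreviation AA :: "'p series ring" where "AA \<equiv> I.A"

definition th :: "'p series \<Rightarrow> ('p iwahori_algebra_elem \<times> int \<Rightarrow> int) set" where
  "th a = I.toOm (I.phi a)"

definition E :: "'p padic mat \<Rightarrow> ('p iwahori_algebra_elem \<times> int \<Rightarrow> int) set" where
  "E g = I.toOm (I.el g)"

lemma A_ring_eq: "A_ring n = AA"
  by (simp add: A_ring_def)

sublocale Om: ring I.Om by (rule I.Om_ring)
sublocale AA: ring AA by (rule nc_ring)

lemma th_closed: "th a \<in> carrier I.Om"
  unfolding th_def by (rule ring_hom_closed[OF I.toOm_hom I.phi_closed])

lemma E_closed: "g \<in> carrier G \<Longrightarrow> E g \<in> carrier I.Om"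
  unfolding E_def by (rule ring_hom_closed[OF I.toOm_hom I.el_closed])

lemma th_mult: "th (a \<otimes>\<^bsub>AA\<^esub> b) = th a \<otimes>\<^bsub>I.Om\<^esub> th b"
  unfolding th_def I.phi_mult by (rule ring_hom_mult[OF I.toOm_hom I.phi_closed I.phi_closed])

lemma th_add: "th (a \<oplus>\<^bsub>AA\<^esub> b) = th a \<oplus>\<^bsub>I.Om\<^esub> th b"
  unfolding th_def I.phi_add by (rule ring_hom_add[OF I.toOm_hom I.phi_closed I.phi_closed])

lemma th_one: "th \<one>\<^bsub>AA\<^esub> = \<one>\<^bsub>I.Om\<^esub>"
  unfolding th_def I.phi_one by (rule ring_hom_one[OF I.toOm_hom])

lemma th_hom: "th \<in> Ring.ring_hom AA I.Om"
  by (rule ring_hom_memI) (auto simp: th_closed th_mult th_add th_one)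

sublocale th: ring_hom_ring AA I.Om th
  by (intro ring_hom_ringI2 nc_ring I.Om_ring th_hom)

lemma E_mult: "g \<in> carrier G \<Longrightarrow> h \<in> carrier G \<Longrightarrow> E g \<otimes>\<^bsub>I.Om\<^esub> E h = E (g * h)"
  unfolding E_def using I.el_mult[of g h] ring_hom_mult[OF I.toOm_hom I.el_closed I.el_closed, of g h] by simp

lemma A_var_closed: "A_var n v \<in> carrier AA"
  by (simp add: A_var_def nc_var_def carrier_nc)

lemma one_plus_closed: "one_plus n v \<in> carrier AA"
  by (simp add: one_plus_def A_ring_def nc_closed)

lemma one_plus_pow_closed: "one_plus_pow n v q \<in> carrier AA"
  by (simp add: one_plus_pow_def nc_binomial_def carrier_nc)

lemma W_prod_closed: "W_prod n i j \<in> carrier AA"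
proof -
  have "foldr (\<lambda>c f. one_plus n (W (c, c + 1)) \<otimes>\<^bsub>AA\<^esub> f) l \<one>\<^bsub>AA\<^esub> \<in> carrier AA" for l
    by (induction l) (auto simp: nc_closed)
  then show ?thesis by (simp add: W_prod_def A_ring_def)
qed

lemma th_var:
  assumes "v \<in> ivars n" shows "th (A_var n v) = E (gen v) \<ominus>\<^bsub>I.Om\<^esub> \<one>\<^bsub>I.Om\<^esub>"
proof -
  interpret h: ring_hom_ring I.L I.Om I.toOm
    by (intro ring_hom_ringI2 I.L_ring I.Om_ring I.toOm_hom)
  have "th (A_var n v) = I.toOm (I.el (gen v) \<ominus>\<^bsub>I.L\<^esub> \<one>\<^bsub>I.L\<^esub>)"
    unfolding th_def A_var_def using I.phi_var[OF assms] by simp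
  also have "\<dots> = I.toOm (I.el (gen v)) \<oplus>\<^bsub>I.Om\<^esub> I.toOm (\<ominus>\<^bsub>I.L\<^esub> \<one>\<^bsub>I.L\<^esub>)"
    unfolding a_minus_def using gen_closed[OF assms] by (intro h.hom_add I.el_closed) auto
  also have "\<dots> = E (gen v) \<ominus>\<^bsub>I.Om\<^esub> \<one>\<^bsub>I.Om\<^esub>"
    using h.hom_a_inv[OF I.L.one_closed] h.hom_one by (simp add: E_def a_minus_def)
  finally show ?thesis .
qed

lemma th_one_plus:
  assumes "v \<in> ivars n" shows "th (one_plus n v) = E (gen v)"
proof -
  have g: "E (gen v) \<in> carrier I.Om" using gen_closed[OF assms] by (rule E_closed)
  have "th (one_plus n v) = \<one>\<^bsub>I.Om\<^esub> \<oplus>\<^bsub>I.Om\<^esub> (E (gen v) \<ominus>\<^bsub>I.Om\<^esub> \<one>\<^bsub>I.Om\<^esub>)"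
    by (simp add: one_plus_def A_ring_def th_add th_one th_var[OF assms])
  also have "\<dots> = E (gen v)"
    using g Om.a_comm[OF Om.one_closed Om.minus_closed[OF g Om.one_closed]]
      Om.a_assoc[OF g Om.a_inv_closed[OF Om.one_closed] Om.one_closed] Om.l_neg[OF Om.one_closed]
    by (simp add: a_minus_def)
  finally show ?thesis .
qed

lemma th_diff_zero:
  assumes "a \<in> carrier AA" "b \<in> carrier AA" "th a = th b"
  shows "th (a \<ominus>\<^bsub>AA\<^esub> b) = \<zero>\<^bsub>I.Om\<^esub>"
  using assms th.hom_add[OF assms(1) AA.a_inv_closed[OF assms(2)]] th.hom_a_inv[OF assms(2)]
    Om.r_neg[OF th_closed[of b]] by (simp add: a_minus_def)

text \<open>Here \<open>xs\<close> is the one-parameter subgroup through \<open>gen v\<close>. At a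
  fixed level modulo p, only finitely many binomial coefficients and the coset of
  \<open>xs q\<close> matter, and both are unchanged when q is replaced by a close natural number m.
  For m the claim is Newton's formula.\<close>

lemma th_one_plus_pow:
  assumes v: "v \<in> ivars n"
    and xs: "\<And>a. xs a \<in> carrier G" "xs 1 = gen v" "xs 0 = 1\<^sub>m n" "\<And>a b. xs (a + b) = xs a * xs b"
    and small: "\<And>a d. padic_p ^ (d + 2) dvd a \<Longrightarrow> xs a \<in> H d"
  shows "th (one_plus_pow n v q) = E (xs q)"
proof -
  let ?f = "nc_binomial (ivars n) v q"
  have "padic_p dvd I.phi ?f N C - I.el (xs q) N C" if N: "N \<in> I.ON" for N C
  proof -
    obtain d where d: "H d \<subseteq> N" by (rule H_cofinal[OF N])
    obtain M where M: "\<forall>w\<in>lists (ivars n). M \<le> length w \<longrightarrow> (\<forall>C. padic_p ^ 1 dvd I.lw w N C)"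
      using I.lw_small[OF N, of 1] by (elim exE)
    obtain K where K: "\<forall>r<M. \<forall>q q' :: 'p padic. padic_p ^ K dvd q - q' \<longrightarrow>
        padic_p dvd padic_binomial q r - padic_binomial q' r"
      using padic_binomial_cong_bounded[where M=M and 'p='p] by (elim exE)
    \<comment> \<open>Precision K protects the binomial coefficients, precision d + 2 the coset
      modulo \<open>H d\<close>.\<close>
    obtain m where m: "padic_p ^ (K + (d + 2)) dvd q - of_nat m"
      using padic_approx_nat[of "K + (d + 2)" q] by (elim exE)
    have m1: "padic_p ^ K dvd q - of_nat m" and m2: "padic_p ^ (d + 2) dvd q - of_nat m"
      by (rule power_le_dvd[OF m], simp)+
    let ?r = "\<lambda>r. I.lw (replicate r v) N C"
    have rX: "replicate r v \<in> lists (ivars n)" for r by (rule in_listsI) (use v in auto)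
    have "I.Phi M ?f N C = (\<Sum>w\<in>(\<lambda>r. replicate r v) ` {..<M}. ?f w * I.lw w N C)"
      unfolding I.Phi_apply[OF N]
    proof (rule sum.mono_neutral_right[OF I.finite_words'])
      show "(\<lambda>r. replicate r v) ` {..<M} \<subseteq> I.words M" using rX by (auto simp: I.words_def)
      show "\<forall>w\<in>I.words M - (\<lambda>r. replicate r v) ` {..<M}. ?f w * I.lw w N C = 0"
      proof
        fix w assume w: "w \<in> I.words M - (\<lambda>r. replicate r v) ` {..<M}"
        then have "w \<noteq> replicate (length w) v" by (auto simp: I.words_def)
        then show "?f w * I.lw w N C = 0" using w by (simp add: nc_binomial_def I.words_def)
      qed
    qed
    also have "\<dots> = (\<Sum>r<M. padic_binomial q r * ?r r)"
      by (subst sum.reindex) (use rX in \<open>auto simp: inj_on_def nc_binomial_def replicate_eq_replicate\<close>)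
    finally have 1: "I.Phi M ?f N C = (\<Sum>r<M. padic_binomial q r * ?r r)" .
    have 2: "padic_p dvd I.phi ?f N C - I.Phi M ?f N C"
      using I.phi_approx[OF N, of M 1 C ?f] M by simp
    have 3: "padic_p dvd (\<Sum>r<M. padic_binomial q r * ?r r) - (\<Sum>r<M. of_nat (m choose r) * ?r r)"
    proof (intro dvd_diff_sum dvd_diff_mult)
      fix r assume "r \<in> {..<M}"
      then show "padic_p dvd padic_binomial q r - of_nat (m choose r)"
        using K[rule_format, of r q "of_nat m"] m1 by simp
    qed simp
    \<comment> \<open>The sum is extended to cover all r \<le> m; the added terms are multiples of p
      since words of length at least M are, and terms with r > m vanish.\<close>
    define B where "B = max M (Suc m)"
    have "(\<Sum>r<B. of_nat (m choose r) * ?r r) - (\<Sum>r<M. of_nat (m choose r) * ?r r) =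
        (\<Sum>r\<in>{..<B} - {..<M}. of_nat (m choose r) * ?r r)"
      by (rule sum_diff[symmetric]) (auto simp: B_def)
    also have "padic_p dvd \<dots>"
      using M rX by (intro dvd_sum dvd_mult) auto
    finally have 4: "padic_p dvd (\<Sum>r<M. of_nat (m choose r) * ?r r) - (\<Sum>r<B. of_nat (m choose r) * ?r r)"
      by (simp only: dvd_diff_sym)
    have g: "gen v \<in> carrier G" by (rule gen_closed[OF v])
    let ?F = "\<lambda>x. if N #>\<^bsub>G\<^esub> x = C then 1 else (0 :: 'p padic)"
    have "(\<Sum>r<B. of_nat (m choose r) * ?r r) = (\<Sum>r\<le>m. of_nat (m choose r) * ?r r)"
      by (rule sum.mono_neutral_right) (auto simp: B_def binomial_eq_0)
    also have "\<dots> = (\<Sum>r\<le>m. of_nat (m choose r) * Dif G (replicate r (gen v)) ?F \<one>\<^bsub>G\<^esub>)"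
    proof (rule sum.cong[OF refl])
      fix r
      have "?r r = Dif G (replicate r (gen v)) ?F \<one>\<^bsub>G\<^esub>"
        unfolding I.lw_def map_replicate using g by (intro I.wl_apply N) auto
      then show "of_nat (m choose r) * ?r r = of_nat (m choose r) * Dif G (replicate r (gen v)) ?F \<one>\<^bsub>G\<^esub>" by simp
    qed
    also have "\<dots> = ?F (gen v [^]\<^bsub>G\<^esub> m \<otimes>\<^bsub>G\<^esub> \<one>\<^bsub>G\<^esub>)" by (rule G.Newton_forward[OF g G.one_closed])
    also have "gen v [^]\<^bsub>G\<^esub> m \<otimes>\<^bsub>G\<^esub> \<one>\<^bsub>G\<^esub> = xs (of_nat m)"
    proof -
      have "gen v [^]\<^bsub>G\<^esub> m = xs (of_nat m)"
      proof (induction m)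
        case (Suc m)
        have "gen v [^]\<^bsub>G\<^esub> Suc m = xs (of_nat m) * xs 1" using Suc xs(2) by simp
        then show ?case using xs(4)[of "of_nat m" 1] by (simp add: add.commute)
      qed (simp add: xs(3))
      then show ?thesis using G.r_one[OF xs(1)] by simp
    qed
    also have "N #>\<^bsub>G\<^esub> xs (of_nat m) = N #>\<^bsub>G\<^esub> xs q"
    proof -
      have c: "xs (q - of_nat m) \<in> N" using small[OF m2] d by (rule subsetD[rotated])
      have "xs q = xs (q - of_nat m) \<otimes>\<^bsub>G\<^esub> xs (of_nat m)" using xs(4)[of "q - of_nat m" "of_nat m"] by simp
      then show ?thesis
        using G.coset_mult_assoc[OF subgroup.subset[OF I.ON_subgroup[OF N]] xs(1) xs(1), of "q - of_nat m" "of_nat m"]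
          G.coset_join2[OF xs(1) I.ON_subgroup[OF N] c] by (simp del: G_simps)
    qed
    finally have 5: "(\<Sum>r<B. of_nat (m choose r) * ?r r) = I.el (xs q) N C"
      using N by (auto simp: I.el_apply single_def)
    show ?thesis using dvd_diff_trans[OF dvd_diff_trans[OF 2[unfolded 1] 3] 4] unfolding 5 .
  qed
  then show ?thesis
    unfolding th_def E_def one_plus_pow_def
    using I.toOm_eq_iff[OF I.phi_closed[of ?f] I.el_closed[OF xs(1)[of q]]] by simp
qed

lemma ivars_mem [simp]: "U \<beta> \<in> ivars n \<longleftrightarrow> \<beta> \<in> NegRoots n" "W \<delta> \<in> ivars n \<longleftrightarrow> \<delta> \<in> SimpleRoots n"
  "V \<alpha> \<in> ivars n \<longleftrightarrow> \<alpha> \<in> PosRoots n"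
  by (auto simp: ivars_def)

lemma x_mat_small:
  assumes "x_mat n \<gamma> t \<in> carrier G" "padic_p ^ (d + 2) dvd t"
  shows "x_mat n \<gamma> t \<in> H d"
  using assms by (intro H_cong_entries) (auto simp: x_mat_index)

lemma PosRoots_iff: "(i, j) \<in> PosRoots n \<longleftrightarrow> i < j \<and> j < n"
  and NegRoots_iff: "(i, j) \<in> NegRoots n \<longleftrightarrow> j < i \<and> i < n"
  and SimpleRoots_iff: "(i, j) \<in> SimpleRoots n \<longleftrightarrow> j = i + 1 \<and> j < n"
  by (auto simp: PosRoots_def NegRoots_def SimpleRoots_def Roots_def)

lemma th_pow_V:
  assumes "\<alpha> \<in> PosRoots n" shows "th (one_plus_pow n (V \<alpha>) q) = E (x_mat n \<alpha> q)"
proof -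
  obtain i j where a: "\<alpha> = (i, j)" by fastforce
  then have ij: "i < n" "j < n" "i \<noteq> j" using assms by (auto simp: PosRoots_iff)
  show ?thesis
    by (rule th_one_plus_pow)
       (use assms x_mat_pos_closed[OF assms] ij in \<open>auto simp: a x_mat_zero x_mat_add intro: x_mat_small\<close>)
qed

lemma th_pow_U:
  assumes "\<beta> \<in> NegRoots n" shows "th (one_plus_pow n (U \<beta>) q) = E (x_mat n \<beta> (q * padic_p))"
proof -
  obtain i j where a: "\<beta> = (i, j)" by fastforce
  then have ij: "i < n" "j < n" "i \<noteq> j" using assms by (auto simp: NegRoots_iff)
  show ?thesis
    by (rule th_one_plus_pow[where xs="\<lambda>q. x_mat n \<beta> (q * padic_p)"])
       (use assms x_mat_neg_closed[OF assms] ij in \<open>auto simp: a x_mat_zero x_mat_add distrib_right intro!: x_mat_small dvd_mult2\<close>)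
qed

abbreviation up :: "'p padic" where "up \<equiv> 1 + padic_p"

lemma up_inverse: "inverse up * up = 1"
  by (rule padic_inverse[OF p_not_dvd_1p])

lemma diag_closed:
  assumes "i < j" "j < n" shows "h_mat n (i, j) up \<in> carrier G"
proof -
  have d: "det (h_mat n (i, j) up) = 1"
  proof -
    have "det (h_mat n (i, j) up) = (\<Prod>a\<in>{0..<n}. h_mat n (i, j) up $$ (a, a))"
      using det_upper_triangular[of "h_mat n (i, j) up" n] prod_list_diag_prod[of "h_mat n (i, j) up"]
      by (auto simp: upper_triangular_def h_mat_index carrier_matD[OF h_mat_carrier])
    also have "\<dots> = (\<Prod>a\<in>{0..<n}. (if a = i then up else 1) * (if a = j then inverse up else 1))"
      by (rule prod.cong) (use assms in \<open>auto simp: h_mat_index\<close>)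
    also have "\<dots> = up * inverse up" using assms by (simp add: prod.distrib)
    finally show ?thesis using up_inverse by (simp add: mult.commute)
  qed
  have "padic_p dvd inverse up - 1" by (rule inverse_1_mod_p) simp
  then show ?thesis using d by (auto simp: iwahori_def h_mat_index)
qed

text \<open>The product telescopes: the inverse entry of each factor cancels against the entry of
  the next one, leaving only the two ends.\<close>

lemma th_W_prod:
  assumes "i < j" "j < n" shows "th (W_prod n i j) = E (h_mat n (i, j) up)"
  using assms(1)
proof (induction "j - i" arbitrary: i)
  case (Suc d)
  have s: "W (i, i + 1) \<in> ivars n" using Suc.prems assms(2) by (simp add: SimpleRoots_iff)
  have c: "W_prod n i j = one_plus n (W (i, i + 1)) \<otimes>\<^bsub>AA\<^esub> W_prod n (Suc i) j"
    using Suc.prems by (simp add: W_prod_def A_ring_def upt_conv_Cons)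
  have g: "th (one_plus n (W (i, i + 1))) = E (h_mat n (i, i + 1) up)" using th_one_plus[OF s] by simp
  show ?case
  proof (cases "Suc i = j")
    case True
    have "W_prod n (Suc i) j = \<one>\<^bsub>AA\<^esub>" by (simp add: W_prod_def A_ring_def True)
    then show ?thesis
      using True Om.r_one[OF E_closed[OF diag_closed[OF Suc.prems assms(2)]]]
      unfolding c th_mult g by (simp add: th_one)
  next
    case False
    then have ij: "Suc i < j" using Suc.prems by simp
    have IH: "th (W_prod n (Suc i) j) = E (h_mat n (Suc i, j) up)" using Suc.hyps ij by (intro Suc.hyps(1)) auto
    have cl: "h_mat n (i, i + 1) up \<in> carrier G" "h_mat n (Suc i, j) up \<in> carrier G"
      using diag_closed[of i "i + 1"] diag_closed[OF ij assms(2)] Suc.prems assms(2) by auto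
    have "h_mat n (i, i + 1) up * h_mat n (Suc i, j) up = h_mat n (i, j) up"
      using ij up_inverse
      by (intro mat_eq_carrierI[of _ n] mult_carrier_mat[OF h_mat_carrier h_mat_carrier] h_mat_carrier)
         (auto simp: h_mat_mult_index, auto simp: h_mat_index mult.commute)
    then show ?thesis unfolding c th_mult g IH using E_mult[OF cl] by simp
  qed
qed simp

text \<open>As the pairing is a definite description, existence and uniqueness of the exponent are
  needed. Uniqueness is tested at l = 1 + p, no positive power of which is 1 in characteristic
  0.\<close>

lemma pairing_property:
  assumes "\<delta> \<in> SimpleRoots n" "\<gamma> \<in> Roots n"
  shows "h_mat n \<delta> up * x_mat n \<gamma> t = x_mat n \<gamma> (up powi pairing TYPE('p) n \<gamma> \<delta> * t) * h_mat n \<delta> up"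
proof -
  obtain c where c: "\<delta> = (c, c + 1)" "c + 1 < n" using assms(1) by (auto simp: SimpleRoots_def Roots_def)
  obtain i j where g: "\<gamma> = (i, j)" "i < n" "j < n" "i \<noteq> j" using assms(2) by (auto simp: Roots_def)
  \<comment> \<open>The exponent of l in the a-th diagonal entry of
    \<open>h_mat n \<delta> l\<close>.\<close>
  define e where "e a = (if a = c then 1 else if a = c + 1 then - 1 else (0::int))" for a
  let ?P = "\<lambda>m. \<forall>(l::'p padic) t. l dvd 1 \<longrightarrow>
     h_mat n \<delta> l * x_mat n \<gamma> t * h_mat n \<delta> (inverse l) = x_mat n \<gamma> (l powi m * t)"
  have unit: "inverse l * l = 1" "inverse (inverse l) = l" if "l dvd 1" for l :: "'p padic"
  proof -
    have nd: "\<not> padic_p dvd l" using that p_not_dvd_1[where 'p='p] dvd_trans by blast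
    show 1: "inverse l * l = 1" by (rule padic_inverse[OF nd])
    have "\<not> padic_p dvd inverse l" using 1 p_not_dvd_1[where 'p='p] by (metis dvd_mult2)
    then have "inverse (inverse l) * inverse l = 1" by (rule padic_inverse)
    then have "inverse (inverse l) * inverse l * l = l" by simp
    then show "inverse (inverse l) = l" using 1 by (simp add: mult.assoc)
  qed
  have ex: "?P (e i - e j)"
  proof (intro allI impI)
    fix l t :: "'p padic" assume l: "l dvd 1"
    note u = unit[OF l]
    have hd: "h_mat n \<delta> l $$ (a, a) = l powi (e a)" if "a < n" for a
      using that by (auto simp: c e_def h_mat_index power_int_def)
    have hd': "h_mat n \<delta> (inverse l) $$ (a, a) = l powi (- e a)" if "a < n" for a
      using that u by (auto simp: c e_def h_mat_index power_int_def)
    have inv0: "l powi (e a) * l powi (- e a) = 1" for a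
      using padic_powi_add[OF u(1), of "e a" "- e a"] by simp
    have hx: "h_mat n \<delta> l * x_mat n \<gamma> t \<in> carrier_mat n n" by (rule mult_carrier_mat[OF h_mat_carrier x_mat_carrier])
    show "h_mat n \<delta> l * x_mat n \<gamma> t * h_mat n \<delta> (inverse l) = x_mat n \<gamma> (l powi (e i - e j) * t)"
    proof (rule mat_eq_carrierI[of _ n])
      show "h_mat n \<delta> l * x_mat n \<gamma> t * h_mat n \<delta> (inverse l) \<in> carrier_mat n n"
        by (rule mult_carrier_mat[OF hx h_mat_carrier])
      fix a b assume ab: "a < n" "b < n"
      have "(h_mat n \<delta> l * x_mat n \<gamma> t * h_mat n \<delta> (inverse l)) $$ (a, b) =
          l powi (e a) * x_mat n \<gamma> t $$ (a, b) * l powi (- e b)"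
        by (simp only: mult_h_mat_index[OF hx ab] h_mat_mult_index[OF x_mat_carrier ab] hd[OF ab(1)] hd'[OF ab(2)])
      also have "\<dots> = x_mat n \<gamma> (l powi (e i - e j) * t) $$ (a, b)"
        using inv0[of a] padic_powi_add[OF u(1), of "e i" "- e j"] ab g(4)
        by (auto simp: x_mat_index g(1) algebra_simps)
      finally show "(h_mat n \<delta> l * x_mat n \<gamma> t * h_mat n \<delta> (inverse l)) $$ (a, b) =
          x_mat n \<gamma> (l powi (e i - e j) * t) $$ (a, b)" .
    qed simp
  qed
  have up1: "up dvd 1" by (rule padic_unit[OF p_not_dvd_1p])
  have uniq: "m = m'" if m: "?P m" "?P m'" for m m'
  proof -
    have "x_mat n \<gamma> (up powi m * 1) = x_mat n \<gamma> (up powi m' * 1)" using m up1 by metis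
    then have "x_mat n \<gamma> (up powi m * 1) $$ (i, j) = x_mat n \<gamma> (up powi m' * 1) $$ (i, j)" by simp
    then have eq: "up powi m = up powi m'" using g by (simp add: x_mat_index)
    have key: "a = b" if ab: "up powi a = up powi b" "a \<le> b" for a b
    proof -
      define k where "k = nat (b - a)"
      have b: "b = a + int k" using ab(2) by (simp add: k_def)
      have "up powi a * up ^ k = up powi a"
        using ab(1) unfolding b padic_powi_add[OF up_inverse] by (simp add: power_int_def)
      then have "up powi (- a) * up powi a * up ^ k = up powi (- a) * up powi a" by (simp add: mult.assoc)
      moreover have "up powi (- a) * up powi a = 1" using padic_powi_add[OF up_inverse, of "- a" a] by simp
      ultimately have "up ^ k = 1" by simp
      then have "(of_nat ((1 + CARD('p)) ^ k) :: 'p padic) = of_nat 1" by simp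
      then have "(1 + CARD('p)) ^ k = 1" by (simp only: of_nat_eq_iff)
      then have "k = 0" using CARD_gt_1[where 'p='p] by simp
      then show ?thesis using b by simp
    qed
    show ?thesis using key[of m m'] key[of m' m] eq by (cases "m \<le> m'") auto
  qed
  have "pairing TYPE('p) n \<gamma> \<delta> = e i - e j"
    unfolding pairing_def by (rule the_equality, rule ex, erule uniq[OF _ ex])
  then have P: "h_mat n \<delta> up * x_mat n \<gamma> t * h_mat n \<delta> (inverse up) = x_mat n \<gamma> (up powi pairing TYPE('p) n \<gamma> \<delta> * t)"
    using ex up1 by simp
  have hh: "h_mat n \<delta> (inverse up) * h_mat n \<delta> up = 1\<^sub>m n"
    using up_inverse unit(2)[OF up1]
    by (intro mat_eq_carrierI[of _ n] mult_carrier_mat[OF h_mat_carrier h_mat_carrier] one_carrier_mat)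
       (auto simp: h_mat_mult_index, auto simp: h_mat_index mult.commute)
  have hx: "h_mat n \<delta> up * x_mat n \<gamma> t \<in> carrier_mat n n" by (rule mult_carrier_mat[OF h_mat_carrier x_mat_carrier])
  have "h_mat n \<delta> up * x_mat n \<gamma> t * h_mat n \<delta> (inverse up) * h_mat n \<delta> up = h_mat n \<delta> up * x_mat n \<gamma> t"
    using assoc_mult_mat[OF hx h_mat_carrier h_mat_carrier, of \<delta> "inverse up" \<delta> up] hh right_mult_one_mat[OF hx] by simp
  then show ?thesis unfolding P by simp
qed

text \<open>The decomposition lower times diagonal times upper of the block with rows (1 + p, 1) and
  (p, 1), placed in rows and columns i and j.\<close>

lemma rel8_matrix:
  assumes "i < j" "j < n"
  shows "x_mat n (i, j) 1 * x_mat n (j, i) padic_p =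
    x_mat n (j, i) (inverse up * padic_p) * (h_mat n (i, j) up * x_mat n (i, j) (inverse up))"
proof -
  have hx: "h_mat n (i, j) up * x_mat n (i, j) (inverse up) \<in> carrier_mat n n"
    by (rule mult_carrier_mat[OF h_mat_carrier x_mat_carrier])
  have e1: "inverse up * padic_p + inverse up = 1" using up_inverse by (simp add: algebra_simps)
  have e2: "up * inverse up = 1" using up_inverse by (simp add: mult.commute)
  have e3: "inverse up * padic_p * up = padic_p" using up_inverse by (metis mult.assoc mult.commute mult_1)
  have e4: "inverse up * padic_p * (up * inverse up) = inverse up * padic_p" using e2 by simp
  show ?thesis
  proof (rule mat_eq_carrierI[of _ n])
    fix a b assume ab: "a < n" "b < n"
    have ij: "i < n" "j < n" "i \<noteq> j" using assms by auto
    have "(x_mat n (i, j) 1 * x_mat n (j, i) padic_p) $$ (a, b) =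
        x_mat n (j, i) padic_p $$ (a, b) + (if a = i then 1 * x_mat n (j, i) padic_p $$ (j, b) else 0)"
      by (rule x_mat_mult_index[OF x_mat_carrier ij(1,2) ab])
    also have "\<dots> = (h_mat n (i, j) up * x_mat n (i, j) (inverse up)) $$ (a, b) +
        (if a = j then inverse up * padic_p * (h_mat n (i, j) up * x_mat n (i, j) (inverse up)) $$ (i, b) else 0)"
      unfolding h_mat_mult_index[OF x_mat_carrier ab] h_mat_mult_index[OF x_mat_carrier ij(1) ab(2)]
      using ij ab e1 e2 e3 e4 by (auto simp: x_mat_index h_mat_index add.commute)
    also have "\<dots> = (x_mat n (j, i) (inverse up * padic_p) * (h_mat n (i, j) up * x_mat n (i, j) (inverse up))) $$ (a, b)"
      by (rule x_mat_mult_index[OF hx ij(2,1) ab, symmetric])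
    finally show "(x_mat n (i, j) 1 * x_mat n (j, i) padic_p) $$ (a, b) =
        (x_mat n (j, i) (inverse up * padic_p) * (h_mat n (i, j) up * x_mat n (i, j) (inverse up))) $$ (a, b)" .
  qed (use hx in auto)
qed

lemma th_var_commute:
  assumes "v \<in> ivars n" "w \<in> ivars n" "gen v * gen w = gen w * gen v"
  shows "th (A_var n v \<otimes>\<^bsub>AA\<^esub> A_var n w \<ominus>\<^bsub>AA\<^esub> A_var n w \<otimes>\<^bsub>AA\<^esub> A_var n v) = \<zero>\<^bsub>I.Om\<^esub>"
proof (rule th_diff_zero)
  have c: "E (gen v) \<in> carrier I.Om" "E (gen w) \<in> carrier I.Om" using assms E_closed gen_closed by auto
  have e: "E (gen v) \<otimes>\<^bsub>I.Om\<^esub> E (gen w) = E (gen w) \<otimes>\<^bsub>I.Om\<^esub> E (gen v)"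
    using E_mult[OF gen_closed[OF assms(1)] gen_closed[OF assms(2)]]
      E_mult[OF gen_closed[OF assms(2)] gen_closed[OF assms(1)]] assms(3) by simp
  have m1: "(x \<ominus>\<^bsub>I.Om\<^esub> \<one>\<^bsub>I.Om\<^esub>) \<otimes>\<^bsub>I.Om\<^esub> (y \<ominus>\<^bsub>I.Om\<^esub> \<one>\<^bsub>I.Om\<^esub>) =
      x \<otimes>\<^bsub>I.Om\<^esub> y \<oplus>\<^bsub>I.Om\<^esub> (\<ominus>\<^bsub>I.Om\<^esub> x \<oplus>\<^bsub>I.Om\<^esub> (\<ominus>\<^bsub>I.Om\<^esub> y \<oplus>\<^bsub>I.Om\<^esub> \<one>\<^bsub>I.Om\<^esub>))"
    if "x \<in> carrier I.Om" "y \<in> carrier I.Om" for x y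
    using that
    by (simp add: a_minus_def Om.l_distr Om.r_distr Om.l_minus Om.r_minus Om.minus_add Om.minus_minus Om.a_ac)
  show "th (A_var n v \<otimes>\<^bsub>AA\<^esub> A_var n w) = th (A_var n w \<otimes>\<^bsub>AA\<^esub> A_var n v)"
    unfolding th_mult th_var[OF assms(1)] th_var[OF assms(2)] m1[OF c] m1[OF c(2,1)] e
    using c by (simp add: Om.a_lcomm[of "\<ominus>\<^bsub>I.Om\<^esub> E (gen v)"])
qed (simp_all add: nc_closed)

lemma relators_closed: "r \<in> relators n \<Longrightarrow> r \<in> carrier AA"
  by (erule relators.cases)
     (simp_all add: A_ring_eq AA.minus_closed AA.m_closed one_plus_closed one_plus_pow_closed A_var_closed W_prod_closed)

lemma E_mult3:
  "g \<in> carrier G \<Longrightarrow> h \<in> carrier G \<Longrightarrow> k \<in> carrier G \<Longrightarrow> E g \<otimes>\<^bsub>I.Om\<^esub> E h \<otimes>\<^bsub>I.Om\<^esub> E k = E (g * (h * k))"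
  using Om.m_assoc[OF E_closed E_closed E_closed, of g h k] E_mult[of h k] E_mult[of g "h * k"] G_mult_closed[of h k]
  by simp

lemma sum_is_root_I1: "i < n \<Longrightarrow> l < n \<Longrightarrow> i \<noteq> l \<Longrightarrow> sum_is_root n (i, j) (j, l)"
  unfolding sum_is_root_def by (rule exI[of _ i], rule exI[of _ j], rule exI[of _ l]) (simp add: Roots_def)

lemma sum_is_root_I2: "k < n \<Longrightarrow> j < n \<Longrightarrow> k \<noteq> j \<Longrightarrow> sum_is_root n (i, j) (k, i)"
  unfolding sum_is_root_def by (rule exI[of _ k], rule exI[of _ i], rule exI[of _ j]) (simp add: Roots_def)

text \<open>Each relation reflects a matrix identity: those stated for 1 plus a variable translate
  directly, and plain commutation of variables follows from commutation of the generators.\<close>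

lemma relators_th:
  assumes "r \<in> relators n" shows "th r = \<zero>\<^bsub>I.Om\<^esub>"
proof -
  note cl = AA.m_closed one_plus_closed one_plus_pow_closed
  \<comment> \<open>Three shapes cover the group relations: a b = c d e for relation (8), a b = c b
    a for brackets, a b = c a for the action of the torus.\<close>
  have two: "th (a \<otimes>\<^bsub>AA\<^esub> b \<ominus>\<^bsub>AA\<^esub> c \<otimes>\<^bsub>AA\<^esub> d \<otimes>\<^bsub>AA\<^esub> e) = \<zero>\<^bsub>I.Om\<^esub>"
    if "a \<in> carrier AA" "b \<in> carrier AA" "c \<in> carrier AA" "d \<in> carrier AA" "e \<in> carrier AA"
      "th a = E ga" "th b = E gb" "th c = E gc" "th d = E gd" "th e = E ge"
      "ga \<in> carrier G" "gb \<in> carrier G" "gc \<in> carrier G" "gd \<in> carrier G" "ge \<in> carrier G"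
      "ga * gb = gc * (gd * ge)" for a b c d e ga gb gc gd ge
    by (intro th_diff_zero AA.m_closed that(1-5))
       (simp only: th_mult that(6-10) E_mult[OF that(11,12)] E_mult3[OF that(13-15)] that(16))
  have com: "th (a \<otimes>\<^bsub>AA\<^esub> b \<ominus>\<^bsub>AA\<^esub> c \<otimes>\<^bsub>AA\<^esub> b \<otimes>\<^bsub>AA\<^esub> a) = \<zero>\<^bsub>I.Om\<^esub>"
    if "a \<in> carrier AA" "b \<in> carrier AA" "c \<in> carrier AA" "th a = E ga" "th b = E gb" "th c = E gc"
      "ga \<in> carrier G" "gb \<in> carrier G" "gc \<in> carrier G" "ga * gb = gc * (gb * ga)" for a b c ga gb gc
    by (rule two[OF that(1,2,3,2,1,4,5,6,5,4,7,8,9,8,7,10)])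
  have wx: "th (a \<otimes>\<^bsub>AA\<^esub> b \<ominus>\<^bsub>AA\<^esub> c \<otimes>\<^bsub>AA\<^esub> a) = \<zero>\<^bsub>I.Om\<^esub>"
    if "a \<in> carrier AA" "b \<in> carrier AA" "c \<in> carrier AA" "th a = E ga" "th b = E gb" "th c = E gc"
      "ga \<in> carrier G" "gb \<in> carrier G" "gc \<in> carrier G" "ga * gb = gc * ga" for a b c ga gb gc
    by (intro th_diff_zero AA.m_closed that(1-3)) (simp add: th_mult that E_mult)
  have V1: "th (one_plus n (V \<alpha>)) = E (x_mat n \<alpha> 1)" if "\<alpha> \<in> PosRoots n" for \<alpha>
    using th_one_plus[of "V \<alpha>"] that by simp
  have U1: "th (one_plus n (U \<beta>)) = E (x_mat n \<beta> padic_p)" if "\<beta> \<in> NegRoots n" for \<beta>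
    using th_one_plus[of "U \<beta>"] that by simp
  have W1: "th (one_plus n (W \<delta>)) = E (h_mat n \<delta> up)" if "\<delta> \<in> SimpleRoots n" for \<delta>
    using th_one_plus[of "W \<delta>"] that by simp
  have Uc: "x_mat n \<beta> padic_p \<in> carrier G" if "\<beta> \<in> NegRoots n" for \<beta> using x_mat_neg_closed[OF that, of 1] by simp
  have Hc: "h_mat n \<delta> up \<in> carrier G" if "\<delta> \<in> SimpleRoots n" for \<delta> by (rule h_mat_closed[OF that]) simp
  note Vc = x_mat_pos_closed
  have neg_R: "\<beta> \<in> Roots n" if "\<beta> \<in> NegRoots n" for \<beta> using that by (auto simp: NegRoots_def)
  have pos_R: "\<alpha> \<in> Roots n" if "\<alpha> \<in> PosRoots n" for \<alpha> using that by (auto simp: PosRoots_def)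
  note i1 = PosRoots_iff NegRoots_iff
  from assms show ?thesis
  proof cases
    case (rel1 \<delta> \<beta>)
    show ?thesis unfolding rel1(1) A_ring_eq
      by (rule wx[OF one_plus_closed one_plus_closed one_plus_pow_closed W1[OF rel1(2)] U1[OF rel1(3)] th_pow_U[OF rel1(3)]
            Hc[OF rel1(2)] Uc[OF rel1(3)] x_mat_neg_closed[OF rel1(3)] pairing_property[OF rel1(2) neg_R[OF rel1(3)]]])
  next
    case (rel2 \<delta> \<alpha>)
    have "h_mat n \<delta> up * x_mat n \<alpha> 1 = x_mat n \<alpha> (up powi pairing TYPE('p) n \<alpha> \<delta>) * h_mat n \<delta> up"
      using pairing_property[OF rel2(2) pos_R[OF rel2(3)], of 1] by simp
    then show ?thesis unfolding rel2(1) A_ring_eq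
      by (rule wx[OF one_plus_closed one_plus_closed one_plus_pow_closed W1[OF rel2(2)] V1[OF rel2(3)] th_pow_V[OF rel2(3)]
            Hc[OF rel2(2)] Vc[OF rel2(3)] Vc[OF rel2(3)]])
  next
    case (rel3 \<alpha> \<beta>)
    obtain i j k l where ab: "\<alpha> = (i, j)" "\<beta> = (k, l)" by fastforce
    have b: "i < j" "j < n" "l < k" "k < n" using rel3 by (auto simp: ab i1)
    have jk: "j \<noteq> k"
    proof
      assume "j = k"
      then have "i \<noteq> l" using rel3(4) by (auto simp: ab)
      then have "sum_is_root n \<alpha> \<beta>" using sum_is_root_I1[of i l j] \<open>j = k\<close> b by (auto simp: ab)
      then show False using rel3 by simp
    qed
    have il: "i \<noteq> l"
    proof
      assume "i = l"
      then have "k \<noteq> j" using rel3(4) by (auto simp: ab)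
      then have "sum_is_root n \<alpha> \<beta>" using sum_is_root_I2[of k j i] \<open>i = l\<close> b by (auto simp: ab)
      then show False using rel3 by simp
    qed
    show ?thesis unfolding rel3(1) A_ring_eq
      by (rule th_var_commute) (use rel3 b jk il in \<open>auto simp: ab x_mat_commute\<close>)
  next
    case (rel4 i j k)
    then have b: "i < n" "j < n" "k < n" "i \<noteq> j" "j \<noteq> k" "i \<noteq> k" and r: "(i, k) \<in> PosRoots n" by (auto simp: i1)
    show ?thesis unfolding rel4(1) A_ring_eq
      by (rule com[OF one_plus_closed one_plus_closed one_plus_pow_closed V1[OF rel4(2)] U1[OF rel4(3)] th_pow_V[OF r]
            Vc[OF rel4(2)] Uc[OF rel4(3)] Vc[OF r]]) (use x_mat_commutator[OF b, of 1 padic_p] in simp)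
  next
    case (rel5 i j k)
    then have b: "i < n" "j < n" "k < n" "i \<noteq> j" "j \<noteq> k" "i \<noteq> k" and r: "(i, k) \<in> NegRoots n" by (auto simp: i1)
    show ?thesis unfolding rel5(1) A_ring_eq
      by (rule com[OF one_plus_closed one_plus_closed one_plus_closed V1[OF rel5(2)] U1[OF rel5(3)] U1[OF r]
            Vc[OF rel5(2)] Uc[OF rel5(3)] Uc[OF r]]) (use x_mat_commutator[OF b, of 1 padic_p] in simp)
  next
    case (rel6 i j k)
    then have b: "i < n" "j < n" "k < n" "i \<noteq> j" "j \<noteq> k" "i \<noteq> k" and r: "(k, j) \<in> PosRoots n" by (auto simp: i1)
    show ?thesis unfolding rel6(1) A_ring_eq
      by (rule com[OF one_plus_closed one_plus_closed one_plus_pow_closed V1[OF rel6(2)] U1[OF rel6(3)] th_pow_V[OF r]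
            Vc[OF rel6(2)] Uc[OF rel6(3)] Vc[OF r]]) (use x_mat_commutator'[OF b, of 1 padic_p] in simp)
  next
    case (rel7 i j k)
    then have b: "i < n" "j < n" "k < n" "i \<noteq> j" "j \<noteq> k" "i \<noteq> k" and r: "(k, j) \<in> NegRoots n" by (auto simp: i1)
    show ?thesis unfolding rel7(1) A_ring_eq
      by (rule com[OF one_plus_closed one_plus_closed one_plus_pow_closed V1[OF rel7(2)] U1[OF rel7(3)] th_pow_U[OF r]
            Vc[OF rel7(2)] Uc[OF rel7(3)] x_mat_neg_closed[OF r]]) (use x_mat_commutator'[OF b, of 1 padic_p] in simp)
  next
    case (rel8 i j)
    then have b: "i < j" "j < n" and r: "(j, i) \<in> NegRoots n" by (auto simp: i1)
    show ?thesis unfolding rel8(1) A_ring_eq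
      by (rule two[OF one_plus_closed one_plus_closed one_plus_pow_closed W_prod_closed one_plus_pow_closed
            V1[OF rel8(2)] U1[OF r] th_pow_U[OF r] th_W_prod[OF b] th_pow_V[OF rel8(2)]
            Vc[OF rel8(2)] Uc[OF r] x_mat_neg_closed[OF r] diag_closed[OF b] Vc[OF rel8(2)] rel8_matrix[OF b]])
  next
    case (rel9 \<beta>1 \<beta>2)
    obtain i j k l where ab: "\<beta>1 = (i, j)" "\<beta>2 = (k, l)" by fastforce
    have b: "j < i" "i < n" "l < k" "k < n" using rel9 by (auto simp: ab i1)
    have jk: "j \<noteq> k"
    proof
      assume "j = k"
      then have "sum_is_root n \<beta>1 \<beta>2" using sum_is_root_I1[of i l j] \<open>j = k\<close> b by (auto simp: ab)
      then show False using rel9 by simp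
    qed
    have il: "i \<noteq> l"
    proof
      assume "i = l"
      then have "sum_is_root n \<beta>1 \<beta>2" using sum_is_root_I2[of k j i] \<open>i = l\<close> b by (auto simp: ab)
      then show False using rel9 by simp
    qed
    show ?thesis unfolding rel9(1) A_ring_eq
      by (rule th_var_commute) (use rel9 b jk il in \<open>auto simp: ab x_mat_commute\<close>)
  next
    case (rel10 i j k)
    then have b: "i < n" "j < n" "k < n" "i \<noteq> j" "j \<noteq> k" "i \<noteq> k" and r: "(i, k) \<in> NegRoots n" by (auto simp: i1)
    show ?thesis unfolding rel10(1) A_ring_eq
      by (rule com[OF one_plus_closed one_plus_closed one_plus_pow_closed U1[OF rel10(2)] U1[OF rel10(3)] th_pow_U[OF r]
            Uc[OF rel10(2)] Uc[OF rel10(3)] x_mat_neg_closed[OF r] x_mat_commutator[OF b]])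
  next
    case (rel11 i j k)
    then have b: "i < n" "j < n" "k < n" "i \<noteq> j" "j \<noteq> k" "i \<noteq> k" and r: "(k, j) \<in> NegRoots n" by (auto simp: i1)
    show ?thesis unfolding rel11(1) A_ring_eq
      by (rule com[OF one_plus_closed one_plus_closed one_plus_pow_closed U1[OF rel11(2)] U1[OF rel11(3)] th_pow_U[OF r]
            Uc[OF rel11(2)] Uc[OF rel11(3)] x_mat_neg_closed[OF r]]) (use x_mat_commutator'[OF b, of padic_p padic_p] in simp)
  next
    case (rel12 \<delta>1 \<delta>2)
    show ?thesis unfolding rel12(1) A_ring_eq
      by (rule th_var_commute) (use rel12 in \<open>auto simp: h_mat_commute\<close>)
  next
    case (rel13 \<alpha>1 \<alpha>2)
    obtain i j k l where ab: "\<alpha>1 = (i, j)" "\<alpha>2 = (k, l)" by fastforce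
    have b: "i < j" "j < n" "k < l" "l < n" using rel13 by (auto simp: ab i1)
    have jk: "j \<noteq> k"
    proof
      assume "j = k"
      then have "sum_is_root n \<alpha>1 \<alpha>2" using sum_is_root_I1[of i l j] \<open>j = k\<close> b by (auto simp: ab)
      then show False using rel13 by simp
    qed
    have il: "i \<noteq> l"
    proof
      assume "i = l"
      then have "sum_is_root n \<alpha>1 \<alpha>2" using sum_is_root_I2[of k j i] \<open>i = l\<close> b by (auto simp: ab)
      then show False using rel13 by simp
    qed
    show ?thesis unfolding rel13(1) A_ring_eq
      by (rule th_var_commute) (use rel13 b jk il in \<open>auto simp: ab x_mat_commute\<close>)
  next
    case (rel14 i j k)
    then have b: "i < n" "j < n" "k < n" "i \<noteq> j" "j \<noteq> k" "i \<noteq> k" and r: "(i, k) \<in> PosRoots n" by (auto simp: i1)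
    show ?thesis unfolding rel14(1) A_ring_eq
      by (rule com[OF one_plus_closed one_plus_closed one_plus_closed V1[OF rel14(2)] V1[OF rel14(3)] V1[OF r]
            Vc[OF rel14(2)] Vc[OF rel14(3)] Vc[OF r]]) (use x_mat_commutator[OF b, of 1 1] in simp)
  next
    case (rel15 i j k)
    then have b: "k < n" "i < n" "j < n" "k \<noteq> i" "i \<noteq> j" "k \<noteq> j" and r: "(k, j) \<in> PosRoots n" by (auto simp: i1)
    show ?thesis unfolding rel15(1) A_ring_eq
      by (rule com[OF one_plus_closed one_plus_closed one_plus_closed V1[OF rel15(3)] V1[OF rel15(2)] V1[OF r]
            Vc[OF rel15(3)] Vc[OF rel15(2)] Vc[OF r]]) (use x_mat_commutator[OF b, of 1 1] in simp)
  qed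
qed

end

section \<open>Commutation modulo higher weight\<close>

lemma distinct_concat_map:
  assumes "distinct js" "\<And>j. distinct (f j)" "\<And>j j'. j \<noteq> j' \<Longrightarrow> set (f j) \<inter> set (f j') = {}"
  shows "distinct (concat (map f js))"
  using assms(1)
proof (induction js)
  case (Cons j js)
  have "set (f j) \<inter> set (concat (map f js)) = {}"
  proof -
    have "set (f j) \<inter> set (f j') = {}" if "j' \<in> set js" for j' using assms(3)[of j j'] that Cons.prems by auto
    then show ?thesis by (simp only: set_concat set_map) blast
  qed
  then show ?case using Cons assms(2) by simp
qed simp

section \<open>The closed ideal of relations and the weights of the variables\<close>

context iwahori_setting
begin

text \<open>The family whose intersection is the closed ideal is inhabited, as the intersection of
  ideals requires.\<close>

lemma R_family: "carrier AA \<in> {J. ideal J AA \<and> closedin (A_topology n) J \<and> relators n \<subseteq> J}"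
proof -
  have "closedin (A_topology n) (carrier AA)"
    using closedin_topspace[of "A_topology n"] by (simp add: A_topology_def nc_topspace)
  then show ?thesis using AA.oneideal relators_closed by auto
qed

lemma R_ideal_eq: "(R_ideal n :: 'p series set) = \<Inter>{J. ideal J AA \<and> closedin (A_topology n) J \<and> relators n \<subseteq> J}"
  by (simp add: R_ideal_def closed_ideal_gen_def A_ring_eq)

lemma R_ideal_ideal: "ideal (R_ideal n) AA"
  unfolding R_ideal_eq by (rule AA.i_Intersect) (use R_family in auto)

lemma R_ideal_closed: "closedin (A_topology n) (R_ideal n :: 'p series set)"
  unfolding R_ideal_eq by (rule closedin_Inter) (use R_family in auto)

lemma relators_R: "r \<in> relators n \<Longrightarrow> (r :: 'p series) \<in> R_ideal n"
  unfolding R_ideal_eq by (rule InterI) auto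

abbreviation X :: "ivar set" where "X \<equiv> ivars n"

text \<open>The weight is the depth of \<open>gen v - 1\<close> in the filtration \<open>Md\<close>.
  It is additive on the roots, up to n whenever the bracket carries a factor p.\<close>

fun wtv :: "ivar \<Rightarrow> nat" where
  "wtv (U (i, j)) = n + j - i"
| "wtv (W _) = n"
| "wtv (V (i, j)) = j - i"

lemma wtv_pos: "v \<in> X \<Longrightarrow> 0 < wtv v"
  using n_ge_2 by (cases v rule: wtv.cases) (auto simp: PosRoots_iff NegRoots_iff)

sublocale wa: weighted_alphabet X wtv pt
  by unfold_locales (auto simp: wtv_pos finite_ivars)

definition RR :: "(ivar, 'p padic) ncs set" where "RR = emb X ` R_ideal n"

lemma R_ideal_carrier: "r \<in> R_ideal n \<Longrightarrow> r \<in> carrier AA"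
  using ideal.Icarr[OF R_ideal_ideal] by blast

lemma RR_AX: "RR \<subseteq> AX X"
  by (auto simp: RR_def emb_in_AX)

lemma RR_zero: "0 \<in> RR"
proof -
  have "\<zero>\<^bsub>AA\<^esub> \<in> R_ideal n" using additive_subgroup.zero_closed[OF ideal.axioms(1)[OF R_ideal_ideal]] .
  then have "emb X \<zero>\<^bsub>AA\<^esub> \<in> RR" unfolding RR_def by (rule imageI)
  then show ?thesis by (simp add: emb_zero)
qed

lemma RR_add:
  assumes "r \<in> RR" "r' \<in> RR" shows "r + r' \<in> RR"
proof -
  obtain s s' where s: "s \<in> R_ideal n" "s' \<in> R_ideal n" "r = emb X s" "r' = emb X s'"
    using assms unfolding RR_def by auto
  have "s \<oplus>\<^bsub>AA\<^esub> s' \<in> R_ideal n"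
    using additive_subgroup.a_closed[OF ideal.axioms(1)[OF R_ideal_ideal] s(1,2)] .
  then have "emb X (s \<oplus>\<^bsub>AA\<^esub> s') \<in> RR" unfolding RR_def by (rule imageI)
  then show ?thesis by (simp add: emb_add s)
qed

lemma RR_mult:
  assumes "a \<in> AX X" "r \<in> RR" shows "a * r \<in> RR" "r * a \<in> RR"
proof -
  obtain s where s: "s \<in> R_ideal n" "r = emb X s" using assms unfolding RR_def by auto
  obtain b where b: "b \<in> carrier AA" "emb X b = a" using emb_surj[OF assms(1)] by blast
  have "b \<otimes>\<^bsub>AA\<^esub> s \<in> R_ideal n" "s \<otimes>\<^bsub>AA\<^esub> b \<in> R_ideal n"
    using ideal.I_l_closed[OF R_ideal_ideal s(1) b(1)] ideal.I_r_closed[OF R_ideal_ideal s(1) b(1)] by auto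
  then have "emb X (b \<otimes>\<^bsub>AA\<^esub> s) \<in> RR" "emb X (s \<otimes>\<^bsub>AA\<^esub> b) \<in> RR" unfolding RR_def by (auto intro: imageI)
  then show "a * r \<in> RR" "r * a \<in> RR" by (simp_all add: emb_mult s b)
qed

lemma RR_uminus: "r \<in> RR \<Longrightarrow> - r \<in> RR"
  using RR_mult(1)[of "- 1" r] by (simp add: AX_uminus AX_1)

abbreviation mv :: "ivar \<Rightarrow> (ivar, 'p padic) ncs" where "mv v \<equiv> nmono [v]"

lemma emb_var: "v \<in> X \<Longrightarrow> emb X (A_var n v) = mv v"
  by (rule ncs_eqI) (auto simp: A_var_def nc_var_def cf_mono)

lemma emb_one_plus: "v \<in> X \<Longrightarrow> emb X (one_plus n v) = 1 + mv v"
  by (simp add: one_plus_def A_ring_eq emb_add emb_one emb_var)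

definition PP :: "ivar \<Rightarrow> 'p padic \<Rightarrow> (ivar, 'p padic) ncs" where
  "PP v q = emb X (one_plus_pow n v q)"

lemma cf_PP: "v \<in> X \<Longrightarrow> cf (PP v q) w = (if w = replicate (length w) v then padic_binomial q (length w) else 0)"
proof -
  assume v: "v \<in> X"
  have "w \<in> lists X" if "w = replicate (length w) v"
    by (subst that, rule in_listsI) (use v in auto)
  then show ?thesis by (auto simp: PP_def one_plus_pow_def nc_binomial_def)
qed

lemma PP_AX: "PP v q \<in> AX X"
  by (simp add: PP_def emb_in_AX)

lemma weight_replicate: "wa.weight (replicate r v) = r * wtv v"
  by (induction r) (simp_all add: wa.weight_Nil wa.weight_Cons)

lemma mv_AX: "v \<in> X \<Longrightarrow> mv v \<in> AX X"
  by (rule mono_AX) simp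

lemma mv_Fd: "v \<in> X \<Longrightarrow> mv v \<in> wa.Fd (wtv v)"
  using wa.nmono_Fd[of "[v]"] by (simp add: wa.weight_Cons wa.weight_Nil)

text \<open>A series in v alone has weight r times that of v in degree r, so its depth is governed
  by the first coefficient not divisible by p.\<close>

lemma Fd_one_variable:
  assumes "f \<in> AX X" "\<And>w. \<not> w = replicate (length w) v \<Longrightarrow> cf f w = 0"
    "\<And>r. r < k \<Longrightarrow> padic_p dvd cf f (replicate r v)"
  shows "f \<in> wa.Fd (k * wtv v)"
  unfolding wa.Fd_def
proof (intro CollectI conjI allI impI)
  fix w assume w: "wa.weight w < k * wtv v"
  show "padic_p dvd cf f w"
  proof (cases "w = replicate (length w) v")
    case True
    then have "length w * wtv v < k * wtv v" using w weight_replicate[of "length w" v] by simp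
    then have "length w < k" by (simp only: mult_less_cancel2)
    then show ?thesis using assms(3)[of "length w"] True by simp
  qed (use assms(2) in simp)
qed (rule assms(1))

lemma nonreplicate: "\<not> w = replicate (length w) v \<Longrightarrow> w \<noteq> []" "\<not> w = replicate (length w) v \<Longrightarrow> w \<noteq> [v]"
  by auto

text \<open>The binomial coefficients of index 1 to p - 1 vanish modulo p when p divides q, so the
  first correction is v^p. The next two lemmas treat the other exponents in the relations in the
  same manner.\<close>

lemma PP_0:
  assumes "v \<in> X" "padic_p dvd q" shows "PP v q - 1 \<in> wa.Fd (CARD('p) * wtv v)"
proof (rule Fd_one_variable)
  show "PP v q - 1 \<in> AX X" by (intro AX_diff PP_AX AX_1)
  show "cf (PP v q - 1) w = 0" if "\<not> w = replicate (length w) v" for w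
    using that nonreplicate[OF that] by (simp add: minus_ncs.rep_eq one_ncs.rep_eq cf_PP[OF assms(1)])
  show "padic_p dvd cf (PP v q - 1) (replicate r v)" if r: "r < CARD('p)" for r
  proof (cases r)
    case (Suc s)
    then show ?thesis
      using p_dvd_padic_binomial[OF r, of 0 q] assms(2)
      by (simp add: minus_ncs.rep_eq one_ncs.rep_eq cf_PP[OF assms(1)] del: replicate_Suc)
  qed (simp add: minus_ncs.rep_eq one_ncs.rep_eq cf_PP[OF assms(1)])
qed

lemma PP_1:
  assumes "v \<in> X" "padic_p dvd q - 1" shows "PP v q - (1 + mv v) \<in> wa.Fd (CARD('p) * wtv v)"
proof (rule Fd_one_variable)
  show "PP v q - (1 + mv v) \<in> AX X" by (intro AX_diff PP_AX AX_1 AX_add mv_AX assms(1))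
  show "cf (PP v q - (1 + mv v)) w = 0" if "\<not> w = replicate (length w) v" for w
    using that nonreplicate[OF that] by (simp add: minus_ncs.rep_eq plus_ncs.rep_eq one_ncs.rep_eq cf_PP[OF assms(1)] cf_mono)
  show "padic_p dvd cf (PP v q - (1 + mv v)) (replicate r v)" if r: "r < CARD('p)" for r
  proof -
    have e: "cf (PP v q - (1 + mv v)) (replicate r v) =
        padic_binomial q r - ((if r = 0 then 1 else 0) + (if r = 1 then 1 else 0))"
      by (auto simp: minus_ncs.rep_eq plus_ncs.rep_eq one_ncs.rep_eq cf_PP[OF assms(1)] cf_mono
          replicate_eq_replicate[of r v 1 v, simplified] simp flip: replicate_Suc)
    consider "r = 0" | "r = 1" | "1 < r" by linarith
    then show ?thesis
      unfolding e using p_dvd_padic_binomial[OF r, of 1 q] assms(2) by cases auto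
  qed
qed

lemma PP_m1:
  assumes "v \<in> X" shows "PP v (- 1) - (1 - mv v) \<in> wa.Fd (2 * wtv v)"
proof (rule Fd_one_variable)
  show "PP v (- 1) - (1 - mv v) \<in> AX X" by (intro AX_diff PP_AX AX_1 mv_AX assms)
  show "cf (PP v (- 1) - (1 - mv v)) w = 0" if "\<not> w = replicate (length w) v" for w
    using that nonreplicate[OF that] by (simp add: minus_ncs.rep_eq one_ncs.rep_eq cf_PP[OF assms(1)] cf_mono)
  show "padic_p dvd cf (PP v (- 1) - (1 - mv v)) (replicate r v)" if r: "r < 2" for r
  proof -
    have "r = 0 \<or> r = 1" using r by linarith
    then show ?thesis
      by (auto simp: minus_ncs.rep_eq one_ncs.rep_eq cf_PP[OF assms(1)] cf_mono)
  qed
qed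

text \<open>This is where p > n + 1 is spent: the p-th power of a letter of weight x lies strictly
  above weight n + x.\<close>

lemma p_weight: "1 \<le> x \<Longrightarrow> n + x + 1 \<le> CARD('p) * x"
proof -
  assume x: "1 \<le> x"
  have "(n + 1) * 1 \<le> (n + 1) * x" by (rule mult_le_mono2[OF x])
  then have "(n + 1) * 1 + x \<le> (n + 1) * x + x" by (rule add_right_mono)
  then have "n + x + 1 \<le> (n + 1) * x + x" by simp
  also have "\<dots> = (n + 2) * x" by (simp add: algebra_simps)
  also have "\<dots> \<le> CARD('p) * x" using p_gt by (intro mult_le_mono1) simp
  finally show "n + x + 1 \<le> CARD('p) * x" .
qed

section \<open>Commutators of pairs of variables\<close>

definition comm_ok :: "ivar \<Rightarrow> ivar \<Rightarrow> bool" where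
  "comm_ok x y \<longleftrightarrow> (\<exists>c r f. (\<forall>z\<in>X. c z \<noteq> 0 \<longrightarrow> wtv z = wtv x + wtv y) \<and>
      r \<in> RR \<and> f \<in> wa.Fd (wtv x + wtv y + 1) \<and>
      mv x * mv y - mv y * mv x = (\<Sum>z\<in>X. const (c z) * mv z) + r + f)"

lemma comm_okI:
  assumes "\<And>z. z \<in> X \<Longrightarrow> c z \<noteq> 0 \<Longrightarrow> wtv z = wtv x + wtv y" "r \<in> RR" "f \<in> wa.Fd (wtv x + wtv y + 1)"
    "mv x * mv y - mv y * mv x = (\<Sum>z\<in>X. const (c z) * mv z) + r + f"
  shows "comm_ok x y"
  unfolding comm_ok_def using assms by (intro exI[of _ c] exI[of _ r] exI[of _ f]) simp

lemma const_0: "const 0 = (0 :: (ivar, 'p padic) ncs)"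
  by (rule ncs_eqI) (simp add: const_def Ncs_inverse zero_ncs.rep_eq)

lemma const_1: "const 1 = (1 :: (ivar, 'p padic) ncs)"
  by (rule ncs_eqI) (simp add: const_def Ncs_inverse one_ncs.rep_eq)

lemma const_uminus: "const (- c) = - (const c :: (ivar, 'p padic) ncs)"
  by (rule ncs_eqI) (simp add: const_def Ncs_inverse uminus_ncs.rep_eq)

lemma comm_ok_zero:
  assumes "r \<in> RR" "f \<in> wa.Fd (wtv x + wtv y + 1)" "mv x * mv y - mv y * mv x = r + f"
  shows "comm_ok x y"
  by (rule comm_okI[where c="\<lambda>_. 0"]) (use assms in \<open>auto simp: const_0\<close>)

lemma comm_ok_single:
  assumes "z \<in> X" "wtv z = wtv x + wtv y" "r \<in> RR" "f \<in> wa.Fd (wtv x + wtv y + 1)"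
    "mv x * mv y - mv y * mv x = const q * mv z + r + f"
  shows "comm_ok x y"
proof (rule comm_okI[where c="\<lambda>z'. if z' = z then q else 0"])
  have "(\<Sum>z'\<in>X. const (if z' = z then q else 0) * mv z') = (\<Sum>z'\<in>X. if z' = z then const q * mv z else 0)"
    by (rule sum.cong) (auto simp: const_0)
  also have "\<dots> = const q * mv z" using assms(1) finite_ivars by simp
  finally show "mv x * mv y - mv y * mv x = (\<Sum>z'\<in>X. const (if z' = z then q else 0) * mv z') + r + f"
    using assms(5) by simp
qed (use assms in \<open>auto split: if_splits\<close>)

lemma comm_ok_sym:
  assumes "comm_ok x y" shows "comm_ok y x"
proof -
  obtain c r f where *: "\<forall>z\<in>X. c z \<noteq> 0 \<longrightarrow> wtv z = wtv x + wtv y" "r \<in> RR" "f \<in> wa.Fd (wtv x + wtv y + 1)"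
    "mv x * mv y - mv y * mv x = (\<Sum>z\<in>X. const (c z) * mv z) + r + f"
    using assms unfolding comm_ok_def by (elim exE conjE)
  show ?thesis
  proof (rule comm_okI[where c="\<lambda>z. - c z" and r="- r" and f="- f"])
    show "- r \<in> RR" by (rule RR_uminus[OF *(2)])
    show "- f \<in> wa.Fd (wtv y + wtv x + 1)" using wa.Fd_uminus[OF *(3)] by (simp add: add.commute)
    have "mv y * mv x - mv x * mv y = - (mv x * mv y - mv y * mv x)" by simp
    also have "\<dots> = (\<Sum>z\<in>X. const (- c z) * mv z) + - r + - f"
      unfolding *(4) by (simp add: const_uminus sum_negf)
    finally show "mv y * mv x - mv x * mv y = (\<Sum>z\<in>X. const (- c z) * mv z) + - r + - f" .
  qed (use * in \<open>auto simp: add.commute\<close>)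
qed

lemma relator_RR: "r \<in> relators n \<Longrightarrow> emb X r \<in> RR"
  unfolding RR_def by (rule imageI[OF relators_R])

lemma emb_rel2: "a \<in> carrier AA \<Longrightarrow> b \<in> carrier AA \<Longrightarrow> emb X (a \<ominus>\<^bsub>AA\<^esub> b) = emb X a - emb X b"
  by (rule emb_minus)

lemmas emb_rel = emb_rel2 emb_mult emb_one_plus AA.m_closed one_plus_closed one_plus_pow_closed A_var_closed
  W_prod_closed emb_var PP_def[symmetric]

lemma AX_1_plus: "v \<in> X \<Longrightarrow> 1 + mv v \<in> AX X"
  by (intro AX_add AX_1 mv_AX)

lemma powi_1_mod_p: "padic_p dvd up powi m - 1"
proof -
  have pow: "padic_p dvd a ^ k - 1" if "padic_p dvd a - 1" for a :: "'p padic" and k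
  proof (induction k)
    case (Suc k)
    then show ?case using dvd_diff_mult[OF that Suc] by simp
  qed simp
  have "padic_p dvd inverse up - 1" by (rule inverse_1_mod_p) simp
  then show ?thesis unfolding power_int_def using pow[of up] pow[of "inverse up"] by simp
qed

lemma comm_ok_var:
  assumes "x \<in> X" "y \<in> X"
    "A_var n x \<otimes>\<^bsub>AA\<^esub> A_var n y \<ominus>\<^bsub>AA\<^esub> A_var n y \<otimes>\<^bsub>AA\<^esub> A_var n x \<in> relators n"
  shows "comm_ok x y"
  by (rule comm_ok_zero[OF relator_RR[OF assms(3)] wa.Fd_zero]) (simp add: emb_rel assms(1,2))

text \<open>The exponent q is 1 modulo p, so (1 + v)^q is 1 + v up to v^p, which outweighs the total
  weight n + \<open>wtv v\<close>. The commutator thus has no terms at its own weight.\<close>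

lemma comm_ok_W:
  assumes "\<delta> \<in> SimpleRoots n" "v \<in> X" "q = up powi m"
    "one_plus n (W \<delta>) \<otimes>\<^bsub>AA\<^esub> one_plus n v \<ominus>\<^bsub>AA\<^esub> one_plus_pow n v q \<otimes>\<^bsub>AA\<^esub> one_plus n (W \<delta>) \<in> relators n"
  shows "comm_ok (W \<delta>) v"
proof -
  have w: "W \<delta> \<in> X" using assms(1) by simp
  define f where "f = PP v q - (1 + mv v)"
  have f: "f \<in> wa.Fd (CARD('p) * wtv v)"
    unfolding f_def by (rule PP_1[OF assms(2)]) (simp add: assms(3) powi_1_mod_p)
  show ?thesis
  proof (rule comm_ok_zero[OF relator_RR[OF assms(4)], where f="f * (1 + mv (W \<delta>))"])
    have "f * (1 + mv (W \<delta>)) \<in> wa.Fd (CARD('p) * wtv v)"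
      by (rule wa.Fd_mult_right[OF AX_1_plus[OF w] f])
    moreover have "wtv (W \<delta>) + wtv v + 1 \<le> CARD('p) * wtv v" using p_weight[of "wtv v"] wtv_pos[OF assms(2)] by simp
    ultimately show "f * (1 + mv (W \<delta>)) \<in> wa.Fd (wtv (W \<delta>) + wtv v + 1)" by (rule wa.Fd_mono[rotated])
    have "PP v q = f + (1 + mv v)" by (simp add: f_def)
    then show "mv (W \<delta>) * mv v - mv v * mv (W \<delta>) =
        emb X (one_plus n (W \<delta>) \<otimes>\<^bsub>AA\<^esub> one_plus n v \<ominus>\<^bsub>AA\<^esub> one_plus_pow n v q \<otimes>\<^bsub>AA\<^esub> one_plus n (W \<delta>)) + f * (1 + mv (W \<delta>))"
      by (simp add: emb_rel assms(1,2) algebra_simps)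
  qed
qed

text \<open>A bracket with p-divisible exponent contributes z^p at the earliest, and that lies above
  n + \<open>wtv z\<close>, the weight of the two letters together.\<close>

lemma comm_ok_p_power:
  assumes "x \<in> X" "y \<in> X" "z \<in> X" "padic_p dvd q" "wtv x + wtv y = n + wtv z"
    "one_plus n x \<otimes>\<^bsub>AA\<^esub> one_plus n y \<ominus>\<^bsub>AA\<^esub> one_plus_pow n z q \<otimes>\<^bsub>AA\<^esub> one_plus n y \<otimes>\<^bsub>AA\<^esub> one_plus n x \<in> relators n"
  shows "comm_ok x y"
proof -
  define f where "f = PP z q - 1"
  have f: "f \<in> wa.Fd (CARD('p) * wtv z)" unfolding f_def by (rule PP_0[OF assms(3,4)])
  let ?f = "f * (1 + mv y) * (1 + mv x)"
  show ?thesis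
  proof (rule comm_ok_zero[OF relator_RR[OF assms(6)], where f="?f"])
    have "?f \<in> wa.Fd (CARD('p) * wtv z)"
      by (intro wa.Fd_mult_right AX_1_plus assms(1,2) f)
    moreover have "wtv x + wtv y + 1 \<le> CARD('p) * wtv z" using p_weight[of "wtv z"] wtv_pos[OF assms(3)] assms(5) by simp
    ultimately show "?f \<in> wa.Fd (wtv x + wtv y + 1)" by (rule wa.Fd_mono[rotated])
    have "PP z q = f + 1" by (simp add: f_def)
    then show "mv x * mv y - mv y * mv x = emb X (one_plus n x \<otimes>\<^bsub>AA\<^esub> one_plus n y \<ominus>\<^bsub>AA\<^esub>
        one_plus_pow n z q \<otimes>\<^bsub>AA\<^esub> one_plus n y \<otimes>\<^bsub>AA\<^esub> one_plus n x) + ?f"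
      by (simp add: emb_rel assms(1,2) algebra_simps)
  qed
qed

text \<open>The bracket is a letter z of exactly the total weight, with coefficient q. Products of z
  with further letters and the quadratic terms in f are strictly heavier.\<close>

lemma comm_ok_bracket:
  assumes "x \<in> X" "y \<in> X" "z \<in> X" "wtv x + wtv y = wtv z"
    "one_plus n x \<otimes>\<^bsub>AA\<^esub> one_plus n y \<ominus>\<^bsub>AA\<^esub> Z \<otimes>\<^bsub>AA\<^esub> one_plus n y \<otimes>\<^bsub>AA\<^esub> one_plus n x \<in> relators n"
    "Z \<in> carrier AA" "emb X Z = 1 + const q * mv z + f" "f \<in> wa.Fd (2 * wtv z)"
  shows "comm_ok x y"
proof -
  let ?f = "const q * mv z * (mv x + mv y + mv y * mv x) + f * ((1 + mv y) * (1 + mv x))"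
  show ?thesis
  proof (rule comm_ok_single[OF assms(3) assms(4)[symmetric] relator_RR[OF assms(5)], where f="?f" and q=q])
    have m: "mv x + mv y + mv y * mv x \<in> wa.Fd 1"
    proof (intro wa.Fd_add)
      have 1: "mv x \<in> wa.Fd 1" "mv y \<in> wa.Fd 1"
        using wa.Fd_mono[OF _ mv_Fd[OF assms(1)], of 1] wa.Fd_mono[OF _ mv_Fd[OF assms(2)], of 1]
          wtv_pos[OF assms(1)] wtv_pos[OF assms(2)] by simp_all
      then show "mv x \<in> wa.Fd 1" "mv y \<in> wa.Fd 1" by auto
      show "mv y * mv x \<in> wa.Fd 1" by (rule wa.Fd_mult_left[OF mv_AX[OF assms(2)] 1(1)])
    qed
    have "const q * mv z * (mv x + mv y + mv y * mv x) \<in> wa.Fd (wtv z + 1)"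
      by (intro wa.Fd_mult[OF wa.Fd_mult_left[OF const_AX mv_Fd[OF assms(3)]] m])
    moreover have "f * ((1 + mv y) * (1 + mv x)) \<in> wa.Fd (wtv z + 1)"
    proof (rule wa.Fd_mono)
      show "f * ((1 + mv y) * (1 + mv x)) \<in> wa.Fd (2 * wtv z)"
        by (intro wa.Fd_mult_right AX_mult AX_1_plus assms)
      show "wtv z + 1 \<le> 2 * wtv z" using wtv_pos[OF assms(3)] by simp
    qed
    ultimately show "?f \<in> wa.Fd (wtv x + wtv y + 1)" unfolding assms(4) by (rule wa.Fd_add)
    have "emb X (one_plus n x \<otimes>\<^bsub>AA\<^esub> one_plus n y \<ominus>\<^bsub>AA\<^esub> Z \<otimes>\<^bsub>AA\<^esub> one_plus n y \<otimes>\<^bsub>AA\<^esub> one_plus n x) =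
        (1 + mv x) * (1 + mv y) - (1 + const q * mv z + f) * (1 + mv y) * (1 + mv x)"
      using assms(1,2,6,7) by (simp add: emb_rel)
    then show "mv x * mv y - mv y * mv x = const q * mv z + emb X (one_plus n x \<otimes>\<^bsub>AA\<^esub> one_plus n y \<ominus>\<^bsub>AA\<^esub>
        Z \<otimes>\<^bsub>AA\<^esub> one_plus n y \<otimes>\<^bsub>AA\<^esub> one_plus n x) + ?f"
      by (simp add: algebra_simps)
  qed
qed

text \<open>Every W has weight n, so products of two of them fall into weight 2 n and only the
  linear terms remain below.\<close>

lemma emb_W_prod:
  assumes "j < n"
  shows "\<exists>f\<in>wa.Fd (2 * n). emb X (W_prod n i j) = 1 + (\<Sum>c\<in>{i..<j}. mv (W (c, Suc c))) + f"
proof -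
  have WX: "W (c, Suc c) \<in> X" if "c < j" for c using that assms by (simp add: SimpleRoots_iff)
  have "\<exists>f\<in>wa.Fd (2 * n). emb X (foldr (\<lambda>c f. one_plus n (W (c, c + 1)) \<otimes>\<^bsub>AA\<^esub> f) l \<one>\<^bsub>AA\<^esub>) =
      1 + (\<Sum>c\<in>set l. mv (W (c, Suc c))) + f" if "distinct l" "\<forall>c\<in>set l. c < j" for l
    using that
  proof (induction l)
    case Nil
    show ?case by (intro bexI[of _ 0]) (simp_all add: emb_one wa.Fd_zero)
  next
    case (Cons c l)
    obtain f where f: "f \<in> wa.Fd (2 * n)" "emb X (foldr (\<lambda>c f. one_plus n (W (c, c + 1)) \<otimes>\<^bsub>AA\<^esub> f) l \<one>\<^bsub>AA\<^esub>) =
      1 + (\<Sum>c\<in>set l. mv (W (c, Suc c))) + f" using Cons by auto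
    have c: "W (c, Suc c) \<in> X" using Cons.prems WX by simp
    let ?S = "\<Sum>c\<in>set l. mv (W (c, Suc c))"
    have S: "?S \<in> wa.Fd n"
    proof -
      have "(\<Sum>c\<in>B. mv (W (c, Suc c))) \<in> wa.Fd n" if "\<forall>c\<in>B. c < j" for B
        using that
      proof (induction B rule: infinite_finite_induct)
        case (insert b B)
        then show ?case using mv_Fd[OF WX, of b] by (auto intro!: wa.Fd_add)
      qed (simp_all add: wa.Fd_zero)
      then show ?thesis using Cons.prems by simp
    qed
    let ?f = "mv (W (c, Suc c)) * ?S + (1 + mv (W (c, Suc c))) * f"
    have "mv (W (c, Suc c)) * ?S \<in> wa.Fd (2 * n)"
      using wa.Fd_mult[OF mv_Fd[OF c] S] by (simp add: mult_2)
    moreover have "(1 + mv (W (c, Suc c))) * f \<in> wa.Fd (2 * n)" by (rule wa.Fd_mult_left[OF AX_1_plus[OF c] f(1)])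
    ultimately have "?f \<in> wa.Fd (2 * n)" by (rule wa.Fd_add)
    moreover have "emb X (foldr (\<lambda>c f. one_plus n (W (c, c + 1)) \<otimes>\<^bsub>AA\<^esub> f) (c # l) \<one>\<^bsub>AA\<^esub>) =
        1 + (\<Sum>c\<in>set (c # l). mv (W (c, Suc c))) + ?f"
      using Cons.prems f(2) c by (simp add: emb_mult emb_one_plus algebra_simps)
    ultimately show ?case by (rule bexI[rotated])
  qed
  from this[of "[i..<j]"] show ?thesis by (simp add: W_prod_def A_ring_eq)
qed

text \<open>Opposite roots have total weight n, the weight of each W. Relation (8) therefore yields
  the sum of the W between i and j at this weight; the exponents of U and V only change terms of
  weight above n.\<close>

lemma comm_ok_opposite:
  assumes "(i, j) \<in> PosRoots n" shows "comm_ok (V (i, j)) (U (j, i))"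
proof -
  have ij: "i < j" "j < n" and neg: "(j, i) \<in> NegRoots n" using assms by (auto simp: PosRoots_iff NegRoots_iff)
  let ?u = "U (j, i)" and ?v = "V (i, j)"
  have uX: "?u \<in> X" and vX: "?v \<in> X" using assms neg by auto
  have wt: "wtv ?v + wtv ?u = n" and wu: "1 \<le> wtv ?u" "1 \<le> wtv ?v" using ij by auto
  obtain fW where fW: "fW \<in> wa.Fd (2 * n)" "emb X (W_prod n i j) = 1 + (\<Sum>c\<in>{i..<j}. mv (W (c, Suc c))) + fW"
    using emb_W_prod[OF ij(2), of i] by (elim bexE)
  let ?q = "inverse up :: 'p padic"
  have q: "padic_p dvd ?q - 1" by (rule inverse_1_mod_p) simp
  define fU fV where "fU = PP ?u ?q - (1 + mv ?u)" and "fV = PP ?v ?q - (1 + mv ?v)"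
  have F: "fU \<in> wa.Fd (n + 1)" "fV \<in> wa.Fd (n + 1)"
    unfolding fU_def fV_def
    using wa.Fd_mono[OF _ PP_1[OF uX q], of "n + 1"] wa.Fd_mono[OF _ PP_1[OF vX q], of "n + 1"]
      p_weight[OF wu(1)] p_weight[OF wu(2)] by auto
  \<comment> \<open>The indicator of the letters W in the product, written as a coefficient function
    on all variables.\<close>
  define c where "c z = (if \<exists>d\<in>{i..<j}. z = W (d, Suc d) then 1 else (0 :: 'p padic))" for z
  define S where "S = (\<Sum>z\<in>X. const (c z) * mv z)"
  have S: "S = (\<Sum>d\<in>{i..<j}. mv (W (d, Suc d)))"
  proof -
    have sub: "(\<lambda>d. W (d, Suc d)) ` {i..<j} \<subseteq> X" using ij by (auto simp: SimpleRoots_iff)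
    have "S = (\<Sum>z\<in>(\<lambda>d. W (d, Suc d)) ` {i..<j}. const (c z) * mv z)"
      unfolding S_def by (rule sum.mono_neutral_right[OF finite_ivars sub]) (auto simp: c_def const_0)
    also have "\<dots> = (\<Sum>d\<in>{i..<j}. const (c (W (d, Suc d))) * mv (W (d, Suc d)))"
      by (subst sum.reindex) (auto simp: inj_on_def)
    also have "\<dots> = (\<Sum>d\<in>{i..<j}. mv (W (d, Suc d)))"
      by (rule sum.cong) (auto simp: c_def const_1)
    finally show ?thesis .
  qed
  have SF: "S \<in> wa.Fd n"
  proof -
    have "const (c z) * mv z \<in> wa.Fd n" if "z \<in> X" for z
    proof (cases "c z = 0")
      case False
      then obtain d where "z = W (d, Suc d)" by (auto simp: c_def split: if_splits)
      then show ?thesis using wa.Fd_mult_left[OF const_AX mv_Fd[OF that]] by simp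
    qed (simp add: const_0 wa.Fd_zero)
    then have "(\<Sum>z\<in>B. const (c z) * mv z) \<in> wa.Fd n" if "B \<subseteq> X" for B
      using that by (induction B rule: infinite_finite_induct) (auto simp: wa.Fd_zero intro!: wa.Fd_add)
    then show ?thesis unfolding S_def by simp
  qed
  let ?Wp = "1 + S + fW" and ?PV = "1 + mv ?v + fV" and ?a = "1 + mv ?u"
  have fW': "fW \<in> wa.Fd (n + 1)" using n_ge_2 by (intro wa.Fd_mono[OF _ fW(1)]) simp
  have A: "?a \<in> AX X" "?PV \<in> AX X" "?Wp \<in> AX X"
    using AX_1_plus[OF uX] AX_add[OF AX_1_plus[OF vX] wa.Fd_AX[OF F(2)]]
      AX_add[OF AX_add[OF AX_1 wa.Fd_AX[OF SF]] wa.Fd_AX[OF fW(1)]] by auto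
  have m1: "mv ?u \<in> wa.Fd 1" "mv ?v \<in> wa.Fd 1"
    using wa.Fd_mono[OF wu(1) mv_Fd[OF uX]] wa.Fd_mono[OF wu(2) mv_Fd[OF vX]] by auto
  \<comment> \<open>Expanding the right-hand side of the relation gives (1 + u)(1 + v) + S and these
    five terms. Each contains a factor of weight n + 1, or S of weight n next to a factor of weight
    at least 1.\<close>
  let ?f = "fU * ?Wp * ?PV + ?a * (fW * ?PV) + ?a * (S * (mv ?v + fV)) + mv ?u * S + ?a * fV"
  have "fU * ?Wp * ?PV \<in> wa.Fd (n + 1)" by (intro wa.Fd_mult_right A F(1))
  moreover have "?a * (fW * ?PV) \<in> wa.Fd (n + 1)" by (intro wa.Fd_mult_left wa.Fd_mult_right A fW')
  moreover have "mv ?v + fV \<in> wa.Fd 1" using wa.Fd_add[OF m1(2) wa.Fd_mono[OF _ F(2)]] by simp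
  then have "?a * (S * (mv ?v + fV)) \<in> wa.Fd (n + 1)" by (intro wa.Fd_mult_left[OF A(1)] wa.Fd_mult SF)
  moreover have "mv ?u * S \<in> wa.Fd (n + 1)" using wa.Fd_mult[OF m1(1) SF] by (simp add: add.commute)
  moreover have "?a * fV \<in> wa.Fd (n + 1)" by (intro wa.Fd_mult_left A F)
  ultimately have fF: "?f \<in> wa.Fd (wtv ?v + wtv ?u + 1)" unfolding wt by (intro wa.Fd_add)
  have r: "one_plus n ?v \<otimes>\<^bsub>AA\<^esub> one_plus n ?u \<ominus>\<^bsub>AA\<^esub> one_plus_pow n ?u ?q \<otimes>\<^bsub>AA\<^esub> W_prod n i j \<otimes>\<^bsub>AA\<^esub> one_plus_pow n ?v ?q \<in> relators n"
    using relators.rel8[OF assms, where 'p='p] unfolding A_ring_eq .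
  have "emb X (one_plus n ?v \<otimes>\<^bsub>AA\<^esub> one_plus n ?u \<ominus>\<^bsub>AA\<^esub> one_plus_pow n ?u ?q \<otimes>\<^bsub>AA\<^esub> W_prod n i j \<otimes>\<^bsub>AA\<^esub> one_plus_pow n ?v ?q)
      = (1 + mv ?v) * (1 + mv ?u) - PP ?u ?q * emb X (W_prod n i j) * PP ?v ?q"
    using uX vX by (simp add: emb_rel)
  also have "\<dots> = (1 + mv ?v) * (1 + mv ?u) - (?a + fU) * ?Wp * ?PV"
    unfolding fW(2) S by (simp add: fU_def fV_def add.commute)
  finally have e: "emb X (one_plus n ?v \<otimes>\<^bsub>AA\<^esub> one_plus n ?u \<ominus>\<^bsub>AA\<^esub> one_plus_pow n ?u ?q \<otimes>\<^bsub>AA\<^esub> W_prod n i j \<otimes>\<^bsub>AA\<^esub> one_plus_pow n ?v ?q)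
      = (1 + mv ?v) * (1 + mv ?u) - (?a + fU) * ?Wp * ?PV" .
  show ?thesis
  proof (rule comm_okI[OF _ relator_RR[OF r] fF, where c=c])
    show "wtv z = wtv ?v + wtv ?u" if "c z \<noteq> 0" for z
      using that unfolding wt by (auto simp: c_def split: if_splits)
    show "mv ?v * mv ?u - mv ?u * mv ?v = (\<Sum>z\<in>X. const (c z) * mv z) +
        emb X (one_plus n ?v \<otimes>\<^bsub>AA\<^esub> one_plus n ?u \<ominus>\<^bsub>AA\<^esub> one_plus_pow n ?u ?q \<otimes>\<^bsub>AA\<^esub> W_prod n i j \<otimes>\<^bsub>AA\<^esub> one_plus_pow n ?v ?q) + ?f"
      unfolding e S_def[symmetric] by (simp add: algebra_simps)
  qed
qed

lemma comm_ok_UU: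
  assumes "\<beta> \<in> NegRoots n" "\<beta>' \<in> NegRoots n" shows "comm_ok (U \<beta>) (U \<beta>')"
proof (cases "sum_is_root n \<beta> \<beta>'")
  case False
  show ?thesis
    using comm_ok_var[of "U \<beta>" "U \<beta>'"] relators.rel9[OF assms False, where 'p='p] assms unfolding A_ring_eq by simp
next
  case True
  have key: "comm_ok (U (i, j)) (U (j, k))" if r: "(i, j) \<in> NegRoots n" "(j, k) \<in> NegRoots n" for i j k
  proof -
    have b: "k < j" "j < i" "i < n" using r by (auto simp: NegRoots_iff)
    show ?thesis
      by (rule comm_ok_p_power[where z="U (i, k)" and q="padic_p"])
         (use r b relators.rel10[OF r, where 'p='p] in \<open>auto simp: A_ring_eq NegRoots_iff\<close>)
  qed
  from True obtain i j k where "\<beta> = (i, j) \<and> \<beta>' = (j, k) \<or> \<beta>' = (i, j) \<and> \<beta> = (j, k)"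
    unfolding sum_is_root_def by (elim exE conjE) (rule that)
  then show ?thesis
  proof
    assume "\<beta> = (i, j) \<and> \<beta>' = (j, k)"
    then show ?thesis using key[of i j k] assms by simp
  next
    assume "\<beta>' = (i, j) \<and> \<beta> = (j, k)"
    then show ?thesis using comm_ok_sym[OF key[of i j k]] assms by simp
  qed
qed

lemma comm_ok_VV:
  assumes "\<alpha> \<in> PosRoots n" "\<alpha>' \<in> PosRoots n" shows "comm_ok (V \<alpha>) (V \<alpha>')"
proof (cases "sum_is_root n \<alpha> \<alpha>'")
  case False
  show ?thesis
    using comm_ok_var[of "V \<alpha>" "V \<alpha>'"] relators.rel13[OF assms False, where 'p='p] assms unfolding A_ring_eq by simp
next
  case True
  have key: "comm_ok (V (i, j)) (V (j, k))" if r: "(i, j) \<in> PosRoots n" "(j, k) \<in> PosRoots n" for i j k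
  proof -
    have b: "i < j" "j < k" "k < n" using r by (auto simp: PosRoots_iff)
    have z: "V (i, k) \<in> X" using b by (simp add: PosRoots_iff)
    have e: "emb X (one_plus n (V (i, k))) = 1 + const 1 * mv (V (i, k)) + 0"
      by (simp add: emb_one_plus[OF z] const_1)
    show ?thesis
      by (rule comm_ok_bracket[OF _ _ z _ _ one_plus_closed e wa.Fd_zero])
         (use r b relators.rel14[OF r, where 'p='p] in \<open>auto simp: A_ring_eq\<close>)
  qed
  from True obtain i j k where "\<alpha> = (i, j) \<and> \<alpha>' = (j, k) \<or> \<alpha>' = (i, j) \<and> \<alpha> = (j, k)"
    unfolding sum_is_root_def by (elim exE conjE) (rule that)
  then show ?thesis
  proof
    assume "\<alpha> = (i, j) \<and> \<alpha>' = (j, k)"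
    then show ?thesis using key[of i j k] assms by simp
  next
    assume "\<alpha>' = (i, j) \<and> \<alpha> = (j, k)"
    then show ?thesis using comm_ok_sym[OF key[of i j k]] assms by simp
  qed
qed

lemma comm_ok_VU:
  assumes "\<alpha> \<in> PosRoots n" "\<beta> \<in> NegRoots n" shows "comm_ok (V \<alpha>) (U \<beta>)"
proof -
  obtain i j k l where ab: "\<alpha> = (i, j)" "\<beta> = (k, l)" by fastforce
  have b: "i < j" "j < n" "l < k" "k < n" using assms by (auto simp: ab PosRoots_iff NegRoots_iff)
  \<comment> \<open>The cases correspond in turn to relations (8), (4), (5), (6), (7) and
    (3).\<close>
  consider "j = k" "i = l" | "j = k" "i < l" | "j = k" "l < i" | "j \<noteq> k" "i = l" "k < j" | "j \<noteq> k" "i = l" "j < k"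
    | "j \<noteq> k" "i \<noteq> l" by linarith
  then show ?thesis
  proof cases
    case 1
    then show ?thesis using comm_ok_opposite[of i j] assms by (simp add: ab)
  next
    case 2
    have r: "(i, j) \<in> PosRoots n" "(j, l) \<in> NegRoots n" using assms 2 by (simp_all add: ab)
    show ?thesis unfolding ab
      by (rule comm_ok_p_power[where z="V (i, l)" and q="padic_p"])
         (use r b 2 relators.rel4[OF r 2(2), where 'p='p] in \<open>auto simp: A_ring_eq PosRoots_iff\<close>)
  next
    case 3
    have r: "(i, j) \<in> PosRoots n" "(j, l) \<in> NegRoots n" using assms 3 by (simp_all add: ab)
    have z: "U (i, l) \<in> X" using b 3 by (simp add: NegRoots_iff)
    have e: "emb X (one_plus n (U (i, l))) = 1 + const 1 * mv (U (i, l)) + 0"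
      by (simp add: emb_one_plus[OF z] const_1)
    show ?thesis unfolding ab
      by (rule comm_ok_bracket[OF _ _ z _ _ one_plus_closed e wa.Fd_zero])
         (use r b 3 relators.rel5[OF r 3(2), where 'p='p] in \<open>auto simp: A_ring_eq\<close>)
  next
    case 4
    have r: "(i, j) \<in> PosRoots n" "(k, i) \<in> NegRoots n" using assms 4 by (simp_all add: ab)
    show ?thesis unfolding ab
      by (rule comm_ok_p_power[where z="V (k, j)" and q="- padic_p"])
         (use r b 4 relators.rel6[OF r 4(3), where 'p='p] in \<open>auto simp: A_ring_eq PosRoots_iff\<close>)
  next
    case 5
    have r: "(i, j) \<in> PosRoots n" "(k, i) \<in> NegRoots n" using assms 5 by (simp_all add: ab)
    have z: "U (k, j) \<in> X" using b 5 by (simp add: NegRoots_iff)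
    define f where "f = PP (U (k, j)) (- 1) - (1 - mv (U (k, j)))"
    have f: "f \<in> wa.Fd (2 * wtv (U (k, j)))" unfolding f_def by (rule PP_m1[OF z])
    have e: "emb X (one_plus_pow n (U (k, j)) (- 1)) = 1 + const (- 1) * mv (U (k, j)) + f"
      by (simp add: f_def PP_def const_uminus const_1)
    show ?thesis unfolding ab
      by (rule comm_ok_bracket[OF _ _ z _ _ one_plus_pow_closed e f])
         (use r b 5 relators.rel7[OF r 5(3), where 'p='p] in \<open>auto simp: A_ring_eq\<close>)
  next
    case 6
    have ns: "\<not> sum_is_root n \<alpha> \<beta>" using 6 unfolding sum_is_root_def ab by auto
    have "\<alpha> \<noteq> neg_root \<beta>" using 6 by (simp add: ab)
    then show ?thesis
      using comm_ok_var[of "V \<alpha>" "U \<beta>"] relators.rel3[OF assms _ ns, where 'p='p] assms unfolding A_ring_eq by simp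
  qed
qed

lemma comm_ok_all:
  assumes "x \<in> X" "y \<in> X" shows "comm_ok x y"
proof -
  have UU: "comm_ok (U \<beta>) (U \<beta>')" if "\<beta> \<in> NegRoots n" "\<beta>' \<in> NegRoots n" for \<beta> \<beta>' by (rule comm_ok_UU[OF that])
  have WU: "comm_ok (W \<delta>) (U \<beta>)" if "\<delta> \<in> SimpleRoots n" "\<beta> \<in> NegRoots n" for \<delta> \<beta>
    using comm_ok_W[OF that(1), of "U \<beta>"] that relators.rel1[OF that, where 'p='p] unfolding A_ring_eq by simp
  have WV: "comm_ok (W \<delta>) (V \<alpha>)" if "\<delta> \<in> SimpleRoots n" "\<alpha> \<in> PosRoots n" for \<delta> \<alpha>
    using comm_ok_W[OF that(1), of "V \<alpha>"] that relators.rel2[OF that, where 'p='p] unfolding A_ring_eq by simp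
  have WW: "comm_ok (W \<delta>) (W \<delta>')" if "\<delta> \<in> SimpleRoots n" "\<delta>' \<in> SimpleRoots n" for \<delta> \<delta>'
    using comm_ok_var[of "W \<delta>" "W \<delta>'"] that relators.rel12[OF that, where 'p='p] unfolding A_ring_eq by simp
  show ?thesis
    using assms UU WU WV WW comm_ok_VU comm_ok_VV comm_ok_sym[OF WU] comm_ok_sym[OF WV] comm_ok_sym[OF comm_ok_VU]
    by (cases x; cases y) simp_all
qed

text \<open>The order is chosen to match matrix entries: U by columns from the left, V by columns
  from the right. In this order no product of two elementary matrices creates a new entry, so the
  exponents are themselves the coordinates of the triangular factors.\<close>

definition vsU :: "ivar list" where "vsU = concat (map (\<lambda>j. map (\<lambda>i. U (i, j)) [Suc j..<n]) [0..<n])"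
definition vsW :: "ivar list" where "vsW = map (\<lambda>c. W (c, Suc c)) [0..<n - 1]"
definition vsV :: "ivar list" where "vsV = concat (map (\<lambda>j. map (\<lambda>i. V (i, j)) [0..<j]) (rev [0..<n]))"
definition vs :: "ivar list" where "vs = vsU @ vsW @ vsV"

lemma set_vsU: "set vsU = U ` NegRoots n" and set_vsW: "set vsW = W ` SimpleRoots n" and set_vsV: "set vsV = V ` PosRoots n"
  using n_ge_2 by (force simp: vsU_def vsW_def vsV_def NegRoots_def PosRoots_def SimpleRoots_def Roots_def image_iff)+

lemma set_vs: "set vs = X"
  by (simp add: vs_def set_vsU set_vsW set_vsV ivars_def Un_assoc)

lemma distinct_vs: "distinct vs"
proof -
  have "distinct vsU" unfolding vsU_def by (rule distinct_concat_map) (auto simp: distinct_map inj_on_def)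
  moreover have "distinct vsW" unfolding vsW_def by (auto simp: distinct_map inj_on_def)
  moreover have "distinct vsV" unfolding vsV_def by (rule distinct_concat_map) (auto simp: distinct_map inj_on_def)
  ultimately show ?thesis by (auto simp: vs_def set_vsU set_vsW set_vsV)
qed

sublocale rw: nc_rewriting X wtv pt vs RR
proof
  show "\<exists>c r f. (\<forall>z\<in>X. c z \<noteq> 0 \<longrightarrow> wtv z = wtv x + wtv y) \<and> r \<in> RR \<and> f \<in> wa.Fd (wtv x + wtv y + 1) \<and>
      mv x * mv y - mv y * mv x = (\<Sum>z\<in>X. const (c z) * mv z) + r + f" if "x \<in> X" "y \<in> X" for x y
    using comm_ok_all[OF that] unfolding comm_ok_def .
qed (fact set_vs distinct_vs RR_AX RR_zero RR_add RR_mult)+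

end

section \<open>Independence of ordered monomials\<close>

lemma power_expansion:
  fixes e :: "'a::comm_ring_1"
  shows "\<exists>t. (1 + e) ^ y = 1 + of_nat y * e + of_nat (y choose 2) * e ^ 2 + e ^ 3 * t"
proof (induction y)
  case 0
  show ?case by (rule exI[of _ 0]) (simp add: binomial_eq_0)
next
  case (Suc y)
  then obtain t where t: "(1 + e) ^ y = 1 + of_nat y * e + of_nat (y choose 2) * e ^ 2 + e ^ 3 * t" by (elim exE)
  have c: "(Suc y choose 2) = (y choose 2) + y" by (simp add: numeral_2_eq_2)
  have "(1 + e) ^ Suc y = 1 + of_nat (Suc y) * e + of_nat (Suc y choose 2) * e ^ 2 +
      e ^ 3 * (of_nat (y choose 2) + t + t * e)"
    unfolding power_Suc t c by (simp add: algebra_simps power2_eq_square power3_eq_cube)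
  then show ?case by (rule exI)
qed

section \<open>Powers of 1 + p\<close>

context iwahori_setting
begin

text \<open>The valuation of (1 + p)^(p^v) - 1 is exactly v + 1: under a p-th power the linear term
  dominates, because p is odd and so divides (p choose 2).\<close>

lemma up_power_p_power:
  "\<exists>z. up ^ (CARD('p) ^ v) = 1 + padic_p ^ Suc v * z \<and> \<not> padic_p dvd z"
proof (induction v)
  case 0
  show ?case using p_not_dvd_1[where 'p='p] by (intro exI[of _ 1]) simp
next
  case (Suc v)
  then obtain z where z: "up ^ (CARD('p) ^ v) = 1 + padic_p ^ Suc v * z" "\<not> padic_p dvd z" by (elim exE conjE)
  let ?p = "CARD('p)" and ?e = "padic_p ^ Suc v * z"
  obtain t where t: "(1 + ?e) ^ ?p = 1 + of_nat ?p * ?e + of_nat (?p choose 2) * ?e ^ 2 + ?e ^ 3 * t"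
    using power_expansion[of ?e ?p] by (elim exE)
  have "2 < ?p" using p_gt n_ge_2 by simp
  then have "?p dvd (?p choose 2)" using prime_card[where 'a='p] by (intro dvd_choose_prime) auto
  then obtain b where b: "(?p choose 2) = ?p * b" by (elim dvdE)
  have "up ^ (?p ^ Suc v) = (up ^ (?p ^ v)) ^ ?p" by (simp add: power_mult[symmetric] mult.commute)
  also have "\<dots> = 1 + of_nat ?p * ?e + of_nat (?p choose 2) * ?e ^ 2 + ?e ^ 3 * t" unfolding z(1) t ..
  also have "\<dots> = 1 + padic_p ^ Suc (Suc v) * (z + padic_p * (padic_p ^ v * of_nat b * z ^ 2 + padic_p ^ v * padic_p ^ v * z ^ 3 * t))"
    unfolding b by (simp add: algebra_simps power2_eq_square power3_eq_cube power_add mult_2)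
  finally have "up ^ (?p ^ Suc v) = 1 + padic_p ^ Suc (Suc v) *
      (z + padic_p * (padic_p ^ v * of_nat b * z ^ 2 + padic_p ^ v * padic_p ^ v * z ^ 3 * t))" .
  moreover have "\<not> padic_p dvd z + padic_p * (padic_p ^ v * of_nat b * z ^ 2 + padic_p ^ v * padic_p ^ v * z ^ 3 * t)"
    using z(2) by (simp add: dvd_add_left_iff)
  ultimately show ?case by blast
qed

text \<open>To first order the power is linear in y with unit slope z. This drives both the recovery
  of exponents and the approximation of elements by powers.\<close>

lemma up_power_multiple:
  "\<exists>z. \<not> padic_p dvd z \<and> (\<forall>y. padic_p ^ Suc (Suc v) dvd up ^ (CARD('p) ^ v * y) - (1 + padic_p ^ Suc v * (of_nat y * z)))"
proof -
  obtain z where z: "up ^ (CARD('p) ^ v) = 1 + padic_p ^ Suc v * z" "\<not> padic_p dvd z"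
    using up_power_p_power[of v] by (elim exE conjE)
  have "padic_p ^ Suc (Suc v) dvd up ^ (CARD('p) ^ v * y) - (1 + padic_p ^ Suc v * (of_nat y * z))" for y
  proof -
    let ?e = "padic_p ^ Suc v * z"
    obtain t where t: "(1 + ?e) ^ y = 1 + of_nat y * ?e + of_nat (y choose 2) * ?e ^ 2 + ?e ^ 3 * t"
      using power_expansion[of ?e y] by (elim exE)
    have "up ^ (CARD('p) ^ v * y) - (1 + padic_p ^ Suc v * (of_nat y * z)) =
        padic_p ^ Suc (Suc v) * (padic_p ^ v * (of_nat (y choose 2) * z ^ 2 + ?e * z ^ 2 * t))"
      unfolding power_mult z(1) t by (simp add: algebra_simps power2_eq_square power3_eq_cube)
    then show ?thesis by simp
  qed
  then show ?thesis using z(2) by blast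
qed

text \<open>If a and b differ with p-adic valuation v, then the powers differ with valuation exactly
  v + 1, which forces k \<le> v.\<close>

lemma up_power_cong:
  assumes "padic_p ^ Suc k dvd up ^ a - up ^ b"
  shows "padic_p ^ k dvd of_nat a - (of_nat b :: 'p padic)"
proof -
  have key: "padic_p ^ k dvd of_nat a - (of_nat b :: 'p padic)"
    if le: "b \<le> a" and d: "padic_p ^ Suc k dvd up ^ a - up ^ b" for a b
  proof (cases "a = b")
    case False
    define x where "x = a - b"
    have x: "a = b + x" "0 < x" using le False by (auto simp: x_def)
    have nd: "\<not> padic_p dvd up ^ b"
      using p_not_dvd_1p by (induction b) (auto simp: p_not_dvd_1 p_dvd_mult_iff)
    have "padic_p ^ Suc k dvd up ^ b * (up ^ x - 1)" using d by (simp add: x(1) power_add algebra_simps)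
    then have d1: "padic_p ^ Suc k dvd up ^ x - 1" by (simp only: p_power_dvd_mult_unit[OF nd])
    obtain y where y: "x = CARD('p) ^ multiplicity CARD('p) x * y" "\<not> CARD('p) dvd y"
      by (rule multiplicity_decompose'[of x "CARD('p)"]) (use x(2) CARD_gt_1[where 'p='p] in auto)
    let ?v = "multiplicity CARD('p) x"
    obtain z where z: "\<not> padic_p dvd z" "padic_p ^ Suc (Suc ?v) dvd up ^ x - (1 + padic_p ^ Suc ?v * (of_nat y * z))"
      using up_power_multiple[of ?v] y(1) by metis
    have "k \<le> ?v"
    proof (rule ccontr)
      assume "\<not> k \<le> ?v"
      then have "Suc (Suc ?v) \<le> Suc k" by simp
      then have "padic_p ^ Suc (Suc ?v) dvd up ^ x - 1" by (rule power_le_dvd[OF d1])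
      from dvd_diff[OF this z(2)] have "padic_p ^ Suc ?v * padic_p dvd padic_p ^ Suc ?v * (of_nat y * z)"
        by (simp add: mult.commute)
      then have "padic_p dvd of_nat y * z"
        using p_nonzero[where 'p='p] by (simp only: dvd_mult_cancel_left power_eq_0_iff) simp
      then show False using z(1) y(2) by (simp add: p_dvd_mult_iff p_dvd_of_nat_iff)
    qed
    then have "CARD('p) ^ k dvd x" using y(1) by (metis dvd_mult2 le_imp_power_dvd)
    then have "padic_p ^ k dvd (of_nat x :: 'p padic)" by (simp only: p_power_dvd_of_nat_iff)
    then show ?thesis by (simp add: x(1))
  qed simp
  show ?thesis
  proof (cases "b \<le> a")
    case True
    then show ?thesis using key assms by blast
  next
    case False
    then have "padic_p ^ k dvd of_nat b - (of_nat a :: 'p padic)"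
      using assms[unfolded dvd_diff_sym[of _ "up ^ a"]] by (intro key) simp_all
    then show ?thesis by (simp only: dvd_diff_sym[of _ "of_nat a"])
  qed
qed

section \<open>Ordered products as lower times diagonal times upper\<close>

definition pml :: "ivar list \<Rightarrow> (ivar \<Rightarrow> nat) \<Rightarrow> 'p padic mat \<Rightarrow> 'p padic mat" where
  "pml l c B = foldr (\<lambda>v g. gen v [^]\<^bsub>G\<^esub> c v * g) l B"

lemma pml_simps [simp]: "pml [] c B = B" "pml (v # l) c B = gen v [^]\<^bsub>G\<^esub> c v * pml l c B"
  by (simp_all add: pml_def)

lemma pml_append: "pml (l @ l') c B = pml l c (pml l' c B)"
  by (simp add: pml_def)

lemma pml_concat: "pml (concat (map f js)) c B = foldr (\<lambda>j. pml (f j) c) js B"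
  by (induction js) (simp_all add: pml_append)

lemma pml_closed: "set l \<subseteq> X \<Longrightarrow> B \<in> carrier G \<Longrightarrow> pml l c B \<in> carrier G"
proof (induction l)
  case (Cons v l)
  then show ?case using G_mult_closed[of "gen v [^]\<^bsub>G\<^esub> c v" "pml l c B"] gen_closed[of v] by simp
qed simp

lemma x_mat_power:
  assumes "x_mat n (i, j) t \<in> carrier G" "i < n" "j < n" "i \<noteq> j"
  shows "x_mat n (i, j) t [^]\<^bsub>G\<^esub> (m::nat) = x_mat n (i, j) (of_nat m * t)"
proof (induction m)
  case 0
  then show ?case by (simp add: x_mat_zero)
next
  case (Suc m)
  then show ?case using x_mat_add[OF assms(2-4), of "of_nat m * t" t] by (simp add: algebra_simps)
qed

text \<open>Every factor reads row j, which none of them changes, so the contributions are added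
  independently of each other.\<close>

lemma foldr_x_mat_index:
  assumes "B \<in> carrier_mat n n" "\<forall>i\<in>set is. i < n \<and> i \<noteq> j" "distinct is" "j < n" "a < n" "b < n"
  shows "foldr (\<lambda>i g. x_mat n (i, j) (t i) * g) is B \<in> carrier_mat n n \<and>
    foldr (\<lambda>i g. x_mat n (i, j) (t i) * g) is B $$ (a, b) =
      B $$ (a, b) + (if a \<in> set is then t a * B $$ (j, b) else (0 :: 'p padic))"
  using assms(2,3,5)
proof (induction "is" arbitrary: a)
  case Nil
  then show ?case using assms(1) by simp
next
  case (Cons i l)
  let ?R = "foldr (\<lambda>i g. x_mat n (i, j) (t i) * g) l B"
  have il: "i < n" "i \<noteq> j" "i \<notin> set l" "j \<notin> set l" using Cons.prems by auto
  have IH: "?R \<in> carrier_mat n n" "?R $$ (a, b) = B $$ (a, b) + (if a \<in> set l then t a * B $$ (j, b) else 0)"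
    "?R $$ (j, b) = B $$ (j, b)"
    using Cons.IH[of a] Cons.IH[of j] Cons.prems assms(4) il by auto
  show ?case
    using x_mat_mult_index[OF IH(1) il(1) assms(4) Cons.prems(3) assms(6), of "t i"] IH il by auto
qed

lemma gen_U_power: "(i, j) \<in> NegRoots n \<Longrightarrow> gen (U (i, j)) [^]\<^bsub>G\<^esub> (m::nat) = x_mat n (i, j) (of_nat m * padic_p)"
  using x_mat_power[of i j padic_p m] gen_closed[of "U (i, j)"] by (simp add: NegRoots_iff)

lemma gen_V_power: "(i, j) \<in> PosRoots n \<Longrightarrow> gen (V (i, j)) [^]\<^bsub>G\<^esub> (m::nat) = x_mat n (i, j) (of_nat m)"
  using x_mat_power[of i j 1 m] gen_closed[of "V (i, j)"] by (simp add: PosRoots_iff)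

text \<open>\<open>Lc\<close>, \<open>Nc\<close> and \<open>Dc\<close> are the entries of the lower
  unipotent, upper unipotent and diagonal factor of the ordered product with exponents c.\<close>

definition Lc :: "(ivar \<Rightarrow> nat) \<Rightarrow> nat \<Rightarrow> nat \<Rightarrow> 'p padic" where
  "Lc c a b = (if a = b then 1 else if b < a then of_nat (c (U (a, b))) * padic_p else 0)"

definition Nc :: "(ivar \<Rightarrow> nat) \<Rightarrow> nat \<Rightarrow> nat \<Rightarrow> 'p padic" where
  "Nc c a b = (if a = b then 1 else if a < b then of_nat (c (V (a, b))) else 0)"

definition Dc :: "(ivar \<Rightarrow> nat) \<Rightarrow> nat \<Rightarrow> 'p padic" where
  "Dc c a = (if a < n - 1 then up ^ c (W (a, Suc a)) else 1) * (if 0 < a then inverse up ^ c (W (a - 1, a)) else 1)"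

lemma pml_column_U:
  assumes "B \<in> carrier_mat n n" "j < n" "a < n" "b < n"
  shows "pml (map (\<lambda>i. U (i, j)) [Suc j..<n]) c B \<in> carrier_mat n n \<and>
    pml (map (\<lambda>i. U (i, j)) [Suc j..<n]) c B $$ (a, b) =
      B $$ (a, b) + (if j < a then of_nat (c (U (a, j))) * padic_p * B $$ (j, b) else 0)"
proof -
  have "pml (map (\<lambda>i. U (i, j)) l) c B = foldr (\<lambda>i g. x_mat n (i, j) (of_nat (c (U (i, j))) * padic_p) * g) l B"
    if "\<forall>i\<in>set l. j < i \<and> i < n" for l
    using that by (induction l) (simp_all add: gen_U_power NegRoots_iff del: gen.simps)
  from this[of "[Suc j..<n]"] show ?thesis
    using foldr_x_mat_index[OF assms(1), of "[Suc j..<n]" j a b "\<lambda>i. of_nat (c (U (i, j))) * padic_p"] assms by auto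
qed

lemma pml_column_V:
  assumes "B \<in> carrier_mat n n" "j < n" "a < n" "b < n"
  shows "pml (map (\<lambda>i. V (i, j)) [0..<j]) c B \<in> carrier_mat n n \<and>
    pml (map (\<lambda>i. V (i, j)) [0..<j]) c B $$ (a, b) =
      B $$ (a, b) + (if a < j then of_nat (c (V (a, j))) * B $$ (j, b) else 0)"
proof -
  have "pml (map (\<lambda>i. V (i, j)) l) c B = foldr (\<lambda>i g. x_mat n (i, j) (of_nat (c (V (i, j)))) * g) l B"
    if "\<forall>i\<in>set l. i < j" for l
    using that assms(2) by (induction l) (simp_all add: gen_V_power PosRoots_iff del: gen.simps)
  from this[of "[0..<j]"] show ?thesis
    using foldr_x_mat_index[OF assms(1), of "[0..<j]" j a b "\<lambda>i. of_nat (c (V (i, j)))"] assms by auto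
qed

lemma pml_vsV:
  assumes "a < n" "b < n"
  shows "pml vsV c (1\<^sub>m n) \<in> carrier_mat n n \<and> pml vsV c (1\<^sub>m n) $$ (a, b) = Nc c a b"
proof -
  let ?P = "\<lambda>m. foldr (\<lambda>j. pml (map (\<lambda>i. V (i, j)) [0..<j]) c) (rev [0..<m]) (1\<^sub>m n)"
  have "?P m \<in> carrier_mat n n \<and> (\<forall>a<n. \<forall>b<n. ?P m $$ (a, b) =
      (if a = b then 1 else if a < b \<and> b < m then of_nat (c (V (a, b))) else 0))" if "m \<le> n" for m
    using that
  proof (induction m)
    case 0
    then show ?case by simp
  next
    case (Suc m)
    then have IH: "?P m \<in> carrier_mat n n" "\<And>a b. a < n \<Longrightarrow> b < n \<Longrightarrow> ?P m $$ (a, b) =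
      (if a = b then 1 else if a < b \<and> b < m then of_nat (c (V (a, b))) else 0)" and m: "m < n" by auto
    have e: "?P (Suc m) = pml (map (\<lambda>i. V (i, m)) [0..<m]) c (?P m)" by simp
    show ?case
      unfolding e
    proof (intro conjI allI impI)
      show "pml (map (\<lambda>i. V (i, m)) [0..<m]) c (?P m) \<in> carrier_mat n n" using pml_column_V[OF IH(1) m m m] by blast
      fix a b assume ab: "a < n" "b < n"
      have "pml (map (\<lambda>i. V (i, m)) [0..<m]) c (?P m) $$ (a, b) =
          ?P m $$ (a, b) + (if a < m then of_nat (c (V (a, m))) * ?P m $$ (m, b) else 0)"
        using pml_column_V[OF IH(1) m ab] by blast
      then show "pml (map (\<lambda>i. V (i, m)) [0..<m]) c (?P m) $$ (a, b) =
          (if a = b then 1 else if a < b \<and> b < Suc m then of_nat (c (V (a, b))) else 0)"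
        unfolding IH(2)[OF ab] IH(2)[OF m ab(2)] by (auto simp: less_Suc_eq)
    qed
  qed
  from this[of n] show ?thesis using assms unfolding vsV_def pml_concat Nc_def by auto
qed

lemma pml_vsU:
  assumes B: "B \<in> carrier_mat n n" and "a < n" "b < n"
  shows "pml vsU c B \<in> carrier_mat n n \<and> pml vsU c B $$ (a, b) = (\<Sum>l<n. Lc c a l * B $$ (l, b))"
proof -
  let ?P = "\<lambda>m. foldr (\<lambda>j. pml (map (\<lambda>i. U (i, j)) [Suc j..<n]) c) [m..<n] B"
  \<comment> \<open>The columns are processed from the last to the first. Columns beyond k affect
    only rows beyond k, so row k still equals that of B when column k is reached.\<close>
  have "?P (n - m) \<in> carrier_mat n n \<and> (\<forall>a<n. \<forall>b<n. ?P (n - m) $$ (a, b) =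
      B $$ (a, b) + (\<Sum>l\<in>{n - m..<n}. if l < a then of_nat (c (U (a, l))) * padic_p * B $$ (l, b) else 0))" if "m \<le> n" for m
    using that
  proof (induction m)
    case 0
    then show ?case using B by simp
  next
    case (Suc m)
    define k where "k = n - Suc m"
    have k: "Suc k = n - m" "k < n" using Suc.prems by (auto simp: k_def)
    have IH: "?P (Suc k) \<in> carrier_mat n n" "\<And>a b. a < n \<Longrightarrow> b < n \<Longrightarrow> ?P (Suc k) $$ (a, b) =
      B $$ (a, b) + (\<Sum>l\<in>{Suc k..<n}. if l < a then of_nat (c (U (a, l))) * padic_p * B $$ (l, b) else 0)"
      using Suc k by auto
    have e: "?P k = pml (map (\<lambda>i. U (i, k)) [Suc k..<n]) c (?P (Suc k))" using k(2) by (simp add: upt_conv_Cons)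
    show ?case
      unfolding k_def[symmetric] e
    proof (intro conjI allI impI)
      show "pml (map (\<lambda>i. U (i, k)) [Suc k..<n]) c (?P (Suc k)) \<in> carrier_mat n n"
        using pml_column_U[OF IH(1) k(2) k(2) k(2)] by blast
      fix a b assume ab: "a < n" "b < n"
      have kb: "?P (Suc k) $$ (k, b) = B $$ (k, b)"
        unfolding IH(2)[OF k(2) ab(2)] by (simp add: sum.neutral)
      have "pml (map (\<lambda>i. U (i, k)) [Suc k..<n]) c (?P (Suc k)) $$ (a, b) =
          ?P (Suc k) $$ (a, b) + (if k < a then of_nat (c (U (a, k))) * padic_p * ?P (Suc k) $$ (k, b) else 0)"
        using pml_column_U[OF IH(1) k(2) ab] by blast
      moreover have "{k..<n} = insert k {Suc k..<n}" using k(2) by auto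
      ultimately show "pml (map (\<lambda>i. U (i, k)) [Suc k..<n]) c (?P (Suc k)) $$ (a, b) =
          B $$ (a, b) + (\<Sum>l\<in>{k..<n}. if l < a then of_nat (c (U (a, l))) * padic_p * B $$ (l, b) else 0)"
        unfolding kb IH(2)[OF ab] by (simp add: algebra_simps)
    qed
  qed
  from this[of n] have *: "pml vsU c B \<in> carrier_mat n n" "pml vsU c B $$ (a, b) =
      B $$ (a, b) + (\<Sum>l<n. if l < a then of_nat (c (U (a, l))) * padic_p * B $$ (l, b) else 0)"
    using assms unfolding vsU_def pml_concat by (auto simp: atLeast0LessThan)
  have "(\<Sum>l<n. Lc c a l * B $$ (l, b)) = (\<Sum>l<n. (if l = a then B $$ (l, b) else 0) +
      (if l < a then of_nat (c (U (a, l))) * padic_p * B $$ (l, b) else 0))"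
    by (rule sum.cong) (auto simp: Lc_def)
  also have "\<dots> = pml vsU c B $$ (a, b)" unfolding *(2) sum.distrib using assms(2) by simp
  finally show ?thesis using *(1) by simp
qed

lemma h_mat_power_mult:
  assumes "C \<in> carrier_mat n n" "d + 1 < n" "a < n" "b < n"
  shows "(gen (W (d, Suc d)) [^]\<^bsub>G\<^esub> (m::nat) * C) $$ (a, b) =
    (if a = d then up ^ m else if a = Suc d then inverse up ^ m else 1) * C $$ (a, b)"
proof -
  let ?h = "gen (W (d, Suc d))"
  have hX: "W (d, Suc d) \<in> X" using assms(2) by (simp add: SimpleRoots_iff)
  have hc: "?h [^]\<^bsub>G\<^esub> r \<in> carrier_mat n n" for r :: nat using G_mat[of "?h [^]\<^bsub>G\<^esub> r"] gen_closed[OF hX] by simp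
  show ?thesis
    using assms(1)
  proof (induction m arbitrary: C)
    case 0
    then show ?case using assms by simp
  next
    case (Suc m)
    have hC: "?h * C \<in> carrier_mat n n" using Suc.prems by (simp add: mult_carrier_mat[OF h_mat_carrier])
    have "?h [^]\<^bsub>G\<^esub> Suc m * C = ?h [^]\<^bsub>G\<^esub> m * (?h * C)"
      using assoc_mult_mat[OF hc[of m] G_mat[OF gen_closed[OF hX]] Suc.prems] by simp
    then have "(?h [^]\<^bsub>G\<^esub> Suc m * C) $$ (a, b) =
        (if a = d then up ^ m else if a = Suc d then inverse up ^ m else 1) * (?h * C) $$ (a, b)"
      using Suc.IH[OF hC] by simp
    also have "(?h * C) $$ (a, b) = (if a = d then up else if a = Suc d then inverse up else 1) * C $$ (a, b)"
      using h_mat_mult_index[OF Suc.prems assms(3,4), of "(d, Suc d)" up] assms(3) by (simp add: h_mat_index)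
    finally show ?case by simp
  qed
qed

lemma pml_vsW:
  assumes B: "B \<in> carrier_mat n n" and "a < n" "b < n"
  shows "pml vsW c B \<in> carrier_mat n n \<and> pml vsW c B $$ (a, b) = Dc c a * B $$ (a, b)"
proof -
  let ?w = "\<lambda>d. c (W (d, Suc d))"
  have "pml (map (\<lambda>d. W (d, Suc d)) l) c B \<in> carrier_mat n n \<and>
      pml (map (\<lambda>d. W (d, Suc d)) l) c B $$ (a, b) =
        (\<Prod>d\<in>set l. (if a = d then up ^ ?w d else 1) * (if a = Suc d then inverse up ^ ?w d else 1)) * B $$ (a, b)"
    if "distinct l" "\<forall>d\<in>set l. d + 1 < n" for l
    using that
  proof (induction l)
    case Nil
    then show ?case using B by simp
  next
    case (Cons d l)
    let ?R = "pml (map (\<lambda>d. W (d, Suc d)) l) c B"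
    have R: "?R \<in> carrier_mat n n" using Cons by auto
    have dX: "W (d, Suc d) \<in> X" using Cons.prems by (simp add: SimpleRoots_iff)
    have gc: "gen (W (d, Suc d)) [^]\<^bsub>G\<^esub> ?w d \<in> carrier_mat n n"
      using G_mat[of "gen (W (d, Suc d)) [^]\<^bsub>G\<^esub> ?w d"] gen_closed[OF dX] by simp
    show ?case
      using Cons h_mat_power_mult[OF R _ assms(2,3), of d "?w d"] mult_carrier_mat[OF gc R]
      by (auto simp del: gen.simps)
  qed
  moreover have "\<forall>d\<in>set [0..<n - 1]. d + 1 < n" by auto
  ultimately have "pml (map (\<lambda>d. W (d, Suc d)) [0..<n - 1]) c B \<in> carrier_mat n n \<and>
      pml (map (\<lambda>d. W (d, Suc d)) [0..<n - 1]) c B $$ (a, b) =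
        (\<Prod>d\<in>set [0..<n - 1]. (if a = d then up ^ ?w d else 1) * (if a = Suc d then inverse up ^ ?w d else 1)) * B $$ (a, b)"
    using distinct_upt by blast
  then have *: "pml vsW c B \<in> carrier_mat n n" "pml vsW c B $$ (a, b) =
      (\<Prod>d\<in>{..<n - 1}. (if a = d then up ^ ?w d else 1) * (if a = Suc d then inverse up ^ ?w d else 1)) * B $$ (a, b)"
    unfolding vsW_def by (auto simp: atLeast0LessThan)
  have "(\<Prod>d\<in>{..<n - 1}. if a = d then up ^ ?w d else 1) = (if a < n - 1 then up ^ ?w a else 1)" by simp
  moreover have "(\<Prod>d\<in>{..<n - 1}. if a = Suc d then inverse up ^ ?w d else 1) =
      (if 0 < a then inverse up ^ c (W (a - 1, a)) else 1)"
  proof (cases a)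
    case (Suc a')
    then have "(\<Prod>d\<in>{..<n - 1}. if a = Suc d then inverse up ^ ?w d else 1) =
        (\<Prod>d\<in>{..<n - 1}. if a' = d then inverse up ^ ?w d else 1)" by simp
    also have "\<dots> = inverse up ^ ?w a'" using Suc assms(2) by (subst prod.delta') auto
    finally show ?thesis using Suc by simp
  qed simp
  ultimately show ?thesis using * unfolding Dc_def prod.distrib by simp
qed

definition pm :: "(ivar \<Rightarrow> nat) \<Rightarrow> 'p padic mat" where "pm c = pml vs c (1\<^sub>m n)"

lemma pm_closed: "pm c \<in> carrier G"
  unfolding pm_def by (rule pml_closed) (simp_all add: set_vs G_one)

lemma pm_index:
  assumes "a < n" "b < n"
  shows "pm c $$ (a, b) = (\<Sum>l<n. Lc c a l * (Dc c l * Nc c l b))"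
proof -
  have N: "pml vsV c (1\<^sub>m n) \<in> carrier_mat n n" using pml_vsV[OF assms] by blast
  have T: "pml vsW c (pml vsV c (1\<^sub>m n)) \<in> carrier_mat n n" using pml_vsW[OF N assms] by blast
  have "pm c $$ (a, b) = (\<Sum>l<n. Lc c a l * pml vsW c (pml vsV c (1\<^sub>m n)) $$ (l, b))"
    unfolding pm_def vs_def pml_append using pml_vsU[OF T assms] by blast
  also have "\<dots> = (\<Sum>l<n. Lc c a l * (Dc c l * Nc c l b))"
    using pml_vsW[OF N _ assms(2), of _ c] pml_vsV[OF _ assms(2), of _ c] by (intro sum.cong refl) auto
  finally show ?thesis .
qed

lemma Dc_unit: "\<not> padic_p dvd Dc c a"
proof -
  have pow: "padic_p dvd x ^ k - 1" if "padic_p dvd x - 1" for x :: "'p padic" and k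
  proof (induction k)
    case (Suc k)
    then show ?case using dvd_diff_mult[OF that Suc] by simp
  qed simp
  have i: "padic_p dvd inverse up - 1" by (rule inverse_1_mod_p) simp
  have "padic_p dvd Dc c a - 1 * 1"
    unfolding Dc_def using pow[of up] pow[OF i] by (intro dvd_diff_mult) auto
  then show ?thesis using inverse_1_mod_p(1)[of "Dc c a"] by simp
qed

text \<open>Induction along the diagonal: at an entry of row or column m the sum stops at index m,
  and the earlier terms agree by induction. The entry (m, m) yields the pivot, which is a unit and
  can be cancelled from the other entries.\<close>

lemma LDU_unique:
  assumes cong: "\<And>a b. a < n \<Longrightarrow> b < n \<Longrightarrow> P dvd pm c $$ (a, b) - pm c' $$ (a, b)" and P: "P = padic_p ^ k"
    and "m < n"
  shows "P dvd Dc c m - Dc c' m \<and> (\<forall>a<n. P dvd Lc c a m - Lc c' a m) \<and> (\<forall>b<n. P dvd Nc c m b - Nc c' m b)"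
  using assms(3)
proof (induction m rule: less_induct)
  case (less m)
  have IH: "P dvd Dc c l - Dc c' l" "\<And>a. a < n \<Longrightarrow> P dvd Lc c a l - Lc c' a l" "\<And>b. b < n \<Longrightarrow> P dvd Nc c l b - Nc c' l b"
    if "l < m" for l using less.IH[OF that] that less.prems by auto
  have split: "pm c $$ (a, b) = (\<Sum>l<m. Lc c a l * (Dc c l * Nc c l b)) + Lc c a m * (Dc c m * Nc c m b)"
    if "a < n" "b < n" "a = m \<or> b = m" for a b c
  proof -
    have "pm c $$ (a, b) = (\<Sum>l\<in>insert m {..<m}. Lc c a l * (Dc c l * Nc c l b))"
      unfolding pm_index[OF that(1,2)] using less.prems that(3)
      by (intro sum.mono_neutral_right) (auto simp: Lc_def Nc_def)
    then show ?thesis by (simp add: add.commute)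
  qed
  have step: "P dvd Lc c a m * (Dc c m * Nc c m b) - Lc c' a m * (Dc c' m * Nc c' m b)"
    if ab: "a < n" "b < n" "a = m \<or> b = m" for a b
  proof -
    have "P dvd (\<Sum>l<m. Lc c a l * (Dc c l * Nc c l b)) - (\<Sum>l<m. Lc c' a l * (Dc c' l * Nc c' l b))"
      by (intro dvd_diff_sum dvd_diff_mult IH ab) auto
    from dvd_diff[OF cong[OF ab(1,2)] this] show ?thesis
      unfolding split[OF ab] by (simp add: algebra_simps)
  qed
  have D: "P dvd Dc c m - Dc c' m"
    using step[of m m] less.prems by (simp add: Lc_def Nc_def)
  have cancel: "P dvd x - x'" if "P dvd Dc c m * x - Dc c' m * x'" for x x'
  proof -
    have "P dvd (Dc c' m - Dc c m) * x'" using D[unfolded dvd_diff_sym[of P "Dc c m"]] by simp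
    from dvd_add[OF that this] have "P dvd Dc c m * (x - x')" by (simp add: algebra_simps)
    moreover have "Dc c m * (x - x') = Dc c m * (x - x')" ..
    ultimately show ?thesis unfolding P by (simp only: p_power_dvd_mult_unit[OF Dc_unit])
  qed
  have "P dvd Lc c a m - Lc c' a m" if a: "a < n" for a
    by (rule cancel) (use step[OF a less.prems] in \<open>simp add: Nc_def mult.commute\<close>)
  moreover have "P dvd Nc c m b - Nc c' m b" if b: "b < n" for b
    by (rule cancel) (use step[OF less.prems b] in \<open>simp add: Lc_def\<close>)
  ultimately show ?case using D by blast
qed

text \<open>One power of p is lost: the entries for U carry a factor p, and for W the passage from
  (1 + p)^a to a costs one.\<close>

lemma pm_injective:
  assumes cong: "\<And>a b. a < n \<Longrightarrow> b < n \<Longrightarrow> padic_p ^ Suc k dvd pm c $$ (a, b) - pm c' $$ (a, b)" and v: "v \<in> X"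
  shows "padic_p ^ k dvd of_nat (c v) - (of_nat (c' v) :: 'p padic)"
proof (cases v)
  case (U \<beta>)
  then obtain i j where u: "v = U (i, j)" by fastforce
  then have ij: "j < i" "i < n" using v by (auto simp: NegRoots_iff)
  have "padic_p ^ Suc k dvd Lc c i j - Lc c' i j" using LDU_unique[OF cong refl, of j] ij by auto
  then have "padic_p * padic_p ^ k dvd padic_p * (of_nat (c v) - of_nat (c' v) :: 'p padic)"
    using ij by (simp add: Lc_def u algebra_simps)
  then show ?thesis using p_nonzero[where 'p='p] by (simp only: dvd_mult_cancel_left) simp
next
  case (V \<alpha>)
  then obtain i j where u: "v = V (i, j)" by fastforce
  then have ij: "i < j" "j < n" using v by (auto simp: PosRoots_iff)
  have "padic_p ^ Suc k dvd Nc c i j - Nc c' i j" using LDU_unique[OF cong refl, of i] ij by auto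
  then have "padic_p ^ Suc k dvd of_nat (c v) - (of_nat (c' v) :: 'p padic)" using ij by (simp add: Nc_def u)
  then show ?thesis by (rule power_le_dvd) simp
next
  case (W \<delta>)
  then obtain d where d: "v = W (d, Suc d)" "d < n - 1" using v by (auto simp: SimpleRoots_def Roots_def)
  have D: "padic_p ^ Suc k dvd Dc c m - Dc c' m" if "m < n" for m using LDU_unique[OF cong refl that] by blast
  \<comment> \<open>Each diagonal entry mixes two neighbouring W exponents, so they are separated
    one after the other from the top.\<close>
  have "padic_p ^ Suc k dvd up ^ c (W (d, Suc d)) - up ^ c' (W (d, Suc d))" if "d < n - 1" for d
    using that
  proof (induction d)
    case 0
    then show ?case using D[of 0] by (simp add: Dc_def)
  next
    case (Suc d)
    let ?x = "c (W (d, Suc d))" and ?x' = "c' (W (d, Suc d))" and ?y = "c (W (Suc d, Suc (Suc d)))" and ?y' = "c' (W (Suc d, Suc (Suc d)))"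
    have 1: "padic_p ^ Suc k dvd up ^ ?x - up ^ ?x'" using Suc by simp
    have 2: "padic_p ^ Suc k dvd up ^ ?y * inverse up ^ ?x - up ^ ?y' * inverse up ^ ?x'"
      using D[of "Suc d"] Suc.prems by (simp add: Dc_def)
    have e: "up ^ y * inverse up ^ x * up ^ x = up ^ y" for x y
      using up_inverse by (simp add: mult.assoc power_mult_distrib[symmetric])
    show ?case using dvd_diff_mult[OF 2 1] unfolding e .
  qed
  from this[OF d(2)] show ?thesis unfolding d(1) by (rule up_power_cong)
qed

text \<open>The differences for the first letter v act on the power of \<open>gen v\<close> at the
  front of the ordered product. By orthogonality the factor (c v choose a v) turns into 1 or 0,
  which is absorbed into K for the remaining letters.\<close>

lemma Dif_ordered:
  fixes F :: "'p padic mat \<Rightarrow> 'p padic"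
  assumes "distinct l" "set l \<subseteq> X"
    and "\<And>c. padic_p dvd F (pml l c (1\<^sub>m n)) - K * (\<Prod>v\<in>set l. of_nat (c v choose a v))"
  shows "padic_p dvd Dif G (map gen (concat (map (\<lambda>v. replicate (b v) v) l))) F (1\<^sub>m n)
    - K * (\<Prod>v\<in>set l. if a v = b v then 1 else 0)"
  using assms
proof (induction l arbitrary: F K)
  case (Cons v l)
  then have vX: "v \<in> X" and l: "distinct l" "set l \<subseteq> X" "v \<notin> set l" by auto
  let ?g = "gen v"
  let ?F = "Dif G (replicate (b v) ?g) F"
  let ?K = "K * (if a v = b v then 1 else 0)"
  have gG: "?g \<in> carrier G" by (rule gen_closed[OF vX])
  have "padic_p dvd ?F (pml l c (1\<^sub>m n)) - ?K * (\<Prod>v\<in>set l. of_nat (c v choose a v))" for c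
  proof -
    let ?x = "pml l c (1\<^sub>m n)" and ?Q = "\<Prod>v\<in>set l. of_nat (c v choose a v) :: 'p padic"
    have xG: "?x \<in> carrier G" by (rule pml_closed[OF l(2) G_one])
    have upd: "pml l (c(v := j)) B = pml l c B" for j B
      using l(3) by (induction l) (auto simp del: gen.simps)
    have "padic_p dvd F (?g [^]\<^bsub>G\<^esub> j \<otimes>\<^bsub>G\<^esub> ?x) - K * of_nat (j choose a v) * ?Q" for j :: nat
    proof -
      have "(\<Prod>w\<in>set (v # l). of_nat ((c(v := j)) w choose a w) :: 'p padic) = of_nat (j choose a v) * ?Q"
        using l(3) by (simp cong: prod.cong) (rule disjI2, rule prod.cong, auto)
      then show ?thesis using Cons.prems(3)[of "c(v := j)"]
        by (simp add: mult.assoc upd fun_upd_same del: gen.simps fun_upd_apply list.set)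
    qed
    then have "padic_p dvd (\<Sum>j\<le>b v. (- 1) ^ (b v + j) * of_nat (b v choose j) * F (?g [^]\<^bsub>G\<^esub> j \<otimes>\<^bsub>G\<^esub> ?x)) -
        (\<Sum>j\<le>b v. (- 1) ^ (b v + j) * of_nat (b v choose j) * (K * of_nat (j choose a v) * ?Q))"
      by (intro dvd_diff_sum dvd_diff_mult[of _ _ _ "F _"]) simp_all
    moreover have "(\<Sum>j\<le>b v. (- 1) ^ (b v + j) * of_nat (b v choose j) * (K * of_nat (j choose a v) * ?Q)) =
        K * (\<Sum>j\<le>b v. (- 1) ^ (b v + j) * of_nat (b v choose j) * of_nat (j choose a v)) * ?Q"
      by (simp add: sum_distrib_left sum_distrib_right mult_ac)
    ultimately show ?thesis
      unfolding G.Dif_replicate[OF gG xG] by (simp only: binomial_orthogonality)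
  qed
  from Cons.IH[OF l(1,2) this]
  have "padic_p dvd Dif G (map gen (concat (map (\<lambda>v. replicate (b v) v) l))) ?F (1\<^sub>m n)
      - ?K * (\<Prod>v\<in>set l. if a v = b v then 1 else 0)" .
  moreover have "Dif G (map gen (concat (map (\<lambda>v. replicate (b v) v) (v # l)))) F =
      Dif G (map gen (concat (map (\<lambda>v. replicate (b v) v) l))) ?F"
    by (simp add: G.Dif_append map_replicate)
  ultimately show ?case using l(3) by (simp add: mult.assoc)
qed simp

text \<open>F is the product of binomial coefficients of the coordinates, made into a function on
  cosets of a sufficiently small N. Pairing with F annihilates modulo p all ordered monomials except
  \<open>ordered a\<close>, so it returns the coefficient in question.\<close>

theorem ordered_independent:
  assumes s: "s \<in> carrier AA" "\<And>w. w \<in> lists X \<Longrightarrow> s w \<noteq> 0 \<Longrightarrow> w \<in> range rw.ordered"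
    and th0: "\<And>N C. N \<in> I.ON \<Longrightarrow> padic_p dvd I.phi s N C"
  shows "padic_p dvd s (rw.ordered a)"
proof -
  define B where "B = Suc (\<Sum>v\<in>X. a v)"
  have aB: "a v < B" if "v \<in> X" for v
    unfolding B_def using member_le_sum[of v X a] that finite_ivars by (simp add: less_Suc_eq_le)
  obtain K where K: "\<forall>r<B. \<forall>q q' :: 'p padic. padic_p ^ K dvd q - q' \<longrightarrow>
      padic_p dvd padic_binomial q r - padic_binomial q' r"
    using padic_binomial_cong_bounded[where M=B and 'p='p] by (elim exE)
  \<comment> \<open>Depth n per power of p, and one more power than K because recovering exponents
    from matrix entries loses one.\<close>
  define N where "N = H (n * Suc K)"
  have N: "N \<in> I.ON" unfolding N_def by (rule H_open_normal)
  have NH: "subgroup N G" by (rule I.ON_subgroup[OF N])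
  have sep: "padic_p dvd (\<Prod>v\<in>X. of_nat (c v choose a v)) - (\<Prod>v\<in>X. of_nat (c' v choose a v) :: 'p padic)"
    if eq: "N #>\<^bsub>G\<^esub> pm c = N #>\<^bsub>G\<^esub> pm c'" for c c'
  proof -
    have "pm c \<in> N #>\<^bsub>G\<^esub> pm c'"
      using G.rcos_self[OF pm_closed NH, of c] eq by simp
    then obtain y where y: "y \<in> N" "pm c = y * pm c'" by (auto simp: r_coset_def)
    have yc: "y \<in> carrier_mat n n" and pc: "pm c' \<in> carrier_mat n n"
      using y(1) H_G G_mat pm_closed unfolding N_def by auto
    have "padic_p ^ Suc K dvd pm c $$ (i, j) - pm c' $$ (i, j)" if ij: "i < n" "j < n" for i j
    proof -
      have "pm c $$ (i, j) - pm c' $$ (i, j) = ((y - 1\<^sub>m n) * pm c') $$ (i, j)"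
        unfolding y(2) minus_one_mult(1)[OF yc pc] using yc pc ij by simp
      also have "\<dots> = (\<Sum>l<n. (y - 1\<^sub>m n) $$ (i, l) * pm c' $$ (l, j))"
        by (rule mat_mult_entry[OF minus_carrier_mat[OF one_carrier_mat] pc ij])
      also have "padic_p ^ Suc K dvd \<dots>"
      proof (intro dvd_sum dvd_mult2)
        fix l assume "l \<in> {..<n}"
        then show "padic_p ^ Suc K dvd (y - 1\<^sub>m n) $$ (i, l)"
          using H_entries[OF y(1)[unfolded N_def] ij(1), of l] ij by (simp del: index_one_mat(1))
      qed
      finally show ?thesis .
    qed
    then have "padic_p ^ K dvd of_nat (c v) - (of_nat (c' v) :: 'p padic)" if "v \<in> X" for v
      using pm_injective that by blast
    then have "padic_p dvd of_nat (c v choose a v) - (of_nat (c' v choose a v) :: 'p padic)" if "v \<in> X" for v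
      using K[rule_format, OF aB[OF that], of "of_nat (c v)" "of_nat (c' v)"] that by simp
    then show ?thesis by (intro dvd_diff_prod)
  qed
  \<comment> \<open>The exponent function chosen for a coset does not matter modulo p, by
    \<open>sep\<close>. Cosets without an ordered product get the value 0.\<close>
  define F where "F C = (if \<exists>c. N #>\<^bsub>G\<^esub> pm c = C
    then (\<Prod>v\<in>X. of_nat ((SOME c. N #>\<^bsub>G\<^esub> pm c = C) v choose a v)) else (0 :: 'p padic))" for C
  have F: "padic_p dvd F (N #>\<^bsub>G\<^esub> pm c) - 1 * (\<Prod>v\<in>set vs. of_nat (c v choose a v))" for c
  proof -
    have ex: "\<exists>c'. N #>\<^bsub>G\<^esub> pm c' = N #>\<^bsub>G\<^esub> pm c" by (rule exI[of _ c]) simp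
    have "N #>\<^bsub>G\<^esub> pm (SOME c'. N #>\<^bsub>G\<^esub> pm c' = N #>\<^bsub>G\<^esub> pm c) = N #>\<^bsub>G\<^esub> pm c"
      by (rule someI_ex[OF ex])
    from sep[OF this] show ?thesis unfolding F_def if_P[OF ex] set_vs by simp
  qed
  have ev: "padic_p dvd mr_eval (I.lw (rw.ordered b) N) F - (\<Prod>v\<in>X. if a v = b v then 1 else 0)" for b
  proof -
    have "mr_eval (I.lw (rw.ordered b) N) F = Dif G (map gen (rw.ordered b)) (\<lambda>x. F (N #>\<^bsub>G\<^esub> x)) \<one>\<^bsub>G\<^esub>"
      unfolding I.lw_def by (rule I.mr_eval_wl[OF I.map_gn[OF rw.ordered_lists] N])
    then show ?thesis
      using Dif_ordered[OF distinct_vs, of "\<lambda>x. F (N #>\<^bsub>G\<^esub> x)" 1 a b] F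
      unfolding pm_def rw.ordered_def set_vs by simp
  qed
  obtain M0 where M0: "\<forall>w\<in>lists X. M0 \<le> length w \<longrightarrow> (\<forall>C. padic_p ^ 1 dvd I.lw w N C)"
    using I.lw_small[OF N, of 1] by (elim exE)
  \<comment> \<open>The truncation must also contain the monomial whose coefficient is
    extracted.\<close>
  define M where "M = max M0 (Suc (length (rw.ordered a)))"
  have ap: "padic_p dvd I.phi s N C - I.Phi M s N C" for C
    using I.phi_approx[OF N, of M 1 C s] M0 by (simp add: M_def)
  have "padic_p dvd I.Phi M s N C" for C
    using dvd_diff[OF th0[OF N, of C] ap[of C]] by simp
  then have "padic_p dvd mr_eval (I.Phi M s N) F" by (rule dvd_mr_eval)
  then have 1: "padic_p dvd (\<Sum>w\<in>I.words M. s w * mr_eval (I.lw w N) F)"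
    unfolding I.Phi_def by (subst (asm) I.mr_eval_lin[OF N]) (auto simp: I.lw_closed I.words_lists)
  have 2: "padic_p dvd (\<Sum>w\<in>I.words M. s w * mr_eval (I.lw w N) F) - (\<Sum>w\<in>I.words M. s w * (if w = rw.ordered a then 1 else 0))"
  proof (rule dvd_diff_sum)
    fix w assume w: "w \<in> I.words M"
    show "padic_p dvd s w * mr_eval (I.lw w N) F - s w * (if w = rw.ordered a then 1 else 0)"
    proof (cases "s w = 0")
      case False
      then obtain b where b: "w = rw.ordered b" using s(2)[OF I.words_lists[OF w]] by blast
      have "(\<Prod>v\<in>X. if a v = b v then 1 else (0 :: 'p padic)) = (if w = rw.ordered a then 1 else 0)"
      proof (cases "\<forall>v\<in>X. a v = b v")
        case True
        then have "rw.ordered a = rw.ordered b"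
          unfolding rw.ordered_def using set_vs by (intro arg_cong[of _ _ concat] map_cong) auto
        then show ?thesis using True b by simp
      next
        case False
        then obtain v where v: "v \<in> X" "a v \<noteq> b v" by blast
        have cnt: "count_list (rw.ordered e) v = e v" for e
        proof -
          have rep: "count_list (replicate k x) v = (if x = v then k else 0)" for k x
            by (induction k) auto
          have "count_list (concat (map (\<lambda>v. replicate (e v) v) l)) v = (if v \<in> set l then e v else 0)"
            if "distinct l" for l using that by (induction l) (auto simp: rep)
          then show ?thesis unfolding rw.ordered_def using distinct_vs set_vs v(1) by simp
        qed
        have "w \<noteq> rw.ordered a" using cnt[of a] cnt[of b] v(2) b by auto
        moreover have "(\<Prod>v\<in>X. if a v = b v then 1 else (0 :: 'p padic)) = 0"
          using v finite_ivars by (intro prod_zero) auto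
        ultimately show ?thesis by simp
      qed
      then have "padic_p dvd mr_eval (I.lw w N) F - (if w = rw.ordered a then 1 else 0)" using ev[of b] b by simp
      then show ?thesis by (simp add: right_diff_distrib[symmetric])
    qed simp
  qed
  have 3: "(\<Sum>w\<in>I.words M. s w * (if w = rw.ordered a then 1 else 0)) = s (rw.ordered a)"
  proof -
    have "rw.ordered a \<in> I.words M" using rw.ordered_lists by (simp add: I.words_def M_def)
    moreover have "(\<Sum>w\<in>I.words M. s w * (if w = rw.ordered a then 1 else 0)) =
        (\<Sum>w\<in>I.words M. if w = rw.ordered a then s w else 0)" by (rule sum.cong) auto
    ultimately show ?thesis using I.finite_words' by simp
  qed
  show ?thesis by (rule I.dvd_diffD[OF 1 iffD1[OF dvd_diff_sym 2], unfolded 3])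
qed

end

section \<open>Surjectivity\<close>

context iwahori_setting
begin

text \<open>Successive approximation: adding p^v m to the exponent y changes the power to first
  order by p^(v+1) m z (1 + p)^y, and m is chosen modulo p so as to cancel the next digit of the
  error.\<close>

lemma up_power_dense:
  assumes "padic_p dvd l - (1 :: 'p padic)"
  shows "\<exists>y. padic_p ^ k dvd l - up ^ y"
proof -
  have "\<exists>y. padic_p ^ Suc v dvd l - up ^ y" for v
  proof (induction v)
    case 0
    show ?case using assms by (intro exI[of _ 0]) simp
  next
    case (Suc v)
    then obtain y where y: "padic_p ^ Suc v dvd l - up ^ y" by (elim exE)
    have nd: "\<not> padic_p dvd up ^ y"
      using p_not_dvd_1p by (induction y) (auto simp: p_not_dvd_1 p_dvd_mult_iff)
    have u: "inverse (up ^ y) * up ^ y = 1" by (rule padic_inverse[OF nd])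
    obtain t where t: "l - up ^ y = padic_p ^ Suc v * t" using y by (elim dvdE)
    obtain z where z: "\<not> padic_p dvd z"
      "\<forall>m. padic_p ^ Suc (Suc v) dvd up ^ (CARD('p) ^ v * m) - (1 + padic_p ^ Suc v * (of_nat m * z))"
      using up_power_multiple[of v] by (elim exE conjE)
    obtain m where m: "padic_p ^ 1 dvd t * inverse (up ^ y) * inverse z - of_nat m"
      using padic_approx_nat[of 1 "t * inverse (up ^ y) * inverse z"] by (elim exE)
    have "padic_p dvd (t * inverse (up ^ y) * inverse z - of_nat m) * (z * up ^ y)" using m by simp
    moreover have "(t * inverse (up ^ y) * inverse z - of_nat m) * (z * up ^ y) = t - of_nat m * z * up ^ y"
    proof -
      have "(t * inverse (up ^ y) * inverse z - of_nat m) * (z * up ^ y) =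
          t * (inverse (up ^ y) * up ^ y) * (inverse z * z) - of_nat m * z * up ^ y"
        by (subst left_diff_distrib) (simp only: mult_ac)
      then show ?thesis unfolding u padic_inverse[OF z(1)] by simp
    qed
    ultimately have "padic_p dvd t - of_nat m * z * up ^ y" by simp
    then obtain s where s: "t - of_nat m * z * up ^ y = padic_p * s" by (elim dvdE)
    obtain r where r: "up ^ (CARD('p) ^ v * m) - (1 + padic_p ^ Suc v * (of_nat m * z)) = padic_p ^ Suc (Suc v) * r"
      using spec[OF z(2), of m] by (elim dvdE)
    have gen: "P * t - Y * (Q * r + P * (M * z)) = P * (t - M * z * Y) - Q * (Y * r)" for P Q M Y :: "'p padic"
      by (simp add: algebra_simps)
    have "l - up ^ (y + CARD('p) ^ v * m) = (l - up ^ y) - up ^ y * (up ^ (CARD('p) ^ v * m) - 1)"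
      by (simp add: power_add algebra_simps)
    also have "up ^ (CARD('p) ^ v * m) - 1 = padic_p ^ Suc (Suc v) * r + padic_p ^ Suc v * (of_nat m * z)"
      using r by (simp add: algebra_simps)
    also have "(l - up ^ y) - up ^ y * (padic_p ^ Suc (Suc v) * r + padic_p ^ Suc v * (of_nat m * z)) =
        padic_p ^ Suc v * (t - of_nat m * z * up ^ y) - padic_p ^ Suc (Suc v) * (up ^ y * r)"
      unfolding t by (rule gen)
    also have "\<dots> = padic_p ^ Suc (Suc v) * (s - up ^ y * r)"
      unfolding s by (simp add: right_diff_distrib mult_ac)
    finally have "padic_p ^ Suc (Suc v) dvd l - up ^ (y + CARD('p) ^ v * m)" by simp
    then show ?case by (rule exI)
  qed
  from this[of k] obtain y where "padic_p ^ Suc k dvd l - up ^ y" by (elim exE)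
  then have "padic_p ^ k dvd l - up ^ y" by (rule power_le_dvd) simp
  then show ?thesis by (rule exI)
qed

text \<open>No pivoting is needed: the diagonal of the remainder stays congruent to \<open>1\<close>.\<close>

lemma Gauss_elimination:
  fixes g :: "'p padic mat"
  assumes g: "\<And>i. i < n \<Longrightarrow> padic_p dvd g $$ (i, i) - 1" "\<And>i j. i < n \<Longrightarrow> j < i \<Longrightarrow> padic_p dvd g $$ (i, j)"
    and "m \<le> n"
  shows "\<exists>l d u. (\<forall>i<m. padic_p dvd d i - (1 :: 'p padic) \<and> l i i = 1 \<and> u i i = 1 \<and>
      (\<forall>a<n. (a < i \<longrightarrow> l a i = 0) \<and> (i < a \<longrightarrow> padic_p dvd l a i)) \<and> (\<forall>b<i. u i b = 0)) \<and>
    (\<forall>a<n. \<forall>b<n. (a < m \<or> b < m \<longrightarrow> g $$ (a, b) = (\<Sum>i<m. l a i * (d i * u i b))) \<and>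
      (m \<le> b \<and> b \<le> a \<longrightarrow> padic_p dvd g $$ (a, b) - (\<Sum>i<m. l a i * (d i * u i b)) - (if a = b then 1 else 0)))"
  using assms(3)
proof (induction m)
  case 0
  have "padic_p dvd g $$ (a, b) - (if a = b then 1 else 0)" if "a < n" "b \<le> a" for a b
    using g(1)[of a] g(2)[of a b] that by (cases "a = b") auto
  then show ?case by simp
next
  case (Suc m)
  then have mn: "m < n" by simp
  obtain l d u where IH1: "\<forall>i<m. padic_p dvd d i - (1 :: 'p padic) \<and> l i i = 1 \<and> u i i = 1 \<and>
      (\<forall>a<n. (a < i \<longrightarrow> l a i = 0) \<and> (i < a \<longrightarrow> padic_p dvd l a i)) \<and> (\<forall>b<i. u i b = 0)"
    and IH2: "\<forall>a<n. \<forall>b<n. (a < m \<or> b < m \<longrightarrow> g $$ (a, b) = (\<Sum>i<m. l a i * (d i * u i b))) \<and>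
      (m \<le> b \<and> b \<le> a \<longrightarrow> padic_p dvd g $$ (a, b) - (\<Sum>i<m. l a i * (d i * u i b)) - (if a = b then 1 else 0))"
    using Suc.IH[OF less_imp_le[OF mn]] by (elim exE conjE)
  \<comment> \<open>The remainder after m pivots, which vanishes in the first m rows and columns and
    is unipotent modulo p on and below the remaining diagonal.\<close>
  define R where "R a b = g $$ (a, b) - (\<Sum>i<m. l a i * (d i * u i b))" for a b
  have R0: "R a b = 0" if "a < n" "b < n" "a < m \<or> b < m" for a b
    using IH2[rule_format, OF that(1,2)] that(3) by (auto simp: R_def)
  have Rp: "padic_p dvd R a b - (if a = b then 1 else 0)" if "a < n" "m \<le> b" "b \<le> a" for a b
    using IH2[rule_format, OF that(1), of b] that by (auto simp: R_def)
  have R1: "padic_p dvd R m m - 1" using Rp[of m m] mn by simp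
  define e where "e = inverse (R m m)"
  have e: "R m m * e = 1" using padic_inverse[OF inverse_1_mod_p(1)[OF R1]] by (simp add: e_def mult.commute)
  define l' d' u' where "l' a i = (if i = m then R a m * e else l a i)" "d' i = (if i = m then R m m else d i)"
    "u' i b = (if i = m then e * R m b else u i b)" for a i b
  have sum': "(\<Sum>i<Suc m. l' a i * (d' i * u' i b)) = (\<Sum>i<m. l a i * (d i * u i b)) + R a m * (e * R m b)" for a b
  proof -
    have "(\<Sum>i<m. l' a i * (d' i * u' i b)) = (\<Sum>i<m. l a i * (d i * u i b))"
      by (rule sum.cong) (auto simp: l'_d'_u'_def)
    moreover have "l' a m * (d' m * u' m b) = R a m * (R m m * e) * (e * R m b)" by (simp add: l'_d'_u'_def mult_ac)
    ultimately show ?thesis unfolding e by simp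
  qed
  have rem: "g $$ (a, b) - (\<Sum>i<Suc m. l' a i * (d' i * u' i b)) = R a b - R a m * (e * R m b)" for a b
    unfolding sum' R_def by simp
  have A: "\<forall>i<Suc m. padic_p dvd d' i - (1 :: 'p padic) \<and> l' i i = 1 \<and> u' i i = 1 \<and>
      (\<forall>a<n. (a < i \<longrightarrow> l' a i = 0) \<and> (i < a \<longrightarrow> padic_p dvd l' a i)) \<and> (\<forall>b<i. u' i b = 0)"
  proof (intro allI impI)
    fix i assume "i < Suc m"
    then consider "i < m" | "i = m" by linarith
    then show "padic_p dvd d' i - 1 \<and> l' i i = 1 \<and> u' i i = 1 \<and>
        (\<forall>a<n. (a < i \<longrightarrow> l' a i = 0) \<and> (i < a \<longrightarrow> padic_p dvd l' a i)) \<and> (\<forall>b<i. u' i b = 0)"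
    proof cases
      case 1
      then show ?thesis using IH1 by (simp add: l'_d'_u'_def)
    next
      case 2
      have "padic_p dvd R a m" if "m < a" "a < n" for a using Rp[of a m] that by simp
      then show ?thesis using 2 R1 R0[OF _ mn] R0[OF mn] mn e by (simp add: l'_d'_u'_def mult.commute)
    qed
  qed
  have B: "\<forall>a<n. \<forall>b<n. (a < Suc m \<or> b < Suc m \<longrightarrow> g $$ (a, b) = (\<Sum>i<Suc m. l' a i * (d' i * u' i b))) \<and>
      (Suc m \<le> b \<and> b \<le> a \<longrightarrow> padic_p dvd g $$ (a, b) - (\<Sum>i<Suc m. l' a i * (d' i * u' i b)) - (if a = b then 1 else 0))"
  proof (intro allI impI conjI)
    fix a b assume ab: "a < n" "b < n"
    show "g $$ (a, b) = (\<Sum>i<Suc m. l' a i * (d' i * u' i b))" if s: "a < Suc m \<or> b < Suc m"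
    proof -
      have "R a b - R a m * (e * R m b) = 0"
      proof (cases "a < m \<or> b < m")
        case True
        then show ?thesis using R0[OF ab] R0[OF ab(1) mn] R0[OF mn ab(2)] by auto
      next
        case False
        then have "a = m \<or> b = m" using s by linarith
        moreover have "R m m * (e * R m b) = R m b" "R a m * (e * R m m) = R a m"
          using e by (simp_all add: mult.assoc[symmetric] mult.commute[of e])
        ultimately show ?thesis by auto
      qed
      then show ?thesis unfolding rem[symmetric] by (simp del: sum.lessThan_Suc)
    qed
    show "padic_p dvd g $$ (a, b) - (\<Sum>i<Suc m. l' a i * (d' i * u' i b)) - (if a = b then 1 else 0)"
      if s: "Suc m \<le> b \<and> b \<le> a"
    proof -
      have "padic_p dvd R a m" using Rp[of a m] s ab by auto
      then have "padic_p dvd R a m * (e * R m b)" by simp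
      from dvd_diff[OF Rp[OF ab(1), of b] this] show ?thesis using s unfolding rem by (simp add: algebra_simps)
    qed
  qed
  show ?case by (rule exI[of _ l'], rule exI[of _ d'], rule exI[of _ u'], rule conjI[OF A B])
qed

text \<open>The three factors from elimination are approximated separately: unipotent entries by
  natural multiples, the diagonal by powers of 1 + p. Since det g = 1, the diagonal has product 1
  and is a product of matrices attached to simple roots.\<close>

lemma pm_dense:
  assumes g: "g \<in> carrier G"
  obtains c where "\<And>a b. a < n \<Longrightarrow> b < n \<Longrightarrow> padic_p ^ k dvd g $$ (a, b) - pm c $$ (a, b)"
proof -
  have gc: "g \<in> carrier_mat n n" "det g = 1" using g by (auto simp: iwahori_def)
  have "\<exists>l d u. (\<forall>i<n. padic_p dvd d i - (1 :: 'p padic) \<and> l i i = 1 \<and> u i i = 1 \<and>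
      (\<forall>a<n. (a < i \<longrightarrow> l a i = 0) \<and> (i < a \<longrightarrow> padic_p dvd l a i)) \<and> (\<forall>b<i. u i b = 0)) \<and>
    (\<forall>a<n. \<forall>b<n. (a < n \<or> b < n \<longrightarrow> g $$ (a, b) = (\<Sum>i<n. l a i * (d i * u i b))) \<and>
      (n \<le> b \<and> b \<le> a \<longrightarrow> padic_p dvd g $$ (a, b) - (\<Sum>i<n. l a i * (d i * u i b)) - (if a = b then 1 else 0)))"
    using g by (intro Gauss_elimination) (auto simp: iwahori_def)
  then obtain l d u where P: "\<forall>i<n. padic_p dvd d i - (1 :: 'p padic) \<and> l i i = 1 \<and> u i i = 1 \<and>
      (\<forall>a<n. (a < i \<longrightarrow> l a i = 0) \<and> (i < a \<longrightarrow> padic_p dvd l a i)) \<and> (\<forall>b<i. u i b = 0)"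
    and Q: "\<forall>a<n. \<forall>b<n. (a < n \<or> b < n \<longrightarrow> g $$ (a, b) = (\<Sum>i<n. l a i * (d i * u i b))) \<and>
      (n \<le> b \<and> b \<le> a \<longrightarrow> padic_p dvd g $$ (a, b) - (\<Sum>i<n. l a i * (d i * u i b)) - (if a = b then 1 else 0))"
    by (elim exE conjE) (rule that)
  have gi: "g $$ (a, b) = (\<Sum>i<n. l a i * (d i * u i b))" if "a < n" "b < n" for a b
    using Q that by blast
  have di: "padic_p dvd d i - 1" if "i < n" for i using P that by blast
  have prod1: "(\<Prod>i<n. d i) = 1"
  proof -
    define L1 U1 where "L1 = mat n n (\<lambda>(a, i). l a i)" and "U1 = mat n n (\<lambda>(i, b). d i * u i b)"
    have c: "L1 \<in> carrier_mat n n" "U1 \<in> carrier_mat n n" by (simp_all add: L1_def U1_def)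
    have "g = L1 * U1"
    proof (rule eq_matI)
      fix i j assume "i < dim_row (L1 * U1)" "j < dim_col (L1 * U1)"
      then have ij: "i < n" "j < n" using c by auto
      show "g $$ (i, j) = (L1 * U1) $$ (i, j)"
        unfolding mat_mult_entry[OF c ij] gi[OF ij] using ij by (intro sum.cong) (auto simp: L1_def U1_def)
    qed (use gc c in auto)
    then have "det L1 * det U1 = 1" using det_mult[OF c] gc by simp
    moreover have "det L1 = prod_list (diag_mat L1)"
      by (rule det_lower_triangular[OF _ c(1)]) (use P in \<open>auto simp: L1_def\<close>)
    moreover have "diag_mat L1 = map (\<lambda>i. 1) [0..<n]"
      unfolding diag_mat_def by (rule map_cong) (use P in \<open>auto simp: L1_def\<close>)
    moreover have "det U1 = prod_list (diag_mat U1)"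
      by (rule det_upper_triangular[OF _ c(2)]) (use P in \<open>auto simp: U1_def upper_triangular_def\<close>)
    moreover have "diag_mat U1 = map d [0..<n]"
      unfolding diag_mat_def by (rule map_cong) (use P in \<open>auto simp: U1_def\<close>)
    moreover have "prod_list (map d [0..<n]) = (\<Prod>i<n. d i)"
      by (simp add: prod.distinct_set_conv_list[symmetric] atLeast0LessThan)
    moreover have "prod_list (map (\<lambda>i. 1 :: 'p padic) [0..<n]) = 1" by (simp add: map_replicate_const)
    ultimately show ?thesis by simp
  qed
  \<comment> \<open>Partial products are the coordinates of a diagonal matrix of determinant 1 with
    respect to the simple roots.\<close>
  define la where "la a = (\<Prod>i\<le>a. d i)" for a
  have la1: "padic_p dvd la a - 1" if "a < n" for a
    using dvd_diff_prod[of "{..a}" padic_p d "\<lambda>_. 1"] di that by (simp add: la_def)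
  have lau: "inverse (la a) * la a = 1" if "a < n" for a by (rule padic_inverse[OF inverse_1_mod_p(1)[OF la1[OF that]]])
  have "\<forall>a\<in>{..<n}. \<exists>y. padic_p ^ k dvd la a - up ^ y" using up_power_dense[OF la1] by simp
  from bchoice[OF this] obtain yW where "\<forall>a\<in>{..<n}. padic_p ^ k dvd la a - up ^ yW a" by (elim exE)
  then have yW: "padic_p ^ k dvd la a - up ^ yW a" if "a < n" for a using that by simp
  have "\<forall>ai\<in>{(a, i). i < a \<and> a < n}. \<exists>m. padic_p ^ k dvd l (fst ai) (snd ai) - of_nat m * padic_p"
  proof
    fix ai assume "ai \<in> {(a, i). i < a \<and> a < n}"
    then have "padic_p dvd l (fst ai) (snd ai)" using P by auto
    then obtain t where t: "l (fst ai) (snd ai) = padic_p * t" by (elim dvdE)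
    obtain m where "padic_p ^ k dvd t - of_nat m" using padic_approx_nat[of k t] by (elim exE)
    then have "padic_p ^ k dvd padic_p * (t - of_nat m)" by (rule dvd_mult)
    then have "padic_p ^ k dvd l (fst ai) (snd ai) - of_nat m * padic_p" unfolding t by (simp add: algebra_simps)
    then show "\<exists>m. padic_p ^ k dvd l (fst ai) (snd ai) - of_nat m * padic_p" by (rule exI)
  qed
  from bchoice[OF this] obtain yU where
    "\<forall>ai\<in>{(a, i). i < a \<and> a < n}. padic_p ^ k dvd l (fst ai) (snd ai) - of_nat (yU ai) * padic_p" by (elim exE)
  then have yU: "padic_p ^ k dvd l a i - of_nat (yU (a, i)) * padic_p" if "i < a" "a < n" for a i using that by auto
  have "\<forall>ib. \<exists>m. padic_p ^ k dvd u (fst ib) (snd ib) - of_nat m" using padic_approx_nat by blast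
  from choice[OF this] obtain yV where "\<forall>ib. padic_p ^ k dvd u (fst ib) (snd ib) - of_nat (yV ib)" by (elim exE)
  then have yV: "padic_p ^ k dvd u i b - of_nat (yV (i, b))" for i b by (auto dest: spec[of _ "(i, b)"])
  define c where "c v = (case v of U ij \<Rightarrow> yU ij | W ij \<Rightarrow> yW (fst ij) | V ij \<Rightarrow> yV ij)" for v
  have "padic_p ^ k dvd g $$ (a, b) - pm c $$ (a, b)" if ab: "a < n" "b < n" for a b
    unfolding gi[OF ab] pm_index[OF ab]
  proof (intro dvd_diff_sum dvd_diff_mult)
    fix i assume "i \<in> {..<n}"
    then have i: "i < n" by simp
    show "padic_p ^ k dvd l a i - Lc c a i"
      using P i ab yU[of i a] by (cases a i rule: linorder_cases) (auto simp: Lc_def c_def)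
    show "padic_p ^ k dvd u i b - Nc c i b"
      using P i ab yV[of i b] by (cases i b rule: linorder_cases) (auto simp: Nc_def c_def)
    define A B where "A = (if i < n - 1 then up ^ yW i else 1)" and "B = (if 0 < i then up ^ yW (i - 1) else 1)"
    define A' B' where "A' = (if i < n - 1 then la i else 1)" and "B' = (if 0 < i then la (i - 1) else 1)"
    have "padic_p ^ k dvd A' - A" using yW[OF i] by (simp add: A_def A'_def)
    moreover have dB: "padic_p ^ k dvd B' - B" using yW[of "i - 1"] i by (simp add: B_def B'_def)
    \<comment> \<open>The entry \<open>d i\<close> is the quotient of consecutive partial products;
      at the last index the numerator is the full product 1.\<close>
    moreover have eA: "A' = B' * d i"
    proof -
      have "(\<Prod>i<n. d i) = la (n - 1)"
        unfolding la_def using n_ge_2 by (intro prod.cong) auto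
      then have "la (n - 1) = 1" using prod1 by simp
      moreover have "i < n - 1 \<or> i = n - 1" using i by linarith
      ultimately have "A' = la i" by (auto simp: A'_def)
      then show ?thesis by (cases i) (auto simp: B'_def la_def)
    qed
    moreover have eD: "A = B * Dc c i"
    proof -
      have "up ^ y * inverse up ^ y = 1" for y
        using up_inverse by (simp add: power_mult_distrib[symmetric] mult.commute)
      then show ?thesis unfolding A_def B_def Dc_def c_def by (auto simp: mult_ac)
    qed
    moreover have nB: "\<not> padic_p dvd B'"
      using inverse_1_mod_p(1)[OF la1[of "i - 1"]] i by (auto simp: B'_def p_not_dvd_1)
    ultimately have "padic_p ^ k dvd (B' * d i - B * Dc c i) - (B' - B) * Dc c i" by (intro dvd_diff[of _ "B' * d i - B * Dc c i"] dvd_mult2) auto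
    then have "padic_p ^ k dvd B' * (d i - Dc c i)" by (simp add: algebra_simps)
    then show "padic_p ^ k dvd d i - Dc c i" by (simp only: p_power_dvd_mult_unit[OF nB])
  qed
  then show ?thesis by (rule that)
qed

section \<open>Lifting elements of the Iwasawa algebra\<close>

lemma H_coset_pm:
  assumes g: "g \<in> carrier G" obtains c where "H d #>\<^bsub>G\<^esub> g = H d #>\<^bsub>G\<^esub> pm c"
proof -
  obtain c where c: "\<And>a b. a < n \<Longrightarrow> b < n \<Longrightarrow> padic_p ^ (d + 1 + 1) dvd g $$ (a, b) - pm c $$ (a, b)"
    using pm_dense[OF g, of "d + 1 + 1"] by blast
  have m: "g \<in> carrier_mat n n" "pm c \<in> carrier_mat n n" using G_mat g pm_closed by auto
  have "g - pm c \<in> Md (int (d + 1))"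
    by (rule Md_all_dvd) (use m c in auto)
  then have "g * inv\<^bsub>G\<^esub> pm c \<in> H d" using H_quotient[OF g pm_closed] by (simp add: add.commute)
  moreover have "g = (g * inv\<^bsub>G\<^esub> pm c) * pm c" by (rule H_quotient_eq[OF g pm_closed])
  ultimately have "g \<in> H d #>\<^bsub>G\<^esub> pm c" unfolding r_coset_def by auto
  then have "H d #>\<^bsub>G\<^esub> pm c = H d #>\<^bsub>G\<^esub> g" by (rule G.repr_independence[OF _ pm_closed H_subgroup])
  from that[OF this[symmetric]] show ?thesis .
qed

text \<open>A polynomial in the variables whose value is exactly the group element
  \<open>pm c\<close>.\<close>

definition fm :: "(ivar \<Rightarrow> nat) \<Rightarrow> 'p series" where
  "fm c = foldr (\<lambda>v f. one_plus n v [^]\<^bsub>AA\<^esub> c v \<otimes>\<^bsub>AA\<^esub> f) vs \<one>\<^bsub>AA\<^esub>"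

lemma phi_one_plus: "v \<in> X \<Longrightarrow> I.phi (one_plus n v) = I.el (gen v)"
proof -
  assume v: "v \<in> X"
  have one: "\<one>\<^bsub>I.L\<^esub> \<in> carrier I.L" by (rule ring.ring_simprules(6)[OF I.L_ring])
  have "I.phi (one_plus n v) = \<one>\<^bsub>I.L\<^esub> \<oplus>\<^bsub>I.L\<^esub> (I.el (gen v) \<ominus>\<^bsub>I.L\<^esub> \<one>\<^bsub>I.L\<^esub>)"
    unfolding one_plus_def A_ring_eq I.phi_add I.phi_one A_var_def I.phi_var[OF v] ..
  also have "\<dots> = I.el (gen v)"
    unfolding I.L_minus[OF I.el_closed[OF gen_closed[OF v]] one] I.L_ops(4)
    by (rule extensionalityI[of _ I.ON]) (auto simp: I.L_extensional[OF I.el_closed[OF gen_closed[OF v]]] simp del: gen.simps)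
  finally show ?thesis .
qed

lemma phi_fm: "fm c \<in> carrier AA \<and> I.phi (fm c) = I.el (pm c)"
proof -
  have pow: "I.phi (one_plus n v [^]\<^bsub>AA\<^esub> k) = I.el (gen v [^]\<^bsub>G\<^esub> k)" if v: "v \<in> X" for v and k :: nat
  proof (induction k)
    case 0
    then show ?case using I.phi_one I.el_one by simp
  next
    case (Suc k)
    have "gen v [^]\<^bsub>G\<^esub> k \<in> carrier G" using gen_closed[OF v] by simp
    from I.el_mult[OF this gen_closed[OF v]] show ?case
      using Suc by (simp add: I.phi_mult phi_one_plus[OF v] del: gen.simps)
  qed
  have "foldr (\<lambda>v f. one_plus n v [^]\<^bsub>AA\<^esub> c v \<otimes>\<^bsub>AA\<^esub> f) l \<one>\<^bsub>AA\<^esub> \<in> carrier AA \<and>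
      I.phi (foldr (\<lambda>v f. one_plus n v [^]\<^bsub>AA\<^esub> c v \<otimes>\<^bsub>AA\<^esub> f) l \<one>\<^bsub>AA\<^esub>) = I.el (pml l c (1\<^sub>m n))" if "set l \<subseteq> X" for l
    using that
  proof (induction l)
    case Nil
    then show ?case using I.phi_one I.el_one by simp
  next
    case (Cons v l)
    then have v: "v \<in> X" and l: "set l \<subseteq> X" by auto
    have gc: "gen v [^]\<^bsub>G\<^esub> c v \<in> carrier G" using gen_closed[OF v] by simp
    have pc: "pml l c (1\<^sub>m n) \<in> carrier G" by (rule pml_closed[OF l G_one])
    show ?case
      using Cons.IH[OF l] I.el_mult[OF gc pc] by (simp add: I.phi_mult pow[OF v] one_plus_closed del: gen.simps)
  qed
  from this[of vs] show ?thesis unfolding fm_def pm_def by (simp add: set_vs)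
qed

text \<open>The coset contains an ordered product, whose polynomial evaluates to the indicator of C
  at this level; it is added m times.\<close>

lemma coset_indicator:
  assumes "C \<in> rcosets\<^bsub>G\<^esub> H d"
  shows "\<exists>a\<in>carrier AA. \<forall>D. I.phi a (H d) D = (if D = C then of_nat m else 0)"
proof (induction m)
  case 0
  have "I.phi \<zero>\<^bsub>AA\<^esub> (H d) D = 0" for D
    by (subst I.phi_finite[OF H_open_normal, of "{}"]) (auto simp: nc_ops)
  then show ?case by (intro bexI[of _ "\<zero>\<^bsub>AA\<^esub>"]) auto
next
  case (Suc m)
  then obtain a where a: "a \<in> carrier AA" "\<forall>D. I.phi a (H d) D = (if D = C then of_nat m else 0)" by (elim bexE)
  obtain g where g: "g \<in> carrier G" "C = H d #>\<^bsub>G\<^esub> g" using assms by (rule I.rcosetsE)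
  obtain c where c: "C = H d #>\<^bsub>G\<^esub> pm c" using H_coset_pm[OF g(1), of d] unfolding g(2) by blast
  have "I.phi (a \<oplus>\<^bsub>AA\<^esub> fm c) (H d) D = (if D = C then of_nat (Suc m) else 0)" for D
    unfolding I.phi_add I.L_ops using H_open_normal phi_fm[of c] a(2)
    by (simp add: I.el_apply[OF H_open_normal] c single_def)
  then show ?case using a(1) phi_fm[of c] by (intro bexI[of _ "a \<oplus>\<^bsub>AA\<^esub> fm c"]) auto
qed

text \<open>Coefficients are needed only modulo p, so natural numbers suffice and the finitely many
  cosets can be corrected one by one.\<close>

lemma component_surjective:
  assumes "lam \<in> carrier I.L"
  shows "\<exists>a\<in>carrier AA. \<forall>D. padic_p dvd I.phi a (H d) D - lam (H d) D"
proof -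
  have "\<exists>a\<in>carrier AA. \<forall>D. padic_p dvd I.phi a (H d) D - (if D \<in> S then lam (H d) D else 0)"
    if "finite S" "S \<subseteq> rcosets\<^bsub>G\<^esub> H d" for S
    using that
  proof (induction S rule: finite_induct)
    case empty
    have "I.phi \<zero>\<^bsub>AA\<^esub> (H d) D = 0" for D
      by (subst I.phi_finite[OF H_open_normal, of "{}"]) (auto simp: nc_ops)
    then show ?case by (intro bexI[of _ "\<zero>\<^bsub>AA\<^esub>"]) auto
  next
    case (insert C S)
    have "S \<subseteq> rcosets\<^bsub>G\<^esub> H d" using insert.prems by simp
    from insert.IH[OF this] obtain a where
      a: "a \<in> carrier AA" "\<forall>D. padic_p dvd I.phi a (H d) D - (if D \<in> S then lam (H d) D else 0)"
      by (elim bexE)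
    obtain m where m: "padic_p ^ 1 dvd lam (H d) C - of_nat m" using padic_approx_nat[of 1 "lam (H d) C"] by (elim exE)
    have CH: "C \<in> rcosets\<^bsub>G\<^esub> H d" using insert.prems by simp
    obtain b where b: "b \<in> carrier AA" "\<forall>D. I.phi b (H d) D = (if D = C then of_nat m else 0)"
      using coset_indicator[OF CH, of m] by (elim bexE)
    have "padic_p dvd I.phi (a \<oplus>\<^bsub>AA\<^esub> b) (H d) D - (if D \<in> insert C S then lam (H d) D else 0)" for D
    proof -
      have e: "I.phi (a \<oplus>\<^bsub>AA\<^esub> b) (H d) D = I.phi a (H d) D + I.phi b (H d) D"
        unfolding I.phi_add I.L_ops using H_open_normal by simp
      show ?thesis
      proof (cases "D = C")
        case True
        have "padic_p dvd I.phi a (H d) D" using a(2) True insert.hyps(2) by (auto dest: spec[of _ D])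
        moreover have "padic_p dvd of_nat m - lam (H d) C" using m by (simp add: dvd_diff_sym[of _ "of_nat m"])
        ultimately have "padic_p dvd I.phi a (H d) D + (of_nat m - lam (H d) C)" by (rule dvd_add)
        then show ?thesis unfolding e using True b(2) by (simp add: add_diff_eq)
      next
        case False
        then show ?thesis unfolding e using a(2) b(2) by simp
      qed
    qed
    then show ?case using a(1) b(1) by (intro bexI[of _ "a \<oplus>\<^bsub>AA\<^esub> b"]) auto
  qed
  from this[OF I.finite_quotient[OF H_open_normal] order_refl] obtain a where
    a: "a \<in> carrier AA" "\<forall>D. padic_p dvd I.phi a (H d) D - (if D \<in> rcosets\<^bsub>G\<^esub> H d then lam (H d) D else 0)" by (elim bexE)
  moreover have "(if D \<in> rcosets\<^bsub>G\<^esub> H d then lam (H d) D else 0) = lam (H d) D" for D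
    using I.L_component_0[OF assms H_open_normal] by simp
  ultimately show ?thesis by auto
qed

text \<open>Coefficients at a coarser level are sums of coefficients at a finer one.\<close>

lemma L_dvd_mono:
  assumes "f \<in> carrier I.L" "f' \<in> carrier I.L" "N \<in> I.ON" "M \<in> I.ON" "N \<subseteq> M" "\<And>C. q dvd f N C - f' N C"
  shows "q dvd f M D - f' M D"
proof -
  have e: "f M D = (\<Sum>C\<in>rcosets\<^bsub>G\<^esub> N. f N C * (if M <#>\<^bsub>G\<^esub> C = D then 1 else 0))"
    if "f \<in> carrier I.L" for f using that assms(3-5) unfolding I.L_carrier_iff by blast
  show ?thesis unfolding e[OF assms(1)] e[OF assms(2)]
    by (intro dvd_diff_sum dvd_diff_mult assms(6)) simp
qed

text \<open>Congruence classes modulo p at level N are open and partition the series, so the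
  complement of one class is a union of open classes.\<close>

lemma closedin_component:
  assumes "mu \<in> carrier I.L" "N \<in> I.ON"
  shows "closedin (nc_topology X) {a \<in> carrier AA. \<forall>C. padic_p dvd I.phi a N C - mu N C}"
proof -
  define Q where "Q mu = {a \<in> carrier AA. \<forall>C. padic_p dvd I.phi a N C - mu N C}" for mu
  have op: "openin (nc_topology X) (Q mu)" if "mu \<in> carrier I.L" for mu
  proof -
    have "openin (nc_topology X) {a \<in> topspace (nc_topology X). I.phi a \<in> {f \<in> carrier I.L. \<forall>C. padic_p dvd f N C - mu N C}}"
      by (rule openin_continuous_map_preimage[OF I.phi_continuous I.open_cong_component[OF assms(2) that]])
    then show ?thesis unfolding nc_topspace Q_def by (simp add: I.phi_closed)
  qed
  have "topspace (nc_topology X) - Q mu = (\<Union>b\<in>carrier AA - Q mu. Q (I.phi b))"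
  proof
    show "topspace (nc_topology X) - Q mu \<subseteq> (\<Union>b\<in>carrier AA - Q mu. Q (I.phi b))"
      unfolding nc_topspace Q_def by auto
    show "(\<Union>b\<in>carrier AA - Q mu. Q (I.phi b)) \<subseteq> topspace (nc_topology X) - Q mu"
    proof
      fix a assume "a \<in> (\<Union>b\<in>carrier AA - Q mu. Q (I.phi b))"
      then obtain b where b: "b \<in> carrier AA" "b \<notin> Q mu" "a \<in> Q (I.phi b)" by blast
      have "a \<notin> Q mu"
      proof
        assume "a \<in> Q mu"
        then have "padic_p dvd (I.phi a N C - mu N C) - (I.phi a N C - I.phi b N C)" for C
          using b(3) unfolding Q_def by (intro dvd_diff[of _ "I.phi a N C - mu N C"]) simp_all
        then show False using b(1,2) by (simp add: Q_def)
      qed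
      then show "a \<in> topspace (nc_topology X) - Q mu" using b(3) by (simp add: nc_topspace Q_def)
    qed
  qed
  moreover have "openin (nc_topology X) (\<Union>b\<in>carrier AA - Q mu. Q (I.phi b))"
    using op I.phi_closed by (intro openin_Union) auto
  moreover have "Q mu \<subseteq> topspace (nc_topology X)" by (auto simp: nc_topspace Q_def)
  ultimately show ?thesis unfolding Q_def[symmetric] closedin_def by simp
qed

text \<open>The series that are correct modulo p at level \<open>H d\<close> form nonempty closed
  sets which decrease with d. A common element exists by compactness and is correct at every level,
  as the \<open>H d\<close> are cofinal.\<close>

theorem th_surjective: "carrier I.Om = th ` carrier AA"
proof
  show "th ` carrier AA \<subseteq> carrier I.Om" using th_closed by blast
  show "carrier I.Om \<subseteq> th ` carrier AA"
  proof
    fix x assume "x \<in> carrier I.Om"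
    then obtain lam where lam: "lam \<in> carrier I.L" "x = I.toOm lam" using I.toOm_surj by blast
    define C where "C d = {a \<in> carrier AA. \<forall>D. padic_p dvd I.phi a (H d) D - lam (H d) D}" for d
    have "(\<Inter>d. C d) \<noteq> {}"
    proof (rule compact_space_imp_nest[OF nc_compact])
      show "closedin (nc_topology X) (C d)" for d unfolding C_def by (rule closedin_component[OF lam(1) H_open_normal])
      show "C d \<noteq> {}" for d using component_surjective[OF lam(1), of d] by (auto simp: C_def)
      show "decseq C" unfolding decseq_def C_def
        using L_dvd_mono[OF I.phi_closed lam(1) H_open_normal H_open_normal H_mono] by blast
    qed
    then obtain a where a: "\<And>d. a \<in> C d" by blast
    have "padic_p dvd I.phi a N D - lam N D" if N: "N \<in> I.ON" for N D
    proof -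
      obtain d where d: "H d \<subseteq> N" by (rule H_cofinal[OF N])
      show ?thesis by (rule L_dvd_mono[OF I.phi_closed lam(1) H_open_normal N d]) (use a[of d] in \<open>simp add: C_def\<close>)
    qed
    then have "th a = x" unfolding th_def lam(2) I.toOm_eq_iff[OF I.phi_closed lam(1)] by blast
    then show "x \<in> th ` carrier AA" using a[of 0] by (auto simp: C_def)
  qed
qed

end

section \<open>The kernel and the natural map\<close>

lemma topspace_quotient_topology: "topspace (quotient_topology f T) = f ` topspace T"
proof
  have "openin (quotient_topology f T) (f ` topspace T)"
    unfolding openin_quotient_topology using openin_topspace[of T] by (auto intro: back_subst[of "openin T"])
  then show "f ` topspace T \<subseteq> topspace (quotient_topology f T)" by (rule openin_subset)
  show "topspace (quotient_topology f T) \<subseteq> f ` topspace T"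
    using openin_topspace[of "quotient_topology f T"] unfolding openin_quotient_topology by blast
qed

section \<open>The kernel of the evaluation map\<close>

context iwahori_setting
begin

lemma pA_iff: "(a :: 'p series) \<in> pA n \<longleftrightarrow> a \<in> carrier AA \<and> (\<forall>w\<in>lists X. padic_p dvd a w)"
proof
  assume "a \<in> pA n"
  then obtain b where b: "b \<in> carrier AA" "a = [CARD('p)] \<cdot>\<^bsub>AA\<^esub> b" unfolding pA_def A_ring_eq by blast
  then show "a \<in> carrier AA \<and> (\<forall>w\<in>lists X. padic_p dvd a w)" by (simp add: nc_add_pow carrier_nc)
next
  assume a: "a \<in> carrier AA \<and> (\<forall>w\<in>lists X. padic_p dvd a w)"
  have "\<forall>w\<in>lists X. \<exists>t. a w = padic_p * t" using a unfolding dvd_def by blast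
  from bchoice[OF this] obtain t where t: "\<forall>w\<in>lists X. a w = padic_p * t w" by (elim exE)
  define b where "b = restrict t (lists X)"
  have b: "b \<in> carrier AA" by (simp add: b_def carrier_nc)
  have "a = [CARD('p)] \<cdot>\<^bsub>AA\<^esub> b"
    unfolding nc_add_pow[OF b]
    by (rule extensionalityI[of _ "lists X"]) (use a t in \<open>auto simp: carrier_nc b_def\<close>)
  then show "a \<in> pA n" unfolding pA_def A_ring_eq using b by blast
qed

lemma pA_ideal: "ideal (pA n :: 'p series set) AA"
proof (rule idealI[OF nc_ring])
  have z: "\<zero>\<^bsub>AA\<^esub> \<in> pA n" by (simp add: pA_iff nc_ops carrier_nc)
  show "subgroup (pA n) (add_monoid AA)"
  proof (rule AA.add.subgroupI)
    show "(pA n :: 'p series set) \<subseteq> carrier AA" by (rule subsetI) (simp only: pA_iff)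
    show "(pA n :: 'p series set) \<noteq> {}" using z by (intro notI) (simp only: empty_iff)
  next
    fix a :: "'p series" assume a: "a \<in> pA n"
    have ac: "a \<in> carrier AA" using a by (simp only: pA_iff)
    have "\<ominus>\<^bsub>AA\<^esub> a = \<zero>\<^bsub>AA\<^esub> \<ominus>\<^bsub>AA\<^esub> a" using ac by (simp add: a_minus_def)
    then have "(\<ominus>\<^bsub>AA\<^esub> a) w = - a w" if "w \<in> lists X" for w
      using nc_minus[OF AA.zero_closed ac that] that by (simp add: nc_ops)
    then show "\<ominus>\<^bsub>AA\<^esub> a \<in> pA n" using a ac by (simp add: pA_iff)
  next
    fix a b :: "'p series" assume "a \<in> pA n" "b \<in> pA n"
    then show "a \<oplus>\<^bsub>AA\<^esub> b \<in> pA n" by (simp add: pA_iff) (simp add: nc_ops)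
  qed
  fix a x :: "'p series" assume a: "a \<in> pA n" and x: "x \<in> carrier AA"
  have ac: "a \<in> carrier AA" and ad: "\<forall>w\<in>lists X. padic_p dvd a w" using a pA_iff by auto
  have tk: "take k w \<in> lists X" "drop k w \<in> lists X" if "w \<in> lists X" for k and w :: "ivar list"
    using that by (auto dest: in_set_takeD in_set_dropD)
  have "padic_p dvd (x \<otimes>\<^bsub>AA\<^esub> a) w" if "w \<in> lists X" for w
    unfolding nc_ops restrict_apply'[OF that] by (intro dvd_sum dvd_mult bspec[OF ad] tk[OF that])
  moreover have "padic_p dvd (a \<otimes>\<^bsub>AA\<^esub> x) w" if "w \<in> lists X" for w
    unfolding nc_ops restrict_apply'[OF that] by (intro dvd_sum dvd_mult2 bspec[OF ad] tk[OF that])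
  ultimately show "x \<otimes>\<^bsub>AA\<^esub> a \<in> pA n" "a \<otimes>\<^bsub>AA\<^esub> x \<in> pA n" using ac x by (auto simp: pA_iff)
qed

lemma th_zero_iff: "th a = \<zero>\<^bsub>I.Om\<^esub> \<longleftrightarrow> (\<forall>N\<in>I.ON. \<forall>C. padic_p dvd I.phi a N C)"
proof -
  have z: "\<zero>\<^bsub>I.L\<^esub> \<in> carrier I.L" by (rule ring.ring_simprules(2)[OF I.L_ring])
  have "I.toOm \<zero>\<^bsub>I.L\<^esub> = \<zero>\<^bsub>I.Om\<^esub>"
    by (rule ring_hom_zero[OF I.toOm_hom I.L_ring I.Om_ring])
  then have "th a = \<zero>\<^bsub>I.Om\<^esub> \<longleftrightarrow> I.toOm (I.phi a) = I.toOm \<zero>\<^bsub>I.L\<^esub>" by (simp add: th_def)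
  also have "\<dots> \<longleftrightarrow> (\<forall>N\<in>I.ON. \<forall>C. padic_p dvd I.phi a N C - \<zero>\<^bsub>I.L\<^esub> N C)"
    by (rule I.toOm_eq_iff[OF I.phi_closed z])
  also have "\<dots> \<longleftrightarrow> (\<forall>N\<in>I.ON. \<forall>C. padic_p dvd I.phi a N C)"
    unfolding I.L_ops(3) by simp
  finally show ?thesis .
qed

lemma th_pA: assumes "a \<in> pA n" shows "th a = \<zero>\<^bsub>I.Om\<^esub>"
  unfolding th_zero_iff
proof (intro ballI allI)
  fix N C assume N: "N \<in> I.ON"
  obtain M where M: "\<forall>w\<in>lists X. M \<le> length w \<longrightarrow> (\<forall>C. padic_p ^ 1 dvd I.lw w N C)"
    using I.lw_small[OF N, of 1] by (elim exE)
  have 1: "padic_p dvd I.phi a N C - I.Phi M a N C"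
    using I.phi_approx[OF N, of M 1 C a] M by simp
  have 2: "padic_p dvd I.Phi M a N C"
    unfolding I.Phi_apply[OF N] using assms I.words_lists by (intro dvd_sum dvd_mult2) (auto simp: pA_iff)
  show "padic_p dvd I.phi a N C" by (rule I.dvd_diffD[OF 2 1])
qed

text \<open>The kernel is an ideal that contains the relators, and it is closed as an intersection
  of congruence conditions at all levels. It therefore belongs to the family defining the closed
  ideal.\<close>

lemma th_R_ideal: assumes "r \<in> R_ideal n" shows "th r = \<zero>\<^bsub>I.Om\<^esub>"
proof -
  let ?K = "a_kernel AA I.Om th"
  have z: "\<zero>\<^bsub>I.L\<^esub> \<in> carrier I.L" by (rule ring.ring_simprules(2)[OF I.L_ring])
  have K: "?K = (\<Inter>N\<in>I.ON. {a \<in> carrier AA. \<forall>C. padic_p dvd I.phi a N C - \<zero>\<^bsub>I.L\<^esub> N C})"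
    unfolding a_kernel_def' th_zero_iff I.L_ops(3) using H_open_normal by auto
  have "closedin (A_topology n) ?K"
    unfolding K A_topology_def using H_open_normal by (intro closedin_INT closedin_component[OF z]) auto
  moreover have "ideal ?K AA" by (rule th.kernel_is_ideal)
  moreover have "relators n \<subseteq> ?K" unfolding a_kernel_def' using relators_closed relators_th by blast
  ultimately have "R_ideal n \<subseteq> ?K" unfolding R_ideal_eq by (intro Inter_lower) simp
  then show ?thesis using assms unfolding a_kernel_def' by blast
qed

lemma closedin_coefficients:
  "closedin (nc_topology X) {r \<in> carrier AA. \<forall>w\<in>lists X. P w \<longrightarrow> (padic_p :: 'p padic) dvd b w - r w}"
  (is "closedin _ ?D")
proof -
  have "openin (nc_topology X) (carrier AA - ?D)"
    unfolding nc_open_iff[OF finite_ivars]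
  proof (intro conjI ballI)
    fix f assume "f \<in> carrier AA - ?D"
    then obtain w where w: "w \<in> lists X" "P w" "\<not> padic_p dvd b w - f w" by blast
    have "f' \<in> carrier AA - ?D" if f': "f' \<in> carrier AA"
      "\<forall>u\<in>lists X. length u < Suc (length w) \<longrightarrow> padic_p ^ Suc (length w) dvd f' u - f u" for f'
    proof -
      have "padic_p ^ Suc (length w) dvd f' w - f w" using f'(2) w(1) by simp
      then have d: "padic_p dvd f' w - f w" using power_le_dvd[of padic_p "Suc (length w)" _ 1] by simp
      have "\<not> padic_p dvd b w - f' w"
      proof
        assume "padic_p dvd b w - f' w"
        from dvd_add[OF this d] show False using w(3) by simp
      qed
      then show ?thesis using f'(1) w by blast
    qed
    then show "\<exists>m. \<forall>f'\<in>carrier AA. (\<forall>w\<in>lists X. length w < m \<longrightarrow> padic_p ^ m dvd f' w - f w) \<longrightarrow> f' \<in> carrier AA - ?D"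
      by (intro exI[of _ "Suc (length w)"]) blast
  qed blast
  moreover have "?D \<subseteq> topspace (nc_topology X)" unfolding nc_topspace by blast
  ultimately show ?thesis unfolding closedin_def nc_topspace by blast
qed

text \<open>The spanning theorem gives an ordered series s with a - s in R up to p and weight d, for
  every d; compactness provides one r for all d. Then s lies in the kernel too, and independence
  makes all its coefficients divisible by p.\<close>

theorem th_kernel:
  assumes a: "a \<in> carrier AA" and th0: "th a = \<zero>\<^bsub>I.Om\<^esub>"
  obtains r where "r \<in> R_ideal n" "a \<ominus>\<^bsub>AA\<^esub> r \<in> pA n"
proof -
  obtain s' where s': "s' \<in> AX X" "\<And>w. cf s' w \<noteq> 0 \<Longrightarrow> w \<in> range rw.ordered" "\<And>d. emb X a - s' \<in> rw.RF d"
    using rw.ordered_spanning[OF emb_in_AX[of X a]] by blast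
  obtain s where s: "s \<in> carrier AA" "emb X s = s'" "\<And>w. w \<in> lists X \<Longrightarrow> s w = cf s' w"
    using emb_surj[OF s'(1)] by blast
  \<comment> \<open>The candidates r that account for a - s modulo p on all words of weight below
    d.\<close>
  define D where "D d = {r \<in> carrier AA. \<forall>w\<in>lists X. wa.weight w < d \<longrightarrow> padic_p dvd (a w - s w) - r w}" for d
  have "(\<Inter>d. R_ideal n \<inter> D d) \<noteq> {}"
  proof (rule compact_space_imp_nest[OF nc_compact])
    show "closedin (nc_topology X) (R_ideal n \<inter> D d)" for d
      unfolding D_def using R_ideal_closed by (intro closedin_Int closedin_coefficients) (simp add: A_topology_def)
    show "R_ideal n \<inter> D d \<noteq> {}" for d
    proof -
      obtain r' f where rf: "emb X a - s' = r' + f" "r' \<in> RR" "f \<in> wa.Fd d"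
        using s'(3)[of d] unfolding rw.RF_def by blast
      obtain r where r: "r \<in> R_ideal n" "r' = emb X r" using rf(2) unfolding RR_def by blast
      have "padic_p dvd (a w - s w) - r w" if w: "w \<in> lists X" "wa.weight w < d" for w
      proof -
        have "cf (emb X a - s') w = cf (r' + f) w" using rf(1) by simp
        then have "a w - s w - r w = cf f w"
          using w(1) s(3)[OF w(1)] by (simp add: minus_ncs.rep_eq plus_ncs.rep_eq r(2))
        then show ?thesis using rf(3) w(2) by (simp add: wa.Fd_def)
      qed
      then show ?thesis using r(1) R_ideal_carrier[OF r(1)] by (auto simp: D_def)
    qed
    show "decseq (\<lambda>d. R_ideal n \<inter> D d)"
      unfolding decseq_def
    proof (intro allI impI)
      fix d e :: nat assume "d \<le> e"
      then have "wa.weight w < e" if "wa.weight w < d" for w using that by simp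
      then show "R_ideal n \<inter> D e \<subseteq> R_ideal n \<inter> D d" unfolding D_def by blast
    qed
  qed
  then obtain r where r: "r \<in> R_ideal n" "\<And>d. r \<in> D d" by blast
  have rc: "r \<in> carrier AA" by (rule R_ideal_carrier[OF r(1)])
  have ars: "padic_p dvd a w - s w - r w" if "w \<in> lists X" for w
    using r(2)[of "Suc (wa.weight w)"] that by (simp add: D_def)
  define q where "q = a \<ominus>\<^bsub>AA\<^esub> (s \<oplus>\<^bsub>AA\<^esub> r)"
  have src: "s \<oplus>\<^bsub>AA\<^esub> r \<in> carrier AA" using s(1) rc by simp
  have "q w = a w - s w - r w" if "w \<in> lists X" for w
    unfolding q_def nc_minus[OF a src that] using that by (simp add: nc_ops)
  then have q: "q \<in> pA n" using ars a src by (simp add: pA_iff q_def)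
  have "a = q \<oplus>\<^bsub>AA\<^esub> (s \<oplus>\<^bsub>AA\<^esub> r)"
    unfolding q_def a_minus_def using a src by (simp add: AA.a_assoc AA.l_neg)
  then have "th a = th q \<oplus>\<^bsub>I.Om\<^esub> (th s \<oplus>\<^bsub>I.Om\<^esub> th r)" by (metis th_add)
  then have "th s = \<zero>\<^bsub>I.Om\<^esub>" using th0 th_closed[of s] by (simp add: th_pA[OF q] th_R_ideal[OF r(1)])
  then have ph: "padic_p dvd I.phi s N C" if "N \<in> I.ON" for N C using that th_zero_iff by blast
  have sp: "padic_p dvd s w" if w: "w \<in> lists X" for w
  proof (cases "s w = 0")
    case False
    have supp: "s u \<noteq> 0 \<Longrightarrow> u \<in> range rw.ordered" if "u \<in> lists X" for u using s(3)[OF that] s'(2) by simp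
    obtain b where "w = rw.ordered b" using supp[OF w False] by blast
    then show ?thesis using ordered_independent[OF s(1) supp ph] by simp
  qed simp
  have "padic_p dvd a w - r w" if w: "w \<in> lists X" for w
    using dvd_add[OF ars[OF w] sp[OF w]] by (simp add: algebra_simps)
  then have "a \<ominus>\<^bsub>AA\<^esub> r \<in> pA n" using a rc by (simp add: pA_iff nc_minus)
  then show ?thesis by (rule that[OF r(1)])
qed

section \<open>The natural map on the quotient modulo p\<close>

lemma Omega_eq: "Omega n = I.Om"
  unfolding Omega_def I.Om_def I.red_def Lambda_scalar_def Lambda_def ..

lemma Lambda_to_Omega_eq: "Lambda_to_Omega n = I.toOm"
  by (rule ext) (unfold Lambda_to_Omega_def I.toOm_def I.red_def Lambda_scalar_def Lambda_def, rule refl)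

lemma Omega_topology_eq: "Omega_topology n = quotient_topology I.toOm I.LT"
  unfolding Omega_topology_def Lambda_to_Omega_eq Lambda_topology_def ..

abbreviation tb :: "'p series \<Rightarrow> 'p series set" where "tb \<equiv> to_A_bar n"
abbreviation Ab :: "'p series set ring" where "Ab \<equiv> A_bar n"

lemma Ab_ring: "ring Ab"
  unfolding A_bar_def A_ring_eq by (rule ideal.quotient_is_ring[OF pA_ideal])

lemma tb_hom: "tb \<in> Ring.ring_hom AA Ab"
  unfolding A_bar_def A_ring_eq to_A_bar_def[abs_def] by (rule ideal.rcos_ring_hom[OF pA_ideal])

lemma carrier_Ab: "carrier Ab = tb ` carrier AA"
  unfolding A_bar_def A_ring_eq to_A_bar_def[abs_def] FactRing_def A_RCOSETS_def' by auto

lemma tb_eq_iff: "a \<in> carrier AA \<Longrightarrow> b \<in> carrier AA \<Longrightarrow> tb a = tb b \<longleftrightarrow> a \<ominus>\<^bsub>AA\<^esub> b \<in> pA n"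
  unfolding to_A_bar_def A_ring_eq using AA.quotient_eq_iff_same_a_r_cos[OF pA_ideal] by blast

lemma topspace_A_bar: "topspace (A_bar_topology n) = carrier Ab"
  unfolding A_bar_topology_def topspace_quotient_topology carrier_Ab A_topology_def nc_topspace ..

text \<open>Defined through an arbitrary lift of a class; the choice is immaterial because
  \<open>th\<close> kills the multiples of p.\<close>

definition psi :: "'p series set \<Rightarrow> 'p omega_elem" where
  "psi = (\<lambda>S\<in>carrier Ab. th (SOME a. a \<in> carrier AA \<and> tb a = S))"

lemma psi_tb: assumes a: "a \<in> carrier AA" shows "psi (tb a) = th a"
proof -
  define b where "b = (SOME b. b \<in> carrier AA \<and> tb b = tb a)"
  have b: "b \<in> carrier AA \<and> tb b = tb a" unfolding b_def by (rule someI[of _ a]) (simp add: a)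
  have "b \<ominus>\<^bsub>AA\<^esub> a \<in> pA n" using tb_eq_iff[of b a] a b by blast
  then have "th (b \<ominus>\<^bsub>AA\<^esub> a) = \<zero>\<^bsub>I.Om\<^esub>" by (rule th_pA)
  moreover have "b = (b \<ominus>\<^bsub>AA\<^esub> a) \<oplus>\<^bsub>AA\<^esub> a"
    using a b by (simp add: a_minus_def AA.a_assoc AA.l_neg)
  ultimately have "th b = th a" using th_closed[of a] by (metis th_add Om.l_zero)
  moreover have "tb a \<in> carrier Ab" using a carrier_Ab by blast
  ultimately show ?thesis by (simp add: psi_def b_def)
qed

lemma psi_hom: "psi \<in> Ring.ring_hom Ab I.Om"
proof (rule ring_hom_memI)
  fix S assume "S \<in> carrier Ab"
  then obtain a where a: "a \<in> carrier AA" "S = tb a" unfolding carrier_Ab by blast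
  then show "psi S \<in> carrier I.Om" by (simp add: psi_tb th_closed)
  fix T assume "T \<in> carrier Ab"
  then obtain b where b: "b \<in> carrier AA" "T = tb b" unfolding carrier_Ab by blast
  show "psi (S \<otimes>\<^bsub>Ab\<^esub> T) = psi S \<otimes>\<^bsub>I.Om\<^esub> psi T"
    unfolding a(2) b(2) ring_hom_mult[OF tb_hom a(1) b(1), symmetric] using a(1) b(1) by (simp add: psi_tb th_mult)
  show "psi (S \<oplus>\<^bsub>Ab\<^esub> T) = psi S \<oplus>\<^bsub>I.Om\<^esub> psi T"
    unfolding a(2) b(2) ring_hom_add[OF tb_hom a(1) b(1), symmetric] using a(1) b(1) by (simp add: psi_tb th_add)
next
  show "psi \<one>\<^bsub>Ab\<^esub> = \<one>\<^bsub>I.Om\<^esub>"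
    unfolding ring_hom_one[OF tb_hom, symmetric] by (simp add: psi_tb th_one)
qed

lemma psi_continuous: "continuous_map (A_bar_topology n) (Omega_topology n) psi"
  unfolding continuous_map_def
proof (intro conjI allI impI)
  have "carrier I.Om = topspace (Omega_topology n)"
    unfolding Omega_topology_eq topspace_quotient_topology I.topspace_LT by (rule I.toOm_surj)
  then show "psi \<in> topspace (A_bar_topology n) \<rightarrow> topspace (Omega_topology n)"
    using ring_hom_closed[OF psi_hom] by (auto simp: topspace_A_bar)
  fix Q :: "'p omega_elem set" assume "openin (Omega_topology n) Q"
  then have "openin I.LT {l \<in> topspace I.LT. I.toOm l \<in> Q}"
    unfolding Omega_topology_eq openin_quotient_topology by blast
  from openin_continuous_map_preimage[OF I.phi_continuous this]
  have op: "openin (nc_topology X) {a \<in> carrier AA. th a \<in> Q}"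
    unfolding nc_topspace I.topspace_LT th_def by (simp add: I.phi_closed)
  have e: "{a \<in> carrier AA. th a \<in> Q} = {a \<in> carrier AA. tb a \<in> {S \<in> carrier Ab. psi S \<in> Q}}"
    using psi_tb unfolding carrier_Ab by auto
  have s: "{S \<in> carrier Ab. psi S \<in> Q} \<subseteq> tb ` carrier AA" unfolding carrier_Ab by blast
  show "openin (A_bar_topology n) {S \<in> topspace (A_bar_topology n). psi S \<in> Q}"
    unfolding topspace_A_bar unfolding A_bar_topology_def openin_quotient_topology A_topology_def nc_topspace
    by (rule conjI[OF s op[unfolded e]])
qed

lemma th_A_var: "v \<in> X \<Longrightarrow> th (A_var n v) = I.toOm (I.el (gen v) \<ominus>\<^bsub>I.L\<^esub> \<one>\<^bsub>I.L\<^esub>)"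
  by (simp only: th_def A_var_def I.phi_var)

lemma natural_map_iff:
  "natural_map n f \<longleftrightarrow> f \<in> Ring.ring_hom Ab I.Om \<and> f \<in> extensional (carrier Ab) \<and>
    continuous_map (A_bar_topology n) (Omega_topology n) f \<and> (\<forall>v\<in>X. f (tb (A_var n v)) = th (A_var n v))"
proof -
  have e: "(\<forall>v\<in>X. f (tb (A_var n v)) = th (A_var n v)) \<longleftrightarrow>
      (\<forall>v\<in>X. f (tb (A_var n v)) = I.toOm (I.el (gen v) \<ominus>\<^bsub>I.L\<^esub> \<one>\<^bsub>I.L\<^esub>))"
    by (intro ball_cong refl) (simp only: th_A_var)
  show ?thesis
    unfolding natural_map_def e Omega_eq Lambda_to_Omega_eq Lambda_def
    by (simp add: ivars_def ball_Un Lambda_elem_def I.el_def)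
qed

lemma psi_natural: "natural_map n psi"
  unfolding natural_map_iff using psi_hom psi_continuous psi_tb[OF A_var_closed]
  by (simp add: psi_def)

text \<open>A ring homomorphism need not be linear over the p-adic integers, so agreement on the
  variables propagates only through sums and products. This reaches the polynomials with natural
  coefficients, which are dense.\<close>

lemma polynomial_agree:
  assumes f: "f \<in> Ring.ring_hom AA I.Om" "\<And>v. v \<in> X \<Longrightarrow> f (A_var n v) = th (A_var n v)"
    and "finite S" "S \<subseteq> lists X"
  shows "f (\<lambda>w\<in>lists X. if w \<in> S then of_nat (k w) else 0) = th (\<lambda>w\<in>lists X. if w \<in> S then of_nat (k w) else 0)"
proof -
  define P where "P = emb X ` {b \<in> carrier AA. f b = th b}"
  have PI: "emb X b \<in> P" if "b \<in> carrier AA" "f b = th b" for b using that by (simp add: P_def)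
  have P1: "1 \<in> P"
    using PI[OF AA.one_closed] ring_hom_one[OF f(1)] th_one by (simp add: emb_one)
  have P0: "0 \<in> P"
    using PI[OF AA.zero_closed] ring_hom_zero[OF f(1) nc_ring I.Om_ring] ring_hom_zero[OF th_hom nc_ring I.Om_ring]
    by (simp add: emb_zero)
  have Pv: "mv v \<in> P" if "v \<in> X" for v
    using PI[OF A_var_closed f(2)[OF that]] by (simp add: emb_var[OF that])
  have Pm: "x * y \<in> P" and Pa: "x + y \<in> P" if xy: "x \<in> P" "y \<in> P" for x y
  proof -
    obtain a b where ab: "a \<in> carrier AA" "b \<in> carrier AA" "f a = th a" "f b = th b" "x = emb X a" "y = emb X b"
      using xy unfolding P_def by blast
    show "x * y \<in> P" using PI[of "a \<otimes>\<^bsub>AA\<^esub> b"] ab ring_hom_mult[OF f(1) ab(1,2)] th_mult[of a b]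
      by (simp add: emb_mult)
    show "x + y \<in> P" using PI[of "a \<oplus>\<^bsub>AA\<^esub> b"] ab ring_hom_add[OF f(1) ab(1,2)] th_add[of a b]
      by (simp add: emb_add)
  qed
  have Pw: "nmono w \<in> P" if "w \<in> lists X" for w
    using that
  proof (induction w)
    case (Cons v w)
    then show ?case using Pm[of "mv v" "nmono w"] Pv[of v] by (simp add: mono_Cons[of v w])
  qed (simp add: mono_Nil P1)
  have Pk: "of_nat m * nmono w \<in> P" if "w \<in> lists X" for m w
    by (induction m) (simp_all add: P0 Pa Pw[OF that] distrib_right)
  have "(\<Sum>w\<in>S. of_nat (k w) * nmono w) \<in> P" using assms(3,4)
    by (induction S rule: finite_induct) (simp_all add: P0 Pa Pk)
  moreover have "(\<Sum>w\<in>S. of_nat (k w) * nmono w) = emb X (\<lambda>w\<in>lists X. if w \<in> S then of_nat (k w) else (0 :: 'p padic))"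
  proof (rule ncs_eqI)
    fix u
    have c: "cf (of_nat m * nmono w :: (ivar, 'p padic) ncs) u = (if u = w then of_nat m else 0)" for m w
    proof (induction m)
      case (Suc m)
      then show ?case by (simp add: distrib_right plus_ncs.rep_eq cf_mono)
    qed (simp add: zero_ncs.rep_eq)
    have "cf (\<Sum>w\<in>S. of_nat (k w) * nmono w :: (ivar, 'p padic) ncs) u = (\<Sum>w\<in>S. if u = w then of_nat (k w) else 0)"
      unfolding cf_sum c ..
    also have "\<dots> = (if u \<in> S then of_nat (k u) else 0)" using assms(3) by simp
    finally show "cf (\<Sum>w\<in>S. of_nat (k w) * nmono w) u = cf (emb X (\<lambda>w\<in>lists X. if w \<in> S then of_nat (k w) else (0 :: 'p padic))) u"
      using assms(4) by (auto simp: subset_iff)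
  qed
  ultimately obtain b where b: "b \<in> carrier AA" "f b = th b"
    "emb X (\<lambda>w\<in>lists X. if w \<in> S then of_nat (k w) else 0) = emb X b" unfolding P_def by auto
  have "(\<lambda>w\<in>lists X. if w \<in> S then of_nat (k w) else 0) = b"
    by (rule emb_inj[OF _ b(1,3)]) (simp add: carrier_nc)
  then show ?thesis using b(2) by simp
qed

text \<open>At each level modulo p, continuity of f and of the evaluation gives a neighbourhood of a
  on which both values are constant. It contains a polynomial with natural coefficients, where the
  two maps agree.\<close>

lemma natural_map_tb:
  assumes nat: "natural_map n f" and a: "a \<in> carrier AA"
  shows "f (tb a) = th a"
proof -
  note f = nat[unfolded natural_map_iff]
  have fh: "f \<circ> tb \<in> Ring.ring_hom AA I.Om" using ring_hom_trans[OF tb_hom] f by blast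
  have agree: "f (tb (\<lambda>w\<in>lists X. if w \<in> S then of_nat (k w) else 0)) = th (\<lambda>w\<in>lists X. if w \<in> S then of_nat (k w) else 0)"
    if "finite S" "S \<subseteq> lists X" for S k
    using polynomial_agree[OF fh _ that, of k] f by simp
  have "f (tb a) \<in> carrier I.Om" using ring_hom_closed[OF fh a] by simp
  then obtain lam where lam: "lam \<in> carrier I.L" "f (tb a) = I.toOm lam" using I.toOm_surj by blast
  have "padic_p dvd lam N C - I.phi a N C" if N: "N \<in> I.ON" for N C
  proof -
    define Q where "Q mu = {l \<in> carrier I.L. \<forall>C. padic_p dvd l N C - mu N C}" for mu
    \<comment> \<open>The set \<open>Q lam\<close> is a union of fibres of the reduction, so its
      image is open in the quotient topology and its preimage is again \<open>Q lam\<close>.\<close>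
    have sat: "l \<in> Q lam" if l: "l \<in> carrier I.L" "I.toOm l \<in> I.toOm ` Q lam" for l
    proof -
      obtain l' where l': "l' \<in> Q lam" "I.toOm l = I.toOm l'" using l(2) by blast
      have l'c: "l' \<in> carrier I.L" and l'd: "padic_p dvd l' N C - lam N C" for C using l'(1) by (simp_all add: Q_def)
      have "padic_p dvd l N C - l' N C" for C using l'(2) N unfolding I.toOm_eq_iff[OF l(1) l'c] by blast
      then have "padic_p dvd (l N C - l' N C) + (l' N C - lam N C)" for C using l'd by (rule dvd_add)
      then show ?thesis using l(1) by (simp add: Q_def)
    qed
    have lamQ: "lam \<in> Q lam" using lam(1) by (simp add: Q_def)
    have "{l \<in> carrier I.L. I.toOm l \<in> I.toOm ` Q lam} = Q lam" using sat by (auto simp: Q_def)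
    then have "openin (Omega_topology n) (I.toOm ` Q lam)"
      unfolding Omega_topology_eq openin_quotient_topology I.topspace_LT
      using I.open_cong_component[OF N lam(1)] by (auto simp: Q_def)
    then have "openin (A_bar_topology n) {S \<in> topspace (A_bar_topology n). f S \<in> I.toOm ` Q lam}"
      using f openin_continuous_map_preimage by blast
    then have "openin (nc_topology X) {b \<in> carrier AA. tb b \<in> {S \<in> carrier Ab. f S \<in> I.toOm ` Q lam}}"
      unfolding topspace_A_bar unfolding A_bar_topology_def openin_quotient_topology A_topology_def nc_topspace by blast
    moreover have "{b \<in> carrier AA. tb b \<in> {S \<in> carrier Ab. f S \<in> I.toOm ` Q lam}} = {b \<in> carrier AA. f (tb b) \<in> I.toOm ` Q lam}"
      using carrier_Ab by auto
    ultimately have o1: "openin (nc_topology X) {b \<in> carrier AA. f (tb b) \<in> I.toOm ` Q lam}" by simp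
    have o2: "openin (nc_topology X) {b \<in> carrier AA. I.phi b \<in> Q (I.phi a)}"
      using openin_continuous_map_preimage[OF I.phi_continuous I.open_cong_component[OF N I.phi_closed[of a]]]
      unfolding nc_topspace Q_def .
    have aV: "a \<in> {b \<in> carrier AA. f (tb b) \<in> I.toOm ` Q lam} \<inter> {b \<in> carrier AA. I.phi b \<in> Q (I.phi a)}"
      using a lamQ lam(2) by (simp add: Q_def I.phi_closed)
    obtain m where m: "\<forall>b\<in>carrier AA. (\<forall>w\<in>lists X. length w < m \<longrightarrow> padic_p ^ m dvd b w - a w) \<longrightarrow>
        b \<in> {b \<in> carrier AA. f (tb b) \<in> I.toOm ` Q lam} \<inter> {b \<in> carrier AA. I.phi b \<in> Q (I.phi a)}"
      using openin_Int[OF o1 o2, unfolded nc_open_iff[OF finite_ivars]] aV by (elim conjE) (drule (1) bspec, elim exE)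
    have "\<forall>w. \<exists>k. padic_p ^ m dvd a w - of_nat k" using padic_approx_nat by blast
    from choice[OF this] obtain k where k: "\<forall>w. padic_p ^ m dvd a w - of_nat (k w)" by (elim exE)
    define b where "b = (\<lambda>w\<in>lists X. if w \<in> {w \<in> lists X. length w < m} then of_nat (k w) else (0 :: 'p padic))"
    have bc: "b \<in> carrier AA" by (simp add: b_def carrier_nc)
    have "padic_p ^ m dvd b w - a w" if "w \<in> lists X" "length w < m" for w
      unfolding dvd_diff_sym[of _ "b w"] using k that by (simp add: b_def)
    then have b: "f (tb b) \<in> I.toOm ` Q lam" "I.phi b \<in> Q (I.phi a)" using m bc by blast+
    have "f (tb b) = I.toOm (I.phi b)"
      unfolding th_def[symmetric] b_def by (rule agree) (auto simp: finite_words[OF finite_ivars])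
    then have "I.phi b \<in> Q lam" using sat[OF I.phi_closed] b(1) by simp
    then have 1: "padic_p dvd I.phi b N C - lam N C" and 2: "padic_p dvd I.phi b N C - I.phi a N C"
      using b(2) by (simp_all add: Q_def)
    from dvd_diff[OF 2 1] show ?thesis by simp
  qed
  then show ?thesis unfolding lam(2) th_def I.toOm_eq_iff[OF lam(1) I.phi_closed] by blast
qed

lemma natural_map_unique: assumes "natural_map n f" shows "f = psi"
proof (rule extensionalityI[of _ "carrier Ab"])
  show "f \<in> extensional (carrier Ab)" using assms natural_map_iff by blast
  show "psi \<in> extensional (carrier Ab)" by (simp add: psi_def)
  fix S assume "S \<in> carrier Ab"
  then obtain a where "a \<in> carrier AA" "S = tb a" unfolding carrier_Ab by blast
  then show "f S = psi S" using natural_map_tb[OF assms] psi_tb by simp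
qed

lemma psi_kernel: "a_kernel Ab I.Om psi = R_bar n"
proof
  show "a_kernel Ab I.Om psi \<subseteq> R_bar n"
  proof
    fix S assume "S \<in> a_kernel Ab I.Om psi"
    then have S: "S \<in> carrier Ab" "psi S = \<zero>\<^bsub>I.Om\<^esub>" unfolding a_kernel_def' by auto
    then obtain a where a: "a \<in> carrier AA" "S = tb a" unfolding carrier_Ab by blast
    have "th a = \<zero>\<^bsub>I.Om\<^esub>" using S(2) psi_tb[OF a(1)] a(2) by simp
    then obtain r where r: "r \<in> R_ideal n" "a \<ominus>\<^bsub>AA\<^esub> r \<in> pA n" by (rule th_kernel[OF a(1)])
    have "S = tb r" using tb_eq_iff[OF a(1) R_ideal_carrier[OF r(1)]] r(2) a(2) by blast
    then show "S \<in> R_bar n" unfolding R_bar_def using r(1) by blast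
  qed
  show "R_bar n \<subseteq> a_kernel Ab I.Om psi"
    unfolding R_bar_def a_kernel_def' carrier_Ab using R_ideal_carrier psi_tb th_R_ideal by auto
qed

theorem psi_induces_iso: "induces_iso psi (A_bar n) (R_bar n) (Omega n)"
proof -
  interpret psi: ring_hom_ring Ab I.Om psi by (intro ring_hom_ringI2 Ab_ring I.Om_ring psi_hom)
  have "psi ` carrier Ab = carrier I.Om"
    unfolding carrier_Ab th_surjective image_image using psi_tb by auto
  from psi.FactRing_iso_set[OF this] show ?thesis
    unfolding induces_iso_def Omega_eq psi_kernel using psi.the_elem_simp[unfolded psi_kernel]
    by (intro bexI[of _ "\<lambda>S. the_elem (psi ` S)"]) simp_all
qed

end

theorem theorem4p4:
  fixes n :: nat
  assumes "n \<ge> 2" and "CARD('p::prime_card) > n + 1"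
  shows "(\<exists>!\<psi> :: 'p series set \<Rightarrow> 'p omega_elem. natural_map n \<psi>) \<and>
    (\<forall>\<psi> :: 'p series set \<Rightarrow> 'p omega_elem. natural_map n \<psi> \<longrightarrow>
       induces_iso \<psi> (A_bar n) (R_bar n) (Omega n))"
proof -
  interpret iwahori_setting n "TYPE('p)" by unfold_locales (use assms in auto)
  show ?thesis using psi_natural natural_map_unique psi_induces_iso by blast
qed

end
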